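(* Let $A$ and $B$ be finite sets with $|A|,|B|\ge 2$ and $A\cap B=\{e\}$, and let $E=A\cup B$. Let $C_{A,B}$ be the graphic matroid on $E$ of the graph obtained by gluing a cycle with edge set $A$ and a cycle with edge set $B$ along the common edge $e$. Let $\mathfrak{S}_{A\smallsetminus e}\times\mathfrak{S}_{B\smallsetminus e}$ act on $C_{A,B}$ by permuting $A\smallsetminus\{e\}$ and $B\smallsetminus\{e\}$ and fixing $e$. Then $$P_{C_{A,B}}^{\mathfrak{S}_{A\smallsetminus e}\times\mathfrak{S}_{B\smallsetminus e}}(x)=P_{C_{E\smallsetminus e}}^{\mathfrak{S}_{A\smallsetminus e}\times\mathfrak{S}_{B\smallsetminus e}}(x)-x\,P_{C_{A\smallsetminus e}}^{\mathfrak{S}_{A\smallsetminus e}}(x)\otimes P_{C_{B\smallsetminus e}}^{\mathfrak{S}_{B\smallsetminus e}}(x).$$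
   Context: For a finite nonempty set $S$, $C_S$ is the graphic matroid of a cycle with edge set $S$, i.e. the uniform matroid $U_{|S|-1,S}$ of rank $|S|-1$ on $S$ (a single loop when $|S|=1$), and $\mathfrak{S}_S$ is the symmetric group on $S$. The matroid $C_{A,B}$ has circuits $A$, $B$ and $(A\cup B)\smallsetminus\{e\}$. The symbol $\otimes$ denotes the external tensor product of a graded $\mathfrak{S}_{A\smallsetminus e}$-representation and a graded $\mathfrak{S}_{B\smallsetminus e}$-representation, which is a graded representation of the product group. $\mathrm{VRep}(W)$ is the Grothendieck ring (with respect to direct sums) of finite-dimensional representations of $W$ over $\mathbb{Q}$, and $\mathrm{grVRep}(W)=\mathrm{VRep}(W)[x]$. $\mathbf{1}_W$ is the trivial representation, and $\mathcal{L}(M)$ the lattice of flats of $M$. Equivariant Kazhdan–Lusztig and $Z$-polynomials: there is a unique way to associate to every loopless matroid $M$ and every group action of $W$ on $M$ (an action on the ground set preserving the bases) elements $P_M^W(x),Z_M^W(x)\in\mathrm{grVRep}(W)$ such that: (i) if $\mathrm{rk}(M)=0$ then $P_M^W(x)=Z_M^W(x)=\mathbf{1}_W$; (ii) if $\mathrm{rk}(M)>0$ then $\deg P_M^W(x)<\frac12\mathrm{rk}(M)$; (iii) for every $M$, $$Z_M^W(x)=\sum_{[F]\in\mathcal{L}(M)/W}x^{\mathrm{rk}(F)}\,\mathrm{Ind}_{W_F}^W P_{M/F}^{W_F}(x)$$ is palindromic of degree $\mathrm{rk}(M)$ (the coefficients of $x^j$ and $x^{\mathrm{rk}(M)-j}$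 agree), where $W_F$ is the stabilizer of $F$. If a matroid $M$ has loops, set $P_M^W(x)=0$. *)

theory Defs
  imports
    "HOL-Algebra.Group_Action"
    "HOL-Algebra.UnivPoly"
    "Jordan_Normal_Form.Matrix"
begin

section \<open>Matroids\<close>

record 'a matroid =
  ground :: "'a set"
  bases :: "'a set set"

definition is_matroid :: "'a matroid \<Rightarrow> bool" where
  "is_matroid M \<longleftrightarrow>
     finite (ground M) \<and> bases M \<noteq> {} \<and> (\<forall>X\<in>bases M. X \<subseteq> ground M) \<and>
     (\<forall>X\<in>bases M. \<forall>Y\<in>bases M. \<forall>x\<in>X - Y. \<exists>y\<in>Y - X. insert y (X - {x}) \<in> bases M)"

definition indep :: "'a matroid \<Rightarrow> 'a set \<Rightarrow> bool" where
  "indep M X \<longleftrightarrow> (\<exists>Y\<in>bases M. X \<subseteq> Y)"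

definition circuit :: "'a matroid \<Rightarrow> 'a set \<Rightarrow> bool" where
  "circuit M X \<longleftrightarrow> X \<subseteq> ground M \<and> \<not> indep M X \<and> (\<forall>Y. Y \<subset> X \<longrightarrow> indep M Y)"

definition mrank :: "'a matroid \<Rightarrow> 'a set \<Rightarrow> nat" where
  "mrank M X = Max ((\<lambda>Y. card (Y \<inter> X)) ` bases M)"

abbreviation rk :: "'a matroid \<Rightarrow> nat" where
  "rk M \<equiv> mrank M (ground M)"

definition flats :: "'a matroid \<Rightarrow> 'a set set" where
  "flats M = {F. F \<subseteq> ground M \<and> (\<forall>x\<in>ground M - F. mrank M F < mrank M (insert x F))}"

definition loopless :: "'a matroid \<Rightarrow> bool" where
  "loopless M \<longleftrightarrow> (\<forall>x\<in>ground M. indep M {x})"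

definition contract :: "'a matroid \<Rightarrow> 'a set \<Rightarrow> 'a matroid" where
  "contract M F =
     \<lparr>ground = ground M - F, bases = {Y - F | Y. Y \<in> bases M \<and> card (Y \<inter> F) = mrank M F}\<rparr>"

definition uniform_matroid :: "nat \<Rightarrow> 'a set \<Rightarrow> 'a matroid" where
  "uniform_matroid k S = \<lparr>ground = S, bases = {Y. Y \<subseteq> S \<and> card Y = k}\<rparr>"

definition cycle_matroid :: "'a set \<Rightarrow> 'a matroid" where
  "cycle_matroid S = uniform_matroid (card S - 1) S"

definition matroid_of_circuits :: "'a set \<Rightarrow> 'a set set \<Rightarrow> 'a matroid" where
  "matroid_of_circuits S \<C> =
     \<lparr>ground = S,
      bases = {Y. Y \<subseteq> S \<and> (\<forall>C\<in>\<C>. \<not> C \<subseteq> Y) \<and>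
                  (\<forall>x\<in>S - Y. \<exists>C\<in>\<C>. C \<subseteq> insert x Y)}\<rparr>"

text \<open>The graph consisting of two cycles \<open>A\<close> and \<open>B\<close> glued along the edge \<open>e\<close> has exactly three
  cycles: \<open>A\<close>, \<open>B\<close>, and the one obtained from \<open>A \<union> B\<close> by dropping \<open>e\<close>.\<close>

definition glued_cycles_matroid :: "'a set \<Rightarrow> 'a set \<Rightarrow> 'a \<Rightarrow> 'a matroid" where
  "glued_cycles_matroid A B e = matroid_of_circuits (A \<union> B) {A, B, (A \<union> B) - {e}}"

lemma indep_matroid_of_circuits:
  assumes "finite S"
  shows "indep (matroid_of_circuits S \<C>) X \<longleftrightarrow> X \<subseteq> S \<and> (\<forall>C\<in>\<C>. \<not> C \<subseteq> X)"
proof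
  assume "indep (matroid_of_circuits S \<C>) X"
  then show "X \<subseteq> S \<and> (\<forall>C\<in>\<C>. \<not> C \<subseteq> X)"
    unfolding indep_def matroid_of_circuits_def by (force dest: subset_trans)
next
  assume X: "X \<subseteq> S \<and> (\<forall>C\<in>\<C>. \<not> C \<subseteq> X)"
  define I where "I = {Y. Y \<subseteq> S \<and> (\<forall>C\<in>\<C>. \<not> C \<subseteq> Y)}"
  have "finite I" using assms unfolding I_def by simp
  moreover have "X \<in> I" using X unfolding I_def by simp
  ultimately obtain Y where Y: "Y \<in> I" "X \<subseteq> Y" "\<And>Z. Z \<in> I \<Longrightarrow> Y \<subseteq> Z \<Longrightarrow> Y = Z"
    using finite_has_maximal2[of I X] by metis
  have "\<exists>C\<in>\<C>. C \<subseteq> insert x Y" if "x \<in> S - Y" for x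
  proof (rule ccontr)
    assume "\<not> ?thesis"
    then have "insert x Y \<in> I" using that Y(1) unfolding I_def by auto
    then show False using Y(3)[of "insert x Y"] that by auto
  qed
  then have "Y \<in> bases (matroid_of_circuits S \<C>)"
    using Y(1) unfolding I_def matroid_of_circuits_def by auto
  then show "indep (matroid_of_circuits S \<C>) X" using Y(2) unfolding indep_def by auto
qed

lemma circuit_glued_cycles_matroid:
  assumes "finite A" "finite B" "card A \<ge> 2" "card B \<ge> 2" "A \<inter> B = {e}"
  shows "circuit (glued_cycles_matroid A B e) X \<longleftrightarrow> X \<in> {A, B, (A \<union> B) - {e}}"
proof -
  let ?\<C> = "{A, B, (A \<union> B) - {e}}"
  have "\<not> A \<subseteq> {e}" "\<not> B \<subseteq> {e}"
    using assms(3,4) card_mono[of "{e}" A] card_mono[of "{e}" B] by auto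
  then obtain a b where a: "a \<in> A" "a \<noteq> e" "a \<notin> B" and b: "b \<in> B" "b \<noteq> e" "b \<notin> A"
    using assms(5) by blast
  have e: "e \<in> A" "e \<in> B" using assms(5) by auto
  have anti: "C = D" if "C \<in> ?\<C>" "D \<in> ?\<C>" "C \<subseteq> D" for C D
    using that a b e by blast
  have sub: "C \<subseteq> A \<union> B" if "C \<in> ?\<C>" for C using that by auto
  have ind: "indep (glued_cycles_matroid A B e) Y \<longleftrightarrow> Y \<subseteq> A \<union> B \<and> (\<forall>C\<in>?\<C>. \<not> C \<subseteq> Y)" for Y
    unfolding glued_cycles_matroid_def using assms(1,2) by (intro indep_matroid_of_circuits) auto
  have gr: "ground (glued_cycles_matroid A B e) = A \<union> B"
    unfolding glued_cycles_matroid_def matroid_of_circuits_def by simp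
  show ?thesis
  proof
    assume X: "circuit (glued_cycles_matroid A B e) X"
    then obtain C where C: "C \<in> ?\<C>" "C \<subseteq> X" unfolding circuit_def ind gr by meson
    have "\<not> C \<subset> X"
    proof
      assume "C \<subset> X"
      then have "indep (glued_cycles_matroid A B e) C" using X unfolding circuit_def by blast
      then show False using C(1) unfolding ind by blast
    qed
    then show "X \<in> ?\<C>" using C by blast
  next
    assume X: "X \<in> ?\<C>"
    show "circuit (glued_cycles_matroid A B e) X"
      unfolding circuit_def ind gr
    proof (intro conjI allI impI ballI)
      show "X \<subseteq> A \<union> B" using sub[OF X] .
      show "\<not> (X \<subseteq> A \<union> B \<and> (\<forall>C\<in>?\<C>. \<not> C \<subseteq> X))" using X by blast
      fix Y assume Y: "Y \<subset> X"
      show "Y \<subseteq> A \<union> B" using Y sub[OF X] by blast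
      fix C assume C: "C \<in> ?\<C>"
      show "\<not> C \<subseteq> Y"
      proof
        assume "C \<subseteq> Y"
        then have "C = X" using anti[OF C X] Y by blast
        then show False using \<open>C \<subseteq> Y\<close> Y by blast
      qed
    qed
  qed
qed


section \<open>Finite-dimensional rational representations\<close>

text \<open>A representation is a dimension together with a matrix for each group element; the matrices
  of elements outside the carrier of the group are irrelevant. Since a representation does not
  record its group, restriction to a subgroup is implicit.\<close>

type_synonym 'g rep = "nat \<times> ('g \<Rightarrow> rat mat)"

definition is_rep :: "'g monoid \<Rightarrow> 'g rep \<Rightarrow> bool" where
  "is_rep W = (\<lambda>(n, \<rho>).
     (\<forall>g\<in>carrier W. \<rho> g \<in> carrier_mat n n) \<and>
     (\<forall>g\<in>carrier W. \<forall>h\<in>carrier W. \<rho> (g \<otimes>\<^bsub>W\<^esub> h) = \<rho> g * \<rho> h) \<and>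
     \<rho> \<one>\<^bsub>W\<^esub> = 1\<^sub>m n)"

definition rep_iso :: "'g monoid \<Rightarrow> 'g rep \<Rightarrow> 'g rep \<Rightarrow> bool" where
  "rep_iso W = (\<lambda>(n, \<rho>) (m, \<sigma>).
     n = m \<and> (\<exists>T\<in>carrier_mat n n. invertible_mat T \<and> (\<forall>g\<in>carrier W. T * \<rho> g = \<sigma> g * T)))"

definition rep_zero :: "'g rep" where
  "rep_zero = (0, \<lambda>_. 1\<^sub>m 0)"

definition rep_triv :: "'g rep" where
  "rep_triv = (1, \<lambda>_. 1\<^sub>m 1)"

definition rep_sum :: "'g rep \<Rightarrow> 'g rep \<Rightarrow> 'g rep" where
  "rep_sum = (\<lambda>(n, \<rho>) (m, \<sigma>).
     (n + m, \<lambda>g. four_block_mat (\<rho> g) (0\<^sub>m n m) (0\<^sub>m m n) (\<sigma> g)))"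

definition kronecker :: "rat mat \<Rightarrow> rat mat \<Rightarrow> rat mat" where
  "kronecker P Q = mat (dim_row P * dim_row Q) (dim_col P * dim_col Q)
     (\<lambda>(i, j). P $$ (i div dim_row Q, j div dim_col Q) * Q $$ (i mod dim_row Q, j mod dim_col Q))"

definition rep_tensor :: "'g rep \<Rightarrow> 'g rep \<Rightarrow> 'g rep" where
  "rep_tensor = (\<lambda>(n, \<rho>) (m, \<sigma>). (n * m, \<lambda>g. kronecker (\<rho> g) (\<sigma> g)))"

definition rep_ext_tensor :: "'g rep \<Rightarrow> 'h rep \<Rightarrow> ('g \<times> 'h) rep" where
  "rep_ext_tensor = (\<lambda>(n, \<rho>) (m, \<sigma>). (n * m, \<lambda>(g, h). kronecker (\<rho> g) (\<sigma> h)))"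

definition left_transversal :: "'g monoid \<Rightarrow> 'g set \<Rightarrow> 'g list" where
  "left_transversal W H = (SOME ts. distinct ts \<and> set ts \<subseteq> carrier W \<and>
     (\<forall>g\<in>carrier W. \<exists>!t. t \<in> set ts \<and> g \<in> t <#\<^bsub>W\<^esub> H))"

text \<open>Induction from a subgroup \<open>H\<close> of finite index: with respect to the basis
  \<open>t\<^sub>a \<otimes> v\<^sub>i\<close> (in position \<open>a * n + i\<close>), where \<open>t\<^sub>a\<close> runs through representatives of
  the left cosets of \<open>H\<close> and \<open>v\<^sub>i\<close> through a basis of the \<open>n\<close>-dimensional representation \<open>\<rho>\<close>,
  the element \<open>g\<close> has the blocks \<open>\<rho> (t\<^sub>a\<^sup>-\<^sup>1 g t\<^sub>b)\<close>, understood to be \<open>0\<close> unless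
  \<open>t\<^sub>a\<^sup>-\<^sup>1 g t\<^sub>b \<in> H\<close>.\<close>

definition rep_ind :: "'g monoid \<Rightarrow> 'g set \<Rightarrow> 'g rep \<Rightarrow> 'g rep" where
  "rep_ind W H = (\<lambda>(n, \<rho>).
     let ts = left_transversal W H; N = length ts * n in
     (N, \<lambda>g. mat N N (\<lambda>(p, q).
        let h = inv\<^bsub>W\<^esub> (ts ! (p div n)) \<otimes>\<^bsub>W\<^esub> g \<otimes>\<^bsub>W\<^esub> ts ! (q div n)
        in if h \<in> H then \<rho> h $$ (p mod n, q mod n) else 0)))"


section \<open>Grothendieck rings of virtual representations\<close>

text \<open>A virtual representation is a class of formal differences \<open>V - V'\<close>, where
  \<open>V - V' = U - U'\<close> iff \<open>V \<oplus> U' \<oplus> X \<cong> U \<oplus> V' \<oplus> X\<close> for some \<open>X\<close>.\<close>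

type_synonym 'g vrep = "('g rep \<times> 'g rep) set"

definition vrep_rel :: "'g monoid \<Rightarrow> (('g rep \<times> 'g rep) \<times> ('g rep \<times> 'g rep)) set" where
  "vrep_rel W = {((V, V'), (U, U')).
     is_rep W V \<and> is_rep W V' \<and> is_rep W U \<and> is_rep W U' \<and>
     (\<exists>X. is_rep W X \<and> rep_iso W (rep_sum (rep_sum V U') X) (rep_sum (rep_sum U V') X))}"

definition vclass :: "'g monoid \<Rightarrow> 'g rep \<Rightarrow> 'g rep \<Rightarrow> 'g vrep" where
  "vclass W V V' = vrep_rel W `` {(V, V')}"

definition VRep :: "'g monoid \<Rightarrow> 'g vrep ring" where
  "VRep W = \<lparr>
     carrier = ({V. is_rep W V} \<times> {V. is_rep W V}) // vrep_rel W,
     monoid.mult = (\<lambda>X Y. \<Union>(V, V')\<in>X. \<Union>(U, U')\<in>Y.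
        vclass W (rep_sum (rep_tensor V U) (rep_tensor V' U'))
                 (rep_sum (rep_tensor V U') (rep_tensor V' U))),
     one = vclass W rep_triv rep_zero,
     zero = vclass W rep_zero rep_zero,
     add = (\<lambda>X Y. \<Union>(V, V')\<in>X. \<Union>(U, U')\<in>Y. vclass W (rep_sum V U) (rep_sum V' U'))\<rparr>"

definition vind :: "'g monoid \<Rightarrow> 'g set \<Rightarrow> 'g vrep \<Rightarrow> 'g vrep" where
  "vind W H X = (\<Union>(V, V')\<in>X. vclass W (rep_ind W H V) (rep_ind W H V'))"

definition vext_tensor ::
    "'g monoid \<Rightarrow> 'h monoid \<Rightarrow> 'g vrep \<Rightarrow> 'h vrep \<Rightarrow> ('g \<times> 'h) vrep" where
  "vext_tensor G H X Y = (\<Union>(V, V')\<in>X. \<Union>(U, U')\<in>Y.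
     vclass (G \<times>\<times> H) (rep_sum (rep_ext_tensor V U) (rep_ext_tensor V' U'))
                      (rep_sum (rep_ext_tensor V U') (rep_ext_tensor V' U)))"

abbreviation grVRep :: "'g monoid \<Rightarrow> ('g vrep, nat \<Rightarrow> 'g vrep) up_ring" where
  "grVRep W \<equiv> UP (VRep W)"

abbreviation gr_coeff :: "'g monoid \<Rightarrow> (nat \<Rightarrow> 'g vrep) \<Rightarrow> nat \<Rightarrow> 'g vrep" where
  "gr_coeff W \<equiv> up_ring.coeff (grVRep W)"

abbreviation gr_x_pow :: "'g monoid \<Rightarrow> nat \<Rightarrow> (nat \<Rightarrow> 'g vrep)" where
  "gr_x_pow W k \<equiv> up_ring.monom (grVRep W) \<one>\<^bsub>VRep W\<^esub> k"

definition gr_ind :: "'g monoid \<Rightarrow> 'g set \<Rightarrow> (nat \<Rightarrow> 'g vrep) \<Rightarrow> (nat \<Rightarrow> 'g vrep)" where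
  "gr_ind W H p = (\<lambda>k. vind W H (gr_coeff (W\<lparr>carrier := H\<rparr>) p k))"

definition gr_ext_tensor :: "'g monoid \<Rightarrow> 'h monoid \<Rightarrow>
    (nat \<Rightarrow> 'g vrep) \<Rightarrow> (nat \<Rightarrow> 'h vrep) \<Rightarrow> (nat \<Rightarrow> ('g \<times> 'h) vrep)" where
  "gr_ext_tensor G H p q = (\<lambda>k. \<Oplus>\<^bsub>VRep (G \<times>\<times> H)\<^esub>i\<in>{..k}.
     vext_tensor G H (gr_coeff G p i) (gr_coeff H q (k - i)))"

definition palindromic :: "'g monoid \<Rightarrow> nat \<Rightarrow> (nat \<Rightarrow> 'g vrep) \<Rightarrow> bool" where
  "palindromic W r p \<longleftrightarrow>
     (\<forall>j\<le>r. gr_coeff W p j = gr_coeff W p (r - j)) \<and>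
     (\<forall>j>r. gr_coeff W p j = \<zero>\<^bsub>VRep W\<^esub>)"


section \<open>Equivariant Kazhdan--Lusztig and Z-polynomials\<close>

text \<open>Only the values of \<open>\<phi> g\<close> on the ground set matter. Hence the action of the stabilizer of a
  flat on the contraction is given by the same \<open>\<phi>\<close>.\<close>

definition acts_on_matroid :: "'g monoid \<Rightarrow> ('g \<Rightarrow> 'a \<Rightarrow> 'a) \<Rightarrow> 'a matroid \<Rightarrow> bool" where
  "acts_on_matroid W \<phi> M \<longleftrightarrow>
     group_action W (ground M) (\<lambda>g. restrict (\<phi> g) (ground M)) \<and>
     (\<forall>g\<in>carrier W. \<forall>Y\<in>bases M. \<phi> g ` Y \<in> bases M)"

definition set_stabilizer :: "'g monoid \<Rightarrow> ('g \<Rightarrow> 'a \<Rightarrow> 'a) \<Rightarrow> 'a set \<Rightarrow> 'g set" where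
  "set_stabilizer W \<phi> F = stabilizer W (\<lambda>g. image (\<phi> g)) F"

definition flat_orbits :: "'g monoid \<Rightarrow> ('g \<Rightarrow> 'a \<Rightarrow> 'a) \<Rightarrow> 'a matroid \<Rightarrow> 'a set set set" where
  "flat_orbits W \<phi> M = orbits W (flats M) (\<lambda>g. image (\<phi> g))"

text \<open>A summand of the Z-polynomial does not depend on the choice of the flat in its orbit.\<close>

definition Z_sum :: "('g monoid \<Rightarrow> ('g \<Rightarrow> 'a \<Rightarrow> 'a) \<Rightarrow> 'a matroid \<Rightarrow> (nat \<Rightarrow> 'g vrep)) \<Rightarrow>
    'g monoid \<Rightarrow> ('g \<Rightarrow> 'a \<Rightarrow> 'a) \<Rightarrow> 'a matroid \<Rightarrow> (nat \<Rightarrow> 'g vrep)" where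
  "Z_sum P W \<phi> M = (\<Oplus>\<^bsub>grVRep W\<^esub>\<O>\<in>flat_orbits W \<phi> M.
     let F = (SOME F. F \<in> \<O>); W\<^sub>F = set_stabilizer W \<phi> F in
     gr_x_pow W (mrank M F) \<otimes>\<^bsub>grVRep W\<^esub>
       gr_ind W W\<^sub>F (P (W\<lparr>carrier := W\<^sub>F\<rparr>) \<phi> (contract M F)))"

definition is_KLZ_family ::
    "('g monoid \<Rightarrow> ('g \<Rightarrow> 'a \<Rightarrow> 'a) \<Rightarrow> 'a matroid \<Rightarrow> (nat \<Rightarrow> 'g vrep)) \<Rightarrow>
     ('g monoid \<Rightarrow> ('g \<Rightarrow> 'a \<Rightarrow> 'a) \<Rightarrow> 'a matroid \<Rightarrow> (nat \<Rightarrow> 'g vrep)) \<Rightarrow> bool" where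
  "is_KLZ_family P Z \<longleftrightarrow>
     (\<forall>W \<phi> M. group W \<and> is_matroid M \<and> loopless M \<and> acts_on_matroid W \<phi> M \<longrightarrow>
        P W \<phi> M \<in> carrier (grVRep W) \<and> Z W \<phi> M \<in> carrier (grVRep W) \<and>
        (rk M = 0 \<longrightarrow> P W \<phi> M = \<one>\<^bsub>grVRep W\<^esub> \<and> Z W \<phi> M = \<one>\<^bsub>grVRep W\<^esub>) \<and>
        (rk M > 0 \<longrightarrow> 2 * deg (VRep W) (P W \<phi> M) < rk M) \<and>
        Z W \<phi> M = Z_sum P W \<phi> M \<and> palindromic W (rk M) (Z W \<phi> M))"

text \<open>A family as above is uniquely determined on all actions of groups on loopless matroids; its
  values on other arguments are arbitrary, so that \<open>SOME\<close> rather than \<open>THE\<close> is appropriate.\<close>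

definition KL_poly :: "'g monoid \<Rightarrow> ('g \<Rightarrow> 'a \<Rightarrow> 'a) \<Rightarrow> 'a matroid \<Rightarrow> (nat \<Rightarrow> 'g vrep)" where
  "KL_poly W \<phi> M =
     (if loopless M then (SOME P. \<exists>Z. is_KLZ_family P Z) W \<phi> M else \<zero>\<^bsub>grVRep W\<^esub>)"

definition glued_action :: "'a set \<Rightarrow> 'a set \<Rightarrow> 'a \<Rightarrow> ('a \<Rightarrow> 'a) \<times> ('a \<Rightarrow> 'a) \<Rightarrow> 'a \<Rightarrow> 'a" where
  "glued_action A B e = (\<lambda>(\<sigma>, \<tau>) x.
     if x \<in> A - {e} then \<sigma> x else if x \<in> B - {e} then \<tau> x else x)"

end

theory Submission
  imports Defs "Jordan_Normal_Form.Determinant"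
begin

text \<open>A virtual representation of a finite group is determined by its character. The value at \<open>w\<close> of the
  character of \<open>P\<^sub>M\<^sup>W(x)\<close> is a polynomial \<open>kl M \<pi>\<close> that only depends on the permutation \<open>\<pi>\<close> of the
  ground set given by \<open>w\<close>: it is characterised by its degree and by the palindromicity of the sum
  \<open>Z(M, \<pi>)\<close> of \<open>x\<^bsup>rk F\<^esup> kl (M/F) \<pi>\<close> over the flats \<open>F\<close> fixed by \<open>\<pi>\<close>. So it suffices to prove the
  corresponding identity of polynomials.

  Let \<open>P = A - {e}\<close>, \<open>Q = B - {e}\<close>, \<open>a = |P|\<close>, \<open>b = |Q|\<close> and \<open>N = P \<union> Q\<close>. For a cycle \<open>S\<close> put
  \<open>T\<^sub>S = \<Sum>\<^bsub>F \<subset> S\<^esub> x\<^bsup>|F|\<^esup> p(S - F)\<close>, where \<open>p\<close> is the Kazhdan--Lusztig polynomial of a cycle, so that the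
  Z-polynomial of the cycle is \<open>T\<^sub>S + x\<^bsup>|S| - 1\<^esup>\<close>. The contraction by a flat \<open>F\<close> of
  \<open>C\<^bsub>A,B\<^esub>\<close> is a direct sum of two cycles if \<open>e \<in> F\<close>. If \<open>e \<notin> F\<close>, then \<open>F\<close> contains neither \<open>P\<close> nor
  \<open>Q\<close>, and the contraction consists of two glued cycles again. With \<open>p(P \<union> Q) - x p(P) p(Q)\<close> for the glued cycles,
  the Z-polynomial of \<open>C\<^bsub>A,B\<^esub>\<close> becomes
  \<open>T\<^sub>N - x\<^sup>a T\<^sub>Q - x\<^sup>b T\<^sub>P - x T\<^sub>P T\<^sub>Q + x (T\<^sub>P + x\<^bsup>a - 1\<^esup>) (T\<^sub>Q + x\<^bsup>b - 1\<^esup>) = T\<^sub>N + x\<^bsup>a + b - 1\<^esup>\<close>,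
  the Z-polynomial of the cycle \<open>N\<close>, which is palindromic.\<close>

section \<open>Contractions of matroids\<close>

text \<open>\<open>KL_poly\<close> picks a family by \<open>SOME\<close>, so nothing can be said
  about it before some family satisfying \<open>is_KLZ_family\<close> is known to exist. That
  predicate ranges over all groups, including infinite ones, where characters do not separate
  virtual representations. Existence is therefore established directly in the Grothendieck groups,
  by recursion on the size of the ground set; induction makes sense there because stabilizers of
  flats have finite index. Characters enter only for finite groups: whatever family
  \<open>SOME\<close> returns, its character is forced to be \<open>kl\<close>. That characters
  determine rational representations rests on an invariant inner product, which yields intertwiners,
  and on averaging, which splits off a common block. The formula for glued cycles is not derived but
  verified by uniqueness, so besides the palindrome the candidate must satisfy the degree bound. The
  flats through \<open>e\<close> require \<open>kl\<close> to be multiplicative on direct sums, and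
  conjugate stabilizers require it to be invariant under isomorphisms.\<close>

lemma finite_bases: "is_matroid M \<Longrightarrow> finite (bases M)"
  unfolding is_matroid_def by (meson PowI finite_Pow_iff rev_finite_subset subsetI)

lemma basis_subset: "is_matroid M \<Longrightarrow> Y \<in> bases M \<Longrightarrow> Y \<subseteq> ground M"
  unfolding is_matroid_def by blast

lemma finite_basis: "is_matroid M \<Longrightarrow> Y \<in> bases M \<Longrightarrow> finite Y"
  by (meson basis_subset finite_subset is_matroid_def)

lemma card_le_mrank:
  assumes "is_matroid M" "Y \<in> bases M"
  shows "card (Y \<inter> X) \<le> mrank M X"
  unfolding mrank_def using finite_bases[OF assms(1)] assms(2) by (intro Max_ge) auto

lemma mrank_attained:
  assumes "is_matroid M"
  obtains Y where "Y \<in> bases M" "card (Y \<inter> X) = mrank M X"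
proof -
  have "mrank M X \<in> (\<lambda>Y. card (Y \<inter> X)) ` bases M"
    unfolding mrank_def using finite_bases[OF assms] assms by (intro Max_in) (auto simp: is_matroid_def)
  then show ?thesis using that by auto
qed

lemma mrank_eqI:
  assumes "is_matroid M" "Y \<in> bases M" "card (Y \<inter> X) = k" "\<And>Y. Y \<in> bases M \<Longrightarrow> card (Y \<inter> X) \<le> k"
  shows "mrank M X = k"
  using assms by (metis card_le_mrank le_antisym mrank_attained)

lemma basis_exchange:
  assumes "is_matroid M" "X \<in> bases M" "Y \<in> bases M" "x \<in> X - Y"
  obtains y where "y \<in> Y - X" "insert y (X - {x}) \<in> bases M"
  using assms unfolding is_matroid_def by blast

lemma card_swap: "finite X \<Longrightarrow> x \<in> X \<Longrightarrow> y \<notin> X \<Longrightarrow> card (insert y (X - {x})) = card X"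
  using card_Suc_Diff1[of X x] by simp

lemma card_Suc_nonempty: "Suc n = card S \<Longrightarrow> \<exists>x. x \<in> S"
  by (cases "S = {}") auto

text \<open>Exchanging elements of \<open>X - Y\<close> one by one for elements of \<open>Y\<close>
  keeps the cardinality of the basis and shrinks \<open>X - Y\<close>, until the basis lies inside
  \<open>Y\<close>.\<close>

lemma card_bases_le:
  assumes M: "is_matroid M" and "X \<in> bases M" "Y \<in> bases M"
  shows "card X \<le> card Y"
  using assms(2)
proof (induction "card (X - Y)" arbitrary: X)
  case 0
  then have "X \<subseteq> Y" using finite_basis[OF M] by (metis Diff_eq_empty_iff card_0_eq finite_Diff)
  then show ?case using finite_basis[OF M assms(3)] by (simp add: card_mono)
next
  case (Suc n)
  have fin: "finite X" using finite_basis[OF M Suc.prems] .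
  obtain x where x: "x \<in> X - Y" using card_Suc_nonempty[OF Suc.hyps(2)] by blast
  obtain y where y: "y \<in> Y - X" "insert y (X - {x}) \<in> bases M"
    using basis_exchange[OF M Suc.prems assms(3) x] .
  have "insert y (X - {x}) - Y = (X - Y) - {x}" using y by auto
  then have "n = card (insert y (X - {x}) - Y)" using Suc.hyps(2) x by simp
  then have "card (insert y (X - {x})) \<le> card Y" using Suc.hyps(1) y(2) by blast
  moreover have "card (insert y (X - {x})) = card X" using x y fin by (intro card_swap) auto
  ultimately show ?case by simp
qed

lemma card_bases_eq:
  assumes "is_matroid M" "X \<in> bases M" "Y \<in> bases M"
  shows "card X = card Y"
  using card_bases_le[OF assms] card_bases_le[OF assms(1,3,2)] by simp

lemma rk_eq_card_basis:
  assumes "is_matroid M" "Y \<in> bases M"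
  shows "rk M = card Y"
proof (rule mrank_eqI[OF assms])
  show "card (Y \<inter> ground M) = card Y" using basis_subset[OF assms] by (simp add: Int_absorb2)
  show "card (Z \<inter> ground M) \<le> card Y" if "Z \<in> bases M" for Z
    using basis_subset[OF assms(1) that] card_bases_le[OF assms(1) that assms(2)]
    by (simp add: Int_absorb2)
qed

text \<open>The axiom removes a prescribed element; here a prescribed \<open>x\<close> is to be
  inserted. Among the bases that contain \<open>x\<close> and \<open>X \<inter> Y\<close>, take one
  with the fewest elements outside \<open>insert x Y\<close>. If any were left outside, an exchange
  against \<open>Y\<close> would lower their number, so the basis lies in \<open>insert x Y\<close>;
  as all bases have the same size, it omits just one element of \<open>Y\<close>.\<close>

lemma basis_dual_exchange:
  assumes M: "is_matroid M" and X: "X \<in> bases M" and Y: "Y \<in> bases M" and x: "x \<in> X - Y"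
  obtains y where "y \<in> Y - X" "insert x (Y - {y}) \<in> bases M"
proof -
  define Q where "Q Z \<longleftrightarrow> Z \<in> bases M \<and> insert x (X \<inter> Y) \<subseteq> Z" for Z
  have "Q X" using X x unfolding Q_def by auto
  then obtain Z where Z: "Q Z" "\<And>Z'. Q Z' \<Longrightarrow> card (Z - insert x Y) \<le> card (Z' - insert x Y)"
    using ex_has_least_nat[of Q X "\<lambda>Z. card (Z - insert x Y)"] by blast
  have fin: "finite Z" using Z(1) finite_basis[OF M] unfolding Q_def by blast
  have sub: "Z \<subseteq> insert x Y"
  proof (rule ccontr)
    assume "\<not> ?thesis"
    then obtain z where z: "z \<in> Z" "z \<noteq> x" "z \<notin> Y" by blast
    then obtain w where w: "w \<in> Y - Z" "insert w (Z - {z}) \<in> bases M"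
      using basis_exchange[OF M _ Y, of Z z] Z(1) unfolding Q_def by blast
    then have "Q (insert w (Z - {z}))" using Z(1) z unfolding Q_def by auto
    then have "card (Z - insert x Y) \<le> card (insert w (Z - {z}) - insert x Y)" using Z(2) by blast
    also have "insert w (Z - {z}) - insert x Y = (Z - insert x Y) - {z}" using w by auto
    also have "card \<dots> < card (Z - insert x Y)" using z fin by (intro psubset_card_mono) auto
    finally show False by simp
  qed
  have ZM: "Z \<in> bases M" and xZ: "x \<in> Z" and XYZ: "X \<inter> Y \<subseteq> Z" using Z(1) unfolding Q_def by auto
  have cZ: "card Z = card Y" using card_bases_eq[OF M ZM Y] .
  have finY: "finite Y" using finite_basis[OF M Y] .
  have "Z - {x} \<subseteq> Y" using sub by auto
  moreover have "card (Z - {x}) < card Y" using cZ xZ fin by (metis card_Diff1_less)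
  ultimately obtain y where y: "y \<in> Y" "y \<notin> Z - {x}" by (metis less_irrefl subset_antisym subsetI)
  have "y \<noteq> x" using y x by auto
  have "Z \<subseteq> insert x (Y - {y})" using sub y \<open>y \<noteq> x\<close> by auto
  moreover have "card (insert x (Y - {y})) = card Z"
    using cZ x y finY card_swap[of Y y x] by simp
  ultimately have "Z = insert x (Y - {y})" using finY by (intro card_subset_eq) auto
  then show ?thesis using that[of y] ZM y XYZ \<open>y \<noteq> x\<close> by blast
qed

text \<open>This is what lets the exchange axiom pass to contractions: the part inside
  \<open>F\<close> of a basis attaining the rank of \<open>F\<close> can be prescribed. The elements
  of \<open>X \<inter> F\<close> are brought into \<open>Y\<close> one at a time by dual exchange,
  without touching \<open>Y - F\<close>.\<close>

lemma basis_swap: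
  assumes M: "is_matroid M" and X: "X \<in> bases M" and "Y \<in> bases M"
    and "card (X \<inter> F) = mrank M F" "card (Y \<inter> F) = mrank M F"
  shows "(X \<inter> F) \<union> (Y - F) \<in> bases M"
  using assms(3,5)
proof (induction "card (X \<inter> F - Y)" arbitrary: Y)
  case 0
  have fin: "finite X" "finite Y" using finite_basis[OF M] X 0 by auto
  have "X \<inter> F \<subseteq> Y \<inter> F" using 0(1) fin by auto
  then have "X \<inter> F = Y \<inter> F" using fin assms(4) 0(3) by (intro card_subset_eq) auto
  then show ?case using 0(2) by (metis Int_Diff_Un)
next
  case (Suc n)
  have fin: "finite X" "finite Y" using finite_basis[OF M] X Suc by auto
  obtain x where x: "x \<in> X \<inter> F - Y" using card_Suc_nonempty[OF Suc.hyps(2)] by blast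
  then obtain y where y: "y \<in> Y - X" "insert x (Y - {y}) \<in> bases M"
    using basis_dual_exchange[OF M X Suc.prems(1)] by blast
  \<comment> \<open>If the expelled element lay outside \<open>F\<close>, the new basis would meet
    \<open>F\<close> in one element more than the rank of \<open>F\<close>.\<close>
  have yF: "y \<in> F"
  proof (rule ccontr)
    assume "y \<notin> F"
    then have "insert x (Y - {y}) \<inter> F = insert x (Y \<inter> F)" using x by auto
    then have "card (insert x (Y - {y}) \<inter> F) = Suc (mrank M F)"
      using x fin Suc.prems(2) by simp
    then show False using card_le_mrank[OF M y(2), of F] by simp
  qed
  have "insert x (Y - {y}) \<inter> F = insert x (Y \<inter> F - {y})" using x by auto
  then have "card (insert x (Y - {y}) \<inter> F) = mrank M F"
    using x y yF fin Suc.prems(2) card_swap[of "Y \<inter> F" y x] by simp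
  moreover have "X \<inter> F - insert x (Y - {y}) = (X \<inter> F - Y) - {x}" using x y by auto
  then have "n = card (X \<inter> F - insert x (Y - {y}))" using Suc.hyps(2) x by simp
  ultimately have "X \<inter> F \<union> (insert x (Y - {y}) - F) \<in> bases M"
    using Suc.hyps(1) y(2) by blast
  moreover have "insert x (Y - {y}) - F = Y - F" using x yF by auto
  ultimately show ?case by simp
qed

lemma ground_contract [simp]: "ground (contract M F) = ground M - F"
  by (simp add: contract_def)

lemma bases_contract:
  "bases (contract M F) = {Y - F | Y. Y \<in> bases M \<and> card (Y \<inter> F) = mrank M F}"
  by (simp add: contract_def)

lemma is_matroid_contract:
  assumes M: "is_matroid M"
  shows "is_matroid (contract M F)"
  unfolding is_matroid_def
proof (intro conjI ballI)
  show "finite (ground (contract M F))" using M by (simp add: is_matroid_def)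
  show "bases (contract M F) \<noteq> {}" using mrank_attained[OF M, of F] by (auto simp: bases_contract)
  show "X \<subseteq> ground (contract M F)" if "X \<in> bases (contract M F)" for X
    using that basis_subset[OF M] by (auto simp: bases_contract)
next
  fix X' Y' x assume X': "X' \<in> bases (contract M F)" and Y': "Y' \<in> bases (contract M F)"
    and x: "x \<in> X' - Y'"
  obtain X Y where XY: "X \<in> bases M" "card (X \<inter> F) = mrank M F" "X' = X - F"
      "Y \<in> bases M" "card (Y \<inter> F) = mrank M F" "Y' = Y - F"
    using X' Y' by (auto simp: bases_contract)
  \<comment> \<open>\<open>Z\<close> represents the same basis \<open>Y'\<close> of the contraction
    but agrees with \<open>X\<close> on \<open>F\<close>, so an exchange between \<open>X\<close>
    and \<open>Z\<close> takes place outside \<open>F\<close>.\<close>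
  define Z where "Z = (X \<inter> F) \<union> (Y - F)"
  have Z: "Z \<in> bases M" unfolding Z_def using basis_swap[OF M] XY by blast
  have "x \<in> X - Z" using x XY unfolding Z_def by auto
  then obtain y where y: "y \<in> Z - X" "insert y (X - {x}) \<in> bases M"
    using basis_exchange[OF M XY(1) Z] by blast
  have yF: "y \<notin> F" using y unfolding Z_def by auto
  have "insert y (X - {x}) \<inter> F = X \<inter> F" using yF x XY by auto
  moreover have "insert y (X' - {x}) = insert y (X - {x}) - F" using yF XY by auto
  ultimately have "insert y (X' - {x}) \<in> bases (contract M F)"
    using XY(2) y(2) unfolding bases_contract mem_Collect_eq
    by (intro exI[of _ "insert y (X - {x})"] conjI) simp_all
  moreover have "y \<in> Y' - X'" using y XY unfolding Z_def by auto
  ultimately show "\<exists>y\<in>Y' - X'. insert y (X' - {x}) \<in> bases (contract M F)" by blast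
qed

lemma rk_contract:
  assumes M: "is_matroid M"
  shows "rk (contract M F) + mrank M F = rk M"
proof -
  obtain Y where Y: "Y \<in> bases M" "card (Y \<inter> F) = mrank M F" using mrank_attained[OF M] .
  then have "Y - F \<in> bases (contract M F)" by (auto simp: bases_contract)
  then have "rk (contract M F) = card (Y - F)" by (intro rk_eq_card_basis is_matroid_contract M)
  moreover have "card (Y - F) + card (Y \<inter> F) = card Y"
    using finite_basis[OF M Y(1)] card_Int_Diff[of Y F] by simp
  ultimately show ?thesis using rk_eq_card_basis[OF M Y(1)] Y(2) by simp
qed

text \<open>A basis attaining the larger rank of \<open>insert x F\<close> must contain
  \<open>x\<close>, and it still attains the rank of \<open>F\<close>; its part outside
  \<open>F\<close> is thus a basis of the contraction through \<open>x\<close>.\<close>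

lemma loopless_contract:
  assumes M: "is_matroid M" and F: "F \<in> flats M"
  shows "loopless (contract M F)"
  unfolding loopless_def
proof
  fix x assume "x \<in> ground (contract M F)"
  then have x: "x \<in> ground M - F" by simp
  then have lt: "mrank M F < mrank M (insert x F)" using F by (auto simp: flats_def)
  obtain Y where Y: "Y \<in> bases M" "card (Y \<inter> insert x F) = mrank M (insert x F)"
    using mrank_attained[OF M] .
  have le: "card (Y \<inter> F) \<le> mrank M F" using card_le_mrank[OF M Y(1)] .
  have xY: "x \<in> Y"
  proof (rule ccontr)
    assume "x \<notin> Y"
    then have "Y \<inter> insert x F = Y \<inter> F" by auto
    then show False using Y(2) lt le by simp
  qed
  then have "card (Y \<inter> insert x F) \<le> Suc (card (Y \<inter> F))"
    using finite_basis[OF M Y(1)] by (simp add: card_insert_le_m1 card_insert_if)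
  then have "card (Y \<inter> F) = mrank M F" using Y(2) lt le by simp
  then have "Y - F \<in> bases (contract M F)" using Y(1) by (auto simp: bases_contract)
  then show "indep (contract M F) {x}" using xY x unfolding indep_def by auto
qed

lemma mrank_empty [simp]: "is_matroid M \<Longrightarrow> mrank M {} = 0"
  by (metis Int_empty_right card.empty mrank_attained)

lemma contract_empty [simp]: "is_matroid M \<Longrightarrow> contract M {} = M"
  unfolding contract_def by simp

lemma empty_flat:
  assumes M: "is_matroid M" and "loopless M"
  shows "{} \<in> flats M"
proof -
  have "0 < mrank M {x}" if "x \<in> ground M" for x
  proof -
    have "indep M {x}" using assms(2) that by (simp add: loopless_def)
    then obtain Y where Y: "Y \<in> bases M" "x \<in> Y" unfolding indep_def by auto
    then have "Y \<inter> {x} = {x}" by auto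
    then show ?thesis using card_le_mrank[OF M Y(1), of "{x}"] by simp
  qed
  then show ?thesis using M by (simp add: flats_def)
qed

lemma rk_eq_0_iff:
  assumes M: "is_matroid M" and "loopless M"
  shows "rk M = 0 \<longleftrightarrow> ground M = {}"
proof
  assume r: "rk M = 0"
  have "Y = {}" if "Y \<in> bases M" for Y
    using rk_eq_card_basis[OF M that] r finite_basis[OF M that] by simp
  then show "ground M = {}" using assms(2) unfolding loopless_def indep_def by fastforce
next
  assume "ground M = {}"
  then show "rk M = 0" using M by simp
qed

lemma finite_flats: "is_matroid M \<Longrightarrow> finite (flats M)"
  unfolding flats_def is_matroid_def by simp

lemma flat_subset: "F \<in> flats M \<Longrightarrow> F \<subseteq> ground M"
  by (simp add: flats_def)

lemma card_contract_less:
  assumes "is_matroid M" "F \<in> flats M" "F \<noteq> {}"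
  shows "card (ground (contract M F)) < card (ground M)"
  using assms flat_subset[OF assms(2)] by (intro psubset_card_mono) (auto simp: is_matroid_def)

text \<open>Turns the search for flats into the computation of contractions, which the recursion
  needs anyway. The flats of direct sums, of cycles and of glued cycles are all found in this
  way.\<close>

lemma flats_iff_loopless_contract:
  assumes M: "is_matroid M"
  shows "F \<in> flats M \<longleftrightarrow> F \<subseteq> ground M \<and> loopless (contract M F)"
proof
  assume "F \<in> flats M"
  then show "F \<subseteq> ground M \<and> loopless (contract M F)" using loopless_contract[OF M] flat_subset by blast
next
  assume F: "F \<subseteq> ground M \<and> loopless (contract M F)"
  have "mrank M F < mrank M (insert x F)" if x: "x \<in> ground M - F" for x
  proof -
    obtain Y where Y: "Y \<in> bases M" "card (Y \<inter> F) = mrank M F" "x \<in> Y"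
      using F x unfolding loopless_def indep_def bases_contract by auto
    have "card (Y \<inter> insert x F) = Suc (card (Y \<inter> F))"
      using x Y finite_basis[OF M Y(1)] by simp
    then show ?thesis using card_le_mrank[OF M Y(1), of "insert x F"] Y by simp
  qed
  then show "F \<in> flats M" using F unfolding flats_def by blast
qed


section \<open>Palindromic polynomials\<close>

definition pal :: "nat \<Rightarrow> rat poly \<Rightarrow> bool" where
  "pal r p \<longleftrightarrow> (\<forall>j\<le>r. poly.coeff p j = poly.coeff p (r - j)) \<and> (\<forall>j>r. poly.coeff p j = 0)"

text \<open>If \<open>p + q\<close> is palindromic of degree \<open>r\<close> and \<open>p\<close>
  has degree less than \<open>r/2\<close>, then \<open>p\<close> vanishes at \<open>r - j\<close>
  whenever \<open>2 * j < r\<close>, which forces its coefficient at \<open>j\<close> to be the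
  difference written here.\<close>

definition palfix :: "nat \<Rightarrow> rat poly \<Rightarrow> rat poly" where
  "palfix r q = Abs_poly (\<lambda>j. if 2 * j < r then poly.coeff q (r - j) - poly.coeff q j else 0)"

lemma coeff_palfix:
  "poly.coeff (palfix r q) j = (if 2 * j < r then poly.coeff q (r - j) - poly.coeff q j else 0)"
  unfolding palfix_def by (subst coeff_Abs_poly[of r]) auto

lemma pal_palfix:
  assumes "\<And>j. j > r \<Longrightarrow> poly.coeff q j = 0"
  shows "pal r (palfix r q + q)"
  unfolding pal_def
proof (intro conjI allI impI)
  fix j assume "j \<le> r"
  then consider "2 * j < r" "\<not> 2 * (r - j) < r" | "2 * (r - j) < r" "\<not> 2 * j < r" | "r - j = j"
    by linarith
  then show "poly.coeff (palfix r q + q) j = poly.coeff (palfix r q + q) (r - j)"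
    by cases (use \<open>j \<le> r\<close> in \<open>auto simp: coeff_palfix\<close>)
qed (use assms in \<open>auto simp: coeff_palfix\<close>)

lemma palfix_unique:
  assumes "\<And>j. r \<le> 2 * j \<Longrightarrow> poly.coeff p j = 0" "pal r (p + q)"
  shows "p = palfix r q"
proof (rule poly_eqI)
  fix j
  show "poly.coeff p j = poly.coeff (palfix r q) j"
  proof (cases "2 * j < r")
    case True
    then have "j \<le> r" by simp
    then have "poly.coeff (p + q) j = poly.coeff (p + q) (r - j)" using assms(2) unfolding pal_def by blast
    moreover have "poly.coeff p (r - j) = 0" using True by (intro assms(1)) auto
    ultimately show ?thesis using True by (simp add: coeff_palfix)
  qed (use assms(1) in \<open>auto simp: coeff_palfix\<close>)
qed

lemma pal_sym: "pal r p \<Longrightarrow> j \<le> r \<Longrightarrow> poly.coeff p (r - j) = poly.coeff p j"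
  unfolding pal_def by metis

lemma pal_coeff_0: "pal r p \<Longrightarrow> j > r \<Longrightarrow> poly.coeff p j = 0"
  unfolding pal_def by metis

lemma pal_mult:
  assumes "pal r p" "pal s q"
  shows "pal (r + s) (p * q)"
proof -
  \<comment> \<open>The summation range is cut down to the indices where both factors can be
    non-zero: only there does the reflection of \<open>i\<close> to \<open>r - i\<close> survive
    truncated subtraction.\<close>
  define S where "S j = {i. i \<le> j \<and> i \<le> r \<and> j - i \<le> s}" for j
  have coeff: "poly.coeff (p * q) j = (\<Sum>i\<in>S j. poly.coeff p i * poly.coeff q (j - i))" for j
    unfolding coeff_mult
  proof (intro sum.mono_neutral_right ballI)
    fix i assume "i \<in> {..j} - S j"
    then have "i > r \<or> j - i > s" unfolding S_def by auto
    then show "poly.coeff p i * poly.coeff q (j - i) = 0"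
      using pal_coeff_0[OF assms(1)] pal_coeff_0[OF assms(2)] by auto
  qed (auto simp: S_def)
  show ?thesis unfolding pal_def
  proof (intro conjI allI impI)
    fix j assume j: "j \<le> r + s"
    have "(\<Sum>i\<in>S j. poly.coeff p i * poly.coeff q (j - i)) =
        (\<Sum>i\<in>S (r + s - j). poly.coeff p i * poly.coeff q (r + s - j - i))"
    proof (rule sum.reindex_bij_witness[of _ "\<lambda>i. r - i" "\<lambda>i. r - i"])
      fix i assume i: "i \<in> S j"
      have "poly.coeff p (r - i) = poly.coeff p i" using i pal_sym[OF assms(1)] unfolding S_def by simp
      moreover have "r + s - j - (r - i) = s - (j - i)" using i j unfolding S_def by auto
      moreover have "poly.coeff q (s - (j - i)) = poly.coeff q (j - i)"
        by (rule pal_sym[OF assms(2)]) (use i in \<open>simp add: S_def\<close>)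
      ultimately show "poly.coeff p (r - i) * poly.coeff q (r + s - j - (r - i)) =
          poly.coeff p i * poly.coeff q (j - i)" by simp
    qed (use j in \<open>auto simp: S_def\<close>)
    then show "poly.coeff (p * q) j = poly.coeff (p * q) (r + s - j)" unfolding coeff .
  next
    fix j assume "j > r + s"
    then have "S j = {}" unfolding S_def by auto
    then show "poly.coeff (p * q) j = 0" unfolding coeff by simp
  qed
qed


section \<open>Kazhdan--Lusztig polynomials twisted by a permutation\<close>

text \<open>The value at \<open>w\<close> of the character of \<open>P\<^sub>M\<^sup>W(x)\<close> only depends on the permutation \<open>\<pi>\<close> by which
  \<open>w\<close> acts on the ground set. Taking characters turns the sum over orbits of induced
  representations into a sum over the flats that are fixed by \<open>\<pi>\<close>.\<close>

function kl :: "'a matroid \<Rightarrow> ('a \<Rightarrow> 'a) \<Rightarrow> rat poly" where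
  "kl M \<pi> = (if finite (ground M) \<and> ground M \<noteq> {} then
     palfix (rk M) (\<Sum>F\<in>{F \<in> flats M. F \<noteq> {} \<and> \<pi> ` F = F}.
       Polynomial.monom 1 (mrank M F) * kl (contract M F) \<pi>) else 1)"
  by auto
termination
  by (relation "measure (\<lambda>(M, \<pi>). card (ground M))")
    (auto simp: flats_def intro!: psubset_card_mono)

declare kl.simps [simp del]

definition kl_rest :: "'a matroid \<Rightarrow> ('a \<Rightarrow> 'a) \<Rightarrow> rat poly" where
  "kl_rest M \<pi> = (\<Sum>F\<in>{F \<in> flats M. F \<noteq> {} \<and> \<pi> ` F = F}.
     Polynomial.monom 1 (mrank M F) * kl (contract M F) \<pi>)"

definition klZ :: "'a matroid \<Rightarrow> ('a \<Rightarrow> 'a) \<Rightarrow> rat poly" where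
  "klZ M \<pi> = (\<Sum>F\<in>{F \<in> flats M. \<pi> ` F = F}.
     Polynomial.monom 1 (mrank M F) * kl (contract M F) \<pi>)"

lemma kl_eq_palfix:
  "finite (ground M) \<Longrightarrow> ground M \<noteq> {} \<Longrightarrow> kl M \<pi> = palfix (rk M) (kl_rest M \<pi>)"
  unfolding kl_rest_def by (subst kl.simps) simp

lemma kl_empty_ground: "ground M = {} \<Longrightarrow> kl M \<pi> = 1"
  by (subst kl.simps) simp

lemma klZ_eq:
  assumes "is_matroid M" "loopless M"
  shows "klZ M \<pi> = kl M \<pi> + kl_rest M \<pi>"
proof -
  have "{F \<in> flats M. \<pi> ` F = F} = insert {} {F \<in> flats M. F \<noteq> {} \<and> \<pi> ` F = F}"
    using empty_flat[OF assms] by auto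
  then show ?thesis unfolding klZ_def kl_rest_def
    using finite_flats[OF assms(1)] assms(1) by simp
qed

text \<open>The second alternative is the constant 1 on the empty ground set, whose rank 0 violates
  the strict bound.\<close>

lemma kl_coeff_nonzero:
  assumes "is_matroid M" "poly.coeff (kl M \<pi>) i \<noteq> 0"
  shows "2 * i < rk M \<or> i = 0 \<and> ground M = {}"
proof (cases "ground M = {}")
  case False
  then have "kl M \<pi> = palfix (rk M) (kl_rest M \<pi>)"
    using assms(1) by (intro kl_eq_palfix) (auto simp: is_matroid_def)
  then show ?thesis using assms(2) by (simp add: coeff_palfix split: if_splits)
qed (use assms in \<open>auto simp: kl_empty_ground split: if_splits\<close>)

lemma kl_rest_coeff_0:
  assumes "is_matroid M" "j > rk M"
  shows "poly.coeff (kl_rest M \<pi>) j = 0"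
  unfolding kl_rest_def coeff_sum
proof (intro sum.neutral ballI)
  fix F
  have "rk (contract M F) + mrank M F = rk M" using rk_contract[OF assms(1)] .
  moreover have "poly.coeff (kl (contract M F) \<pi>) (j - mrank M F) = 0" if "rk (contract M F) < j - mrank M F"
  proof (rule ccontr)
    assume "\<not> ?thesis"
    from kl_coeff_nonzero[OF is_matroid_contract[OF assms(1)] this] that show False
      by (elim disjE conjE) linarith+
  qed
  ultimately show "poly.coeff (Polynomial.monom 1 (mrank M F) * kl (contract M F) \<pi>) j = 0"
    using assms(2) by (auto simp: coeff_monom_mult)
qed

lemma pal_klZ:
  assumes "is_matroid M" "loopless M"
  shows "pal (rk M) (klZ M \<pi>)"
proof (cases "ground M = {}")
  case True
  then have "{F \<in> flats M. F \<noteq> {} \<and> \<pi> ` F = F} = {}" by (auto simp: flats_def)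
  then have "kl_rest M \<pi> = 0" unfolding kl_rest_def by (simp only: sum.empty)
  then have "klZ M \<pi> = 1" unfolding klZ_eq[OF assms] using True by (simp add: kl_empty_ground)
  moreover have "rk M = 0" using True assms rk_eq_0_iff by blast
  ultimately show ?thesis by (simp add: pal_def)
next
  case False
  then have "kl M \<pi> = palfix (rk M) (kl_rest M \<pi>)"
    using assms(1) by (intro kl_eq_palfix) (auto simp: is_matroid_def)
  then show ?thesis unfolding klZ_eq[OF assms]
    using pal_palfix[of "rk M" "kl_rest M \<pi>"] kl_rest_coeff_0[OF assms(1)] by simp
qed

text \<open>Used to confirm a guessed value of \<open>kl\<close>: only the values on proper
  contractions enter \<open>kl_rest\<close>, and the guess must be the one polynomial of low degree
  that completes them to a palindrome.\<close>

lemma kl_unique: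
  assumes "is_matroid M" "ground M \<noteq> {}"
    and "\<And>j. rk M \<le> 2 * j \<Longrightarrow> poly.coeff p j = 0" "pal (rk M) (p + kl_rest M \<pi>)"
  shows "kl M \<pi> = p"
  using palfix_unique[OF assms(3,4)] kl_eq_palfix[of M \<pi>] assms(1,2) by (auto simp: is_matroid_def)

lemma image_contract_eq:
  assumes "bij_betw \<pi> S S" "F \<subseteq> S" "\<pi> ` F = F"
  shows "bij_betw \<pi> (S - F) (S - F)"
  using assms by (metis bij_betw_DiffI bij_betw_subset)

lemma mrank_image:
  assumes M: "is_matroid M" and f: "inj_on f (ground M)" and N: "bases N = (`) f ` bases M"
    and F: "F \<subseteq> ground M"
  shows "mrank N (f ` F) = mrank M F"
proof -
  have "card (f ` Y \<inter> f ` F) = card (Y \<inter> F)" if "Y \<in> bases M" for Y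
  proof -
    have "f ` Y \<inter> f ` F = f ` (Y \<inter> F)" using inj_on_image_Int[OF f basis_subset[OF M that] F] by simp
    then show ?thesis using f F by (metis card_image inf.coboundedI2 inj_on_subset)
  qed
  then show ?thesis unfolding mrank_def N image_image by (metis (mono_tags, lifting) image_cong)
qed

lemma contract_image:
  assumes M: "is_matroid M" and f: "bij_betw f (ground M) (ground N)" and N: "bases N = (`) f ` bases M"
    and F: "F \<subseteq> ground M"
  shows "bases (contract N (f ` F)) = (`) f ` bases (contract M F)"
    and "bij_betw f (ground (contract M F)) (ground (contract N (f ` F)))"
proof -
  have inj: "inj_on f (ground M)" using f by (simp add: bij_betw_def)
  have *: "card (f ` Y \<inter> f ` F) = card (Y \<inter> F)" "f ` Y - f ` F = f ` (Y - F)" if "Y \<in> bases M" for Y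
  proof -
    have "f ` Y \<inter> f ` F = f ` (Y \<inter> F)" using inj_on_image_Int[OF inj basis_subset[OF M that] F] by simp
    then show "card (f ` Y \<inter> f ` F) = card (Y \<inter> F)"
      using inj F by (metis card_image inf.coboundedI2 inj_on_subset)
    show "f ` Y - f ` F = f ` (Y - F)"
      using inj_on_image_set_diff[OF inj _ F, of Y] basis_subset[OF M that] by auto
  qed
  show "bases (contract N (f ` F)) = (`) f ` bases (contract M F)"
  proof
    show "bases (contract N (f ` F)) \<subseteq> (`) f ` bases (contract M F)"
    proof
      fix Z assume "Z \<in> bases (contract N (f ` F))"
      then obtain Y where Y: "Y \<in> bases M" "card (f ` Y \<inter> f ` F) = mrank M F" "Z = f ` Y - f ` F"
        unfolding bases_contract mrank_image[OF M inj N F] N by auto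
      then have "Y - F \<in> bases (contract M F)" unfolding bases_contract using *(1)[OF Y(1)] by auto
      then show "Z \<in> (`) f ` bases (contract M F)" unfolding Y(3) *(2)[OF Y(1)] by (rule imageI)
    qed
    show "(`) f ` bases (contract M F) \<subseteq> bases (contract N (f ` F))"
    proof
      fix Z assume "Z \<in> (`) f ` bases (contract M F)"
      then obtain Y where Y: "Y \<in> bases M" "card (Y \<inter> F) = mrank M F" "Z = f ` (Y - F)"
        unfolding bases_contract by auto
      have "Z = f ` Y - f ` F" "card (f ` Y \<inter> f ` F) = mrank M F" using * Y by auto
      then show "Z \<in> bases (contract N (f ` F))"
        unfolding bases_contract mrank_image[OF M inj N F] N using Y(1) by blast
    qed
  qed
  show "bij_betw f (ground (contract M F)) (ground (contract N (f ` F)))"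
    using f F inj_on_image_set_diff[OF inj, of "ground M" F]
    by (auto simp: bij_betw_def intro: inj_on_subset)
qed

lemma flats_image:
  assumes M: "is_matroid M" and f: "bij_betw f (ground M) (ground N)" and N: "bases N = (`) f ` bases M"
    and F: "F \<subseteq> ground M"
  shows "f ` F \<in> flats N \<longleftrightarrow> F \<in> flats M"
proof -
  have inj: "inj_on f (ground M)" and gN: "ground N = f ` ground M" using f by (auto simp: bij_betw_def)
  have "ground N - f ` F = f ` (ground M - F)"
    unfolding gN using inj_on_image_set_diff[OF inj _ F, of "ground M"] by auto
  moreover have "mrank N (insert (f x) (f ` F)) = mrank M (insert x F)" if "x \<in> ground M" for x
    using mrank_image[OF M inj N, of "insert x F"] F that by simp
  ultimately show ?thesis
    using F mrank_image[OF M inj N F] unfolding flats_def gN by (auto simp: image_mono)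
qed

text \<open>An isomorphism carries fixed flats to fixed flats and restricts to isomorphisms of the
  contractions, so the recursions agree. It is applied to translation by a group element and, with
  \<open>f\<close> the identity, to two maps that agree on the ground set.\<close>

lemma kl_iso:
  assumes "is_matroid M" "bij_betw f (ground M) (ground N)" "bases N = (`) f ` bases M"
    and "bij_betw \<pi> (ground M) (ground M)" "\<And>x. x \<in> ground M \<Longrightarrow> f (\<pi> x) = \<pi>' (f x)"
  shows "kl N \<pi>' = kl M \<pi>"
  using assms
proof (induction "card (ground M)" arbitrary: M N rule: less_induct)
  case less
  note M = less.prems(1) and f = less.prems(2) and N = less.prems(3) and \<pi> = less.prems(4) and
    eq = less.prems(5)
  have inj: "inj_on f (ground M)" and gN: "ground N = f ` ground M" using f by (auto simp: bij_betw_def)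
  have fin: "finite (ground M)" "finite (ground N)" using M gN by (auto simp: is_matroid_def)
  have fixed: "\<pi>' ` (f ` F) = f ` F \<longleftrightarrow> \<pi> ` F = F" if F: "F \<subseteq> ground M" for F
  proof -
    have "\<pi>' ` (f ` F) = f ` (\<pi> ` F)" using eq F unfolding image_image by (intro image_cong) auto
    moreover have "\<pi> ` F \<subseteq> ground M" using \<pi> F by (metis bij_betw_def image_mono)
    ultimately show ?thesis using inj_on_image_eq_iff[OF inj _ F] by auto
  qed
  have "kl_rest N \<pi>' = kl_rest M \<pi>"
    unfolding kl_rest_def
  proof (rule sum.reindex_cong[where l = "(`) f"])
    show "inj_on ((`) f) {F \<in> flats M. F \<noteq> {} \<and> \<pi> ` F = F}"
      using inj_on_image_eq_iff[OF inj flat_subset flat_subset] by (intro inj_onI) blast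
    show "{F \<in> flats N. F \<noteq> {} \<and> \<pi>' ` F = F} = (`) f ` {F \<in> flats M. F \<noteq> {} \<and> \<pi> ` F = F}" (is "?L = ?R")
    proof
      show "?L \<subseteq> ?R"
      proof
        fix F' assume F': "F' \<in> ?L"
        then have "F' \<subseteq> f ` ground M" using flat_subset gN by blast
        then obtain F where F: "F \<subseteq> ground M" "F' = f ` F" by (meson subset_imageE)
        then show "F' \<in> ?R" using F' flats_image[OF M f N F(1)] fixed[OF F(1)] by auto
      qed
      show "?R \<subseteq> ?L"
      proof
        fix F' assume "F' \<in> ?R"
        then obtain F where F: "F' = f ` F" "F \<in> flats M" "F \<noteq> {}" "\<pi> ` F = F" by auto
        then show "F' \<in> ?L"
          using flats_image[OF M f N flat_subset[OF F(2)]] fixed[OF flat_subset[OF F(2)]] by simp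
      qed
    qed
    fix F assume "F \<in> {F \<in> flats M. F \<noteq> {} \<and> \<pi> ` F = F}"
    then have F: "F \<in> flats M" "F \<noteq> {}" "\<pi> ` F = F" and FM: "F \<subseteq> ground M" using flat_subset by auto
    have "kl (contract N (f ` F)) \<pi>' = kl (contract M F) \<pi>"
    proof (rule less.hyps)
      show "card (ground (contract M F)) < card (ground M)" using card_contract_less[OF M F(1,2)] .
      show "bij_betw \<pi> (ground (contract M F)) (ground (contract M F))"
        using image_contract_eq[OF \<pi> FM F(3)] by simp
    qed (use contract_image[OF M f N FM] is_matroid_contract[OF M] eq in auto)
    then show "Polynomial.monom 1 (mrank N (f ` F)) * kl (contract N (f ` F)) \<pi>' =
        Polynomial.monom 1 (mrank M F) * kl (contract M F) \<pi>"
      using mrank_image[OF M inj N FM] by simp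
  qed
  moreover have "rk N = rk M" using mrank_image[OF M inj N subset_refl] gN by simp
  moreover have "ground N = {} \<longleftrightarrow> ground M = {}" using gN by simp
  ultimately show ?case using fin by (metis kl_eq_palfix kl_empty_ground)
qed


subsection \<open>Direct sums\<close>

definition dsum :: "'a matroid \<Rightarrow> 'a matroid \<Rightarrow> 'a matroid" where
  "dsum M N = \<lparr>ground = ground M \<union> ground N, bases = {Y \<union> Y' | Y Y'. Y \<in> bases M \<and> Y' \<in> bases N}\<rparr>"

lemma ground_dsum [simp]: "ground (dsum M N) = ground M \<union> ground N"
  by (simp add: dsum_def)

lemma bases_dsum: "bases (dsum M N) = {Y \<union> Y' | Y Y'. Y \<in> bases M \<and> Y' \<in> bases N}"
  by (simp add: dsum_def)

lemma dsum_exchange: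
  assumes M: "is_matroid M" "is_matroid N" and disj: "ground M \<inter> ground N = {}"
    and X: "X \<in> bases M" "X' \<in> bases N" and Y: "Y \<in> bases M" "Y' \<in> bases N"
    and x: "x \<in> X" "x \<notin> Y"
  shows "\<exists>y\<in>(Y \<union> Y') - (X \<union> X'). \<exists>Z\<in>bases M. insert y ((X \<union> X') - {x}) = Z \<union> X'"
proof -
  obtain y where y: "y \<in> Y - X" "insert y (X - {x}) \<in> bases M"
    using basis_exchange[OF M(1) X(1) Y(1)] x by blast
  have "y \<notin> X'" "x \<notin> X'" using y x basis_subset[OF M(1) Y(1)] basis_subset[OF M(1) X(1)]
      basis_subset[OF M(2) X(2)] disj by blast+
  then show ?thesis using y by (intro bexI[of _ y] bexI[of _ "insert y (X - {x})"]) auto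
qed

lemma is_matroid_dsum:
  assumes M: "is_matroid M" "is_matroid N" and disj: "ground M \<inter> ground N = {}"
  shows "is_matroid (dsum M N)"
  unfolding is_matroid_def
proof (intro conjI ballI)
  show "finite (ground (dsum M N))" using M by (simp add: is_matroid_def)
  show "bases (dsum M N) \<noteq> {}" using M by (auto simp: is_matroid_def bases_dsum)
  show "X \<subseteq> ground (dsum M N)" if "X \<in> bases (dsum M N)" for X
    using that basis_subset[OF M(1)] basis_subset[OF M(2)] by (auto simp: bases_dsum)
next
  fix X\<^sub>0 Y\<^sub>0 x assume "X\<^sub>0 \<in> bases (dsum M N)" "Y\<^sub>0 \<in> bases (dsum M N)" and x: "x \<in> X\<^sub>0 - Y\<^sub>0"
  then obtain X X' Y Y' where *: "X\<^sub>0 = X \<union> X'" "Y\<^sub>0 = Y \<union> Y'"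
      "X \<in> bases M" "X' \<in> bases N" "Y \<in> bases M" "Y' \<in> bases N"
    by (auto simp: bases_dsum)
  consider "x \<in> X" "x \<notin> Y" | "x \<in> X'" "x \<notin> Y'" using x * by blast
  then show "\<exists>y\<in>Y\<^sub>0 - X\<^sub>0. insert y (X\<^sub>0 - {x}) \<in> bases (dsum M N)"
  proof cases
    case 1
    obtain y Z where "y \<in> Y\<^sub>0 - X\<^sub>0" "Z \<in> bases M" "insert y (X\<^sub>0 - {x}) = Z \<union> X'"
      using dsum_exchange[OF M disj *(3-6) 1] unfolding *(1,2) by blast
    moreover have "Z \<union> X' \<in> bases (dsum M N)" using \<open>Z \<in> bases M\<close> *(4) unfolding bases_dsum by blast
    ultimately show ?thesis by metis
  next
    case 2
    have disj': "ground N \<inter> ground M = {}" using disj by blast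
    obtain y Z where "y \<in> Y\<^sub>0 - X\<^sub>0" "Z \<in> bases N" "insert y (X\<^sub>0 - {x}) = Z \<union> X"
      using dsum_exchange[OF M(2,1) disj' *(4,3) *(6,5) 2] unfolding *(1,2) by (metis Un_commute)
    moreover have "Z \<union> X \<in> bases (dsum M N)"
      using \<open>Z \<in> bases N\<close> *(3) unfolding bases_dsum by blast
    ultimately show ?thesis by metis
  qed
qed

lemma card_dsum_basis:
  assumes M: "is_matroid M" "is_matroid N" and disj: "ground M \<inter> ground N = {}"
    and Y: "Y \<in> bases M" "Y' \<in> bases N"
  shows "card ((Y \<union> Y') \<inter> F) = card (Y \<inter> F) + card (Y' \<inter> F)"
proof -
  have "(Y \<inter> F) \<inter> (Y' \<inter> F) = {}"
    using basis_subset[OF M(1) Y(1)] basis_subset[OF M(2) Y(2)] disj by blast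
  then show ?thesis using finite_basis[OF M(1) Y(1)] finite_basis[OF M(2) Y(2)]
    by (simp add: Int_Un_distrib2 card_Un_disjoint)
qed

lemma mrank_dsum:
  assumes M: "is_matroid M" "is_matroid N" and disj: "ground M \<inter> ground N = {}"
  shows "mrank (dsum M N) F = mrank M F + mrank N F"
proof -
  obtain Y Y' where Y: "Y \<in> bases M" "card (Y \<inter> F) = mrank M F" "Y' \<in> bases N" "card (Y' \<inter> F) = mrank N F"
    using mrank_attained[OF M(1)] mrank_attained[OF M(2)] by metis
  show ?thesis
  proof (rule mrank_eqI[OF is_matroid_dsum[OF M disj]])
    show "Y \<union> Y' \<in> bases (dsum M N)" using Y by (auto simp: bases_dsum)
    show "card ((Y \<union> Y') \<inter> F) = mrank M F + mrank N F" using card_dsum_basis[OF M disj] Y by simp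
    fix Z assume "Z \<in> bases (dsum M N)"
    then show "card (Z \<inter> F) \<le> mrank M F + mrank N F"
      using card_dsum_basis[OF M disj] card_le_mrank[OF M(1)] card_le_mrank[OF M(2)]
      by (auto simp: bases_dsum intro!: add_mono)
  qed
qed

lemma contract_dsum:
  assumes M: "is_matroid M" "is_matroid N" and disj: "ground M \<inter> ground N = {}"
  shows "contract (dsum M N) F = dsum (contract M F) (contract N F)"
proof -
  have *: "card ((Y \<union> Y') \<inter> F) = mrank (dsum M N) F \<longleftrightarrow>
      card (Y \<inter> F) = mrank M F \<and> card (Y' \<inter> F) = mrank N F"
    if Y: "Y \<in> bases M" "Y' \<in> bases N" for Y Y'
    using card_le_mrank[OF M(1) Y(1), of F] card_le_mrank[OF M(2) Y(2), of F]
    unfolding card_dsum_basis[OF M disj Y] mrank_dsum[OF M disj] by linarith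
  have "bases (contract (dsum M N) F) = bases (dsum (contract M F) (contract N F))" (is "?L = ?R")
  proof
    show "?L \<subseteq> ?R"
    proof
      fix Z assume "Z \<in> ?L"
      then obtain Y Y' where Y: "Y \<in> bases M" "Y' \<in> bases N" "Z = (Y \<union> Y') - F"
          "card ((Y \<union> Y') \<inter> F) = mrank (dsum M N) F"
        by (auto simp: bases_contract bases_dsum)
      then have "Z = (Y - F) \<union> (Y' - F)" by blast
      then show "Z \<in> ?R" using Y *[OF Y(1,2)] by (auto simp: bases_contract bases_dsum)
    qed
    show "?R \<subseteq> ?L"
    proof
      fix Z assume "Z \<in> ?R"
      then obtain Y Y' where Y: "Y \<in> bases M" "Y' \<in> bases N" "Z = (Y - F) \<union> (Y' - F)"
          "card (Y \<inter> F) = mrank M F" "card (Y' \<inter> F) = mrank N F"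
        by (auto simp: bases_contract bases_dsum)
      then have "Z = (Y \<union> Y') - F" by blast
      moreover have "Y \<union> Y' \<in> bases (dsum M N)" using Y by (auto simp: bases_dsum)
      ultimately show "Z \<in> ?L" using Y *[OF Y(1,2)] by (auto simp: bases_contract)
    qed
  qed
  moreover have "ground (contract (dsum M N) F) = ground (dsum (contract M F) (contract N F))" by auto
  ultimately show ?thesis by simp
qed

lemma loopless_dsum:
  assumes M: "is_matroid M" "is_matroid N" and disj: "ground M \<inter> ground N = {}"
  shows "loopless (dsum M N) \<longleftrightarrow> loopless M \<and> loopless N"
proof -
  obtain B B' where B: "B \<in> bases M" "B' \<in> bases N" using M by (auto simp: is_matroid_def)
  have 1: "indep (dsum M N) {x} \<longleftrightarrow> indep M {x}" if "x \<in> ground M" for x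
  proof -
    have "x \<notin> Y'" if "Y' \<in> bases N" for Y' using basis_subset[OF M(2) that] disj \<open>x \<in> ground M\<close> by blast
    then show ?thesis using B unfolding indep_def bases_dsum by blast
  qed
  have 2: "indep (dsum M N) {x} \<longleftrightarrow> indep N {x}" if "x \<in> ground N" for x
  proof -
    have "x \<notin> Y'" if "Y' \<in> bases M" for Y' using basis_subset[OF M(1) that] disj \<open>x \<in> ground N\<close> by blast
    then show ?thesis using B unfolding indep_def bases_dsum by blast
  qed
  show ?thesis unfolding loopless_def using 1 2 by auto
qed

text \<open>Lets one set \<open>F\<close> in the ground set of a direct sum be used for both
  summands without being split.\<close>

lemma mrank_Int_ground: "is_matroid M \<Longrightarrow> mrank M (F \<inter> ground M) = mrank M F"
  unfolding mrank_def using basis_subset by (intro arg_cong[of _ _ Max] image_cong arg_cong[of _ _ card]) auto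

lemma contract_Int_ground:
  assumes M: "is_matroid M"
  shows "contract M (F \<inter> ground M) = contract M F"
proof -
  have *: "Y \<inter> (F \<inter> ground M) = Y \<inter> F" "Y - F \<inter> ground M = Y - F" if "Y \<in> bases M" for Y
    using basis_subset[OF M that] by auto
  have "bases (contract M (F \<inter> ground M)) = bases (contract M F)"
    unfolding bases_contract mrank_Int_ground[OF M]
    by (intro Collect_cong ex_cong1, metis *)
  moreover have "ground M - F \<inter> ground M = ground M - F" by blast
  ultimately show ?thesis by (simp add: contract_def)
qed

text \<open>A contraction of a direct sum is the direct sum of the contractions, and it is loopless
  iff both of them are.\<close>

lemma flats_dsum:
  assumes M: "is_matroid M" "is_matroid N" and disj: "ground M \<inter> ground N = {}"
  shows "F \<in> flats (dsum M N) \<longleftrightarrow>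
    F \<subseteq> ground M \<union> ground N \<and> F \<inter> ground M \<in> flats M \<and> F \<inter> ground N \<in> flats N"
proof -
  have disj': "ground (contract M F) \<inter> ground (contract N F) = {}" using disj by auto
  show ?thesis
    unfolding flats_iff_loopless_contract[OF is_matroid_dsum[OF M disj]]
      flats_iff_loopless_contract[OF M(1)] flats_iff_loopless_contract[OF M(2)]
      contract_dsum[OF M disj] contract_Int_ground[OF M(1)] contract_Int_ground[OF M(2)]
      loopless_dsum[OF is_matroid_contract[OF M(1)] is_matroid_contract[OF M(2)] disj']
    by auto
qed

lemma image_Un_fixed_iff:
  assumes "\<pi> ` P \<subseteq> P" "\<pi> ` Q \<subseteq> Q" "P \<inter> Q = {}" "F \<subseteq> P" "F' \<subseteq> Q"
  shows "\<pi> ` (F \<union> F') = F \<union> F' \<longleftrightarrow> \<pi> ` F = F \<and> \<pi> ` F' = F'"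
proof
  assume eq: "\<pi> ` (F \<union> F') = F \<union> F'"
  have P: "\<pi> ` F \<subseteq> P" "\<pi> ` F' \<subseteq> Q" using assms by (meson image_mono order_trans)+
  have "\<pi> ` F = (\<pi> ` (F \<union> F')) \<inter> P" using P assms(3) by blast
  moreover have "\<pi> ` F' = (\<pi> ` (F \<union> F')) \<inter> Q" using P assms(3) by blast
  ultimately show "\<pi> ` F = F \<and> \<pi> ` F' = F'" unfolding eq using assms(3-5) by blast
qed (simp add: image_Un)

lemma sum_Un_subsets:
  fixes f :: "'a set \<Rightarrow> 'b::comm_monoid_add"
  assumes "P \<inter> Q = {}"
    and S: "\<And>F F'. F \<subseteq> P \<Longrightarrow> F' \<subseteq> Q \<Longrightarrow> F \<union> F' \<in> S \<longleftrightarrow> F \<in> S1 \<and> F' \<in> S2"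
    and sub: "\<And>F. F \<in> S \<Longrightarrow> F \<subseteq> P \<union> Q" "\<And>F. F \<in> S1 \<Longrightarrow> F \<subseteq> P" "\<And>F. F \<in> S2 \<Longrightarrow> F \<subseteq> Q"
  shows "sum f S = (\<Sum>F\<in>S1. \<Sum>F'\<in>S2. f (F \<union> F'))"
  unfolding sum.cartesian_product
proof (rule sum.reindex_bij_witness[of _ "\<lambda>(F, F'). F \<union> F'" "\<lambda>F. (F \<inter> P, F \<inter> Q)"])
  fix F assume F: "F \<in> S"
  have eq: "(F \<inter> P) \<union> (F \<inter> Q) = F" using sub(1)[OF F] by blast
  then show "(case (F \<inter> P, F \<inter> Q) of (F, F') \<Rightarrow> F \<union> F') = F" by simp
  show "(F \<inter> P, F \<inter> Q) \<in> S1 \<times> S2" using S[of "F \<inter> P" "F \<inter> Q"] eq F by auto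
  show "(case (F \<inter> P, F \<inter> Q) of (F, F') \<Rightarrow> f (F \<union> F')) = f F" using eq by simp
next
  fix a assume "a \<in> S1 \<times> S2"
  then obtain F F' where a: "a = (F, F')" and F: "F \<in> S1" "F' \<in> S2" by auto
  have "(F \<union> F') \<inter> P = F" "(F \<union> F') \<inter> Q = F'" using sub(2)[OF F(1)] sub(3)[OF F(2)] assms(1) by auto
  then show "((case a of (F, F') \<Rightarrow> F \<union> F') \<inter> P, (case a of (F, F') \<Rightarrow> F \<union> F') \<inter> Q) = a" by (simp add: a)
  show "(case a of (F, F') \<Rightarrow> F \<union> F') \<in> S" using S F sub by (simp add: a)
qed

text \<open>The right side is the Z-polynomial of the direct sum, except that \<open>kl\<close> of
  each contraction is replaced by the product that multiplicativity predicts. This holds before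
  multiplicativity is known and supplies the palindrome in its induction.\<close>

lemma klZ_mult:
  assumes M: "is_matroid M" "is_matroid N" and disj: "ground M \<inter> ground N = {}"
    and \<pi>: "\<pi> ` ground M \<subseteq> ground M" "\<pi> ` ground N \<subseteq> ground N"
  shows "klZ M \<pi> * klZ N \<pi> = (\<Sum>F\<in>{F \<in> flats (dsum M N). \<pi> ` F = F}.
     Polynomial.monom 1 (mrank (dsum M N) F) * (kl (contract M F) \<pi> * kl (contract N F) \<pi>))"
proof -
  let ?S = "{F \<in> flats M. \<pi> ` F = F}" and ?T = "{F \<in> flats N. \<pi> ` F = F}"
  have Int: "(F \<union> F') \<inter> ground M = F" "(F \<union> F') \<inter> ground N = F'"
    if "F \<subseteq> ground M" "F' \<subseteq> ground N" for F F'
    using that disj by auto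
  have "(\<Sum>F\<in>{F \<in> flats (dsum M N). \<pi> ` F = F}.
     Polynomial.monom 1 (mrank (dsum M N) F) * (kl (contract M F) \<pi> * kl (contract N F) \<pi>)) =
    (\<Sum>F\<in>?S. \<Sum>F'\<in>?T. Polynomial.monom 1 (mrank (dsum M N) (F \<union> F')) *
       (kl (contract M (F \<union> F')) \<pi> * kl (contract N (F \<union> F')) \<pi>))"
  proof (rule sum_Un_subsets[OF disj])
    fix F F' assume F: "F \<subseteq> ground M" "F' \<subseteq> ground N"
    show "F \<union> F' \<in> {F \<in> flats (dsum M N). \<pi> ` F = F} \<longleftrightarrow> F \<in> ?S \<and> F' \<in> ?T"
      using F Int[OF F] flats_dsum[OF M disj, of "F \<union> F'"] image_Un_fixed_iff[OF \<pi> disj F] by auto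
  qed (auto dest!: flat_subset)
  also have "\<dots> = (\<Sum>F\<in>?S. \<Sum>F'\<in>?T. (Polynomial.monom 1 (mrank M F) * kl (contract M F) \<pi>) *
      (Polynomial.monom 1 (mrank N F') * kl (contract N F') \<pi>))"
  proof (intro sum.cong refl)
    fix F F' assume "F \<in> ?S" "F' \<in> ?T"
    then have F: "F \<subseteq> ground M" "F' \<subseteq> ground N" using flat_subset by auto
    have "mrank (dsum M N) (F \<union> F') = mrank M F + mrank N F'"
      using mrank_dsum[OF M disj, of "F \<union> F'"] mrank_Int_ground[OF M(1), of "F \<union> F'"]
        mrank_Int_ground[OF M(2), of "F \<union> F'"] Int[OF F] by simp
    moreover have "contract M (F \<union> F') = contract M F" "contract N (F \<union> F') = contract N F'"
      using contract_Int_ground[OF M(1), of "F \<union> F'"] contract_Int_ground[OF M(2), of "F \<union> F'"] Int[OF F]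
      by simp_all
    moreover have "Polynomial.monom 1 (mrank M F + mrank N F') =
        Polynomial.monom (1::rat) (mrank M F) * Polynomial.monom 1 (mrank N F')"
      by (simp add: mult_monom)
    ultimately show "Polynomial.monom 1 (mrank (dsum M N) (F \<union> F')) *
       (kl (contract M (F \<union> F')) \<pi> * kl (contract N (F \<union> F')) \<pi>) =
       (Polynomial.monom 1 (mrank M F) * kl (contract M F) \<pi>) *
      (Polynomial.monom 1 (mrank N F') * kl (contract N F') \<pi>)" by (simp only: mult.assoc mult.left_commute)
  qed
  also have "\<dots> = klZ M \<pi> * klZ N \<pi>" unfolding klZ_def sum_product ..
  finally show ?thesis by simp
qed

theorem kl_dsum:
  assumes "is_matroid M" "is_matroid N" "loopless M" "loopless N" "ground M \<inter> ground N = {}"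
    and \<pi>: "bij_betw \<pi> (ground M) (ground M)" "bij_betw \<pi> (ground N) (ground N)"
  shows "kl (dsum M N) \<pi> = kl M \<pi> * kl N \<pi>"
  using assms
proof (induction "card (ground (dsum M N))" arbitrary: M N rule: less_induct)
  case less
  note M = less.prems(1,2) and ll = less.prems(3,4) and disj = less.prems(5) and \<pi> = less.prems(6,7)
  have D: "is_matroid (dsum M N)" using is_matroid_dsum[OF M disj] .
  have llD: "loopless (dsum M N)" using loopless_dsum[OF M disj] ll by simp
  have sub: "\<pi> ` ground M \<subseteq> ground M" "\<pi> ` ground N \<subseteq> ground N" using \<pi> by (auto simp: bij_betw_def)
  show ?case
  proof (cases "ground (dsum M N) = {}")
    case True
    then show ?thesis by (simp add: kl_empty_ground)
  next
    case False
    show ?thesis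
    proof (rule kl_unique[OF D False])
      fix j assume j: "rk (dsum M N) \<le> 2 * j"
      have rk: "rk (dsum M N) = rk M + rk N"
        using mrank_dsum[OF M disj] mrank_Int_ground[OF M(1), of "ground M \<union> ground N"]
          mrank_Int_ground[OF M(2), of "ground M \<union> ground N"] by (simp add: Int_absorb1)
      \<comment> \<open>Two strict bounds add up to \<open>2 * j < rk M + rk N\<close>. If one
        ground set is empty, its factor is the constant 1 and the bound comes from the other,
        non-empty one.\<close>
      have "poly.coeff (kl M \<pi>) i * poly.coeff (kl N \<pi>) (j - i) = 0" if "i \<le> j" for i
      proof (rule ccontr)
        assume "\<not> ?thesis"
        then have "2 * i < rk M \<or> i = 0 \<and> ground M = {}" "2 * (j - i) < rk N \<or> j - i = 0 \<and> ground N = {}"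
          using kl_coeff_nonzero[OF M(1), of \<pi> i] kl_coeff_nonzero[OF M(2), of \<pi> "j - i"] by auto
        then show False using j rk False that by auto
      qed
      then show "poly.coeff (kl M \<pi> * kl N \<pi>) j = 0" unfolding coeff_mult by (intro sum.neutral) auto
    next
      have IH: "kl (contract (dsum M N) F) \<pi> = kl (contract M F) \<pi> * kl (contract N F) \<pi>"
        if F: "F \<in> flats (dsum M N)" "F \<noteq> {}" "\<pi> ` F = F" for F
        unfolding contract_dsum[OF M disj]
      proof (rule less.hyps)
        show "card (ground (dsum (contract M F) (contract N F))) < card (ground (dsum M N))"
          using card_contract_less[OF D F(1,2)] unfolding contract_dsum[OF M disj] .
        show "ground (contract M F) \<inter> ground (contract N F) = {}" using disj by auto
        have "loopless (dsum (contract M F) (contract N F))"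
          using loopless_contract[OF D F(1)] unfolding contract_dsum[OF M disj] .
        moreover have "ground (contract M F) \<inter> ground (contract N F) = {}" using disj by auto
        ultimately show "loopless (contract M F)" "loopless (contract N F)"
          using loopless_dsum[OF is_matroid_contract[OF M(1)] is_matroid_contract[OF M(2)]] by blast+
        have "bij_betw \<pi> (ground M \<union> ground N) (ground M \<union> ground N)"
          using bij_betw_combine[OF \<pi> disj] .
        then have inj: "inj_on \<pi> (ground M \<union> ground N)" by (simp add: bij_betw_def)
        have FS: "F \<subseteq> ground M \<union> ground N" using flat_subset[OF F(1)] by simp
        have "\<pi> ` (ground M - F) = ground M - F" "\<pi> ` (ground N - F) = ground N - F"
          using inj_on_image_set_diff[OF inj _ FS, of "ground M"]
            inj_on_image_set_diff[OF inj _ FS, of "ground N"] F(3) \<pi> by (auto simp: bij_betw_def)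
        then show "bij_betw \<pi> (ground (contract M F)) (ground (contract M F))"
            "bij_betw \<pi> (ground (contract N F)) (ground (contract N F))"
          using inj by (auto simp: bij_betw_def intro: inj_on_subset)
      qed (use is_matroid_contract M in auto)
      let ?f = "\<lambda>F. Polynomial.monom 1 (mrank (dsum M N) F) * (kl (contract M F) \<pi> * kl (contract N F) \<pi>)"
      have "{F \<in> flats (dsum M N). \<pi> ` F = F} = insert {} {F \<in> flats (dsum M N). F \<noteq> {} \<and> \<pi> ` F = F}"
        using empty_flat[OF D llD] by auto
      then have "klZ M \<pi> * klZ N \<pi> = ?f {} + sum ?f {F \<in> flats (dsum M N). F \<noteq> {} \<and> \<pi> ` F = F}"
        unfolding klZ_mult[OF M disj sub] using finite_flats[OF D] by simp
      also have "sum ?f {F \<in> flats (dsum M N). F \<noteq> {} \<and> \<pi> ` F = F} = kl_rest (dsum M N) \<pi>"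
        unfolding kl_rest_def using IH by (intro sum.cong) auto
      also have "?f {} = kl M \<pi> * kl N \<pi>" using M D by simp
      finally have "klZ M \<pi> * klZ N \<pi> = kl M \<pi> * kl N \<pi> + kl_rest (dsum M N) \<pi>" .
      moreover have "pal (rk M + rk N) (klZ M \<pi> * klZ N \<pi>)"
        by (intro pal_mult pal_klZ M ll)
      moreover have rk: "rk (dsum M N) = rk M + rk N"
        using mrank_dsum[OF M disj] mrank_Int_ground[OF M(1), of "ground M \<union> ground N"]
          mrank_Int_ground[OF M(2), of "ground M \<union> ground N"] by (simp add: Int_absorb1)
      ultimately show "pal (rk (dsum M N)) (kl M \<pi> * kl N \<pi> + kl_rest (dsum M N) \<pi>)" by simp
    qed
  qed
qed


section \<open>Cycles and pairs of glued cycles\<close>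

text \<open>Computes a contraction from a bound \<open>k\<close> on the intersections with
  \<open>F\<close>; that the bound is attained comes from \<open>N\<close> having a basis.\<close>

lemma contract_eqI:
  assumes "is_matroid M" "ground N = ground M - F"
    and "\<And>Y. Y \<in> bases M \<Longrightarrow> card (Y \<inter> F) \<le> k"
    and "bases N = {Y - F | Y. Y \<in> bases M \<and> card (Y \<inter> F) = k}" "bases N \<noteq> {}"
  shows "contract M F = N"
proof -
  obtain Y where "Y \<in> bases M" "card (Y \<inter> F) = k" using assms(4,5) by auto
  then have "mrank M F = k" using assms(3) by (intro mrank_eqI[OF assms(1)]) auto
  then show ?thesis unfolding contract_def using assms(2,4) by simp
qed

lemma is_matroid_uniform:
  assumes "finite S" "k \<le> card S"
  shows "is_matroid (uniform_matroid k S)"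
  unfolding is_matroid_def
proof (intro conjI ballI)
  show "bases (uniform_matroid k S) \<noteq> {}"
    using obtain_subset_with_card_n[OF assms(2)] by (auto simp: uniform_matroid_def)
next
  fix X Y x assume "X \<in> bases (uniform_matroid k S)" "Y \<in> bases (uniform_matroid k S)" "x \<in> X - Y"
  then have X: "X \<subseteq> S" "card X = k" and Y: "Y \<subseteq> S" "card Y = k" and x: "x \<in> X" "x \<notin> Y"
    by (auto simp: uniform_matroid_def)
  have "finite X" using X(1) assms(1) finite_subset by blast
  then have "\<not> Y \<subseteq> X" using card_subset_eq[of X Y] X Y x by metis
  then obtain y where y: "y \<in> Y" "y \<notin> X" by blast
  then have "card (insert y (X - {x})) = k" using card_swap[OF \<open>finite X\<close> x(1)] X(2) by simp
  moreover have "insert y (X - {x}) \<subseteq> S" using X(1) Y(1) y by blast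
  ultimately show "\<exists>y\<in>Y - X. insert y (X - {x}) \<in> bases (uniform_matroid k S)"
    using y by (auto simp: uniform_matroid_def)
qed (use assms in \<open>auto simp: uniform_matroid_def\<close>)

lemma ground_cycle [simp]: "ground (cycle_matroid S) = S"
  by (simp add: cycle_matroid_def uniform_matroid_def)

lemma is_matroid_cycle: "finite S \<Longrightarrow> is_matroid (cycle_matroid S)"
  unfolding cycle_matroid_def by (rule is_matroid_uniform) auto

lemma bases_cycle_empty [simp]: "bases (cycle_matroid {}) = {{}}"
  by (auto simp: cycle_matroid_def uniform_matroid_def)

lemma bases_cycle:
  assumes "finite S" "S \<noteq> {}"
  shows "bases (cycle_matroid S) = (\<lambda>x. S - {x}) ` S"
proof
  show "bases (cycle_matroid S) \<subseteq> (\<lambda>x. S - {x}) ` S"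
  proof
    fix Y assume "Y \<in> bases (cycle_matroid S)"
    then have Y: "Y \<subseteq> S" "card Y = card S - 1" by (auto simp: cycle_matroid_def uniform_matroid_def)
    then have "card (S - Y) = 1" using assms by (simp add: card_Diff_subset finite_subset card_gt_0_iff Suc_leI)
    then obtain x where x: "S - Y = {x}" by (auto simp: card_1_singleton_iff)
    then have "x \<in> S" "Y = S - {x}" using Y by blast+
    then show "Y \<in> (\<lambda>x. S - {x}) ` S" by blast
  qed
  show "(\<lambda>x. S - {x}) ` S \<subseteq> bases (cycle_matroid S)"
    using assms by (auto simp: cycle_matroid_def uniform_matroid_def)
qed

lemma rk_cycle:
  assumes "finite S"
  shows "rk (cycle_matroid S) = card S - 1"
proof -
  obtain Y where "Y \<in> bases (cycle_matroid S)" using is_matroid_cycle[OF assms] by (auto simp: is_matroid_def)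
  then show ?thesis using rk_eq_card_basis[OF is_matroid_cycle[OF assms]]
    by (auto simp: cycle_matroid_def uniform_matroid_def)
qed

lemma mrank_cycle:
  assumes "finite S" "F \<subset> S"
  shows "mrank (cycle_matroid S) F = card F"
proof -
  obtain x where x: "x \<in> S" "x \<notin> F" using assms(2) by blast
  have fin: "finite F" using assms finite_subset by blast
  show ?thesis
  proof (rule mrank_eqI[OF is_matroid_cycle[OF assms(1)]])
    show "S - {x} \<in> bases (cycle_matroid S)" using bases_cycle[OF assms(1)] x by blast
    have "(S - {x}) \<inter> F = F" using x assms by blast
    then show "card ((S - {x}) \<inter> F) = card F" by simp
  qed (use fin in \<open>auto intro: card_mono\<close>)
qed

lemma contract_cycle:
  assumes "finite S" "F \<subseteq> S"
  shows "contract (cycle_matroid S) F = cycle_matroid (S - F)"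
proof (cases "F = S")
  \<comment> \<open>\<open>F = S\<close> stands apart because a non-empty \<open>S\<close> is
    dependent, of rank \<open>card S - 1\<close>: the count \<open>card F\<close> of the other case
    is not attained.\<close>
  case True
  have M: "is_matroid (cycle_matroid S)" using is_matroid_cycle[OF assms(1)] .
  have *: "Y - S = {}" if "Y \<in> bases (cycle_matroid S)" for Y using basis_subset[OF M that] by simp
  obtain Y where Y: "Y \<in> bases (cycle_matroid S)" "card (Y \<inter> S) = mrank (cycle_matroid S) S"
    using mrank_attained[OF M] .
  have "bases (contract (cycle_matroid S) S) = {{}}"
  proof
    show "bases (contract (cycle_matroid S) S) \<subseteq> {{}}" using * by (auto simp: bases_contract)
    have "Y - S \<in> bases (contract (cycle_matroid S) S)" using Y by (auto simp: bases_contract)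
    then show "{{}} \<subseteq> bases (contract (cycle_matroid S) S)" using *[OF Y(1)] by simp
  qed
  then show ?thesis using True bases_cycle_empty by (intro matroid.equality) auto
next
  case False
  have S: "S \<noteq> {}" and SF: "S - F \<noteq> {}" using False assms by auto
  have fin: "finite F" using assms finite_subset by blast
  have card: "card ((S - {x}) \<inter> F) = card F \<longleftrightarrow> x \<notin> F" for x
  proof -
    have "(S - {x}) \<inter> F = F - {x}" using assms(2) by blast
    then show ?thesis using fin by (metis Diff_empty Diff_insert0 card_Diff1_less less_irrefl)
  qed
  show ?thesis
  proof (rule contract_eqI[OF is_matroid_cycle[OF assms(1)], where k = "card F"])
    show "card (Y \<inter> F) \<le> card F" for Y using fin by (auto intro: card_mono)
    show "bases (cycle_matroid (S - F)) =
        {Y - F | Y. Y \<in> bases (cycle_matroid S) \<and> card (Y \<inter> F) = card F}" (is "_ = ?R")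
      unfolding bases_cycle[OF assms(1) S] bases_cycle[OF finite_Diff[OF assms(1)] SF]
    proof
      show "(\<lambda>x. S - F - {x}) ` (S - F) \<subseteq> {Y - F | Y. Y \<in> (\<lambda>x. S - {x}) ` S \<and> card (Y \<inter> F) = card F}"
      proof
        fix Z assume "Z \<in> (\<lambda>x. S - F - {x}) ` (S - F)"
        then obtain x where x: "x \<in> S" "x \<notin> F" "Z = S - F - {x}" by auto
        then have "Z = (S - {x}) - F" by blast
        then show "Z \<in> {Y - F | Y. Y \<in> (\<lambda>x. S - {x}) ` S \<and> card (Y \<inter> F) = card F}"
          using x card by blast
      qed
      show "{Y - F | Y. Y \<in> (\<lambda>x. S - {x}) ` S \<and> card (Y \<inter> F) = card F} \<subseteq> (\<lambda>x. S - F - {x}) ` (S - F)"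
        using card by auto
    qed
    show "bases (cycle_matroid (S - F)) \<noteq> {}"
      unfolding bases_cycle[OF finite_Diff[OF assms(1)] SF] using SF by simp
  qed simp
qed

lemma loopless_cycle:
  assumes "finite S"
  shows "loopless (cycle_matroid S) \<longleftrightarrow> card S \<noteq> 1"
proof
  assume l: "loopless (cycle_matroid S)"
  show "card S \<noteq> 1"
  proof
    assume "card S = 1"
    then have "S \<noteq> {}" "rk (cycle_matroid S) = 0" using rk_cycle[OF assms] by auto
    then show False using rk_eq_0_iff[OF is_matroid_cycle[OF assms] l] by simp
  qed
next
  assume c: "card S \<noteq> 1"
  show "loopless (cycle_matroid S)" unfolding loopless_def
  proof
    fix x assume x: "x \<in> ground (cycle_matroid S)"
    then have "S \<noteq> {x}" using c by auto
    then obtain y where "y \<in> S" "y \<noteq> x" using x by auto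
    then have "S - {y} \<in> bases (cycle_matroid S)" "x \<in> S - {y}" using x bases_cycle[OF assms] by auto
    then show "indep (cycle_matroid S) {x}" unfolding indep_def by (intro bexI[of _ "S - {y}"]) auto
  qed
qed

lemma flats_cycle:
  assumes "finite S"
  shows "F \<in> flats (cycle_matroid S) \<longleftrightarrow> F \<subseteq> S \<and> card (S - F) \<noteq> 1"
proof (cases "F \<subseteq> S")
  case True
  then show ?thesis
    unfolding flats_iff_loopless_contract[OF is_matroid_cycle[OF assms]]
    using loopless_cycle[of "S - F"] assms by (simp add: contract_cycle)
qed (auto simp: flats_def)

text \<open>Builds in the convention that matroids with loops have polynomial 0: a finite cycle
  matroid has a loop only when \<open>S\<close> has one element, and the recursion for
  \<open>kl\<close> takes no notice of loops.\<close>

definition klc :: "'a set \<Rightarrow> ('a \<Rightarrow> 'a) \<Rightarrow> rat poly" where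
  "klc S \<pi> = (if card S = 1 then 0 else kl (cycle_matroid S) \<pi>)"

definition fixed_subsets :: "('a \<Rightarrow> 'a) \<Rightarrow> 'a set \<Rightarrow> 'a set set" where
  "fixed_subsets \<pi> S = {F. F \<subseteq> S \<and> \<pi> ` F = F}"

lemma finite_fixed_subsets: "finite S \<Longrightarrow> finite (fixed_subsets \<pi> S)"
  unfolding fixed_subsets_def by simp

lemma monom_eq_X_power: "Polynomial.monom (1::rat) k = [:0, 1:] ^ k"
  by (simp add: monom_altdef)

lemma klc_empty [simp]: "klc {} \<pi> = 1"
  by (simp add: klc_def kl_empty_ground)

lemma klc_coeff_nonzero:
  assumes "finite S" "S \<noteq> {}" "poly.coeff (klc S \<pi>) i \<noteq> 0"
  shows "2 * i + 1 < card S"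
proof -
  have "card S \<noteq> 1" "poly.coeff (kl (cycle_matroid S) \<pi>) i \<noteq> 0"
    using assms(3) by (auto simp: klc_def split: if_splits)
  then have "2 * i < rk (cycle_matroid S) \<or> i = 0 \<and> ground (cycle_matroid S) = {}"
    using kl_coeff_nonzero[OF is_matroid_cycle[OF assms(1)]] by blast
  then show ?thesis unfolding rk_cycle[OF assms(1)] using assms(2) by auto
qed

text \<open>The sum runs over all \<open>F \<noteq> S\<close>, not just over flats: the sets \<open>F\<close> of cardinality \<open>card S - 1\<close>
  are not flats, but they contribute \<open>0\<close> as \<open>klc\<close> vanishes on one-element sets.\<close>

definition kl_proper :: "'a set \<Rightarrow> ('a \<Rightarrow> 'a) \<Rightarrow> rat poly" where
  "kl_proper S \<pi> = (\<Sum>F\<in>fixed_subsets \<pi> S. if F = S then 0 else [:0, 1:] ^ card F * klc (S - F) \<pi>)"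

text \<open>All proper subsets are independent, with rank \<open>card F\<close>; the top term
  \<open>F = S\<close> has rank \<open>card S - 1\<close> and coefficient
  \<open>klc {} \<pi> = 1\<close>.\<close>

lemma kl_proper_add:
  assumes "finite S" "\<pi> ` S = S"
  shows "(\<Sum>F\<in>fixed_subsets \<pi> S. [:0, 1:] ^ mrank (cycle_matroid S) F * klc (S - F) \<pi>) =
    kl_proper S \<pi> + [:0, 1:] ^ (card S - 1)"
proof -
  let ?X = "[:0, 1::rat:]"
  have fin: "finite (fixed_subsets \<pi> S)" using finite_fixed_subsets[OF assms(1)] .
  have S: "S \<in> fixed_subsets \<pi> S" using assms by (simp add: fixed_subsets_def)
  have "(\<Sum>F\<in>fixed_subsets \<pi> S. ?X ^ mrank (cycle_matroid S) F * klc (S - F) \<pi>) =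
      ?X ^ rk (cycle_matroid S) + (\<Sum>F\<in>fixed_subsets \<pi> S - {S}. ?X ^ mrank (cycle_matroid S) F * klc (S - F) \<pi>)"
    by (subst sum.remove[OF fin S]) simp
  also have "(\<Sum>F\<in>fixed_subsets \<pi> S - {S}. ?X ^ mrank (cycle_matroid S) F * klc (S - F) \<pi>) =
      (\<Sum>F\<in>fixed_subsets \<pi> S - {S}. if F = S then 0 else ?X ^ card F * klc (S - F) \<pi>)"
  proof (intro sum.cong refl)
    fix F assume F: "F \<in> fixed_subsets \<pi> S - {S}"
    then have "F \<subset> S" by (auto simp: fixed_subsets_def)
    from mrank_cycle[OF assms(1) this] F
    show "?X ^ mrank (cycle_matroid S) F * klc (S - F) \<pi> = (if F = S then 0 else ?X ^ card F * klc (S - F) \<pi>)"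
      by simp
  qed
  also have "\<dots> = kl_proper S \<pi>" unfolding kl_proper_def by (subst sum.remove[OF fin S]) simp
  finally show ?thesis using rk_cycle[OF assms(1)] by (simp add: add.commute)
qed

lemma klZ_cycle:
  assumes "finite S" "\<pi> ` S = S"
  shows "klZ (cycle_matroid S) \<pi> = kl_proper S \<pi> + [:0, 1:] ^ (card S - 1)"
proof -
  have "(\<Sum>F\<in>fixed_subsets \<pi> S. [:0, 1:] ^ mrank (cycle_matroid S) F * klc (S - F) \<pi>) =
      klZ (cycle_matroid S) \<pi>"
    unfolding klZ_def monom_eq_X_power
  proof (intro sum.mono_neutral_cong_right finite_fixed_subsets ballI)
    show "{F \<in> flats (cycle_matroid S). \<pi> ` F = F} \<subseteq> fixed_subsets \<pi> S"
      using flats_cycle[OF assms(1)] by (auto simp: fixed_subsets_def)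
    fix F assume "F \<in> fixed_subsets \<pi> S - {F \<in> flats (cycle_matroid S). \<pi> ` F = F}"
    then have "card (S - F) = 1" using flats_cycle[OF assms(1)] by (auto simp: fixed_subsets_def)
    then show "[:0, 1:] ^ mrank (cycle_matroid S) F * klc (S - F) \<pi> = 0" by (simp add: klc_def)
  next
    fix F assume "F \<in> {F \<in> flats (cycle_matroid S). \<pi> ` F = F}"
    then have "F \<subseteq> S" "card (S - F) \<noteq> 1" using flats_cycle[OF assms(1)] by auto
    then show "[:0, 1:] ^ mrank (cycle_matroid S) F * klc (S - F) \<pi> =
        [:0, 1:] ^ mrank (cycle_matroid S) F * kl (contract (cycle_matroid S) F) \<pi>"
      using contract_cycle[OF assms(1)] by (simp add: klc_def)
  qed (rule assms(1))
  then show ?thesis using kl_proper_add[of S \<pi>] assms by simp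
qed


subsection \<open>Two cycles with a common edge\<close>

text \<open>The graph is a theta graph: three paths \<open>P\<close>, \<open>Q\<close> and
  \<open>{e}\<close> joining the same two vertices. \<open>P\<close> and \<open>Q\<close> are the
  cycles without \<open>e\<close>, so their being non-empty expresses that the cycles have at least
  two edges.\<close>

locale theta =
  fixes P Q :: "'a set" and e :: 'a
  assumes fin: "finite P" "finite Q" and nonempty: "P \<noteq> {}" "Q \<noteq> {}"
    and disj: "P \<inter> Q = {}" and e_notin: "e \<notin> P" "e \<notin> Q"
begin

abbreviation M :: "'a matroid" where
  "M \<equiv> glued_cycles_matroid (insert e P) (insert e Q) e"

abbreviation E :: "'a set" where
  "E \<equiv> insert e (P \<union> Q)"

text \<open>The bases are the complements of the pairs of edges taken from two different ones of the
  three paths \<open>P\<close>, \<open>Q\<close>, \<open>{e}\<close>.\<close>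

definition path :: "'a \<Rightarrow> nat" where
  "path x = (if x = e then 0 else if x \<in> P then 1 else 2)"

lemma path_P: "x \<in> E \<Longrightarrow> path x = 1 \<longleftrightarrow> x \<in> P"
  and path_Q: "x \<in> E \<Longrightarrow> path x = 2 \<longleftrightarrow> x \<in> Q"
  and path_e: "path x = 0 \<longleftrightarrow> x = e"
  using e_notin disj by (auto simp: path_def)

lemma path_e_neq: "x \<noteq> e \<Longrightarrow> path e \<noteq> path x" "x \<noteq> e \<Longrightarrow> path x \<noteq> path e"
  by (auto simp: path_def)

lemma path_neq: "x \<in> P \<Longrightarrow> y \<in> Q \<Longrightarrow> path x \<noteq> path y"
  using disj e_notin by (auto simp: path_def)

lemma ground_M: "ground M = E"
  by (auto simp: glued_cycles_matroid_def matroid_of_circuits_def)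

lemma bases_M_iff: "Y \<in> bases M \<longleftrightarrow> Y \<subseteq> E \<and> \<not> insert e P \<subseteq> Y \<and> \<not> insert e Q \<subseteq> Y \<and> \<not> P \<union> Q \<subseteq> Y \<and>
    (\<forall>x\<in>E - Y. insert e P \<subseteq> insert x Y \<or> insert e Q \<subseteq> insert x Y \<or> P \<union> Q \<subseteq> insert x Y)"
proof -
  have "(insert e P \<union> insert e Q) - {e} = P \<union> Q" "insert e P \<union> insert e Q = E" using e_notin by auto
  then show ?thesis unfolding glued_cycles_matroid_def matroid_of_circuits_def by simp
qed

lemma basis_pairI:
  assumes "u \<in> E" "v \<in> E" "path u \<noteq> path v"
  shows "E - {u, v} \<in> bases M"
proof -
  obtain a b where ab: "a \<in> P" "b \<in> Q" using nonempty by blast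
  have "u = e \<and> v \<in> P \<or> u = e \<and> v \<in> Q \<or> v = e \<and> u \<in> P \<or> v = e \<and> u \<in> Q \<or>
      u \<in> P \<and> v \<in> Q \<or> u \<in> Q \<and> v \<in> P"
    using assms by (auto simp: path_def split: if_splits)
  then show ?thesis unfolding bases_M_iff using ab disj e_notin
    by (elim disjE conjE) (safe; blast)+
qed

lemma basis_pairE:
  assumes Y: "Y \<in> bases M"
  obtains u v where "u \<in> E" "v \<in> E" "path u \<noteq> path v" "Y = E - {u, v}"
proof -
  note Y' = Y[unfolded bases_M_iff]
  have YE: "Y \<subseteq> E" using Y' by blast
  have close: "insert e P \<subseteq> insert x Y \<or> insert e Q \<subseteq> insert x Y \<or> P \<union> Q \<subseteq> insert x Y"
    if "x \<in> E" "x \<notin> Y" for x using Y' that by blast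
  show ?thesis
  proof (cases "e \<in> Y")
    case True
    then obtain u v where uv: "u \<in> P" "u \<notin> Y" "v \<in> Q" "v \<notin> Y" using Y' by blast
    have ne: "u \<noteq> v" using uv disj by blast
    \<comment> \<open>Adding \<open>u\<close> must close a circuit. The circuits containing
      \<open>Q\<close> are ruled out as \<open>v\<close> is still missing, so
      \<open>insert e P\<close> is closed; symmetrically for \<open>v\<close>.\<close>
    have "insert e P \<subseteq> insert u Y" using close[of u] uv ne by blast
    moreover have "insert e Q \<subseteq> insert v Y" using close[of v] uv ne by blast
    ultimately have "Y = E - {u, v}" using YE uv by blast
    moreover have "path u = 1" "path v = 2" using uv path_P[of u] path_Q[of v] by auto
    moreover from this have "path u \<noteq> path v" by simp
    ultimately show ?thesis using that[of u v] uv by blast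
  next
    case False
    \<comment> \<open>Without \<open>e\<close> the only circuit that adding \<open>y\<close> can
      close is \<open>P \<union> Q\<close>, so \<open>y\<close> is the only other element
      missing.\<close>
    obtain y where y: "y \<in> P \<union> Q" "y \<notin> Y" using Y' by blast
    have ye: "y \<noteq> e" using y e_notin by blast
    have "\<not> insert e P \<subseteq> insert y Y" "\<not> insert e Q \<subseteq> insert y Y" using False ye by blast+
    then have "P \<union> Q \<subseteq> insert y Y" using close[of y] y by blast
    then have "Y = E - {e, y}" using YE y False by blast
    moreover have "path e \<noteq> path y" using ye path_e by metis
    ultimately show ?thesis using that[of e y] y by blast
  qed
qed

lemma is_matroid_M: "is_matroid M"
  unfolding is_matroid_def ground_M
proof (intro conjI ballI)
  show "finite E" using fin by simp
  obtain a where "a \<in> P" using nonempty by blast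
  then have "E - {e, a} \<in> bases M" using e_notin by (intro basis_pairI path_e_neq) auto
  then show "bases M \<noteq> {}" by blast
  show "X \<subseteq> E" if "X \<in> bases M" for X using that basis_pairE by blast
next
  fix X Y x assume X: "X \<in> bases M" and Y: "Y \<in> bases M" and x: "x \<in> X - Y"
  obtain u v where uv: "u \<in> E" "v \<in> E" "path u \<noteq> path v" "X = E - {u, v}" using basis_pairE[OF X] .
  obtain u' v' where uv': "u' \<in> E" "v' \<in> E" "path u' \<noteq> path v'" "Y = E - {u', v'}" using basis_pairE[OF Y] .
  \<comment> \<open>In terms of complements, the exchange of \<open>x\<close> for \<open>u\<close>
    turns the missing pair \<open>{u, v}\<close> into \<open>{x, v}\<close>, which is again
    admissible if \<open>x\<close> and \<open>v\<close> lie on different paths.\<close>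
  have sym: "\<exists>y\<in>Y - X. insert y (X - {x}) \<in> bases M"
    if X': "X = E - {u, v}" "path u \<noteq> path v" "u \<in> E" "v \<in> E" and u: "u \<notin> {u', v'}" and v: "path x \<noteq> path v"
    for u v
  proof (intro bexI[of _ u])
    have "insert u (X - {x}) = E - {x, v}" using X' x by auto
    then show "insert u (X - {x}) \<in> bases M" using basis_pairI[of x v] x v X' uv' by auto
    show "u \<in> Y - X" using X' u uv' by blast
  qed
  have "x \<in> {u', v'}" "x \<notin> {u, v}" using x uv uv' by auto
  then consider "x = u'" "v = v'" "u \<notin> {u', v'}" | "x = u'" "u = v'" "v \<notin> {u', v'}" | "x = v'" "v = u'" "u \<notin> {u', v'}"
    | "x = v'" "u = u'" "v \<notin> {u', v'}" | "u \<notin> {u', v'}" "v \<notin> {u', v'}"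
    using uv(3) uv'(3) by (cases "u = v") auto
  then show "\<exists>y\<in>Y - X. insert y (X - {x}) \<in> bases M"
  proof cases
    \<comment> \<open>Both elements missing from \<open>X\<close> lie in \<open>Y\<close> here. As
      they are on different paths, \<open>x\<close> differs in path from at least one of them; that
      one is kept out and the other is inserted.\<close>
    case 5
    show ?thesis
    proof (cases "path x = path v")
      case True
      then show ?thesis using sym[of v u] 5 uv by (auto simp: insert_commute)
    next
      case False
      then show ?thesis using sym[of u v] 5 uv by auto
    qed
  qed (use sym[of u v] sym[of v u] uv uv' in \<open>auto simp: insert_commute\<close>)
qed

lemma loopless_M: "loopless M"
  unfolding loopless_def ground_M
proof
  fix x assume x: "x \<in> E"
  obtain a b where ab: "a \<in> P" "b \<in> Q" using nonempty by blast
  have ne: "a \<noteq> e" "b \<noteq> e" using ab e_notin by auto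
  have "E - {a, b} \<in> bases M" by (rule basis_pairI) (use ab path_neq in auto)
  moreover have "E - {e, b} \<in> bases M" by (rule basis_pairI) (use ab ne path_e_neq in auto)
  moreover have "E - {e, a} \<in> bases M" by (rule basis_pairI) (use ab ne path_e_neq in auto)
  moreover have "x \<in> E - {a, b} \<or> x \<in> E - {e, b} \<or> x \<in> E - {e, a}" using x ab disj e_notin by auto
  ultimately show "indep M {x}" unfolding indep_def by (meson empty_subsetI insert_subset)
qed

lemma rk_M: "rk M = card P + card Q - 1"
proof -
  obtain a b where ab: "a \<in> P" "b \<in> Q" using nonempty by blast
  have Y: "E - {a, b} \<in> bases M"
    using ab by (intro basis_pairI path_neq) auto
  have "a \<noteq> b" using ab disj by blast
  then have "card (E - {a, b}) = card E - 2" using ab fin by (subst card_Diff_subset) auto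
  moreover have "card E = card P + card Q + 1" using fin disj e_notin by (simp add: card_Un_disjoint)
  ultimately show ?thesis using rk_eq_card_basis[OF is_matroid_M Y] by simp
qed

text \<open>A sum rather than a difference, so that counts can be compared by linear
  arithmetic.\<close>

lemma card_basis_Int:
  assumes "u \<in> E" "v \<in> E" "path u \<noteq> path v" "F \<subseteq> E"
  shows "card ((E - {u, v}) \<inter> F) + of_bool (u \<in> F) + of_bool (v \<in> F) = card F"
proof -
  have F: "finite F" using assms(4) fin finite_subset by blast
  have "u \<noteq> v" using assms by auto
  have "(E - {u, v}) \<inter> F = F - {u, v}" using assms by auto
  moreover have "card F = card (F - {u, v}) + card (F \<inter> {u, v})"
    using F card_Int_Diff[of F "{u, v}"] by simp
  moreover have "card (F \<inter> {u, v}) = of_bool (u \<in> F) + of_bool (v \<in> F)"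
    using \<open>u \<noteq> v\<close> by (auto simp: Int_insert_right)
  ultimately show ?thesis by simp
qed

lemma theta_diff:
  assumes "\<not> P \<subseteq> F" "\<not> Q \<subseteq> F"
  shows "theta (P - F) (Q - F) e"
  using fin disj e_notin assms by unfold_locales auto

lemma mrank_independent:
  assumes "F \<subseteq> P \<union> Q" "\<not> P \<subseteq> F" "\<not> Q \<subseteq> F"
  shows "mrank M F = card F"
proof -
  obtain a b where ab: "a \<in> P" "b \<in> Q" "a \<notin> F" "b \<notin> F" using assms by blast
  have Y: "E - {a, b} \<in> bases M"
    using ab by (intro basis_pairI path_neq) auto
  have F: "finite F" using assms(1) fin finite_subset by blast
  have "(E - {a, b}) \<inter> F = F" using assms ab by auto
  then show ?thesis using F by (intro mrank_eqI[OF is_matroid_M Y]) (auto intro: card_mono)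
qed

text \<open>Such an \<open>F\<close> is independent, so the relevant bases are those whose missing
  pair avoids \<open>F\<close>, and removing \<open>F\<close> does not change which path an element
  lies on.\<close>

lemma contract_independent:
  assumes F: "F \<subseteq> P \<union> Q" "\<not> P \<subseteq> F" "\<not> Q \<subseteq> F"
  shows "contract M F = glued_cycles_matroid (insert e (P - F)) (insert e (Q - F)) e"
proof -
  interpret c: theta "P - F" "Q - F" e using theta_diff[OF F(2,3)] .
  have FE: "F \<subseteq> E" and eF: "e \<notin> F" using F e_notin by auto
  have E': "c.E = E - F" using eF by auto
  have p: "c.path x = path x" if "x \<in> E - F" for x using that by (auto simp: path_def c.path_def)
  have "bases c.M = bases (contract M F)"
    unfolding bases_contract mrank_independent[OF F]
  proof
    show "bases c.M \<subseteq> {Y - F | Y. Y \<in> bases M \<and> card (Y \<inter> F) = card F}"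
    proof
      fix Z assume "Z \<in> bases c.M"
      then obtain u v where uv: "u \<in> E - F" "v \<in> E - F" "c.path u \<noteq> c.path v" "Z = E - F - {u, v}"
        unfolding E'[symmetric] using c.basis_pairE by metis
      then have ne: "path u \<noteq> path v" using p by simp
      have uvE: "u \<in> E" "v \<in> E" using uv by auto
      have "E - {u, v} \<in> bases M" by (rule basis_pairI[OF uvE ne])
      moreover have "card ((E - {u, v}) \<inter> F) = card F" using card_basis_Int[OF uvE ne FE] uv by simp
      moreover have "Z = E - {u, v} - F" using uv by blast
      ultimately show "Z \<in> {Y - F | Y. Y \<in> bases M \<and> card (Y \<inter> F) = card F}" by blast
    qed
    show "{Y - F | Y. Y \<in> bases M \<and> card (Y \<inter> F) = card F} \<subseteq> bases c.M"
    proof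
      fix Z assume "Z \<in> {Y - F | Y. Y \<in> bases M \<and> card (Y \<inter> F) = card F}"
      then obtain Y where Y: "Y \<in> bases M" "card (Y \<inter> F) = card F" "Z = Y - F" by blast
      then obtain u v where uv: "u \<in> E" "v \<in> E" "path u \<noteq> path v" "Y = E - {u, v}" using basis_pairE by metis
      have "u \<notin> F" "v \<notin> F" using card_basis_Int[OF uv(1-3) FE] Y(2) uv(4) by (auto split: if_splits)
      then have "c.E - {u, v} \<in> bases c.M" unfolding E' using uv p
        by (intro c.basis_pairI[unfolded E']) auto
      moreover have "Z = c.E - {u, v}" unfolding E' using Y uv by auto
      ultimately show "Z \<in> bases c.M" by simp
    qed
  qed
  moreover have "ground c.M = ground (contract M F)" using c.ground_M ground_M E' by simp
  ultimately show ?thesis by (intro matroid.equality) auto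
qed

lemma contract_insert_e:
  assumes F: "F \<subseteq> P \<union> Q"
  shows "contract M (insert e F) = dsum (cycle_matroid (P - F)) (cycle_matroid (Q - F))" (is "_ = ?N")
proof -
  define F' where "F' = insert e F"
  \<comment> \<open>\<open>e\<close> lies in \<open>F'\<close>, and each of \<open>P\<close>,
    \<open>Q\<close> that lies in \<open>F\<close> adds another whole path to \<open>F'\<close>. A
    missing pair occupies two of the three paths, hence meets \<open>F'\<close> at least once for
    each path so added; \<open>k\<close> is the largest possible intersection.\<close>
  define k where "k = card F' - (of_bool (P \<subseteq> F) + of_bool (Q \<subseteq> F))"
  have F': "F' \<subseteq> E" using F unfolding F'_def by auto
  have N: "is_matroid ?N" using fin disj by (intro is_matroid_dsum is_matroid_cycle) auto
  have count: "of_bool (P \<subseteq> F) + of_bool (Q \<subseteq> F) \<le> (of_bool (u \<in> F') + of_bool (v \<in> F') :: nat)"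
    if "u \<in> E" "v \<in> E" "path u \<noteq> path v" for u v
    using that path_P[of u] path_P[of v] path_Q[of u] path_Q[of v] unfolding F'_def by (auto simp: of_bool_def)
  have k: "card ((E - {u, v}) \<inter> F') = k \<longleftrightarrow>
      of_bool (u \<in> F') + of_bool (v \<in> F') = (of_bool (P \<subseteq> F) + of_bool (Q \<subseteq> F) :: nat)"
    if uv: "u \<in> E" "v \<in> E" "path u \<noteq> path v" for u v
    using card_basis_Int[OF uv F'] count[OF uv] unfolding k_def by linarith
  have ex: "(E - {u, v}) - F' \<in> {Y - F' | Y. Y \<in> bases M \<and> card (Y \<inter> F') = k}"
    if "u \<in> E" "v \<in> E" "path u \<noteq> path v"
      "of_bool (u \<in> F') + of_bool (v \<in> F') = (of_bool (P \<subseteq> F) + of_bool (Q \<subseteq> F) :: nat)" for u v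
    using k[OF that(1-3)] that(4) basis_pairI[OF that(1-3)] by blast
  have bN: "bases ?N = {Y \<union> Y' | Y Y'. Y \<in> bases (cycle_matroid (P - F)) \<and> Y' \<in> bases (cycle_matroid (Q - F))}"
    by (rule bases_dsum)
  have bc: "bases (cycle_matroid (S - F)) = (if S \<subseteq> F then {{}} else (\<lambda>x. S - F - {x}) ` (S - F))"
    if "finite S" for S
  proof (cases "S \<subseteq> F")
    case True
    then have "S - F = {}" by blast
    then show ?thesis unfolding \<open>S - F = {}\<close> using True by simp
  next
    case False
    then have "S - F \<noteq> {}" by blast
    then show ?thesis using bases_cycle[of "S - F"] that False by simp
  qed
  show ?thesis unfolding F'_def[symmetric]
  proof (rule contract_eqI[OF is_matroid_M, where k = k])
    show "ground ?N = ground M - F'" unfolding ground_M F'_def using e_notin by auto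
    show "bases ?N \<noteq> {}" using N by (simp add: is_matroid_def)
    show "card (Y \<inter> F') \<le> k" if Y: "Y \<in> bases M" for Y
    proof -
      obtain u v where uv: "u \<in> E" "v \<in> E" "path u \<noteq> path v" "Y = E - {u, v}" using basis_pairE[OF Y] .
      show ?thesis using card_basis_Int[OF uv(1-3) F'] count[OF uv(1-3)] unfolding k_def uv(4) by linarith
    qed
    show "bases ?N = {Y - F' | Y. Y \<in> bases M \<and> card (Y \<inter> F') = k}" (is "_ = ?R")
    proof
      show "bases ?N \<subseteq> ?R"
      proof
        fix Z assume "Z \<in> bases ?N"
        then obtain Y Y' where Z: "Z = Y \<union> Y'" and Y: "Y \<in> bases (cycle_matroid (P - F))"
            "Y' \<in> bases (cycle_matroid (Q - F))" unfolding bN by blast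
        obtain a b where ab: "a \<in> P" "b \<in> Q" using nonempty by blast
        have ne: "path x \<noteq> path y" "path e \<noteq> path x" "path e \<noteq> path y" if "x \<in> P" "y \<in> Q" for x y
          using that disj e_notin by (auto simp: path_def)
        consider "P \<subseteq> F" "Q \<subseteq> F" | "P \<subseteq> F" "\<not> Q \<subseteq> F" | "\<not> P \<subseteq> F" "Q \<subseteq> F" | "\<not> P \<subseteq> F" "\<not> Q \<subseteq> F"
          by blast
        then show "Z \<in> ?R"
        proof cases
          case 1
          then have "Y = {}" "Y' = {}" using Y bc[OF fin(1)] bc[OF fin(2)] by simp_all
          then have Z': "Z = (E - {a, b}) - F'" using Z 1 e_notin unfolding F'_def by auto
          show ?thesis unfolding Z'
            by (rule ex) (use ne[OF ab] ab 1 in \<open>auto simp: F'_def\<close>)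
        next
          case 2
          then obtain y where y: "y \<in> Q" "y \<notin> F" "Y' = Q - F - {y}" using Y(2) bc[OF fin(2)] by auto
          have "Y = {}" using Y(1) bc[OF fin(1)] 2 by simp
          then have Z': "Z = (E - {e, y}) - F'" using Z y 2 e_notin unfolding F'_def by auto
          have "y \<noteq> e" using y e_notin by blast
          then show ?thesis unfolding Z'
            by (intro ex) (use ne[OF ab(1) y(1)] y 2 in \<open>auto simp: F'_def\<close>)
        next
          case 3
          then obtain x where x: "x \<in> P" "x \<notin> F" "Y = P - F - {x}" using Y(1) bc[OF fin(1)] by auto
          have "Y' = {}" using Y(2) bc[OF fin(2)] 3 by simp
          then have Z': "Z = (E - {e, x}) - F'" using Z x 3 e_notin unfolding F'_def by auto
          have "x \<noteq> e" using x e_notin by blast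
          then show ?thesis unfolding Z'
            by (intro ex) (use ne[OF x(1) ab(2)] x 3 in \<open>auto simp: F'_def\<close>)
        next
          case 4
          obtain x where x: "x \<in> P" "x \<notin> F" "Y = P - F - {x}" using Y(1) bc[OF fin(1)] 4 by auto
          obtain y where y: "y \<in> Q" "y \<notin> F" "Y' = Q - F - {y}" using Y(2) bc[OF fin(2)] 4 by auto
          have Z': "Z = (E - {x, y}) - F'" using Z x y disj e_notin unfolding F'_def by auto
          have "x \<noteq> e" "y \<noteq> e" using x y e_notin by blast+
          then show ?thesis unfolding Z'
            by (intro ex) (use ne[OF x(1) y(1)] x y 4 in \<open>auto simp: F'_def\<close>)
        qed
      qed
      show "?R \<subseteq> bases ?N"
      proof
        fix Z assume "Z \<in> ?R"
        then obtain Y where Y: "Y \<in> bases M" "card (Y \<inter> F') = k" "Z = Y - F'" by blast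
        then obtain u v where uv: "u \<in> E" "v \<in> E" "path u \<noteq> path v" "Y = E - {u, v}" using basis_pairE by metis
        have cnt: "of_bool (u \<in> F') + of_bool (v \<in> F') = (of_bool (P \<subseteq> F) + of_bool (Q \<subseteq> F) :: nat)"
          using k[OF uv(1-3)] Y(2) uv(4) by simp
        have Z: "Z = (P - F - {u, v}) \<union> (Q - F - {u, v})" using Y uv e_notin unfolding F'_def by auto
        have part: "S - F - {u, v} \<in> bases (cycle_matroid (S - F))"
          if "finite S" and S: "S \<subseteq> F \<or> (\<exists>w\<in>S - F. (S - F) \<inter> {u, v} = {w})" for S
        proof (cases "S \<subseteq> F")
          case True
          then have "S - F - {u, v} = {}" by blast
          then show ?thesis using bc[OF that(1)] True by simp
        next
          case False
          then obtain w where w: "w \<in> S - F" "(S - F) \<inter> {u, v} = {w}" using S by blast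
          then have "S - F - {u, v} = S - F - {w}" by blast
          moreover have "S - F - {w} \<in> (\<lambda>x. S - F - {x}) ` (S - F)" using w(1) by (rule imageI)
          ultimately show ?thesis using bc[OF that(1)] False by simp
        qed
        \<comment> \<open>A path not inside \<open>F\<close> holds exactly one element of the pair
          outside \<open>F\<close>. It cannot hold two, as the pair lies on different paths. If it
          held none, then either both elements would lie in \<open>F'\<close>, exceeding the count,
          or both would lie on \<open>T\<close>.\<close>
        have one: "S \<subseteq> F \<or> (\<exists>w\<in>S - F. (S - F) \<inter> {u, v} = {w})"
          if S: "E = insert e (S \<union> T)" "\<And>x y. x \<in> S \<Longrightarrow> y \<in> S \<Longrightarrow> path x = path y"
            and T: "\<And>x y. x \<in> T \<Longrightarrow> y \<in> T \<Longrightarrow> path x = path y"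
            and cnt: "of_bool (u \<in> F') + of_bool (v \<in> F') = (of_bool (S \<subseteq> F) + of_bool (T \<subseteq> F) :: nat)" for S T
        proof (cases "S \<subseteq> F")
          case nS: False
          have "u \<in> S - F \<or> v \<in> S - F"
          proof (rule ccontr)
            assume "\<not> ?thesis"
            then have *: "u \<in> F' \<or> u \<in> T - F" "v \<in> F' \<or> v \<in> T - F"
              using uv(1,2) S(1) unfolding F'_def by blast+
            show False
            proof (cases "T \<subseteq> F")
              case True
              then have "u \<in> F'" "v \<in> F'" using * by blast+
              then show False using cnt nS True by simp
            next
              case False
              then have "u \<notin> F'" "v \<notin> F'" using cnt nS by (simp_all split: if_splits)
              then have "path u = path v" using * T by blast
              then show False using uv(3) by simp
            qed
          qed
          then obtain w where w: "w \<in> S - F" "w \<in> {u, v}" by blast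
          have "z = w" if "z \<in> S - F" "z \<in> {u, v}" for z
            using S(2)[of z w] w that uv(3) by auto
          then have "(S - F) \<inter> {u, v} = {w}" using w by blast
          then show ?thesis using w(1) by blast
        qed simp
        have eqP: "path x = path y" if "x \<in> P" "y \<in> P" for x y using that path_P[of x] path_P[of y] by simp
        have eqQ: "path x = path y" if "x \<in> Q" "y \<in> Q" for x y using that path_Q[of x] path_Q[of y] by simp
        have "P \<subseteq> F \<or> (\<exists>w\<in>P - F. (P - F) \<inter> {u, v} = {w})"
          by (rule one[OF refl eqP eqQ cnt])
        moreover have "Q \<subseteq> F \<or> (\<exists>w\<in>Q - F. (Q - F) \<inter> {u, v} = {w})"
        proof (rule one[OF _ eqQ eqP])
          show "E = insert e (Q \<union> P)" by (simp add: Un_commute)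
          show "of_bool (u \<in> F') + of_bool (v \<in> F') = (of_bool (Q \<subseteq> F) + of_bool (P \<subseteq> F) :: nat)"
            using cnt by linarith
        qed
        ultimately have "P - F - {u, v} \<in> bases (cycle_matroid (P - F))" "Q - F - {u, v} \<in> bases (cycle_matroid (Q - F))"
          using part[OF fin(1)] part[OF fin(2)] by simp_all
        then show "Z \<in> bases ?N" unfolding Z bN
          by (intro CollectI exI[of _ "P - F - {u, v}"] exI[of _ "Q - F - {u, v}"] conjI) simp_all
      qed
    qed
  qed
qed

text \<open>Follows from additivity of the rank under contraction: \<open>M\<close> has rank
  \<open>card P + card Q - 1\<close>, while the ranks of the cycles on \<open>P\<close> and
  \<open>Q\<close> add up to one less; the difference is the summand 1.\<close>

lemma mrank_insert_e:
  assumes F: "F \<subseteq> P \<union> Q"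
  shows "mrank M (insert e F) =
    1 + mrank (cycle_matroid P) (F \<inter> P) + mrank (cycle_matroid Q) (F \<inter> Q)"
proof -
  have disj': "ground (cycle_matroid (P - F)) \<inter> ground (cycle_matroid (Q - F)) = {}" using disj by auto
  have C: "is_matroid (cycle_matroid (P - F))" "is_matroid (cycle_matroid (Q - F))"
    using fin by (auto intro: is_matroid_cycle)
  have "rk (dsum (cycle_matroid (P - F)) (cycle_matroid (Q - F))) =
      rk (cycle_matroid (P - F)) + rk (cycle_matroid (Q - F))"
    using mrank_dsum[OF C disj'] mrank_Int_ground[OF C(1), of "(P - F) \<union> (Q - F)"]
      mrank_Int_ground[OF C(2), of "(P - F) \<union> (Q - F)"] by (simp add: Int_absorb1)
  moreover have "rk (cycle_matroid (S - F)) + mrank (cycle_matroid S) (F \<inter> S) = card S - 1" if "finite S" for S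
  proof -
    have "S - F \<inter> S = S - F" by blast
    then show ?thesis using rk_contract[OF is_matroid_cycle[OF that], of "F \<inter> S"]
        contract_cycle[OF that, of "F \<inter> S"] rk_cycle[OF that] by simp
  qed
  from this[OF fin(1)] this[OF fin(2)]
  have "rk (cycle_matroid (P - F)) + mrank (cycle_matroid P) (F \<inter> P) = card P - 1"
    "rk (cycle_matroid (Q - F)) + mrank (cycle_matroid Q) (F \<inter> Q) = card Q - 1" .
  moreover have "rk (contract M (insert e F)) + mrank M (insert e F) = card P + card Q - 1"
    using rk_contract[OF is_matroid_M] rk_M by simp
  moreover have "card P > 0" "card Q > 0" using fin nonempty by (auto simp: card_gt_0_iff)
  ultimately show ?thesis unfolding contract_insert_e[OF F] by linarith
qed

lemma flats_M:
  "flats M = {F. F \<subseteq> P \<union> Q \<and> \<not> P \<subseteq> F \<and> \<not> Q \<subseteq> F} \<union>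
    insert e ` {F. F \<subseteq> P \<union> Q \<and> card (P - F) \<noteq> 1 \<and> card (Q - F) \<noteq> 1}" (is "_ = ?I \<union> insert e ` ?D")
proof -
  have D: "insert e F \<in> flats M \<longleftrightarrow> F \<in> ?D" if F: "F \<subseteq> P \<union> Q" for F
  proof -
    have disj': "ground (cycle_matroid (P - F)) \<inter> ground (cycle_matroid (Q - F)) = {}" using disj by auto
    have "finite (P - F)" "finite (Q - F)" using fin by auto
    then show ?thesis unfolding flats_iff_loopless_contract[OF is_matroid_M] contract_insert_e[OF F] ground_M
      using F by (auto simp: loopless_dsum[OF is_matroid_cycle is_matroid_cycle disj'] loopless_cycle)
  qed
  have I: "F \<in> flats M" if "F \<in> ?I" for F
    unfolding flats_iff_loopless_contract[OF is_matroid_M] ground_M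
    using that contract_independent[of F] theta.loopless_M[OF theta_diff, of F] by auto
  have "F \<in> ?I" if F: "F \<in> flats M" and e: "e \<notin> F" for F
  proof -
    have FE: "F \<subseteq> E" and ll: "loopless (contract M F)"
      using F flats_iff_loopless_contract[OF is_matroid_M] ground_M by auto
    then have "indep (contract M F) {e}" using e by (simp add: loopless_def ground_M)
    then obtain Z where "Z \<in> bases (contract M F)" "e \<in> Z" unfolding indep_def by auto
    then obtain Y where Y: "Y \<in> bases M" "card (Y \<inter> F) = mrank M F" "e \<in> Y"
      unfolding bases_contract by auto
    obtain u v where uv: "u \<in> E" "v \<in> E" "path u \<noteq> path v" "Y = E - {u, v}" using basis_pairE[OF Y(1)] .
    have ne: "u \<noteq> e" "v \<noteq> e" using Y(3) uv by auto
    \<comment> \<open>\<open>Y\<close> attains the rank of \<open>F\<close>. Comparing it with the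
      bases that miss \<open>{e, u}\<close> and \<open>{e, v}\<close>, where \<open>e\<close> lies
      outside \<open>F\<close>, shows that \<open>F\<close> contains neither \<open>u\<close> nor
      \<open>v\<close>, and these lie one on \<open>P\<close> and one on \<open>Q\<close>.\<close>
    have le: "card ((E - {e, w}) \<inter> F) \<le> card ((E - {u, v}) \<inter> F)" if "w \<in> {u, v}" for w
      unfolding uv(4)[symmetric] Y(2)
      using that uv(1,2) ne by (intro card_le_mrank[OF is_matroid_M basis_pairI] path_e_neq) auto
    have "of_bool (w \<in> F) \<ge> (of_bool (u \<in> F) + of_bool (v \<in> F) :: nat)" if w: "w \<in> {u, v}" for w
    proof -
      have "path e \<noteq> path w" "w \<in> E" using w ne uv path_e_neq[of w] by auto
      then have "card ((E - {e, w}) \<inter> F) + of_bool (e \<in> F) + of_bool (w \<in> F) = card F"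
        by (intro card_basis_Int FE) auto
      then show ?thesis using card_basis_Int[OF uv(1-3) FE] le[OF w] e by simp
    qed
    from this[of u] this[of v] have "u \<notin> F" "v \<notin> F" by (auto simp: of_bool_def split: if_splits)
    moreover have "u \<in> P \<and> v \<in> Q \<or> u \<in> Q \<and> v \<in> P"
      using uv(1-3) ne path_P[of u] path_P[of v] path_Q[of u] path_Q[of v] by auto
    ultimately show "F \<in> ?I" using FE e by blast
  qed
  moreover have "F \<in> insert e ` ?D" if "F \<in> flats M" "e \<in> F" for F
  proof -
    have "F - {e} \<subseteq> P \<union> Q" "insert e (F - {e}) = F" using that flat_subset[OF that(1)] ground_M by auto
    from D[OF this(1)] this(2) that(1) have "F - {e} \<in> ?D" by simp
    then have "insert e (F - {e}) \<in> insert e ` ?D" by (rule imageI)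
    then show ?thesis using \<open>insert e (F - {e}) = F\<close> by simp
  qed
  ultimately have sub: "flats M \<subseteq> ?I \<union> insert e ` ?D" by (metis (no_types, lifting) UnI1 UnI2 subsetI)
  have "insert e ` ?D \<subseteq> flats M"
  proof
    fix F assume "F \<in> insert e ` ?D"
    then obtain F' where F': "F = insert e F'" "F' \<in> ?D" by (rule imageE)
    then show "F \<in> flats M" using D[of F'] by simp
  qed
  moreover have "?I \<subseteq> flats M" using I by (rule subsetI)
  ultimately show ?thesis using sub by (intro equalityI Un_least)
qed

end


section \<open>Summation over the flats of two glued cycles\<close>

lemma mult_sum_product:
  fixes c :: "'c::comm_semiring_0"
  shows "c * (sum f A * sum g B) = (\<Sum>a\<in>A. \<Sum>b\<in>B. c * (f a * g b))"
  unfolding sum_product by (simp only: sum_distrib_left)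

context theta
begin

lemma sum_fixed_Un:
  fixes f :: "'a set \<Rightarrow> rat poly"
  assumes "\<pi> ` P \<subseteq> P" "\<pi> ` Q \<subseteq> Q"
  shows "sum f (fixed_subsets \<pi> (P \<union> Q)) =
    (\<Sum>F\<in>fixed_subsets \<pi> P. \<Sum>F'\<in>fixed_subsets \<pi> Q. f (F \<union> F'))"
proof (rule sum_Un_subsets[OF disj])
  fix F F' assume F: "F \<subseteq> P" "F' \<subseteq> Q"
  show "F \<union> F' \<in> fixed_subsets \<pi> (P \<union> Q) \<longleftrightarrow> F \<in> fixed_subsets \<pi> P \<and> F' \<in> fixed_subsets \<pi> Q"
    using F image_Un_fixed_iff[OF assms disj F] by (auto simp: fixed_subsets_def)
qed (auto simp: fixed_subsets_def)

lemma fixed_pair: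
  assumes "F \<in> fixed_subsets \<pi> P" "F' \<in> fixed_subsets \<pi> Q"
  shows "card (F \<union> F') = card F + card F'" "P - (F \<union> F') = P - F" "Q - (F \<union> F') = Q - F'"
    "(F \<union> F') \<inter> P = F" "(F \<union> F') \<inter> Q = F'" "P \<subseteq> F \<union> F' \<longleftrightarrow> F = P" "Q \<subseteq> F \<union> F' \<longleftrightarrow> F' = Q"
proof -
  have F: "F \<subseteq> P" "F' \<subseteq> Q" using assms by (auto simp: fixed_subsets_def)
  then have "finite F" "finite F'" using fin finite_subset by auto
  then show "card (F \<union> F') = card F + card F'" using F disj by (intro card_Un_disjoint) auto
qed (use assms disj in \<open>auto simp: fixed_subsets_def\<close>)

text \<open>The pairs with \<open>F \<noteq> P\<close> and \<open>F' \<noteq> Q\<close> are the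
  fixed flats avoiding \<open>e\<close>. The remaining proper subsets of \<open>P \<union> Q\<close>
  contain \<open>P\<close> or \<open>Q\<close>: they consist of \<open>P\<close> and a proper subset
  of \<open>Q\<close>, or the reverse, and no proper subset is of both kinds.\<close>

lemma kl_proper_Un:
  assumes \<pi>: "\<pi> ` P = P" "\<pi> ` Q = Q"
  shows "(\<Sum>F\<in>fixed_subsets \<pi> P. \<Sum>F'\<in>fixed_subsets \<pi> Q.
      if F = P \<or> F' = Q then 0 else [:0, 1:] ^ (card F + card F') * klc (P \<union> Q - (F \<union> F')) \<pi>) =
    kl_proper (P \<union> Q) \<pi> - [:0, 1:] ^ card P * kl_proper Q \<pi> - [:0, 1:] ^ card Q * kl_proper P \<pi>"
    (is "?I = _")
proof -
  let ?X = "[:0, 1::rat:]" and ?f = "fixed_subsets \<pi>"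
  let ?cP = "\<lambda>F. if F = P then 0 else ?X ^ card F * klc (P - F) \<pi>"
  let ?cQ = "\<lambda>F. if F = Q then 0 else ?X ^ card F * klc (Q - F) \<pi>"
  let ?I' = "\<lambda>F F'. if F = P \<or> F' = Q then 0 else ?X ^ (card F + card F') * klc (P \<union> Q - (F \<union> F')) \<pi>"
  have ff: "finite (?f P)" "finite (?f Q)" and mem: "P \<in> ?f P" "Q \<in> ?f Q"
    using fin \<pi> finite_fixed_subsets by (auto simp: fixed_subsets_def)
  have "kl_proper (P \<union> Q) \<pi> = (\<Sum>F\<in>?f P. \<Sum>F'\<in>?f Q.
      if F \<union> F' = P \<union> Q then 0 else ?X ^ card (F \<union> F') * klc (P \<union> Q - (F \<union> F')) \<pi>)"
    unfolding kl_proper_def using \<pi> by (intro sum_fixed_Un) auto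
  also have "\<dots> = (\<Sum>F\<in>?f P. \<Sum>F'\<in>?f Q. ?I' F F' +
      (if F = P then ?X ^ card P * ?cQ F' else 0) + (if F' = Q then ?X ^ card Q * ?cP F else 0))"
  proof (intro sum.cong refl)
    fix F F' assume F: "F \<in> ?f P" "F' \<in> ?f Q"
    have full: "F \<union> F' = P \<union> Q \<longleftrightarrow> F = P \<and> F' = Q"
      using F disj by (auto simp: fixed_subsets_def)
    have "P \<union> Q - (P \<union> F') = Q - F'" "P \<union> Q - (F \<union> Q) = P - F"
      using F disj by (auto simp: fixed_subsets_def)
    then show "(if F \<union> F' = P \<union> Q then 0 else ?X ^ card (F \<union> F') * klc (P \<union> Q - (F \<union> F')) \<pi>) =
      ?I' F F' + (if F = P then ?X ^ card P * ?cQ F' else 0) + (if F' = Q then ?X ^ card Q * ?cP F else 0)"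
      unfolding full fixed_pair(1)[OF F] by (simp add: power_add mult.assoc mult.left_commute)
  qed
  also have "\<dots> = ?I + (\<Sum>F\<in>?f P. \<Sum>F'\<in>?f Q. if F = P then ?X ^ card P * ?cQ F' else 0) +
      (\<Sum>F\<in>?f P. \<Sum>F'\<in>?f Q. if F' = Q then ?X ^ card Q * ?cP F else 0)"
    by (simp only: sum.distrib)
  also have "(\<Sum>F\<in>?f P. \<Sum>F'\<in>?f Q. if F = P then ?X ^ card P * ?cQ F' else 0) = ?X ^ card P * kl_proper Q \<pi>"
  proof -
    have "(\<Sum>F\<in>?f P. \<Sum>F'\<in>?f Q. if F = P then ?X ^ card P * ?cQ F' else 0) =
        (\<Sum>F\<in>?f P. if F = P then ?X ^ card P * (\<Sum>F'\<in>?f Q. ?cQ F') else 0)"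
      unfolding sum_distrib_left by (intro sum.cong refl) simp
    also have "\<dots> = ?X ^ card P * (\<Sum>F'\<in>?f Q. ?cQ F')" using ff mem by (simp add: sum.delta)
    finally show ?thesis unfolding kl_proper_def .
  qed
  also have "(\<Sum>F\<in>?f P. \<Sum>F'\<in>?f Q. if F' = Q then ?X ^ card Q * ?cP F else 0) = ?X ^ card Q * kl_proper P \<pi>"
    unfolding kl_proper_def sum_distrib_left using ff mem by (intro sum.cong refl) (simp add: sum.delta)
  finally show ?thesis by (simp add: algebra_simps)
qed

text \<open>The sum extends over all fixed subsets, since those that give no flat contribute a
  factor \<open>klc\<close> of a one-element set. It then factors, because the rank and the
  remaining cycles separate into a part for \<open>P\<close> and a part for \<open>Q\<close>; the
  leading x is the rank added by \<open>e\<close>.\<close>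

lemma sum_dependent_flats:
  assumes \<pi>: "\<pi> ` P = P" "\<pi> ` Q = Q"
  shows "(\<Sum>F\<in>fixed_subsets \<pi> (P \<union> Q). [:0, 1:] ^ mrank M (insert e F) * (klc (P - F) \<pi> * klc (Q - F) \<pi>)) =
    [:0, 1:] * (kl_proper P \<pi> + [:0, 1:] ^ (card P - 1)) * (kl_proper Q \<pi> + [:0, 1:] ^ (card Q - 1))"
proof -
  let ?X = "[:0, 1::rat:]" and ?f = "fixed_subsets \<pi>"
  let ?m = "\<lambda>S F. mrank (cycle_matroid S) F"
  have "(\<Sum>F\<in>?f (P \<union> Q). ?X ^ mrank M (insert e F) * (klc (P - F) \<pi> * klc (Q - F) \<pi>)) =
      (\<Sum>F\<in>?f P. \<Sum>F'\<in>?f Q. ?X ^ mrank M (insert e (F \<union> F')) *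
        (klc (P - (F \<union> F')) \<pi> * klc (Q - (F \<union> F')) \<pi>))"
    using \<pi> by (intro sum_fixed_Un) auto
  also have "\<dots> = (\<Sum>F\<in>?f P. \<Sum>F'\<in>?f Q. ?X * ((?X ^ ?m P F * klc (P - F) \<pi>) * (?X ^ ?m Q F' * klc (Q - F') \<pi>)))"
  proof (intro sum.cong refl)
    fix F F' assume F: "F \<in> ?f P" "F' \<in> ?f Q"
    then have "F \<union> F' \<subseteq> P \<union> Q" by (auto simp: fixed_subsets_def)
    then have "mrank M (insert e (F \<union> F')) = 1 + ?m P F + ?m Q F'"
      by (subst mrank_insert_e) (simp_all only: fixed_pair[OF F])
    then show "?X ^ mrank M (insert e (F \<union> F')) * (klc (P - (F \<union> F')) \<pi> * klc (Q - (F \<union> F')) \<pi>) =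
        ?X * ((?X ^ ?m P F * klc (P - F) \<pi>) * (?X ^ ?m Q F' * klc (Q - F') \<pi>))"
      unfolding fixed_pair[OF F] by (simp only: power_add power_one_right mult.assoc mult.left_commute)
  qed
  also have "\<dots> = ?X * ((\<Sum>F\<in>?f P. ?X ^ ?m P F * klc (P - F) \<pi>) * (\<Sum>F'\<in>?f Q. ?X ^ ?m Q F' * klc (Q - F') \<pi>))"
    unfolding mult_sum_product ..
  also have "\<dots> = ?X * ((kl_proper P \<pi> + ?X ^ (card P - 1)) * (kl_proper Q \<pi> + ?X ^ (card Q - 1)))"
    unfolding kl_proper_add[OF fin(1) \<pi>(1)] kl_proper_add[OF fin(2) \<pi>(2)] ..
  finally show ?thesis by (simp only: mult.assoc)
qed

lemma fixed_flats_M: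
  assumes \<pi>: "\<pi> ` P = P" "\<pi> ` Q = Q" "\<pi> e = e"
  shows "{F \<in> flats M. \<pi> ` F = F} = {F \<in> fixed_subsets \<pi> (P \<union> Q). \<not> P \<subseteq> F \<and> \<not> Q \<subseteq> F} \<union>
    insert e ` {F \<in> fixed_subsets \<pi> (P \<union> Q). card (P - F) \<noteq> 1 \<and> card (Q - F) \<noteq> 1}"
proof -
  have "\<pi> ` insert e F = insert e F \<longleftrightarrow> \<pi> ` F = F" if "F \<subseteq> P \<union> Q" for F
  proof
    assume eq: "\<pi> ` insert e F = insert e F"
    have "\<pi> ` F \<subseteq> P \<union> Q" using \<pi> that by (metis image_Un image_mono)
    then have "e \<notin> \<pi> ` F" "e \<notin> F" using e_notin that by auto
    moreover have "insert e (\<pi> ` F) = insert e F" using eq \<pi> by simp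
    ultimately show "\<pi> ` F = F" by (metis insert_ident)
  qed (simp add: \<pi>)
  then show ?thesis unfolding flats_M fixed_subsets_def by auto
qed

end

text \<open>The induction serves the flats avoiding \<open>e\<close>, whose contractions are smaller
  pairs of glued cycles; for flats through \<open>e\<close> the multiplicativity
  \<open>kl_dsum\<close> applies. If \<open>P\<close> has one element, \<open>klc P \<pi>\<close> is
  0, as it should be: the glued matroid is then the cycle on \<open>P \<union> Q\<close> with
  \<open>e\<close> added parallel to that element.\<close>

theorem kl_glued_cycles:
  assumes "theta P Q e" "bij_betw \<pi> P P" "bij_betw \<pi> Q Q" "\<pi> e = e"
  shows "kl (glued_cycles_matroid (insert e P) (insert e Q) e) \<pi> =
    kl (cycle_matroid (P \<union> Q)) \<pi> - [:0, 1:] * (klc P \<pi> * klc Q \<pi>)"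
  using assms
proof (induction "card (P \<union> Q)" arbitrary: P Q rule: less_induct)
  case less
  interpret theta P Q e by (rule less.prems(1))
  note bij = less.prems(2,3) and e = less.prems(4)
  have \<pi>: "\<pi> ` P = P" "\<pi> ` Q = Q" using bij by (auto simp: bij_betw_def)
  let ?X = "[:0, 1::rat:]" and ?f = "fixed_subsets \<pi>"
  define p where "p = kl (cycle_matroid (P \<union> Q)) \<pi> - ?X * (klc P \<pi> * klc Q \<pi>)"
  \<comment> \<open>The summand of the Z-polynomial at \<open>F\<close>, with the candidate
    \<open>p\<close> at the empty flat, where the value of \<open>kl\<close> is still to be
    determined.\<close>
  define h where "h F = ?X ^ mrank M F * (if F = {} then p else kl (contract M F) \<pi>)" for F
  have finPQ: "finite (P \<union> Q)" and card2: "card (P \<union> Q) \<noteq> 1"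
  proof -
    have "card P > 0" "card Q > 0" using fin nonempty by (auto simp: card_gt_0_iff)
    then show "card (P \<union> Q) \<noteq> 1" using card_Un_disjoint[OF fin disj] by simp
  qed (use fin in simp)
  have bijPQ: "bij_betw \<pi> (P \<union> Q) (P \<union> Q)" using bij_betw_combine[OF bij disj] .
  have bij_diff: "bij_betw \<pi> (P - F) (P - F)" "bij_betw \<pi> (Q - F) (Q - F)" if F: "F \<in> ?f (P \<union> Q)" for F
  proof -
    have "F = (F \<inter> P) \<union> (F \<inter> Q)" using F by (auto simp: fixed_subsets_def)
    then have "\<pi> ` (F \<inter> P) = F \<inter> P" "\<pi> ` (F \<inter> Q) = F \<inter> Q"
      using image_Un_fixed_iff[of \<pi> P Q "F \<inter> P" "F \<inter> Q"] \<pi> disj F by (auto simp: fixed_subsets_def)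
    moreover have "P - F = P - F \<inter> P" "Q - F = Q - F \<inter> Q" by auto
    ultimately show "bij_betw \<pi> (P - F) (P - F)" "bij_betw \<pi> (Q - F) (Q - F)"
      using image_contract_eq[OF bij(1), of "F \<inter> P"] image_contract_eq[OF bij(2), of "F \<inter> Q"] by simp_all
  qed
  have h_indep: "h F = ?X ^ card F * (klc (P \<union> Q - F) \<pi> - ?X * (klc (P - F) \<pi> * klc (Q - F) \<pi>))"
    if F: "F \<in> ?f (P \<union> Q)" "\<not> P \<subseteq> F" "\<not> Q \<subseteq> F" for F
  proof -
    have FE: "F \<subseteq> P \<union> Q" using F by (simp add: fixed_subsets_def)
    interpret c: theta "P - F" "Q - F" e using theta_diff[OF F(2,3)] .
    have PQ: "(P - F) \<union> (Q - F) = P \<union> Q - F" by blast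
    have "card (P - F) > 0" "card (Q - F) > 0" using c.fin c.nonempty by (auto simp: card_gt_0_iff)
    then have "card (P \<union> Q - F) \<noteq> 1" using card_Un_disjoint[OF c.fin c.disj] unfolding PQ by simp
    then have klc: "klc (P \<union> Q - F) \<pi> = kl (cycle_matroid (P \<union> Q - F)) \<pi>" by (simp add: klc_def)
    have "(if F = {} then p else kl (contract M F) \<pi>) =
        klc (P \<union> Q - F) \<pi> - ?X * (klc (P - F) \<pi> * klc (Q - F) \<pi>)"
    proof (cases "F = {}")
      case True
      then show ?thesis using klc by (simp add: p_def)
    next
      case False
      have "card ((P - F) \<union> (Q - F)) < card (P \<union> Q)"
        unfolding PQ using False FE finPQ by (intro psubset_card_mono) auto
      then show ?thesis
        using less.hyps[OF _ c.theta_axioms bij_diff[OF F(1)] e] contract_independent[OF FE F(2,3)] False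
        unfolding PQ klc by simp
    qed
    then show ?thesis unfolding h_def mrank_independent[OF FE F(2,3)] by simp
  qed
  have h_dep: "h (insert e F) = ?X ^ mrank M (insert e F) * (klc (P - F) \<pi> * klc (Q - F) \<pi>)"
    if F: "F \<in> ?f (P \<union> Q)" "card (P - F) \<noteq> 1" "card (Q - F) \<noteq> 1" for F
  proof -
    have FE: "F \<subseteq> P \<union> Q" using F by (simp add: fixed_subsets_def)
    have "finite (P - F)" "finite (Q - F)" using fin by auto
    then have "kl (dsum (cycle_matroid (P - F)) (cycle_matroid (Q - F))) \<pi> = klc (P - F) \<pi> * klc (Q - F) \<pi>"
      using F(2,3) bij_diff[OF F(1)] disj
      by (subst kl_dsum) (auto simp: klc_def loopless_cycle is_matroid_cycle)
    then show ?thesis unfolding h_def contract_insert_e[OF FE] by simp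
  qed
  let ?I = "{F \<in> ?f (P \<union> Q). \<not> P \<subseteq> F \<and> \<not> Q \<subseteq> F}"
  let ?D = "{F \<in> ?f (P \<union> Q). card (P - F) \<noteq> 1 \<and> card (Q - F) \<noteq> 1}"
  have ff: "finite (?f (P \<union> Q))" using finite_fixed_subsets[OF finPQ] .
  have eD: "e \<notin> F" if "F \<in> ?f (P \<union> Q)" for F using that e_notin by (auto simp: fixed_subsets_def)
  have sumI: "sum h ?I = kl_proper (P \<union> Q) \<pi> - ?X ^ card P * kl_proper Q \<pi> - ?X ^ card Q * kl_proper P \<pi> -
      ?X * (kl_proper P \<pi> * kl_proper Q \<pi>)"
  proof -
    have "sum h ?I = (\<Sum>F\<in>?f (P \<union> Q). if P \<subseteq> F \<or> Q \<subseteq> F then 0 else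
        ?X ^ card F * (klc (P \<union> Q - F) \<pi> - ?X * (klc (P - F) \<pi> * klc (Q - F) \<pi>)))"
      using h_indep by (intro sum.mono_neutral_cong_left ff) auto
    also have "\<dots> = (\<Sum>F\<in>?f P. \<Sum>F'\<in>?f Q. if P \<subseteq> F \<union> F' \<or> Q \<subseteq> F \<union> F' then 0 else
        ?X ^ card (F \<union> F') * (klc (P \<union> Q - (F \<union> F')) \<pi> - ?X * (klc (P - (F \<union> F')) \<pi> * klc (Q - (F \<union> F')) \<pi>)))"
      using \<pi> by (intro sum_fixed_Un) auto
    also have "\<dots> = (\<Sum>F\<in>?f P. \<Sum>F'\<in>?f Q.
        (if F = P \<or> F' = Q then 0 else ?X ^ (card F + card F') * klc (P \<union> Q - (F \<union> F')) \<pi>) -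
        ?X * ((if F = P then 0 else ?X ^ card F * klc (P - F) \<pi>) * (if F' = Q then 0 else ?X ^ card F' * klc (Q - F') \<pi>)))"
    proof (intro sum.cong refl)
      fix F F' assume F: "F \<in> ?f P" "F' \<in> ?f Q"
      have "?X ^ (card F + card F') * (klc (P \<union> Q - (F \<union> F')) \<pi> - ?X * (klc (P - F) \<pi> * klc (Q - F') \<pi>)) =
          ?X ^ (card F + card F') * klc (P \<union> Q - (F \<union> F')) \<pi> -
          ?X * ((?X ^ card F * klc (P - F) \<pi>) * (?X ^ card F' * klc (Q - F') \<pi>))"
        by (simp only: power_add right_diff_distrib mult.assoc mult.left_commute)
      then show "(if P \<subseteq> F \<union> F' \<or> Q \<subseteq> F \<union> F' then 0 else
        ?X ^ card (F \<union> F') * (klc (P \<union> Q - (F \<union> F')) \<pi> - ?X * (klc (P - (F \<union> F')) \<pi> * klc (Q - (F \<union> F')) \<pi>))) =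
        (if F = P \<or> F' = Q then 0 else ?X ^ (card F + card F') * klc (P \<union> Q - (F \<union> F')) \<pi>) -
        ?X * ((if F = P then 0 else ?X ^ card F * klc (P - F) \<pi>) * (if F' = Q then 0 else ?X ^ card F' * klc (Q - F') \<pi>))"
        unfolding fixed_pair[OF F] by (cases "F = P"; cases "F' = Q") simp_all
    qed
    also have "\<dots> = (kl_proper (P \<union> Q) \<pi> - ?X ^ card P * kl_proper Q \<pi> - ?X ^ card Q * kl_proper P \<pi>) -
        ?X * (kl_proper P \<pi> * kl_proper Q \<pi>)"
      unfolding sum_subtractf kl_proper_Un[OF \<pi>]
      unfolding kl_proper_def[of P] kl_proper_def[of Q] mult_sum_product ..
    finally show ?thesis .
  qed
  have sumD: "sum (\<lambda>F. h (insert e F)) ?D =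
      ?X * (kl_proper P \<pi> + ?X ^ (card P - 1)) * (kl_proper Q \<pi> + ?X ^ (card Q - 1))"
    unfolding sum_dependent_flats[OF \<pi>, symmetric]
    using h_dep by (intro sum.mono_neutral_cong_left ff) (auto simp: klc_def)
  have "p + kl_rest M \<pi> = sum h {F \<in> flats M. \<pi> ` F = F}"
  proof -
    have "{F \<in> flats M. \<pi> ` F = F} = insert {} {F \<in> flats M. F \<noteq> {} \<and> \<pi> ` F = F}"
      using empty_flat[OF is_matroid_M loopless_M] by auto
    then have "sum h {F \<in> flats M. \<pi> ` F = F} = h {} + sum h {F \<in> flats M. F \<noteq> {} \<and> \<pi> ` F = F}"
      using finite_flats[OF is_matroid_M] by simp
    also have "sum h {F \<in> flats M. F \<noteq> {} \<and> \<pi> ` F = F} = kl_rest M \<pi>"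
      unfolding kl_rest_def monom_eq_X_power by (intro sum.cong) (auto simp: h_def)
    finally show ?thesis using is_matroid_M by (simp add: h_def)
  qed
  also have "\<dots> = sum h ?I + sum h (insert e ` ?D)"
    unfolding fixed_flats_M[OF \<pi> e] using ff eD by (intro sum.union_disjoint) auto
  also have "sum h (insert e ` ?D) = sum (\<lambda>F. h (insert e F)) ?D"
    using eD by (intro sum.reindex_cong[OF _ refl refl] inj_onI) (metis (mono_tags, lifting) insert_ident mem_Collect_eq)
  also have "sum h ?I + \<dots> = kl_proper (P \<union> Q) \<pi> + ?X ^ (card (P \<union> Q) - 1)"
  proof -
    \<comment> \<open>Cardinalities written as successors make the exponents
      \<open>card P - 1\<close> and \<open>card Q - 1\<close> free of truncated subtraction; the
      mixed terms then cancel.\<close>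
    obtain a b where ab: "card P = Suc a" "card Q = Suc b"
      using fin nonempty by (metis card_gt_0_iff gr0_conv_Suc)
    have "card (P \<union> Q) = Suc (Suc (a + b))" using ab card_Un_disjoint[OF fin disj] by simp
    then show ?thesis unfolding sumI sumD ab by (simp add: power_add ring_distribs)
  qed
  also have "\<dots> = klZ (cycle_matroid (P \<union> Q)) \<pi>"
    using klZ_cycle[OF finPQ, of \<pi>] \<pi> by (simp add: image_Un)
  finally have Z: "p + kl_rest M \<pi> = klZ (cycle_matroid (P \<union> Q)) \<pi>" .
  have rk: "rk M = card (P \<union> Q) - 1" using rk_M card_Un_disjoint[OF fin disj] by simp
  have "kl M \<pi> = p"
  proof (rule kl_unique[OF is_matroid_M])
    show "ground M \<noteq> {}" unfolding ground_M by simp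
    show "pal (rk M) (p + kl_rest M \<pi>)"
      unfolding Z rk rk_cycle[OF finPQ, symmetric] using card2
      by (intro pal_klZ is_matroid_cycle finPQ) (simp add: loopless_cycle[OF finPQ])
    fix j assume j: "rk M \<le> 2 * j"
    have "card P > 0" "card Q > 0" using fin nonempty by (auto simp: card_gt_0_iff)
    then have j': "card P + card Q \<le> 2 * j + 1" "j > 0" using j rk_M by auto
    have "poly.coeff (klc (P \<union> Q) \<pi>) j = 0"
    proof (rule ccontr)
      assume "poly.coeff (klc (P \<union> Q) \<pi>) j \<noteq> 0"
      then have "2 * j + 1 < card (P \<union> Q)" using klc_coeff_nonzero[OF finPQ] nonempty by blast
      then show False using j' card_Un_disjoint[OF fin disj] by simp
    qed
    then have "poly.coeff (kl (cycle_matroid (P \<union> Q)) \<pi>) j = 0" using card2 by (simp add: klc_def)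
    moreover have "poly.coeff (?X * (klc P \<pi> * klc Q \<pi>)) j = 0"
    proof -
      obtain j0 where j0: "j = Suc j0" using j' gr0_conv_Suc by blast
      have "poly.coeff (klc P \<pi>) i * poly.coeff (klc Q \<pi>) (j0 - i) = 0" if "i \<le> j0" for i
      proof (rule ccontr)
        assume "\<not> ?thesis"
        \<comment> \<open>The factor x shifts the index by one. The two bounds add up to
          \<open>2 * j0 + 4 \<le> card P + card Q\<close>, that is
          \<open>2 * j + 2 \<le> card P + card Q\<close>, against \<open>j'\<close>.\<close>
        then have "2 * i + 1 < card P" "2 * (j0 - i) + 1 < card Q"
          using klc_coeff_nonzero[OF fin(1) nonempty(1)] klc_coeff_nonzero[OF fin(2) nonempty(2)] by auto
        then show False using that j' j0 by linarith
      qed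
      then have "poly.coeff (klc P \<pi> * klc Q \<pi>) j0 = 0" unfolding coeff_mult by (intro sum.neutral) auto
      then show ?thesis unfolding j0 by (simp add: mult_pCons_left)
    qed
    ultimately show "poly.coeff p j = 0" unfolding p_def by simp
  qed
  then show ?case unfolding p_def .
qed


section \<open>Constructions on rational representations\<close>

lemma index_mult_mat_sum:
  "A \<in> carrier_mat n k \<Longrightarrow> B \<in> carrier_mat k m \<Longrightarrow> i < n \<Longrightarrow> j < m \<Longrightarrow>
    (A * B) $$ (i, j) = (\<Sum>l<k. A $$ (i, l) * B $$ (l, j))"
  by (simp add: scalar_prod_def atLeast0LessThan)

lemma is_repI:
  assumes "\<And>g. g \<in> carrier W \<Longrightarrow> \<rho> g \<in> carrier_mat n n"
    and "\<And>g h. g \<in> carrier W \<Longrightarrow> h \<in> carrier W \<Longrightarrow> \<rho> (g \<otimes>\<^bsub>W\<^esub> h) = \<rho> g * \<rho> h"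
    and "\<rho> \<one>\<^bsub>W\<^esub> = 1\<^sub>m n"
  shows "is_rep W (n, \<rho>)"
  using assms by (simp add: is_rep_def)

lemma is_repD:
  assumes "is_rep W (n, \<rho>)"
  shows "g \<in> carrier W \<Longrightarrow> \<rho> g \<in> carrier_mat n n"
    and "g \<in> carrier W \<Longrightarrow> h \<in> carrier W \<Longrightarrow> \<rho> (g \<otimes>\<^bsub>W\<^esub> h) = \<rho> g * \<rho> h"
    and "\<rho> \<one>\<^bsub>W\<^esub> = 1\<^sub>m n"
  using assms by (simp_all add: is_rep_def)

lemma rep_isoI:
  assumes "T \<in> carrier_mat n n" "S \<in> carrier_mat n n" "T * S = 1\<^sub>m n"
    and "\<And>g. g \<in> carrier W \<Longrightarrow> T * \<rho> g = \<sigma> g * T"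
  shows "rep_iso W (n, \<rho>) (n, \<sigma>)"
proof -
  have "S * T = 1\<^sub>m n" using mat_mult_left_right_inverse[OF assms(1-3)] .
  then have "invertible_mat T" using assms(1-3)
    by (auto simp: invertible_mat_def inverts_mat_def square_mat.simps)
  then show ?thesis using assms(1,4) by (auto simp: rep_iso_def)
qed

lemma rep_isoE:
  assumes "rep_iso W (n, \<rho>) (m, \<sigma>)"
  obtains T S where "m = n" "T \<in> carrier_mat n n" "S \<in> carrier_mat n n" "T * S = 1\<^sub>m n" "S * T = 1\<^sub>m n"
    "\<forall>g\<in>carrier W. T * \<rho> g = \<sigma> g * T"
proof -
  obtain T where T: "n = m" "T \<in> carrier_mat n n" "invertible_mat T" "\<forall>g\<in>carrier W. T * \<rho> g = \<sigma> g * T"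
    using assms by (auto simp: rep_iso_def)
  then obtain S where S: "T * S = 1\<^sub>m n" "S * T = 1\<^sub>m (dim_row S)"
    by (auto simp: invertible_mat_def inverts_mat_def)
  have "dim_col S = n" using arg_cong[OF S(1), of dim_col] by simp
  moreover have "dim_row S = n" using arg_cong[OF S(2), of dim_col] T(2) by simp
  ultimately have "S \<in> carrier_mat n n" by auto
  then show ?thesis using that T S by auto
qed

lemma rep_iso_eq:
  assumes "is_rep W (n, \<rho>)" "\<And>g. g \<in> carrier W \<Longrightarrow> \<sigma> g = \<rho> g"
  shows "rep_iso W (n, \<rho>) (n, \<sigma>)"
proof (rule rep_isoI[of "1\<^sub>m n" _ "1\<^sub>m n"])
  fix g assume g: "g \<in> carrier W"
  note c = is_repD(1)[OF assms(1) g]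
  show "1\<^sub>m n * \<rho> g = \<sigma> g * 1\<^sub>m n"
    unfolding assms(2)[OF g] left_mult_one_mat[OF c] right_mult_one_mat[OF c] ..
qed auto

lemma rep_iso_refl: "is_rep W V \<Longrightarrow> rep_iso W V V"
  by (cases V) (auto intro: rep_iso_eq)

lemma rep_iso_sym:
  assumes "is_rep W V" "is_rep W U" "rep_iso W V U"
  shows "rep_iso W U V"
proof -
  obtain n \<rho> m \<sigma> where V: "V = (n, \<rho>)" and U: "U = (m, \<sigma>)" by (cases V; cases U)
  obtain T S where TS: "m = n" "T \<in> carrier_mat n n" "S \<in> carrier_mat n n" "T * S = 1\<^sub>m n" "S * T = 1\<^sub>m n"
    "\<forall>g\<in>carrier W. T * \<rho> g = \<sigma> g * T"
    by (rule rep_isoE[OF assms(3)[unfolded V U]])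
  have "S * \<sigma> g = \<rho> g * S" if g: "g \<in> carrier W" for g
  proof -
    have c: "\<rho> g \<in> carrier_mat n n" "\<sigma> g \<in> carrier_mat n n"
      using is_repD(1)[OF assms(1)[unfolded V] g] is_repD(1)[OF assms(2)[unfolded U] g] TS(1) by auto
    have "S * \<sigma> g = S * (\<sigma> g * (T * S))" using TS c by simp
    also have "\<dots> = S * ((\<sigma> g * T) * S)" using TS c by (simp add: assoc_mult_mat[of _ n n _ n _ n])
    also have "\<dots> = S * ((T * \<rho> g) * S)" using TS(6)[rule_format, OF g] by simp
    also have "\<dots> = (S * T) * (\<rho> g * S)" using TS(2,3) c by (simp add: assoc_mult_mat[of _ n n _ n _ n])
    also have "\<dots> = \<rho> g * S" using TS c by simp
    finally show ?thesis .
  qed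
  then show ?thesis unfolding V U TS(1) by (intro rep_isoI[OF TS(3,2,5)])
qed

lemma rep_iso_trans:
  assumes "is_rep W V" "is_rep W U" "is_rep W X" "rep_iso W V U" "rep_iso W U X"
  shows "rep_iso W V X"
proof -
  obtain n \<rho> m \<sigma> k \<tau> where V: "V = (n, \<rho>)" and U: "U = (m, \<sigma>)" and X: "X = (k, \<tau>)"
    by (cases V; cases U; cases X)
  obtain T S where TS: "m = n" "T \<in> carrier_mat n n" "S \<in> carrier_mat n n" "T * S = 1\<^sub>m n" "S * T = 1\<^sub>m n"
    "\<forall>g\<in>carrier W. T * \<rho> g = \<sigma> g * T"
    by (rule rep_isoE[OF assms(4)[unfolded V U]])
  obtain T' S' where TS': "k = m" "T' \<in> carrier_mat m m" "S' \<in> carrier_mat m m" "T' * S' = 1\<^sub>m m" "S' * T' = 1\<^sub>m m"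
    "\<forall>g\<in>carrier W. T' * \<sigma> g = \<tau> g * T'"
    by (rule rep_isoE[OF assms(5)[unfolded U X]])
  note TS' = TS'[unfolded TS(1)]
  have "(T' * T) * \<rho> g = \<tau> g * (T' * T)" if g: "g \<in> carrier W" for g
  proof -
    have c: "\<rho> g \<in> carrier_mat n n" "\<sigma> g \<in> carrier_mat n n" "\<tau> g \<in> carrier_mat n n"
      using is_repD(1)[OF assms(1)[unfolded V] g] is_repD(1)[OF assms(2)[unfolded U] g]
        is_repD(1)[OF assms(3)[unfolded X] g] TS(1) TS'(1) by auto
    have "(T' * T) * \<rho> g = T' * (T * \<rho> g)" using TS TS' c by (simp add: assoc_mult_mat[of _ n n _ n _ n])
    also have "\<dots> = (T' * \<sigma> g) * T" using TS(2) TS'(2) TS(6)[rule_format, OF g] c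
      by (simp add: assoc_mult_mat[of _ n n _ n _ n])
    also have "\<dots> = \<tau> g * (T' * T)" using TS(2) TS'(2) TS'(6)[rule_format, OF g] c
      by (simp add: assoc_mult_mat[of _ n n _ n _ n])
    finally show ?thesis .
  qed
  moreover have "(T' * T) * (S * S') = 1\<^sub>m n"
  proof -
    have "(T' * T) * (S * S') = T' * ((T * S) * S')"
      using TS(2,3) TS'(2,3) by (simp add: assoc_mult_mat[of _ n n _ n _ n])
    then show ?thesis using TS(4) TS'(3,4) by simp
  qed
  ultimately show ?thesis unfolding V X TS'(1) using TS TS'
    by (intro rep_isoI[of "T' * T" _ "S * S'"]) auto
qed

text \<open>Reordering a basis: the permutation matrix of \<open>f\<close> intertwines. For block
  constructions that differ only in the order of the basis, it remains to compare entries.\<close>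

lemma rep_iso_reindex:
  assumes f: "bij_betw f {..<n} {..<n}"
    and c: "\<And>g. g \<in> carrier W \<Longrightarrow> \<rho> g \<in> carrier_mat n n" "\<And>g. g \<in> carrier W \<Longrightarrow> \<sigma> g \<in> carrier_mat n n"
    and eq: "\<And>g i j. g \<in> carrier W \<Longrightarrow> i < n \<Longrightarrow> j < n \<Longrightarrow> \<sigma> g $$ (f i, f j) = \<rho> g $$ (i, j)"
  shows "rep_iso W (n, \<rho>) (n, \<sigma>)"
proof -
  define T where "T = mat n n (\<lambda>(i, j). if i = f j then 1 else 0 :: rat)"
  define S where "S = mat n n (\<lambda>(i, j). if f i = j then 1 else 0 :: rat)"
  have T: "T \<in> carrier_mat n n" and S: "S \<in> carrier_mat n n" unfolding T_def S_def by auto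
  have fn: "f i < n" if "i < n" for i using f that by (auto simp: bij_betw_def)
  have finj: "f i = f j \<longleftrightarrow> i = j" if "i < n" "j < n" for i j
    using f that by (auto simp: bij_betw_def inj_on_def)
  have fsurj: "\<exists>i<n. p = f i" if "p < n" for p
  proof -
    have "p \<in> f ` {..<n}" using f that by (simp add: bij_betw_def)
    then show ?thesis by auto
  qed
  have "S * T = 1\<^sub>m n"
  proof (rule eq_matI)
    fix i j assume "i < dim_row (1\<^sub>m n :: rat mat)" "j < dim_col (1\<^sub>m n :: rat mat)"
    then have ij: "i < n" "j < n" by auto
    have "(S * T) $$ (i, j) = (\<Sum>l<n. S $$ (i, l) * T $$ (l, j))" using index_mult_mat_sum[OF S T ij] .
    also have "\<dots> = (\<Sum>l<n. if l = f i then (if f i = f j then 1 else 0) else 0)"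
      using ij by (intro sum.cong) (auto simp: S_def T_def)
    also have "\<dots> = (if f i = f j then 1 else 0)" using fn[OF ij(1)] by simp
    finally show "(S * T) $$ (i, j) = 1\<^sub>m n $$ (i, j)" using finj[OF ij] ij by simp
  qed (use S T in auto)
  then have TS: "T * S = 1\<^sub>m n" by (rule mat_mult_left_right_inverse[OF S T])
  have "T * \<rho> g = \<sigma> g * T" if g: "g \<in> carrier W" for g
  proof (rule eq_matI)
    fix p j assume "p < dim_row (\<sigma> g * T)" "j < dim_col (\<sigma> g * T)"
    then have pj: "p < n" "j < n" using c(2)[OF g] T by auto
    obtain i where i: "i < n" "p = f i" using fsurj[OF pj(1)] by blast
    have "(T * \<rho> g) $$ (p, j) = (\<Sum>l<n. T $$ (p, l) * \<rho> g $$ (l, j))"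
      using index_mult_mat_sum[OF T c(1)[OF g] pj] .
    also have "\<dots> = (\<Sum>l<n. if l = i then \<rho> g $$ (i, j) else 0)"
      using i finj fn by (intro sum.cong) (auto simp: T_def)
    also have "\<dots> = \<sigma> g $$ (p, f j)" using i eq[OF g i(1) pj(2)] by simp
    finally have l: "(T * \<rho> g) $$ (p, j) = \<sigma> g $$ (p, f j)" .
    have "(\<sigma> g * T) $$ (p, j) = (\<Sum>l<n. \<sigma> g $$ (p, l) * T $$ (l, j))"
      using index_mult_mat_sum[OF c(2)[OF g] T pj] .
    also have "\<dots> = (\<Sum>l<n. if l = f j then \<sigma> g $$ (p, f j) else 0)"
      using pj by (intro sum.cong) (auto simp: T_def)
    also have "\<dots> = \<sigma> g $$ (p, f j)" using fn[OF pj(2)] by simp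
    finally show "(T * \<rho> g) $$ (p, j) = (\<sigma> g * T) $$ (p, j)" using l by simp
  qed (use c[OF g] T in auto)
  then show ?thesis by (rule rep_isoI[OF T S TS])
qed


subsection \<open>Direct sums\<close>

abbreviation (input) bdiag :: "nat \<Rightarrow> nat \<Rightarrow> rat mat \<Rightarrow> rat mat \<Rightarrow> rat mat" where
  "bdiag n m A B \<equiv> four_block_mat A (0\<^sub>m n m) (0\<^sub>m m n) B"

lemma bdiag_mult:
  assumes "A \<in> carrier_mat n n" "B \<in> carrier_mat m m" "C \<in> carrier_mat n n" "D \<in> carrier_mat m m"
  shows "bdiag n m A B * bdiag n m C D = bdiag n m (A * C) (B * D)"
  using assms by (subst mult_four_block_mat[of _ n n _ m _ m _ _ n _ m]) auto

lemma index_bdiag: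
  assumes "A \<in> carrier_mat n n" "B \<in> carrier_mat m m" "i < n + m" "j < n + m"
  shows "bdiag n m A B $$ (i, j) = (if i < n then if j < n then A $$ (i, j) else 0
    else if j < n then 0 else B $$ (i - n, j - n))"
  using assms by (auto simp: not_less)

lemma rep_sum_pair: "rep_sum (n, \<rho>) (m, \<sigma>) = (n + m, \<lambda>g. bdiag n m (\<rho> g) (\<sigma> g))"
  by (simp add: rep_sum_def)

lemma is_rep_sum:
  assumes "is_rep W V" "is_rep W U"
  shows "is_rep W (rep_sum V U)"
proof -
  obtain n \<rho> m \<sigma> where V: "V = (n, \<rho>)" and U: "U = (m, \<sigma>)" by (cases V; cases U)
  note \<rho> = is_repD[OF assms(1)[unfolded V]] and \<sigma> = is_repD[OF assms(2)[unfolded U]]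
  show ?thesis unfolding V U rep_sum_pair
    by (rule is_repI) (use \<rho> \<sigma> in \<open>auto simp: bdiag_mult\<close>)
qed

lemma rep_sum_cong:
  assumes "is_rep W V" "is_rep W V'" "is_rep W U" "is_rep W U'" "rep_iso W V V'" "rep_iso W U U'"
  shows "rep_iso W (rep_sum V U) (rep_sum V' U')"
proof -
  obtain n \<rho> m \<sigma> n' \<rho>' m' \<sigma>' where V: "V = (n, \<rho>)" "V' = (n', \<rho>')" and U: "U = (m, \<sigma>)" "U' = (m', \<sigma>')"
    by (cases V; cases U; cases V'; cases U')
  obtain T S where TS: "n' = n" "T \<in> carrier_mat n n" "S \<in> carrier_mat n n" "T * S = 1\<^sub>m n" "S * T = 1\<^sub>m n"
    "\<forall>g\<in>carrier W. T * \<rho> g = \<rho>' g * T"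
    by (rule rep_isoE[OF assms(5)[unfolded V]])
  obtain T' S' where TS': "m' = m" "T' \<in> carrier_mat m m" "S' \<in> carrier_mat m m" "T' * S' = 1\<^sub>m m" "S' * T' = 1\<^sub>m m"
    "\<forall>g\<in>carrier W. T' * \<sigma> g = \<sigma>' g * T'"
    by (rule rep_isoE[OF assms(6)[unfolded U]])
  show ?thesis unfolding V U TS(1) TS'(1) rep_sum_pair
  proof (rule rep_isoI[of "bdiag n m T T'" _ "bdiag n m S S'"])
    show "bdiag n m T T' * bdiag n m S S' = 1\<^sub>m (n + m)" using TS TS' by (simp add: bdiag_mult)
    fix g assume g: "g \<in> carrier W"
    note c = is_repD(1)[OF assms(1)[unfolded V] g] is_repD(1)[OF assms(2)[unfolded V TS(1)] g]
      is_repD(1)[OF assms(3)[unfolded U] g] is_repD(1)[OF assms(4)[unfolded U TS'(1)] g]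
    show "bdiag n m T T' * bdiag n m (\<rho> g) (\<sigma> g) = bdiag n m (\<rho>' g) (\<sigma>' g) * bdiag n m T T'"
      using TS(2) TS'(2) TS(6)[rule_format, OF g] TS'(6)[rule_format, OF g] c by (simp add: bdiag_mult)
  qed (use TS TS' in auto)
qed

lemma rep_sum_commute:
  assumes "is_rep W V" "is_rep W U"
  shows "rep_iso W (rep_sum V U) (rep_sum U V)"
proof -
  obtain n \<rho> m \<sigma> where V: "V = (n, \<rho>)" and U: "U = (m, \<sigma>)" by (cases V; cases U)
  note \<rho> = is_repD[OF assms(1)[unfolded V]] and \<sigma> = is_repD[OF assms(2)[unfolded U]]
  define f where "f i = (if i < n then m + i else i - n)" for i
  have "bij_betw f {..<n + m} {..<n + m}"
    by (rule bij_betw_byWitness[of _ "\<lambda>i. if i < m then n + i else i - m"]) (auto simp: f_def)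
  then have "rep_iso W (n + m, \<lambda>g. bdiag n m (\<rho> g) (\<sigma> g)) (n + m, \<lambda>g. bdiag m n (\<sigma> g) (\<rho> g))"
  proof (rule rep_iso_reindex)
    fix g i j assume g: "g \<in> carrier W" and ij: "i < n + m" "j < n + m"
    show "bdiag m n (\<sigma> g) (\<rho> g) $$ (f i, f j) = bdiag n m (\<rho> g) (\<sigma> g) $$ (i, j)"
      using \<rho>(1)[OF g] \<sigma>(1)[OF g] ij by (cases "i < n"; cases "j < n") (auto simp: f_def)
  next
    fix g assume g: "g \<in> carrier W"
    show "bdiag n m (\<rho> g) (\<sigma> g) \<in> carrier_mat (n + m) (n + m)" using \<rho>(1)[OF g] \<sigma>(1)[OF g] by auto
    show "bdiag m n (\<sigma> g) (\<rho> g) \<in> carrier_mat (n + m) (n + m)" using \<rho>(1)[OF g] \<sigma>(1)[OF g] by auto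
  qed
  then show ?thesis unfolding V U rep_sum_pair by (simp add: add.commute)
qed

lemma rep_sum_assoc:
  assumes "is_rep W V" "is_rep W U" "is_rep W X"
  shows "rep_iso W (rep_sum (rep_sum V U) X) (rep_sum V (rep_sum U X))"
proof -
  obtain n \<rho> m \<sigma> k \<tau> where V: "V = (n, \<rho>)" and U: "U = (m, \<sigma>)" and X: "X = (k, \<tau>)"
    by (cases V; cases U; cases X)
  note \<rho> = is_repD(1)[OF assms(1)[unfolded V]] and \<sigma> = is_repD(1)[OF assms(2)[unfolded U]]
    and \<tau> = is_repD(1)[OF assms(3)[unfolded X]]
  have "is_rep W (n + m + k, \<lambda>g. bdiag (n + m) k (bdiag n m (\<rho> g) (\<sigma> g)) (\<tau> g))"
    using is_rep_sum[OF is_rep_sum[OF assms(1,2)] assms(3)] unfolding V U X rep_sum_pair .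
  moreover have "bdiag n (m + k) (\<rho> g) (bdiag m k (\<sigma> g) (\<tau> g)) = bdiag (n + m) k (bdiag n m (\<rho> g) (\<sigma> g)) (\<tau> g)"
    if g: "g \<in> carrier W" for g
    using \<rho>[OF g] \<sigma>[OF g] \<tau>[OF g] by (intro eq_matI) (auto simp: not_less)
  ultimately show ?thesis unfolding V U X rep_sum_pair add.assoc[symmetric] by (rule rep_iso_eq)
qed

lemma is_rep_zero: "is_rep W rep_zero"
  unfolding rep_zero_def by (rule is_repI) auto

lemma is_rep_triv: "is_rep W rep_triv"
  unfolding rep_triv_def by (rule is_repI) auto

lemma rep_sum_dim0:
  assumes "is_rep W V" "is_rep W (0, \<sigma>)"
  shows "rep_iso W V (rep_sum V (0, \<sigma>))"
proof -
  obtain n \<rho> where V: "V = (n, \<rho>)" by (cases V)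
  note \<rho> = is_repD(1)[OF assms(1)[unfolded V]] and \<sigma> = is_repD(1)[OF assms(2)]
  have "bdiag n 0 (\<rho> g) (\<sigma> g) = \<rho> g" if g: "g \<in> carrier W" for g
    using \<rho>[OF g] \<sigma>[OF g] by (intro eq_matI) auto
  then have "rep_iso W (n, \<rho>) (n, \<lambda>g. bdiag n 0 (\<rho> g) (\<sigma> g))"
    using assms(1) V by (intro rep_iso_eq) auto
  then show ?thesis unfolding V rep_sum_pair by simp
qed


subsection \<open>Tensor products\<close>

text \<open>The position \<open>p = i * b + j\<close> of a pair of indices, used both for Kronecker
  products and for the blocks of induced matrices.\<close>

lemma sum_div_mod:
  fixes f :: "nat \<Rightarrow> nat \<Rightarrow> 'b::comm_monoid_add"
  shows "(\<Sum>p<a * b. f (p div b) (p mod b)) = (\<Sum>i<a. \<Sum>j<b. f i j)"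
  unfolding sum.cartesian_product
proof (rule sum.reindex_bij_witness[of _ "\<lambda>(i, j). i * b + j" "\<lambda>p. (p div b, p mod b)"])
  fix p assume "p \<in> {..<a * b}"
  then have p: "p < a * b" "0 < b" by (auto intro: Nat.gr0I)
  then show "(p div b, p mod b) \<in> {..<a} \<times> {..<b}" by (simp add: less_mult_imp_div_less)
next
  fix x assume "x \<in> {..<a} \<times> {..<b}"
  then obtain i j where x: "x = (i, j)" "i < a" "j < b" by auto
  have "i * b + j < Suc i * b" using x by simp
  also have "\<dots> \<le> a * b" using x by (intro mult_le_mono1) simp
  finally show "(case x of (i, j) \<Rightarrow> i * b + j) \<in> {..<a * b}" using x by simp
  show "((case x of (i, j) \<Rightarrow> i * b + j) div b, (case x of (i, j) \<Rightarrow> i * b + j) mod b) = x" using x by simp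
qed auto

lemma div_mod_less:
  fixes p a b :: nat
  assumes "p < a * b"
  shows "p div b < a" "p mod b < b"
proof -
  have "0 < b" using assms by (auto intro: Nat.gr0I)
  then show "p div b < a" "p mod b < b" using assms by (auto simp: less_mult_imp_div_less)
qed

lemma kronecker_carrier [simp]:
  "A \<in> carrier_mat a b \<Longrightarrow> B \<in> carrier_mat c d \<Longrightarrow> kronecker A B \<in> carrier_mat (a * c) (b * d)"
  by (auto simp: kronecker_def)

lemma index_kronecker:
  "A \<in> carrier_mat a b \<Longrightarrow> B \<in> carrier_mat c d \<Longrightarrow> p < a * c \<Longrightarrow> q < b * d \<Longrightarrow>
    kronecker A B $$ (p, q) = A $$ (p div c, q div d) * B $$ (p mod c, q mod d)"
  by (auto simp: kronecker_def)

lemma kronecker_mult: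
  assumes A: "A \<in> carrier_mat a b" and C: "C \<in> carrier_mat b c" and B: "B \<in> carrier_mat a' b'" and D: "D \<in> carrier_mat b' c'"
  shows "kronecker A B * kronecker C D = kronecker (A * C) (B * D)"
proof (rule eq_matI)
  have AC: "A * C \<in> carrier_mat a c" and BD: "B * D \<in> carrier_mat a' c'" using assms by auto
  fix p q assume "p < dim_row (kronecker (A * C) (B * D))" "q < dim_col (kronecker (A * C) (B * D))"
  then have pq: "p < a * a'" "q < c * c'" using kronecker_carrier[OF AC BD] by auto
  note p = div_mod_less[OF pq(1)] and q = div_mod_less[OF pq(2)]
  have "(kronecker A B * kronecker C D) $$ (p, q) =
      (\<Sum>l<b * b'. kronecker A B $$ (p, l) * kronecker C D $$ (l, q))"
    by (rule index_mult_mat_sum[OF kronecker_carrier[OF A B] kronecker_carrier[OF C D] pq])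
  also have "\<dots> = (\<Sum>l<b * b'. (A $$ (p div a', l div b') * B $$ (p mod a', l mod b')) *
      (C $$ (l div b', q div c') * D $$ (l mod b', q mod c')))"
    using index_kronecker[OF A B pq(1)] index_kronecker[OF C D _ pq(2)] by (intro sum.cong) auto
  also have "\<dots> = (\<Sum>i<b. \<Sum>j<b'. (A $$ (p div a', i) * B $$ (p mod a', j)) *
      (C $$ (i, q div c') * D $$ (j, q mod c')))"
    by (rule sum_div_mod[of "\<lambda>i j. (A $$ (p div a', i) * B $$ (p mod a', j)) * (C $$ (i, q div c') * D $$ (j, q mod c'))"])
  also have "\<dots> = (\<Sum>i<b. A $$ (p div a', i) * C $$ (i, q div c')) * (\<Sum>j<b'. B $$ (p mod a', j) * D $$ (j, q mod c'))"
    unfolding sum_product by (intro sum.cong refl) (simp add: mult_ac)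
  also have "\<dots> = (A * C) $$ (p div a', q div c') * (B * D) $$ (p mod a', q mod c')"
    unfolding index_mult_mat_sum[OF A C p(1) q(1)] index_mult_mat_sum[OF B D p(2) q(2)] ..
  also have "\<dots> = kronecker (A * C) (B * D) $$ (p, q)" using index_kronecker[OF AC BD pq] by simp
  finally show "(kronecker A B * kronecker C D) $$ (p, q) = kronecker (A * C) (B * D) $$ (p, q)" .
qed (use assms in \<open>auto simp: kronecker_def\<close>)

lemma kronecker_one [simp]: "kronecker (1\<^sub>m a) (1\<^sub>m b) = 1\<^sub>m (a * b)"
proof (rule eq_matI)
  fix p q assume "p < dim_row (1\<^sub>m (a * b) :: rat mat)" "q < dim_col (1\<^sub>m (a * b) :: rat mat)"
  then have pq: "p < a * b" "q < a * b" by auto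
  have "p div b = q div b \<and> p mod b = q mod b \<longleftrightarrow> p = q" by (metis div_mult_mod_eq)
  then show "kronecker (1\<^sub>m a) (1\<^sub>m b) $$ (p, q) = 1\<^sub>m (a * b) $$ (p, q)"
    using pq div_mod_less[OF pq(1)] div_mod_less[OF pq(2)]
    by (subst index_kronecker[of _ a a _ b b]) auto
qed (auto simp: kronecker_def)

lemma rep_tensor_pair: "rep_tensor (n, \<rho>) (m, \<sigma>) = (n * m, \<lambda>g. kronecker (\<rho> g) (\<sigma> g))"
  by (simp add: rep_tensor_def)

lemma is_rep_tensor:
  assumes "is_rep W V" "is_rep W U"
  shows "is_rep W (rep_tensor V U)"
proof -
  obtain n \<rho> m \<sigma> where V: "V = (n, \<rho>)" and U: "U = (m, \<sigma>)" by (cases V; cases U)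
  note \<rho> = is_repD[OF assms(1)[unfolded V]] and \<sigma> = is_repD[OF assms(2)[unfolded U]]
  show ?thesis unfolding V U rep_tensor_pair
    by (rule is_repI) (use \<rho> \<sigma> in \<open>auto simp: kronecker_mult[OF \<rho>(1) \<rho>(1) \<sigma>(1) \<sigma>(1)]\<close>)
qed

lemma rep_tensor_cong_left:
  assumes "is_rep W V" "is_rep W V'" "is_rep W U" "rep_iso W V V'"
  shows "rep_iso W (rep_tensor V U) (rep_tensor V' U)"
proof -
  obtain n \<rho> n' \<rho>' m \<sigma> where V: "V = (n, \<rho>)" "V' = (n', \<rho>')" and U: "U = (m, \<sigma>)"
    by (cases V; cases U; cases V')
  obtain T S where TS: "n' = n" "T \<in> carrier_mat n n" "S \<in> carrier_mat n n" "T * S = 1\<^sub>m n" "S * T = 1\<^sub>m n"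
    "\<forall>g\<in>carrier W. T * \<rho> g = \<rho>' g * T"
    by (rule rep_isoE[OF assms(4)[unfolded V]])
  show ?thesis unfolding V U TS(1) rep_tensor_pair
  proof (rule rep_isoI[of "kronecker T (1\<^sub>m m)" _ "kronecker S (1\<^sub>m m)"])
    show "kronecker T (1\<^sub>m m) * kronecker S (1\<^sub>m m) = 1\<^sub>m (n * m)"
      using kronecker_mult[OF TS(2,3) one_carrier_mat one_carrier_mat, of m] TS(4) by simp
    fix g assume g: "g \<in> carrier W"
    note c = is_repD(1)[OF assms(1)[unfolded V] g] is_repD(1)[OF assms(2)[unfolded V TS(1)] g]
      is_repD(1)[OF assms(3)[unfolded U] g]
    show "kronecker T (1\<^sub>m m) * kronecker (\<rho> g) (\<sigma> g) = kronecker (\<rho>' g) (\<sigma> g) * kronecker T (1\<^sub>m m)"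
      using kronecker_mult[OF TS(2) c(1) one_carrier_mat c(3)] kronecker_mult[OF c(2) TS(2) c(3) one_carrier_mat]
        TS(6)[rule_format, OF g] c(3) by simp
  qed (use TS in auto)
qed

text \<open>The index of the left factor is the leading one, so the blocks of a direct sum on the
  left stay contiguous: the two families of matrices are equal, without reordering the
  basis.\<close>

lemma rep_tensor_sum_left:
  assumes "is_rep W V" "is_rep W U" "is_rep W X"
  shows "rep_iso W (rep_tensor (rep_sum V U) X) (rep_sum (rep_tensor V X) (rep_tensor U X))"
proof -
  obtain n \<rho> m \<sigma> k \<tau> where V: "V = (n, \<rho>)" and U: "U = (m, \<sigma>)" and X: "X = (k, \<tau>)"
    by (cases V; cases U; cases X)
  note \<rho> = is_repD(1)[OF assms(1)[unfolded V]] and \<sigma> = is_repD(1)[OF assms(2)[unfolded U]]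
    and \<tau> = is_repD(1)[OF assms(3)[unfolded X]]
  have "is_rep W ((n + m) * k, \<lambda>g. kronecker (bdiag n m (\<rho> g) (\<sigma> g)) (\<tau> g))"
    using is_rep_tensor[OF is_rep_sum[OF assms(1,2)] assms(3)] unfolding V U X rep_sum_pair rep_tensor_pair .
  moreover have "bdiag (n * k) (m * k) (kronecker (\<rho> g) (\<tau> g)) (kronecker (\<sigma> g) (\<tau> g)) =
      kronecker (bdiag n m (\<rho> g) (\<sigma> g)) (\<tau> g)" if g: "g \<in> carrier W" for g
  proof (rule eq_matI)
    have c: "bdiag n m (\<rho> g) (\<sigma> g) \<in> carrier_mat (n + m) (n + m)" using \<rho>[OF g] \<sigma>[OF g] by auto
    note kc = kronecker_carrier[OF \<rho>[OF g] \<tau>[OF g]] kronecker_carrier[OF \<sigma>[OF g] \<tau>[OF g]]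
    fix p q assume "p < dim_row (kronecker (bdiag n m (\<rho> g) (\<sigma> g)) (\<tau> g))" "q < dim_col (kronecker (bdiag n m (\<rho> g) (\<sigma> g)) (\<tau> g))"
    then have pq: "p < (n + m) * k" "q < (n + m) * k" using kronecker_carrier[OF c \<tau>[OF g]] by auto
    have k: "0 < k" using pq by (auto intro: Nat.gr0I)
    note d = div_mod_less[OF pq(1)] div_mod_less[OF pq(2)]
    have lt: "r div k < n \<longleftrightarrow> r < n * k" for r using k by (simp add: div_less_iff_less_mult)
    have sub: "(r - n * k) div k = r div k - n" "(r - n * k) mod k = r mod k" if "n * k \<le> r" for r
    proof -
      define s where "s = r - n * k"
      have s: "r = n * k + s" using that unfolding s_def by simp
      have "(n * k + s) div k = n + s div k" using k by (intro div_mult_self3) simp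
      then show "(r - n * k) div k = r div k - n" unfolding s by (simp only: add_diff_cancel_left')
      show "(r - n * k) mod k = r mod k" unfolding s by (simp only: add_diff_cancel_left' mod_mult_self3)
    qed
    have r: "kronecker (bdiag n m (\<rho> g) (\<sigma> g)) (\<tau> g) $$ (p, q) =
        bdiag n m (\<rho> g) (\<sigma> g) $$ (p div k, q div k) * \<tau> g $$ (p mod k, q mod k)"
      by (rule index_kronecker[OF c \<tau>[OF g] pq])
    have pq': "p < n * k + m * k" "q < n * k + m * k" using pq by (simp_all only: add_mult_distrib)
    note l = index_bdiag[OF kc pq'] and m = index_bdiag[OF \<rho>[OF g] \<sigma>[OF g] d(1,3), unfolded lt]
    have k1: "kronecker (\<rho> g) (\<tau> g) $$ (p, q) = \<rho> g $$ (p div k, q div k) * \<tau> g $$ (p mod k, q mod k)"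
      if "p < n * k" "q < n * k" using index_kronecker[OF \<rho>[OF g] \<tau>[OF g] that] .
    have k2: "kronecker (\<sigma> g) (\<tau> g) $$ (p - n * k, q - n * k) =
        \<sigma> g $$ (p div k - n, q div k - n) * \<tau> g $$ (p mod k, q mod k)"
      if "\<not> p < n * k" "\<not> q < n * k"
    proof -
      have ge: "n * k \<le> p" "n * k \<le> q" using that by (simp_all only: not_less)
      have lt: "p - n * k < m * k" "q - n * k < m * k" using ge pq' by linarith+
      show ?thesis unfolding index_kronecker[OF \<sigma>[OF g] \<tau>[OF g] lt] sub[OF ge(1)] sub[OF ge(2)] ..
    qed
    show "bdiag (n * k) (m * k) (kronecker (\<rho> g) (\<tau> g)) (kronecker (\<sigma> g) (\<tau> g)) $$ (p, q) =
        kronecker (bdiag n m (\<rho> g) (\<sigma> g)) (\<tau> g) $$ (p, q)"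
    proof (cases "p < n * k \<and> q < n * k")
      case True
      then show ?thesis unfolding r l m k1[OF conjunct1[OF True] conjunct2[OF True]] by simp
    next
      case not1: False
      show ?thesis
      proof (cases "\<not> p < n * k \<and> \<not> q < n * k")
        case True
        then show ?thesis unfolding r l m k2[OF conjunct1[OF True] conjunct2[OF True]] by simp
      next
        case False
        then show ?thesis unfolding r l m using not1 by auto
      qed
    qed
  qed (use \<rho>[OF g] \<sigma>[OF g] \<tau>[OF g] in \<open>auto simp: kronecker_def add_mult_distrib\<close>)
  ultimately show ?thesis unfolding V U X rep_sum_pair rep_tensor_pair add_mult_distrib[symmetric]
    by (rule rep_iso_eq)
qed

lemma rep_tensor_triv:
  assumes "is_rep W U"
  shows "rep_iso W U (rep_tensor rep_triv U)"
proof -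
  obtain m \<sigma> where U: "U = (m, \<sigma>)" by (cases U)
  note \<sigma> = is_repD(1)[OF assms[unfolded U]]
  have "kronecker (1\<^sub>m 1) (\<sigma> g) = \<sigma> g" if g: "g \<in> carrier W" for g
    using \<sigma>[OF g] by (intro eq_matI) (auto simp: kronecker_def)
  then have "rep_iso W (m, \<sigma>) (m, \<lambda>g. kronecker (1\<^sub>m 1) (\<sigma> g))"
    using assms U by (intro rep_iso_eq) auto
  then show ?thesis unfolding U rep_triv_def rep_tensor_pair by simp
qed


subsection \<open>Induction\<close>

text \<open>Representatives are identified by their position in the list, which is the block index
  in \<open>rep_ind\<close>, and cosets by the kind of membership test in \<open>H\<close> that
  \<open>rep_ind\<close> performs.\<close>

definition transversal :: "('g, 'b) monoid_scheme \<Rightarrow> 'g set \<Rightarrow> 'g list \<Rightarrow> bool" where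
  "transversal W H ts \<longleftrightarrow> set ts \<subseteq> carrier W \<and>
    (\<forall>g\<in>carrier W. \<exists>!a. a < length ts \<and> inv\<^bsub>W\<^esub> (ts ! a) \<otimes>\<^bsub>W\<^esub> g \<in> H)"

lemma (in group) mem_l_coset_iff:
  assumes "subgroup H G" "t \<in> carrier G" "g \<in> carrier G"
  shows "g \<in> t <# H \<longleftrightarrow> inv t \<otimes> g \<in> H"
proof
  assume "g \<in> t <# H"
  then obtain h where "h \<in> H" "g = t \<otimes> h" unfolding l_coset_def by auto
  then show "inv t \<otimes> g \<in> H" using assms subgroup.mem_carrier[OF assms(1)] by (simp add: m_assoc[symmetric])
next
  assume "inv t \<otimes> g \<in> H"
  moreover have "g = t \<otimes> (inv t \<otimes> g)" using assms by (simp add: m_assoc[symmetric])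
  ultimately show "g \<in> t <# H" unfolding l_coset_def by blast
qed

text \<open>\<open>left_transversal\<close> is a choice, so a suitable list has to be exhibited
  first: one representative from each of the finitely many cosets.\<close>

lemma transversal_left_transversal:
  fixes G :: "'g monoid" (structure)
  assumes "group G" and H: "subgroup H G" and fin: "finite ((\<lambda>g. g <# H) ` carrier G)"
  shows "transversal G H (left_transversal G H)"
proof -
  interpret group G by fact
  define r where "r C = (SOME g. g \<in> carrier G \<and> g <# H = C)" for C
  have r: "r (g <# H) \<in> carrier G" "r (g <# H) <# H = g <# H" if "g \<in> carrier G" for g
    using someI[of "\<lambda>t. t \<in> carrier G \<and> t <# H = g <# H" g] that unfolding r_def by auto
  have self: "g \<in> g <# H" if "g \<in> carrier G" for g
    using that mem_l_coset_iff[OF H that that] subgroup.one_closed[OF H] by simp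
  have eq: "g <# H = t <# H" if "g \<in> t <# H" "t \<in> carrier G" for g t
    using l_repr_independence[OF that H] by simp
  have "\<exists>ts. set ts = r ` (\<lambda>g. g <# H) ` carrier G \<and> distinct ts"
    by (rule finite_distinct_list[OF finite_imageI[OF fin]])
  then obtain ts where ts: "set ts = r ` (\<lambda>g. g <# H) ` carrier G" "distinct ts" by (elim exE conjE)
  let ?P = "\<lambda>ts. distinct ts \<and> set ts \<subseteq> carrier G \<and> (\<forall>g\<in>carrier G. \<exists>!t. t \<in> set ts \<and> g \<in> t <# H)"
  have "\<exists>!t. t \<in> set ts \<and> g \<in> t <# H" if g: "g \<in> carrier G" for g
  proof (rule ex1I[of _ "r (g <# H)"])
    show "r (g <# H) \<in> set ts \<and> g \<in> r (g <# H) <# H" using g ts r self by auto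
    fix t assume t: "t \<in> set ts \<and> g \<in> t <# H"
    then obtain g' where g': "g' \<in> carrier G" "t = r (g' <# H)" using ts by auto
    have tc: "t \<in> carrier G" unfolding g'(2) by (rule r(1)[OF g'(1)])
    have "g <# H = t <# H" by (rule eq[OF conjunct2[OF t] tc])
    also have "\<dots> = g' <# H" unfolding g'(2) by (rule r(2)[OF g'(1)])
    finally show "t = r (g <# H)" unfolding g'(2) by simp
  qed
  then have "?P ts" using ts r by auto
  then have P: "?P (left_transversal G H)" unfolding left_transversal_def by (rule someI)
  show ?thesis unfolding transversal_def
  proof (intro conjI ballI)
    show "set (left_transversal G H) \<subseteq> carrier G" using P by blast
    fix g assume g: "g \<in> carrier G"
    let ?ts = "left_transversal G H"
    obtain t where t: "t \<in> set ?ts" "g \<in> t <# H" "\<And>t'. t' \<in> set ?ts \<Longrightarrow> g \<in> t' <# H \<Longrightarrow> t' = t"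
      using P g by metis
    have iff: "inv (?ts ! a) \<otimes> g \<in> H \<longleftrightarrow> ?ts ! a = t" if "a < length ?ts" for a
    proof -
      have "?ts ! a \<in> carrier G" using P nth_mem[OF that] by blast
      from mem_l_coset_iff[OF H this g] show ?thesis using t nth_mem[OF that] by metis
    qed
    obtain a where a: "a < length ?ts" "?ts ! a = t" using t(1) by (metis in_set_conv_nth)
    show "\<exists>!a. a < length ?ts \<and> inv (?ts ! a) \<otimes> g \<in> H"
    proof (rule ex1I[of _ a])
      show "a < length ?ts \<and> inv (?ts ! a) \<otimes> g \<in> H" using a iff by blast
      fix b assume "b < length ?ts \<and> inv (?ts ! b) \<otimes> g \<in> H"
      then have "b < length ?ts" "?ts ! b = ?ts ! a" using a iff by auto
      then show "b = a" using P a nth_eq_iff_index_eq by blast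
    qed
  qed
qed

text \<open>The finiteness is one of the index, not of the group: the conditions that define the
  polynomials range over all groups, and stabilizers of flats always have finite index.\<close>

locale induction_setup = group W for W :: "'g monoid" (structure) +
  fixes H :: "'g set"
  assumes H: "subgroup H W" and fin_index: "finite ((\<lambda>g. g <#\<^bsub>W\<^esub> H) ` carrier W)"
begin

abbreviation WH :: "'g monoid" where
  "WH \<equiv> W\<lparr>carrier := H\<rparr>"

definition ts :: "'g list" where
  "ts = left_transversal W H"

definition conj :: "nat \<Rightarrow> 'g \<Rightarrow> nat \<Rightarrow> 'g" where
  "conj a g b = inv (ts ! a) \<otimes> g \<otimes> ts ! b"

lemma ts: "transversal W H ts"
  unfolding ts_def by (rule transversal_left_transversal[OF is_group H fin_index])

lemma ts_carrier: "a < length ts \<Longrightarrow> ts ! a \<in> carrier W"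
  using ts nth_mem unfolding transversal_def by blast

lemma conj_closed: "a < length ts \<Longrightarrow> b < length ts \<Longrightarrow> g \<in> carrier W \<Longrightarrow> conj a g b \<in> carrier W"
  unfolding conj_def using ts_carrier by simp

text \<open>\<open>g \<otimes> ts ! b\<close> lies in exactly one left coset, so every block column
  of an induced matrix has exactly one block that can be non-zero.\<close>

lemma ex1_conj:
  assumes "b < length ts" "g \<in> carrier W"
  shows "\<exists>!a. a < length ts \<and> conj a g b \<in> H"
proof -
  have "g \<otimes> ts ! b \<in> carrier W" using ts_carrier assms by simp
  moreover have "inv (ts ! a) \<otimes> (g \<otimes> ts ! b) = conj a g b" if "a < length ts" for a
    unfolding conj_def using ts_carrier assms that by (simp add: m_assoc)
  ultimately show ?thesis using ts unfolding transversal_def by (metis (no_types, lifting))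
qed

lemma conj_one:
  assumes "a < length ts" "b < length ts"
  shows "conj a \<one> b \<in> H \<longleftrightarrow> a = b" "conj a \<one> a = \<one>"
proof -
  have one: "conj a \<one> a = \<one>" if "a < length ts" for a unfolding conj_def using ts_carrier[OF that] by simp
  then show "conj a \<one> a = \<one>" using assms by simp
  have "conj b \<one> b \<in> H" using one[OF assms(2)] subgroup.one_closed[OF H] by simp
  then show "conj a \<one> b \<in> H \<longleftrightarrow> a = b" using ex1_conj[OF assms(2) one_closed] assms by metis
qed

lemma conj_mult:
  assumes "a < length ts" "b < length ts" "c < length ts" "g \<in> carrier W" "h \<in> carrier W"
  shows "conj a (g \<otimes> h) b = conj a g c \<otimes> conj c h b"
proof -
  have "ts ! c \<otimes> (inv (ts ! c) \<otimes> x) = x" if "x \<in> carrier W" for x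
    using ts_carrier[OF assms(3)] that by (simp add: m_assoc[symmetric])
  then show ?thesis unfolding conj_def using assms ts_carrier by (simp add: m_assoc)
qed

definition ind_mat :: "nat \<Rightarrow> ('g \<Rightarrow> rat mat) \<Rightarrow> 'g \<Rightarrow> rat mat" where
  "ind_mat n \<rho> g = mat (length ts * n) (length ts * n) (\<lambda>(p, q).
     if conj (p div n) g (q div n) \<in> H then \<rho> (conj (p div n) g (q div n)) $$ (p mod n, q mod n) else 0)"

lemma rep_ind_pair: "rep_ind W H (n, \<rho>) = (length ts * n, ind_mat n \<rho>)"
  unfolding rep_ind_def ind_mat_def conj_def ts_def Let_def by (auto simp: fun_eq_iff intro!: cong_mat)

lemma ind_mat_carrier [simp]: "ind_mat n \<rho> g \<in> carrier_mat (length ts * n) (length ts * n)"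
  by (simp add: ind_mat_def)

lemma index_ind_mat:
  "p < length ts * n \<Longrightarrow> q < length ts * n \<Longrightarrow> ind_mat n \<rho> g $$ (p, q) =
    (if conj (p div n) g (q div n) \<in> H then \<rho> (conj (p div n) g (q div n)) $$ (p mod n, q mod n) else 0)"
  by (simp add: ind_mat_def)

lemma is_rep_ind:
  assumes "is_rep WH V"
  shows "is_rep W (rep_ind W H V)"
proof -
  obtain n \<rho> where V: "V = (n, \<rho>)" by (cases V)
  note \<rho> = is_repD[OF assms[unfolded V], simplified]
  let ?l = "length ts"
  show ?thesis unfolding V rep_ind_pair
  proof (rule is_repI)
    fix g h assume g: "g \<in> carrier W" and h: "h \<in> carrier W"
    show "ind_mat n \<rho> (g \<otimes> h) = ind_mat n \<rho> g * ind_mat n \<rho> h"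
    proof (rule eq_matI)
      fix p q assume "p < dim_row (ind_mat n \<rho> g * ind_mat n \<rho> h)" "q < dim_col (ind_mat n \<rho> g * ind_mat n \<rho> h)"
      then have pq: "p < ?l * n" "q < ?l * n" by (auto simp: ind_mat_def)
      define a i b j where ab: "a = p div n" "i = p mod n" "b = q div n" "j = q mod n"
      have lt: "a < ?l" "i < n" "b < ?l" "j < n" unfolding ab using div_mod_less[OF pq(1)] div_mod_less[OF pq(2)] by auto
      \<comment> \<open>In the product of the two matrices only one intermediate block survives, the
        one of the coset containing \<open>h \<otimes> ts ! b\<close>.\<close>
      obtain c where c: "c < ?l" "conj c h b \<in> H" and uniq: "\<And>c'. c' < ?l \<Longrightarrow> conj c' h b \<in> H \<Longrightarrow> c' = c"
        using ex1_conj[OF lt(3) h] by auto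
      have cm: "conj a (g \<otimes> h) b = conj a g c \<otimes> conj c h b" using conj_mult[OF lt(1,3) c(1) g h] .
      have acH: "conj a (g \<otimes> h) b \<in> H \<longleftrightarrow> conj a g c \<in> H"
      proof
        assume "conj a (g \<otimes> h) b \<in> H"
        then have "(conj a g c \<otimes> conj c h b) \<otimes> inv (conj c h b) \<in> H"
          unfolding cm using c(2) subgroup.m_closed[OF H] subgroup.m_inv_closed[OF H] by blast
        then show "conj a g c \<in> H" using conj_closed lt c g h by (simp add: m_assoc)
      qed (use c(2) cm subgroup.m_closed[OF H] in simp)
      have "(ind_mat n \<rho> g * ind_mat n \<rho> h) $$ (p, q) = (\<Sum>r<?l * n. ind_mat n \<rho> g $$ (p, r) * ind_mat n \<rho> h $$ (r, q))"
        by (rule index_mult_mat_sum[OF ind_mat_carrier ind_mat_carrier pq])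
      also have "\<dots> = (\<Sum>r<?l * n. (if conj a g (r div n) \<in> H then \<rho> (conj a g (r div n)) $$ (i, r mod n) else 0) *
          (if conj (r div n) h b \<in> H then \<rho> (conj (r div n) h b) $$ (r mod n, j) else 0))"
        using pq by (intro sum.cong refl) (simp add: index_ind_mat ab)
      also have "\<dots> = (\<Sum>c'<?l. \<Sum>k<n. (if conj a g c' \<in> H then \<rho> (conj a g c') $$ (i, k) else 0) *
          (if conj c' h b \<in> H then \<rho> (conj c' h b) $$ (k, j) else 0))"
        by (rule sum_div_mod[of "\<lambda>c' k. (if conj a g c' \<in> H then \<rho> (conj a g c') $$ (i, k) else 0) *
          (if conj c' h b \<in> H then \<rho> (conj c' h b) $$ (k, j) else 0)"])
      also have "\<dots> = (\<Sum>c'<?l. if c' = c then (\<Sum>k<n. (if conj a g c \<in> H then \<rho> (conj a g c) $$ (i, k) else 0) *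
          \<rho> (conj c h b) $$ (k, j)) else 0)"
      proof (rule sum.cong[OF refl])
        fix c' assume "c' \<in> {..<?l}"
        then have c': "c' < ?l" by simp
        show "(\<Sum>k<n. (if conj a g c' \<in> H then \<rho> (conj a g c') $$ (i, k) else 0) *
          (if conj c' h b \<in> H then \<rho> (conj c' h b) $$ (k, j) else 0)) =
          (if c' = c then (\<Sum>k<n. (if conj a g c \<in> H then \<rho> (conj a g c) $$ (i, k) else 0) *
          \<rho> (conj c h b) $$ (k, j)) else 0)"
        proof (cases "c' = c")
          case False
          then have "conj c' h b \<notin> H" using uniq c' by blast
          then show ?thesis using False by simp
        next
          case True
          show ?thesis unfolding True using c by simp
        qed
      qed
      also have "\<dots> = (\<Sum>k<n. (if conj a g c \<in> H then \<rho> (conj a g c) $$ (i, k) else 0) * \<rho> (conj c h b) $$ (k, j))"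
        using c(1) by simp
      also have "\<dots> = (if conj a g c \<in> H then (\<rho> (conj a g c) * \<rho> (conj c h b)) $$ (i, j) else 0)"
        using index_mult_mat_sum[OF \<rho>(1) \<rho>(1) lt(2,4)] c(2) by simp
      also have "\<dots> = (if conj a (g \<otimes> h) b \<in> H then \<rho> (conj a (g \<otimes> h) b) $$ (i, j) else 0)"
        unfolding acH unfolding cm using \<rho>(2) c(2) by simp
      also have "\<dots> = ind_mat n \<rho> (g \<otimes> h) $$ (p, q)" using pq by (simp add: index_ind_mat ab)
      finally show "ind_mat n \<rho> (g \<otimes> h) $$ (p, q) = (ind_mat n \<rho> g * ind_mat n \<rho> h) $$ (p, q)" by simp
    qed (simp_all add: ind_mat_def)
  next
    show "ind_mat n \<rho> \<one> = 1\<^sub>m (?l * n)"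
    proof (rule eq_matI)
      fix p q assume "p < dim_row (1\<^sub>m (?l * n) :: rat mat)" "q < dim_col (1\<^sub>m (?l * n) :: rat mat)"
      then have pq: "p < ?l * n" "q < ?l * n" by auto
      note d = div_mod_less[OF pq(1)] div_mod_less[OF pq(2)]
      have eq: "p div n = q div n \<and> p mod n = q mod n \<longleftrightarrow> p = q" by (metis div_mult_mod_eq)
      show "ind_mat n \<rho> \<one> $$ (p, q) = 1\<^sub>m (?l * n) $$ (p, q)"
      proof (cases "p div n = q div n")
        case True
        have o: "conj (p div n) \<one> (q div n) = \<one>" unfolding True by (rule conj_one(2)[OF d(3) d(3)])
        have "ind_mat n \<rho> \<one> $$ (p, q) = \<rho> \<one> $$ (p mod n, q mod n)"
          unfolding index_ind_mat[OF pq] o using subgroup.one_closed[OF H] by simp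
        then show ?thesis unfolding \<rho>(3) using d pq True eq by auto
      next
        case False
        then have "conj (p div n) \<one> (q div n) \<notin> H" using conj_one(1)[OF d(1,3)] by simp
        moreover have "p \<noteq> q" using False by blast
        ultimately show ?thesis using index_ind_mat[OF pq] pq by simp
      qed
    qed (simp_all add: ind_mat_def)
  qed simp
qed

text \<open>The intertwiner acts by \<open>T\<close> in each block, which is a Kronecker product
  with an identity matrix.\<close>

lemma rep_ind_cong:
  assumes "is_rep WH V" "is_rep WH U" "rep_iso WH V U"
  shows "rep_iso W (rep_ind W H V) (rep_ind W H U)"
proof -
  obtain n \<rho> m \<sigma> where V: "V = (n, \<rho>)" and U: "U = (m, \<sigma>)" by (cases V; cases U)
  obtain T S where TS: "m = n" "T \<in> carrier_mat n n" "S \<in> carrier_mat n n" "T * S = 1\<^sub>m n" "S * T = 1\<^sub>m n"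
    "\<forall>g\<in>carrier WH. T * \<rho> g = \<sigma> g * T"
    by (rule rep_isoE[OF assms(3)[unfolded V U]])
  note \<rho> = is_repD(1)[OF assms(1)[unfolded V], simplified] and \<sigma> = is_repD(1)[OF assms(2)[unfolded U TS(1)], simplified]
  let ?l = "length ts"
  show ?thesis unfolding V U TS(1) rep_ind_pair
  proof (rule rep_isoI[of "kronecker (1\<^sub>m ?l) T" _ "kronecker (1\<^sub>m ?l) S"])
    show "kronecker (1\<^sub>m ?l) T * kronecker (1\<^sub>m ?l) S = 1\<^sub>m (?l * n)"
      using kronecker_mult[OF one_carrier_mat one_carrier_mat TS(2,3), of ?l] TS(4) by simp
    fix g assume g: "g \<in> carrier W"
    have K: "kronecker (1\<^sub>m ?l) T \<in> carrier_mat (?l * n) (?l * n)" using TS(2) by simp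
    show "kronecker (1\<^sub>m ?l) T * ind_mat n \<rho> g = ind_mat n \<sigma> g * kronecker (1\<^sub>m ?l) T"
    proof (rule eq_matI)
      fix p q assume "p < dim_row (ind_mat n \<sigma> g * kronecker (1\<^sub>m ?l) T)" "q < dim_col (ind_mat n \<sigma> g * kronecker (1\<^sub>m ?l) T)"
      then have pq: "p < ?l * n" "q < ?l * n" using K by (auto simp: ind_mat_def)
      define a i b j where ab: "a = p div n" "i = p mod n" "b = q div n" "j = q mod n"
      have lt: "a < ?l" "i < n" "b < ?l" "j < n" unfolding ab using div_mod_less[OF pq(1)] div_mod_less[OF pq(2)] by auto
      let ?h = "conj a g b"
      have "(kronecker (1\<^sub>m ?l) T * ind_mat n \<rho> g) $$ (p, q) =
          (\<Sum>r<?l * n. kronecker (1\<^sub>m ?l) T $$ (p, r) * ind_mat n \<rho> g $$ (r, q))"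
        by (rule index_mult_mat_sum[OF K ind_mat_carrier pq])
      also have "\<dots> = (\<Sum>r<?l * n. ((if a = r div n then 1 else 0) * T $$ (i, r mod n)) *
          (if conj (r div n) g b \<in> H then \<rho> (conj (r div n) g b) $$ (r mod n, j) else 0))"
        using pq lt div_mod_less by (intro sum.cong refl)
          (simp add: index_ind_mat index_kronecker[OF one_carrier_mat TS(2)] ab)
      also have "\<dots> = (\<Sum>c<?l. \<Sum>k<n. ((if a = c then 1 else 0) * T $$ (i, k)) *
          (if conj c g b \<in> H then \<rho> (conj c g b) $$ (k, j) else 0))"
        by (rule sum_div_mod[of "\<lambda>c k. ((if a = c then 1 else 0) * T $$ (i, k)) *
          (if conj c g b \<in> H then \<rho> (conj c g b) $$ (k, j) else 0)"])
      also have "\<dots> = (\<Sum>c<?l. if c = a then (\<Sum>k<n. T $$ (i, k) * (if ?h \<in> H then \<rho> ?h $$ (k, j) else 0)) else 0)"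
        by (intro sum.cong refl) (simp cong: if_cong)
      also have "\<dots> = (if ?h \<in> H then (T * \<rho> ?h) $$ (i, j) else 0)"
        using lt index_mult_mat_sum[OF TS(2) \<rho> lt(2,4)] by simp
      finally have L: "(kronecker (1\<^sub>m ?l) T * ind_mat n \<rho> g) $$ (p, q) = (if ?h \<in> H then (T * \<rho> ?h) $$ (i, j) else 0)" .
      have "(ind_mat n \<sigma> g * kronecker (1\<^sub>m ?l) T) $$ (p, q) =
          (\<Sum>r<?l * n. ind_mat n \<sigma> g $$ (p, r) * kronecker (1\<^sub>m ?l) T $$ (r, q))"
        by (rule index_mult_mat_sum[OF ind_mat_carrier K pq])
      also have "\<dots> = (\<Sum>r<?l * n. (if conj a g (r div n) \<in> H then \<sigma> (conj a g (r div n)) $$ (i, r mod n) else 0) *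
          ((if r div n = b then 1 else 0) * T $$ (r mod n, j)))"
        using pq lt div_mod_less by (intro sum.cong refl)
          (simp add: index_ind_mat index_kronecker[OF one_carrier_mat TS(2)] ab)
      also have "\<dots> = (\<Sum>c<?l. \<Sum>k<n. (if conj a g c \<in> H then \<sigma> (conj a g c) $$ (i, k) else 0) *
          ((if c = b then 1 else 0) * T $$ (k, j)))"
        by (rule sum_div_mod[of "\<lambda>c k. (if conj a g c \<in> H then \<sigma> (conj a g c) $$ (i, k) else 0) *
          ((if c = b then 1 else 0) * T $$ (k, j))"])
      also have "\<dots> = (\<Sum>c<?l. if c = b then (\<Sum>k<n. (if ?h \<in> H then \<sigma> ?h $$ (i, k) else 0) * T $$ (k, j)) else 0)"
        by (intro sum.cong refl) (simp cong: if_cong)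
      also have "\<dots> = (if ?h \<in> H then (\<sigma> ?h * T) $$ (i, j) else 0)"
        using lt index_mult_mat_sum[OF \<sigma> TS(2) lt(2,4)] by simp
      finally show "(kronecker (1\<^sub>m ?l) T * ind_mat n \<rho> g) $$ (p, q) = (ind_mat n \<sigma> g * kronecker (1\<^sub>m ?l) T) $$ (p, q)"
        using L TS(6) by simp
    qed (use TS(2) in \<open>auto simp: kronecker_def ind_mat_def\<close>)
  qed (use TS in auto)
qed

lemma rep_ind_sum:
  assumes "is_rep WH V" "is_rep WH U"
  shows "rep_iso W (rep_ind W H (rep_sum V U)) (rep_sum (rep_ind W H V) (rep_ind W H U))"
proof -
  obtain n \<rho> m \<sigma> where V: "V = (n, \<rho>)" and U: "U = (m, \<sigma>)" by (cases V; cases U)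
  note \<rho> = is_repD(1)[OF assms(1)[unfolded V], simplified] and \<sigma> = is_repD(1)[OF assms(2)[unfolded U], simplified]
  let ?l = "length ts"
  \<comment> \<open>The induced sum lists, for every coset, \<open>n\<close> coordinates followed by
    \<open>m\<close>; the sum of the induced representations lists the \<open>n\<close> coordinates
    of all cosets first. \<open>f\<close> passes from the former order to the latter, and
    \<open>f'\<close> back.\<close>
  define f where "f p = (let a = p div (n + m); i = p mod (n + m) in
    if i < n then a * n + i else ?l * n + a * m + (i - n))" for p
  define f' where "f' r = (if r < ?l * n then (r div n) * (n + m) + r mod n
    else ((r - ?l * n) div m) * (n + m) + (n + (r - ?l * n) mod m))" for r
  have bound: "a * k + i < ?l * k" if "a < ?l" "i < k" for a i k
  proof -
    have "a * k + i < Suc a * k" using that by simp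
    also have "\<dots> \<le> ?l * k" using that by (intro mult_le_mono1) simp
    finally show ?thesis .
  qed
  have f: "bij_betw f {..<?l * (n + m)} {..<?l * (n + m)}"
  proof (rule bij_betw_byWitness[of _ f'])
    show "\<forall>p\<in>{..<?l * (n + m)}. f' (f p) = p"
    proof
      fix p assume "p \<in> {..<?l * (n + m)}"
      then have p: "p < ?l * (n + m)" by simp
      define a i where ai: "a = p div (n + m)" "i = p mod (n + m)"
      have lt: "a < ?l" "i < n + m" unfolding ai using div_mod_less[OF p] by auto
      have pe: "p = a * (n + m) + i" unfolding ai by (simp only: div_mult_mod_eq)
      show "f' (f p) = p"
      proof (cases "i < n")
        case True
        then have fp: "f p = a * n + i" unfolding f_def Let_def ai by simp
        have "f p < ?l * n" unfolding fp by (rule bound[OF lt(1) True])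
        then show ?thesis unfolding f'_def fp using True pe by simp
      next
        case False
        then have fp: "f p = ?l * n + (a * m + (i - n))" unfolding f_def Let_def ai by simp
        have im: "i - n < m" using lt False by simp
        then have "(a * m + (i - n)) div m = a" "(a * m + (i - n)) mod m = i - n" by simp_all
        then show ?thesis unfolding f'_def fp using False pe by simp
      qed
    qed
    show "\<forall>r\<in>{..<?l * (n + m)}. f (f' r) = r"
    proof
      fix r assume "r \<in> {..<?l * (n + m)}"
      then have r: "r < ?l * n + ?l * m" by (simp add: add_mult_distrib2)
      show "f (f' r) = r"
      proof (cases "r < ?l * n")
        case True
        note d = div_mod_less[OF True]
        have "((r div n) * (n + m) + r mod n) div (n + m) = r div n"
          "((r div n) * (n + m) + r mod n) mod (n + m) = r mod n" using d by simp_all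
        then show ?thesis unfolding f_def f'_def Let_def using True d by simp
      next
        case False
        define s where "s = r - ?l * n"
        have s: "s < ?l * m" "r = ?l * n + s" unfolding s_def using r False by auto
        note d = div_mod_less[OF s(1)]
        have "((s div m) * (n + m) + (n + s mod m)) div (n + m) = s div m"
          "((s div m) * (n + m) + (n + s mod m)) mod (n + m) = n + s mod m" using d by simp_all
        then show ?thesis unfolding f_def f'_def Let_def using False s(2) d by simp
      qed
    qed
    show "f ` {..<?l * (n + m)} \<subseteq> {..<?l * (n + m)}"
    proof
      fix r assume "r \<in> f ` {..<?l * (n + m)}"
      then obtain p where p: "p < ?l * (n + m)" "r = f p" by auto
      define a i where ai: "a = p div (n + m)" "i = p mod (n + m)"
      have lt: "a < ?l" "i < n + m" unfolding ai using div_mod_less[OF p(1)] by auto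
      show "r \<in> {..<?l * (n + m)}"
      proof (cases "i < n")
        case True
        then show ?thesis using bound[OF lt(1) True] p(2) unfolding f_def Let_def ai by (simp add: add_mult_distrib2)
      next
        case False
        then have "i - n < m" using lt by simp
        then show ?thesis using bound[OF lt(1), of "i - n" m] p(2) False
          unfolding f_def Let_def ai by (simp add: add_mult_distrib2)
      qed
    qed
    show "f' ` {..<?l * (n + m)} \<subseteq> {..<?l * (n + m)}"
    proof
      fix p assume "p \<in> f' ` {..<?l * (n + m)}"
      then obtain r where r: "r < ?l * (n + m)" "p = f' r" by auto
      show "p \<in> {..<?l * (n + m)}"
      proof (cases "r < ?l * n")
        case True
        note d = div_mod_less[OF True]
        show ?thesis using bound[OF d(1), of "r mod n" "n + m"] d r(2) True unfolding f'_def by simp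
      next
        case False
        then have s: "r - ?l * n < ?l * m" using r(1) by (simp add: add_mult_distrib2)
        note d = div_mod_less[OF s]
        show ?thesis using bound[OF d(1), of "n + (r - ?l * n) mod m" "n + m"] d r(2) False unfolding f'_def by simp
      qed
    qed
  qed
  have "rep_iso W (?l * (n + m), ind_mat (n + m) (\<lambda>g. bdiag n m (\<rho> g) (\<sigma> g)))
      (?l * (n + m), \<lambda>g. bdiag (?l * n) (?l * m) (ind_mat n \<rho> g) (ind_mat m \<sigma> g))"
  proof (rule rep_iso_reindex[OF f])
    fix g p q assume g: "g \<in> carrier W" and pq: "p < ?l * (n + m)" "q < ?l * (n + m)"
    define a i b j where ab: "a = p div (n + m)" "i = p mod (n + m)" "b = q div (n + m)" "j = q mod (n + m)"
    have lt: "a < ?l" "i < n + m" "b < ?l" "j < n + m"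
      unfolding ab using div_mod_less[OF pq(1)] div_mod_less[OF pq(2)] by auto
    let ?h = "conj a g b"
    have L: "ind_mat (n + m) (\<lambda>g. bdiag n m (\<rho> g) (\<sigma> g)) g $$ (p, q) =
        (if ?h \<in> H then bdiag n m (\<rho> ?h) (\<sigma> ?h) $$ (i, j) else 0)"
      using index_ind_mat[OF pq] unfolding ab .
    have fp: "f p = (if i < n then a * n + i else ?l * n + (a * m + (i - n)))"
      by (simp only: f_def Let_def ab add.assoc)
    have fq: "f q = (if j < n then b * n + j else ?l * n + (b * m + (j - n)))"
      by (simp only: f_def Let_def ab add.assoc)
    note dims = \<rho>[of ?h] \<sigma>[of ?h]
    have I: "ind_mat k \<tau> g $$ (a * k + i', b * k + j') = (if ?h \<in> H then \<tau> ?h $$ (i', j') else 0)"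
      if "i' < k" "j' < k" for k \<tau> i' j'
      using index_ind_mat[OF bound[OF lt(1) that(1)] bound[OF lt(3) that(2)], of \<tau> g] that by simp
    have fl: "f p < ?l * n + ?l * m" "f q < ?l * n + ?l * m"
      using f pq by (auto simp: bij_betw_def add_mult_distrib2)
    have nl: "\<not> ?l * n + x < ?l * n" for x by simp
    note B = index_bdiag[OF ind_mat_carrier ind_mat_carrier fl]
    have h: "bdiag n m (\<rho> ?h) (\<sigma> ?h) $$ (i, j) = (if i < n then if j < n then \<rho> ?h $$ (i, j) else 0
        else if j < n then 0 else \<sigma> ?h $$ (i - n, j - n))" if "?h \<in> H"
      by (rule index_bdiag[OF dims(1)[OF that] dims(2)[OF that] lt(2,4)])
    consider "i < n" "j < n" | "i < n" "\<not> j < n" | "\<not> i < n" "j < n" | "\<not> i < n" "\<not> j < n" by blast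
    then show "bdiag (?l * n) (?l * m) (ind_mat n \<rho> g) (ind_mat m \<sigma> g) $$ (f p, f q) =
        ind_mat (n + m) (\<lambda>g. bdiag n m (\<rho> g) (\<sigma> g)) g $$ (p, q)"
    proof cases
      case 1
      then have "f p = a * n + i" "f q = b * n + j" using fp fq by simp_all
      then show ?thesis unfolding B L using 1 bound[OF lt(1) 1(1)] bound[OF lt(3) 1(2)] I[OF 1, of \<rho>] h by simp
    next
      case 2
      then have j: "j - n < m" using lt by simp
      have "f p = a * n + i" "f q = ?l * n + (b * m + (j - n))" using 2 fp fq by simp_all
      then show ?thesis unfolding B L using 2 bound[OF lt(1) 2(1)] nl h by simp
    next
      case 3
      then have i: "i - n < m" using lt by simp
      have "f q = b * n + j" "f p = ?l * n + (a * m + (i - n))" using 3 fp fq by simp_all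
      then show ?thesis unfolding B L using 3 bound[OF lt(3) 3(2)] nl h by simp
    next
      case 4
      then have ij: "i - n < m" "j - n < m" using lt by auto
      define u v where "u = a * m + (i - n)" "v = b * m + (j - n)"
      have "f p = ?l * n + u" "f q = ?l * n + v" unfolding u_v_def using 4 by (simp_all only: fp fq if_False)
      moreover have "ind_mat m \<sigma> g $$ (u, v) = (if ?h \<in> H then \<sigma> ?h $$ (i - n, j - n) else 0)"
        unfolding u_v_def by (rule I[OF ij])
      ultimately show ?thesis unfolding B L using 4(1,2) h by simp
    qed
  next
    fix g
    show "bdiag (?l * n) (?l * m) (ind_mat n \<rho> g) (ind_mat m \<sigma> g) \<in> carrier_mat (?l * (n + m)) (?l * (n + m))"
      unfolding add_mult_distrib2 by (intro four_block_carrier_mat) auto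
  qed simp
  then show ?thesis unfolding V U rep_sum_pair rep_ind_pair by (simp add: add_mult_distrib2)
qed

end

text \<open>The transversal for the whole group is a single element \<open>t\<close>, which need not
  be the identity: the induced matrices belong to the conjugates
  \<open>inv t \<otimes> g \<otimes> t\<close>, and \<open>\<rho> (inv t)\<close> is the
  isomorphism.\<close>

lemma rep_ind_self:
  fixes G :: "'g monoid" (structure)
  assumes "group G" and "is_rep G V"
  shows "rep_iso G V (rep_ind G (carrier G) V)"
proof -
  interpret group G by fact
  have lc: "g <# carrier G = carrier G" if "g \<in> carrier G" for g
    using that coset_join3[OF that subgroup_self] by simp
  then have "(\<lambda>g. g <# carrier G) ` carrier G \<subseteq> {carrier G}" by blast
  then have fin: "finite ((\<lambda>g. g <# carrier G) ` carrier G)" using finite_subset by blast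
  interpret induction_setup G "carrier G" by (intro induction_setup.intro induction_setup_axioms.intro is_group subgroup_self fin)
  obtain n \<rho> where V: "V = (n, \<rho>)" by (cases V)
  note \<rho> = is_repD[OF assms(2)[unfolded V]]
  obtain b where b: "b < length ts" using ex1_implies_ex[of "\<lambda>a. a < length ts \<and> inv (ts ! a) \<otimes> \<one> \<in> carrier G"]
      ts one_closed unfolding transversal_def by auto
  have "c = b" if "c < length ts" for c
    using ex1_conj[OF b one_closed] conj_closed[OF that b one_closed] conj_closed[OF b b one_closed] that b
    by (metis (no_types))
  from this[of 0] this[of 1] have len: "length ts = 1" using b by (cases "length ts"; cases "length ts - 1") auto
  define t where "t = ts ! 0"
  have t: "t \<in> carrier G" using ts_carrier[of 0] len unfolding t_def by simp
  have eq: "ind_mat n \<rho> g = \<rho> (inv t \<otimes> g \<otimes> t)" if g: "g \<in> carrier G" for g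
  proof -
    have c: "inv t \<otimes> g \<otimes> t \<in> carrier G" using t g by simp
    note d = \<rho>(1)[OF c]
    show ?thesis
      by (rule eq_matI) (use d c len in \<open>auto simp: ind_mat_def conj_def t_def[symmetric]\<close>)
  qed
  have "rep_iso G (n, \<rho>) (n, ind_mat n \<rho>)"
  proof (rule rep_isoI[of "\<rho> (inv t)" _ "\<rho> t"])
    show "\<rho> (inv t) * \<rho> t = 1\<^sub>m n" using \<rho>(2)[of "inv t" t] \<rho>(3) t by simp
    fix g assume g: "g \<in> carrier G"
    have "\<rho> (inv t) * \<rho> g = \<rho> (inv t \<otimes> g)" using \<rho>(2) t g by simp
    also have "inv t \<otimes> g = (inv t \<otimes> g \<otimes> t) \<otimes> inv t" using t g by (simp add: m_assoc)
    also have "\<rho> \<dots> = \<rho> (inv t \<otimes> g \<otimes> t) * \<rho> (inv t)" using \<rho>(2) t g by simp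
    finally show "\<rho> (inv t) * \<rho> g = ind_mat n \<rho> g * \<rho> (inv t)" unfolding eq[OF g] .
  qed (use \<rho>(1) t in auto)
  then show ?thesis unfolding V rep_ind_pair len by simp
qed


section \<open>Characters\<close>

definition mtrace :: "rat mat \<Rightarrow> rat" where
  "mtrace A = (\<Sum>i<dim_row A. A $$ (i, i))"

definition rchar :: "'g rep \<Rightarrow> 'g \<Rightarrow> rat" where
  "rchar V g = mtrace (snd V g)"

lemma rchar_pair: "rchar (n, \<rho>) g = mtrace (\<rho> g)"
  by (simp add: rchar_def)

lemma mtrace_commute:
  assumes A: "A \<in> carrier_mat n m" and B: "B \<in> carrier_mat m n"
  shows "mtrace (A * B) = mtrace (B * A)"
proof -
  have "mtrace (A * B) = (\<Sum>i<n. \<Sum>k<m. A $$ (i, k) * B $$ (k, i))"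
    unfolding mtrace_def using A by (intro sum.cong) (auto simp: index_mult_mat_sum[OF A B] simp del: index_mult_mat(1))
  also have "\<dots> = (\<Sum>k<m. \<Sum>i<n. B $$ (k, i) * A $$ (i, k))"
    by (subst sum.swap) (simp add: mult.commute)
  also have "\<dots> = mtrace (B * A)"
    unfolding mtrace_def using B by (intro sum.cong) (auto simp: index_mult_mat_sum[OF B A] simp del: index_mult_mat(1))
  finally show ?thesis .
qed

lemma rchar_iso:
  assumes "is_rep W V" "is_rep W U" "rep_iso W V U" "g \<in> carrier W"
  shows "rchar V g = rchar U g"
proof -
  obtain n \<rho> m \<sigma> where V: "V = (n, \<rho>)" and U: "U = (m, \<sigma>)" by (cases V; cases U)
  obtain T S where TS: "m = n" "T \<in> carrier_mat n n" "S \<in> carrier_mat n n" "T * S = 1\<^sub>m n" "S * T = 1\<^sub>m n"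
    "\<forall>g\<in>carrier W. T * \<rho> g = \<sigma> g * T"
    by (rule rep_isoE[OF assms(3)[unfolded V U]])
  have c: "\<rho> g \<in> carrier_mat n n" "\<sigma> g \<in> carrier_mat n n"
    using is_repD(1)[OF assms(1)[unfolded V] assms(4)] is_repD(1)[OF assms(2)[unfolded U] assms(4)] TS(1) by auto
  have "\<sigma> g = \<sigma> g * (T * S)" using TS c by simp
  also have "\<dots> = (T * \<rho> g) * S" using TS(2,3) TS(6)[rule_format, OF assms(4)] c
    by (simp add: assoc_mult_mat[of _ n n _ n _ n])
  finally have "mtrace (\<sigma> g) = mtrace ((T * \<rho> g) * S)" by simp
  also have "\<dots> = mtrace (S * (T * \<rho> g))" using TS c by (intro mtrace_commute[of _ n n]) auto
  also have "S * (T * \<rho> g) = (S * T) * \<rho> g" using TS(2,3) c by (simp add: assoc_mult_mat[of _ n n _ n _ n])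
  also have "\<dots> = \<rho> g" using TS c by simp
  finally show ?thesis unfolding V U rchar_pair by simp
qed

lemma mtrace_bdiag:
  assumes "A \<in> carrier_mat n n" "B \<in> carrier_mat m m"
  shows "mtrace (bdiag n m A B) = mtrace A + mtrace B"
proof -
  have "mtrace (bdiag n m A B) = (\<Sum>i<n + m. if i < n then A $$ (i, i) else B $$ (i - n, i - n))"
    unfolding mtrace_def using assms by (intro sum.cong) auto
  also have "{..<n + m} = {..<n} \<union> {n..<n + m}" by auto
  also have "(\<Sum>i\<in>{..<n} \<union> {n..<n + m}. if i < n then A $$ (i, i) else B $$ (i - n, i - n)) =
      (\<Sum>i<n. A $$ (i, i)) + (\<Sum>i\<in>{n..<n + m}. B $$ (i - n, i - n))"
    by (subst sum.union_disjoint) auto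
  also have "(\<Sum>i\<in>{n..<n + m}. B $$ (i - n, i - n)) = (\<Sum>i<m. B $$ (i, i))"
    by (rule sum.reindex_bij_witness[of _ "\<lambda>i. i + n" "\<lambda>i. i - n"]) auto
  finally show ?thesis using assms by (simp add: mtrace_def)
qed

lemma mtrace_kronecker:
  assumes A: "A \<in> carrier_mat n n" and B: "B \<in> carrier_mat m m"
  shows "mtrace (kronecker A B) = mtrace A * mtrace B"
proof -
  have "mtrace (kronecker A B) = (\<Sum>p<n * m. A $$ (p div m, p div m) * B $$ (p mod m, p mod m))"
    unfolding mtrace_def using A B by (intro sum.cong) (auto simp: index_kronecker[OF A B] kronecker_def)
  also have "\<dots> = (\<Sum>i<n. \<Sum>j<m. A $$ (i, i) * B $$ (j, j))"
    by (rule sum_div_mod[of "\<lambda>i j. A $$ (i, i) * B $$ (j, j)"])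
  finally show ?thesis using A B by (simp add: mtrace_def sum_product)
qed

lemma rchar_sum:
  assumes "is_rep W V" "is_rep W U" "g \<in> carrier W"
  shows "rchar (rep_sum V U) g = rchar V g + rchar U g"
proof -
  obtain n \<rho> m \<sigma> where V: "V = (n, \<rho>)" and U: "U = (m, \<sigma>)" by (cases V; cases U)
  show ?thesis unfolding V U rep_sum_pair rchar_pair
    by (rule mtrace_bdiag[OF is_repD(1)[OF assms(1)[unfolded V] assms(3)] is_repD(1)[OF assms(2)[unfolded U] assms(3)]])
qed

lemma rchar_one:
  assumes "is_rep W (n, \<rho>)"
  shows "rchar (n, \<rho>) \<one>\<^bsub>W\<^esub> = of_nat n"
  using is_repD(3)[OF assms] by (simp add: rchar_pair mtrace_def)

lemma rep_ext_tensor_pair: "rep_ext_tensor (n, \<rho>) (m, \<sigma>) = (n * m, \<lambda>(g, h). kronecker (\<rho> g) (\<sigma> h))"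
  by (simp add: rep_ext_tensor_def)

lemma is_rep_ext_tensor:
  assumes "is_rep G V" "is_rep H U"
  shows "is_rep (G \<times>\<times> H) (rep_ext_tensor V U)"
proof -
  obtain n \<rho> m \<sigma> where V: "V = (n, \<rho>)" and U: "U = (m, \<sigma>)" by (cases V; cases U)
  note \<rho> = is_repD[OF assms(1)[unfolded V]] and \<sigma> = is_repD[OF assms(2)[unfolded U]]
  show ?thesis unfolding V U rep_ext_tensor_pair
    by (rule is_repI) (use \<rho> \<sigma> in \<open>auto simp: DirProd_def kronecker_mult[OF \<rho>(1) \<rho>(1) \<sigma>(1) \<sigma>(1)]\<close>)
qed

lemma rchar_ext_tensor:
  assumes "is_rep G V" "is_rep H U" "g \<in> carrier G" "h \<in> carrier H"
  shows "rchar (rep_ext_tensor V U) (g, h) = rchar V g * rchar U h"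
proof -
  obtain n \<rho> m \<sigma> where V: "V = (n, \<rho>)" and U: "U = (m, \<sigma>)" by (cases V; cases U)
  show ?thesis unfolding V U rep_ext_tensor_pair rchar_pair prod.case
    by (rule mtrace_kronecker[OF is_repD(1)[OF assms(1)[unfolded V] assms(3)] is_repD(1)[OF assms(2)[unfolded U] assms(4)]])
qed

text \<open>Frobenius' formula: the trace sees only the diagonal blocks, that is, the cosets fixed
  by \<open>g\<close>.\<close>

lemma (in induction_setup) rchar_ind:
  assumes "is_rep WH V"
  shows "rchar (rep_ind W H V) g = (\<Sum>a<length ts. if conj a g a \<in> H then rchar V (conj a g a) else 0)"
proof -
  obtain n \<rho> where V: "V = (n, \<rho>)" by (cases V)
  note \<rho> = is_repD(1)[OF assms[unfolded V], simplified]
  have "rchar (rep_ind W H V) g = (\<Sum>p<length ts * n. if conj (p div n) g (p div n) \<in> H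
      then \<rho> (conj (p div n) g (p div n)) $$ (p mod n, p mod n) else 0)"
    unfolding V rep_ind_pair rchar_pair mtrace_def by (intro sum.cong) (auto simp: index_ind_mat ind_mat_def)
  also have "\<dots> = (\<Sum>a<length ts. \<Sum>i<n. if conj a g a \<in> H then \<rho> (conj a g a) $$ (i, i) else 0)"
    by (rule sum_div_mod[of "\<lambda>a i. if conj a g a \<in> H then \<rho> (conj a g a) $$ (i, i) else 0"])
  also have "\<dots> = (\<Sum>a<length ts. if conj a g a \<in> H then rchar V (conj a g a) else 0)"
  proof (intro sum.cong refl)
    fix a
    show "(\<Sum>i<n. if conj a g a \<in> H then \<rho> (conj a g a) $$ (i, i) else 0) =
      (if conj a g a \<in> H then rchar V (conj a g a) else 0)"
      using \<rho>[of "conj a g a"] unfolding V rchar_pair mtrace_def by (cases "conj a g a \<in> H") auto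
  qed
  finally show ?thesis .
qed


subsection \<open>Rank normal form\<close>

text \<open>\<open>P'\<close> and \<open>Q'\<close> witness invertibility; for square matrices a
  one-sided inverse is two-sided.\<close>

definition mat_eqv :: "nat \<Rightarrow> nat \<Rightarrow> rat mat \<Rightarrow> rat mat \<Rightarrow> bool" where
  "mat_eqv m n T T' \<longleftrightarrow> (\<exists>P P' Q Q'. P \<in> carrier_mat m m \<and> P' \<in> carrier_mat m m \<and>
     Q \<in> carrier_mat n n \<and> Q' \<in> carrier_mat n n \<and> P * P' = 1\<^sub>m m \<and> Q * Q' = 1\<^sub>m n \<and> P * T * Q = T')"

lemma mat_eqvI:
  "P \<in> carrier_mat m m \<Longrightarrow> P' \<in> carrier_mat m m \<Longrightarrow> Q \<in> carrier_mat n n \<Longrightarrow> Q' \<in> carrier_mat n n \<Longrightarrow>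
    P * P' = 1\<^sub>m m \<Longrightarrow> Q * Q' = 1\<^sub>m n \<Longrightarrow> P * T * Q = T' \<Longrightarrow> mat_eqv m n T T'"
  unfolding mat_eqv_def by blast

lemma mat_eqv_refl: "T \<in> carrier_mat m n \<Longrightarrow> mat_eqv m n T T"
  by (rule mat_eqvI[of "1\<^sub>m m" _ "1\<^sub>m m" "1\<^sub>m n" _ "1\<^sub>m n"]) auto

lemma mat_eqv_trans:
  assumes T: "T \<in> carrier_mat m n" and "mat_eqv m n T T'" "mat_eqv m n T' T''"
  shows "mat_eqv m n T T''"
proof -
  obtain P P' Q Q' where 1: "P \<in> carrier_mat m m" "P' \<in> carrier_mat m m" "Q \<in> carrier_mat n n" "Q' \<in> carrier_mat n n"
    "P * P' = 1\<^sub>m m" "Q * Q' = 1\<^sub>m n" "P * T * Q = T'" using assms(2) unfolding mat_eqv_def by blast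
  obtain R R' S S' where 2: "R \<in> carrier_mat m m" "R' \<in> carrier_mat m m" "S \<in> carrier_mat n n" "S' \<in> carrier_mat n n"
    "R * R' = 1\<^sub>m m" "S * S' = 1\<^sub>m n" "R * T' * S = T''" using assms(3) unfolding mat_eqv_def by blast
  have inv: "(A * B) * (B' * A') = 1\<^sub>m k" if "A \<in> carrier_mat k k" "B \<in> carrier_mat k k" "A' \<in> carrier_mat k k"
    "B' \<in> carrier_mat k k" "A * A' = 1\<^sub>m k" "B * B' = 1\<^sub>m k" for A B A' B' :: "rat mat" and k
  proof -
    have "(A * B) * (B' * A') = A * ((B * B') * A')" using that(1-4) by (simp add: assoc_mult_mat[of _ k k _ k _ k])
    then show ?thesis using that by simp
  qed
  show ?thesis
  proof (rule mat_eqvI[of "R * P" _ "P' * R'" "Q * S" _ "S' * Q'"])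
    show "(R * P) * (P' * R') = 1\<^sub>m m" using 1 2 by (intro inv) auto
    show "(Q * S) * (S' * Q') = 1\<^sub>m n" using 1 2 by (intro inv) auto
    have "(R * P) * T * (Q * S) = R * (P * T) * (Q * S)" using 1(1) 2(1) T by (simp add: assoc_mult_mat[of _ m m _ m _ n])
    also have "\<dots> = (R * (P * T) * Q) * S" using 1 2 T by (intro assoc_mult_mat[symmetric, of _ m n _ n _ n]) auto
    also have "R * (P * T) * Q = R * (P * T * Q)" using 1 2 T by (intro assoc_mult_mat[of _ m m _ n _ n]) auto
    finally show "(R * P) * T * (Q * S) = T''" unfolding 1(7) 2(7) .
  qed (use 1 2 in auto)
qed

definition rank_mat :: "nat \<Rightarrow> nat \<Rightarrow> nat \<Rightarrow> rat mat" where
  "rank_mat m n r = mat m n (\<lambda>(i, j). if i = j \<and> i < r then 1 else 0)"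

lemma mat_eqv_swap:
  assumes T: "T \<in> carrier_mat m n" and ij: "i < m" "j < n"
  shows "\<exists>T'\<in>carrier_mat m n. mat_eqv m n T T' \<and> T' $$ (0, 0) = T $$ (i, j)"
proof (intro bexI conjI)
  let ?T' = "swapcols 0 j (swaprows 0 i T)"
  show T': "?T' \<in> carrier_mat m n" using T by (auto simp: mat_swapcols_def)
  have m: "0 < m" "0 < n" using ij by auto
  have "swaprows_mat m 0 i * T \<in> carrier_mat m n" by (rule mult_carrier_mat[OF swaprows_mat_carrier T])
  then have "?T' = swaprows_mat m 0 i * T * swaprows_mat n 0 j"
    unfolding swaprows_mat[OF T m(1) ij(1)] using m ij by (intro swapcols_mat)
  then show "mat_eqv m n T ?T'"
    using m ij by (intro mat_eqvI[of "swaprows_mat m 0 i" _ "swaprows_mat m 0 i" "swaprows_mat n 0 j" _ "swaprows_mat n 0 j"])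
      (auto intro: swaprows_mat_inv)
  show "?T' $$ (0, 0) = T $$ (i, j)" using T ij m by auto
qed

lemma mat_eqv_pivot:
  assumes T: "T \<in> carrier_mat (Suc m) (Suc n)" and c: "T $$ (0, 0) \<noteq> 0"
  shows "\<exists>D\<in>carrier_mat m n. mat_eqv (Suc m) (Suc n) T (four_block_mat (1\<^sub>m 1) (0\<^sub>m 1 n) (0\<^sub>m m 1) D)"
proof -
  define c where "c = T $$ (0, 0)"
  define A where "A = mat 1 1 (\<lambda>_. c)"
  define A' where "A' = mat 1 1 (\<lambda>_. 1 / c)"
  define b where "b = mat 1 n (\<lambda>(i, j). T $$ (0, Suc j))"
  define b' where "b' = mat 1 n (\<lambda>(i, j). T $$ (0, Suc j) / c)"
  define d where "d = mat m 1 (\<lambda>(i, j). T $$ (Suc i, 0))"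
  define d' where "d' = mat m 1 (\<lambda>(i, j). - T $$ (Suc i, 0) / c)"
  define D where "D = mat m n (\<lambda>(i, j). T $$ (Suc i, Suc j))"
  note defs = A_def A'_def b_def b'_def d_def d'_def D_def
  have c0: "c \<noteq> 0" using assms by (simp add: c_def)
  have TB: "T = four_block_mat A b d D"
    using T by (intro eq_matI) (auto simp: defs c_def less_Suc_eq_0_disj)
  have cr: "A \<in> carrier_mat 1 1" "A' \<in> carrier_mat 1 1" "b \<in> carrier_mat 1 n" "b' \<in> carrier_mat 1 n" "-b' \<in> carrier_mat 1 n"
    "d \<in> carrier_mat m 1" "d' \<in> carrier_mat m 1" "D \<in> carrier_mat m n" by (auto simp: defs)
  have e: "A * A' = 1\<^sub>m 1" "A' * A = 1\<^sub>m 1" "A' * b = b'" "d' * A + d = 0\<^sub>m m 1" "d * A' + d' = 0\<^sub>m m 1"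
    "b' + - b' = 0\<^sub>m 1 n" "- b' + b' = 0\<^sub>m 1 n"
    using c0 by (auto intro!: eq_matI simp: defs scalar_prod_def)
  \<comment> \<open>Elimination with pivot \<open>c\<close>: \<open>?L\<close> scales the first row
    and clears the first column below it, \<open>?R\<close> clears the rest of the first row. The
    remaining block is the Schur complement \<open>d' * b + D\<close>.\<close>
  let ?L = "four_block_mat A' (0\<^sub>m 1 m) d' (1\<^sub>m m)" and ?L' = "four_block_mat A (0\<^sub>m 1 m) d (1\<^sub>m m)"
  let ?R = "four_block_mat (1\<^sub>m 1) (- b') (0\<^sub>m n 1) (1\<^sub>m n)" and ?R' = "four_block_mat (1\<^sub>m 1) b' (0\<^sub>m n 1) (1\<^sub>m n)"
  have LL: "?L * ?L' = 1\<^sub>m (1 + m)"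
    using cr e by (subst mult_four_block_mat[of _ 1 1 _ m _ m _ _ 1 _ m]) auto
  have RR: "?R * ?R' = 1\<^sub>m (1 + n)"
  proof -
    have "1\<^sub>m 1 * b' + - b' * 1\<^sub>m n = 0\<^sub>m 1 n" using cr e by simp
    then show ?thesis using cr by (subst mult_four_block_mat[of _ 1 1 _ n _ n _ _ 1 _ n]) auto
  qed
  have LT: "?L * T = four_block_mat (1\<^sub>m 1) b' (0\<^sub>m m 1) (d' * b + D)"
    unfolding TB using cr e by (subst mult_four_block_mat[of _ 1 1 _ m _ m _ _ 1 _ n]) auto
  have "?L * T * ?R = four_block_mat (1\<^sub>m 1) (0\<^sub>m 1 n) (0\<^sub>m m 1) (d' * b + D)"
  proof -
    have dD: "d' * b + D \<in> carrier_mat m n" using cr by auto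
    have "1\<^sub>m 1 * - b' + b' * 1\<^sub>m n = 0\<^sub>m 1 n" using cr e by simp
    moreover have "0\<^sub>m m 1 * - b' + (d' * b + D) * 1\<^sub>m n = d' * b + D"
      unfolding left_mult_zero_mat[OF cr(5)] right_mult_one_mat[OF dD] left_add_zero_mat[OF dD] ..
    moreover have "0\<^sub>m m 1 * 1\<^sub>m 1 + (d' * b + D) * 0\<^sub>m n 1 = 0\<^sub>m m 1" using right_mult_zero_mat[OF dD, of 1] by simp
    moreover have "1\<^sub>m 1 * 1\<^sub>m 1 + b' * 0\<^sub>m n 1 = 1\<^sub>m 1" using cr by simp
    ultimately show ?thesis unfolding LT using cr dD by (subst mult_four_block_mat[of _ 1 1 _ n _ m _ _ 1 _ n]) auto
  qed
  then have "mat_eqv (Suc m) (Suc n) T (four_block_mat (1\<^sub>m 1) (0\<^sub>m 1 n) (0\<^sub>m m 1) (d' * b + D))"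
    using LL RR cr four_block_carrier_mat[of A' 1 1 "1\<^sub>m m" m m] four_block_carrier_mat[of A 1 1 "1\<^sub>m m" m m]
      four_block_carrier_mat[of "1\<^sub>m 1" 1 1 "1\<^sub>m n" n n]
    by (intro mat_eqvI[of ?L _ ?L' ?R _ ?R']) auto
  moreover have "d' * b + D \<in> carrier_mat m n" using cr by auto
  ultimately show ?thesis by blast
qed

lemma mat_eqv_bdiag:
  assumes D: "D \<in> carrier_mat m n" and "mat_eqv m n D D'"
  shows "mat_eqv (Suc m) (Suc n) (four_block_mat (1\<^sub>m 1) (0\<^sub>m 1 n) (0\<^sub>m m 1) D) (four_block_mat (1\<^sub>m 1) (0\<^sub>m 1 n) (0\<^sub>m m 1) D')"
proof -
  obtain P P' Q Q' where 1: "P \<in> carrier_mat m m" "P' \<in> carrier_mat m m" "Q \<in> carrier_mat n n" "Q' \<in> carrier_mat n n"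
    "P * P' = 1\<^sub>m m" "Q * Q' = 1\<^sub>m n" "P * D * Q = D'" using assms(2) unfolding mat_eqv_def by blast
  have PD: "P * D \<in> carrier_mat m n" using 1 D by simp
  have a: "bdiag 1 m (1\<^sub>m 1) P * four_block_mat (1\<^sub>m 1) (0\<^sub>m 1 n) (0\<^sub>m m 1) D = four_block_mat (1\<^sub>m 1) (0\<^sub>m 1 n) (0\<^sub>m m 1) (P * D)"
    using 1 D by (subst mult_four_block_mat[of _ 1 1 _ m _ m _ _ 1 _ n]) auto
  have b: "four_block_mat (1\<^sub>m 1) (0\<^sub>m 1 n) (0\<^sub>m m 1) (P * D) * bdiag 1 n (1\<^sub>m 1) Q = four_block_mat (1\<^sub>m 1) (0\<^sub>m 1 n) (0\<^sub>m m 1) (P * D * Q)"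
    using 1 PD D by (subst mult_four_block_mat[of _ 1 1 _ n _ m _ _ 1 _ n]) auto
  have "bdiag 1 k (1\<^sub>m 1) X \<in> carrier_mat (Suc k) (Suc k)" if "X \<in> carrier_mat k k" for X k
    using that four_block_carrier_mat[of "1\<^sub>m 1" 1 1 X k k] by simp
  moreover have "bdiag 1 m (1\<^sub>m 1) P * bdiag 1 m (1\<^sub>m 1) P' = 1\<^sub>m (Suc m)"
    using 1 bdiag_mult[of "1\<^sub>m 1" 1 P m "1\<^sub>m 1" P'] four_block_one_mat[of 1 m] by simp
  moreover have "bdiag 1 n (1\<^sub>m 1) Q * bdiag 1 n (1\<^sub>m 1) Q' = 1\<^sub>m (Suc n)"
    using 1 bdiag_mult[of "1\<^sub>m 1" 1 Q n "1\<^sub>m 1" Q'] four_block_one_mat[of 1 n] by simp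
  ultimately show ?thesis using 1(1-4) a b unfolding 1(7)[symmetric]
    by (intro mat_eqvI[of "bdiag 1 m (1\<^sub>m 1) P" _ "bdiag 1 m (1\<^sub>m 1) P'" "bdiag 1 n (1\<^sub>m 1) Q" _ "bdiag 1 n (1\<^sub>m 1) Q'"]) auto
qed

lemma rank_normal_form:
  "T \<in> carrier_mat m n \<Longrightarrow> \<exists>r\<le>m. r \<le> n \<and> mat_eqv m n T (rank_mat m n r)"
proof (induction m arbitrary: n T)
  case 0
  then have "T = rank_mat 0 n 0" by (intro eq_matI) (auto simp: rank_mat_def)
  then show ?case using mat_eqv_refl[OF 0] by auto
next
  case (Suc m)
  show ?case
  proof (cases "\<exists>i<Suc m. \<exists>j<n. T $$ (i, j) \<noteq> 0")
    case False
    then have "T = rank_mat (Suc m) n 0" using Suc.prems by (intro eq_matI) (auto simp: rank_mat_def)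
    then show ?thesis using mat_eqv_refl[OF Suc.prems] by auto
  next
    case True
    then obtain i j where ij: "i < Suc m" "j < n" "T $$ (i, j) \<noteq> 0" by blast
    then obtain n' where n: "n = Suc n'" by (cases n) auto
    obtain T' where T': "T' \<in> carrier_mat (Suc m) n" "mat_eqv (Suc m) n T T'" "T' $$ (0, 0) \<noteq> 0"
      using mat_eqv_swap[OF Suc.prems ij(1,2)] ij(3) by auto
    obtain D where D: "D \<in> carrier_mat m n'"
      "mat_eqv (Suc m) n T' (four_block_mat (1\<^sub>m 1) (0\<^sub>m 1 n') (0\<^sub>m m 1) D)"
      using mat_eqv_pivot[of T' m n'] T' unfolding n by auto
    obtain r where r: "r \<le> m" "r \<le> n'" "mat_eqv m n' D (rank_mat m n' r)" using Suc.IH[OF D(1)] by auto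
    have "four_block_mat (1\<^sub>m 1) (0\<^sub>m 1 n') (0\<^sub>m m 1) (rank_mat m n' r) = rank_mat (Suc m) n (Suc r)"
      unfolding n by (intro eq_matI) (auto simp: rank_mat_def less_Suc_eq_0_disj split: if_splits)
    then have "mat_eqv (Suc m) n (four_block_mat (1\<^sub>m 1) (0\<^sub>m 1 n') (0\<^sub>m m 1) D) (rank_mat (Suc m) n (Suc r))"
      using mat_eqv_bdiag[OF D(1) r(3)] unfolding n by simp
    then have "mat_eqv (Suc m) n T (rank_mat (Suc m) n (Suc r))"
      using mat_eqv_trans[OF Suc.prems T'(2)] mat_eqv_trans[OF T'(1) D(2)] by blast
    then show ?thesis using r n by auto
  qed
qed


subsection \<open>Characters determine representations of finite groups\<close>

locale finite_group = group W for W :: "'g monoid" (structure) +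
  assumes fin: "finite (carrier W)"
begin

definition msum :: "nat \<Rightarrow> nat \<Rightarrow> ('g \<Rightarrow> rat mat) \<Rightarrow> rat mat" where
  "msum n m f = mat n m (\<lambda>(i, j). \<Sum>g\<in>carrier W. f g $$ (i, j))"

lemma msum_carrier [simp]: "msum n m f \<in> carrier_mat n m"
  by (simp add: msum_def)

lemma index_msum: "i < n \<Longrightarrow> j < m \<Longrightarrow> msum n m f $$ (i, j) = (\<Sum>g\<in>carrier W. f g $$ (i, j))"
  by (simp add: msum_def)

lemma msum_cong: "(\<And>g. g \<in> carrier W \<Longrightarrow> f g = f' g) \<Longrightarrow> msum n m f = msum n m f'"
  unfolding msum_def by (intro cong_mat refl) (auto intro!: sum.cong)

lemma mult_msum:
  assumes A: "A \<in> carrier_mat k n" and f: "\<And>g. g \<in> carrier W \<Longrightarrow> f g \<in> carrier_mat n m"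
  shows "A * msum n m f = msum k m (\<lambda>g. A * f g)"
proof (rule eq_matI)
  fix i j assume "i < dim_row (msum k m (\<lambda>g. A * f g))" "j < dim_col (msum k m (\<lambda>g. A * f g))"
  then have ij: "i < k" "j < m" by (auto simp: msum_def)
  have "(A * msum n m f) $$ (i, j) = (\<Sum>l<n. A $$ (i, l) * (\<Sum>g\<in>carrier W. f g $$ (l, j)))"
    unfolding index_mult_mat_sum[OF A msum_carrier ij] using ij by (intro sum.cong) (auto simp: index_msum)
  also have "\<dots> = (\<Sum>g\<in>carrier W. \<Sum>l<n. A $$ (i, l) * f g $$ (l, j))"
    unfolding sum_distrib_left by (rule sum.swap)
  also have "\<dots> = (\<Sum>g\<in>carrier W. (A * f g) $$ (i, j))"
    using index_mult_mat_sum[OF A f ij] by (intro sum.cong) auto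
  finally show "(A * msum n m f) $$ (i, j) = msum k m (\<lambda>g. A * f g) $$ (i, j)" using ij by (simp add: index_msum)
qed (use A in \<open>auto simp: msum_def\<close>)

lemma msum_mult:
  assumes A: "A \<in> carrier_mat m k" and f: "\<And>g. g \<in> carrier W \<Longrightarrow> f g \<in> carrier_mat n m"
  shows "msum n m f * A = msum n k (\<lambda>g. f g * A)"
proof (rule eq_matI)
  fix i j assume "i < dim_row (msum n k (\<lambda>g. f g * A))" "j < dim_col (msum n k (\<lambda>g. f g * A))"
  then have ij: "i < n" "j < k" by (auto simp: msum_def)
  have "(msum n m f * A) $$ (i, j) = (\<Sum>l<m. (\<Sum>g\<in>carrier W. f g $$ (i, l)) * A $$ (l, j))"
    unfolding index_mult_mat_sum[OF msum_carrier A ij] using ij by (intro sum.cong) (auto simp: index_msum)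
  also have "\<dots> = (\<Sum>g\<in>carrier W. \<Sum>l<m. f g $$ (i, l) * A $$ (l, j))"
    unfolding sum_distrib_right by (rule sum.swap)
  also have "\<dots> = (\<Sum>g\<in>carrier W. (f g * A) $$ (i, j))"
    using index_mult_mat_sum[OF f A ij] by (intro sum.cong) auto
  finally show "(msum n m f * A) $$ (i, j) = msum n k (\<lambda>g. f g * A) $$ (i, j)" using ij by (simp add: index_msum)
qed (use A in \<open>auto simp: msum_def\<close>)

lemma msum_translate:
  assumes "h \<in> carrier W"
  shows "msum n m (\<lambda>g. f (h \<otimes> g)) = msum n m f" "msum n m (\<lambda>g. f (g \<otimes> h)) = msum n m f"
proof -
  have "(\<Sum>g\<in>carrier W. f (h \<otimes> g) $$ p) = (\<Sum>g\<in>carrier W. f g $$ p)" for p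
    by (rule sum.reindex_bij_witness[of _ "\<lambda>g. inv h \<otimes> g" "\<lambda>g. h \<otimes> g"]) (use assms in \<open>auto simp: m_assoc[symmetric]\<close>)
  moreover have "(\<Sum>g\<in>carrier W. f (g \<otimes> h) $$ p) = (\<Sum>g\<in>carrier W. f g $$ p)" for p
    by (rule sum.reindex_bij_witness[of _ "\<lambda>g. g \<otimes> inv h" "\<lambda>g. g \<otimes> h"]) (use assms in \<open>auto simp: m_assoc\<close>)
  ultimately show "msum n m (\<lambda>g. f (h \<otimes> g)) = msum n m f" "msum n m (\<lambda>g. f (g \<otimes> h)) = msum n m f"
    unfolding msum_def by simp_all
qed

text \<open>The matrix \<open>B = \<Sum>\<^sub>g \<rho>(g)\<^sup>T \<rho>(g)\<close> of an invariant inner product identifies the first representation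
  with its dual, so that the averages \<open>\<Sum>\<^sub>g \<sigma>(g) E \<rho>(g)\<^sup>T\<close> become intertwiners after multiplication by \<open>B\<close>.
  If they all vanished, so would \<open>\<Sum>\<^sub>g \<chi>(g)\<^sup>2\<close>, which is positive as the characters are rational.\<close>

lemma exists_intertwiner:
  assumes V: "is_rep W (n, \<rho>)" and U: "is_rep W (m, \<sigma>)"
    and eq: "\<And>g. g \<in> carrier W \<Longrightarrow> rchar (n, \<rho>) g = rchar (m, \<sigma>) g" and n: "n > 0"
  shows "\<exists>T\<in>carrier_mat m n. T \<noteq> 0\<^sub>m m n \<and> (\<forall>g\<in>carrier W. T * \<rho> g = \<sigma> g * T)"
proof (rule ccontr)
  assume none: "\<not> ?thesis"
  note \<rho> = is_repD[OF V] and \<sigma> = is_repD[OF U]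
  have \<rho>T: "(\<rho> g)\<^sup>T \<in> carrier_mat n n" if "g \<in> carrier W" for g using \<rho>(1)[OF that] by simp
  have TT: "(\<rho> g)\<^sup>T * \<rho> g \<in> carrier_mat n n" if "g \<in> carrier W" for g
    by (rule mult_carrier_mat[OF \<rho>T[OF that] \<rho>(1)[OF that]])
  define B where "B = msum n n (\<lambda>g. (\<rho> g)\<^sup>T * \<rho> g)"
  have B: "B \<in> carrier_mat n n" unfolding B_def by simp
  have Binv: "(\<rho> h)\<^sup>T * B * \<rho> h = B" if h: "h \<in> carrier W" for h
  proof -
    have "(\<rho> h)\<^sup>T * B = msum n n (\<lambda>g. (\<rho> h)\<^sup>T * ((\<rho> g)\<^sup>T * \<rho> g))"
      unfolding B_def by (rule mult_msum[OF \<rho>T[OF h] TT])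
    also have "\<dots> * \<rho> h = msum n n (\<lambda>g. (\<rho> h)\<^sup>T * ((\<rho> g)\<^sup>T * \<rho> g) * \<rho> h)"
      by (rule msum_mult[OF \<rho>(1)[OF h] mult_carrier_mat[OF \<rho>T[OF h] TT]])
    also have "\<dots> = msum n n (\<lambda>g. (\<rho> (g \<otimes> h))\<^sup>T * \<rho> (g \<otimes> h))"
    proof (rule msum_cong)
      fix g assume g: "g \<in> carrier W"
      show "(\<rho> h)\<^sup>T * ((\<rho> g)\<^sup>T * \<rho> g) * \<rho> h = (\<rho> (g \<otimes> h))\<^sup>T * \<rho> (g \<otimes> h)"
        unfolding \<rho>(2)[OF g h] transpose_mult[OF \<rho>(1)[OF g] \<rho>(1)[OF h]]
        using \<rho>T[OF g] \<rho>T[OF h] \<rho>(1)[OF g] \<rho>(1)[OF h] by (simp add: assoc_mult_mat[of _ n n _ n _ n])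
    qed
    also have "\<dots> = B" unfolding B_def by (rule msum_translate(2)[OF h, of n n "\<lambda>g. (\<rho> g)\<^sup>T * \<rho> g"])
    finally show ?thesis .
  qed
  define S where "S E = msum m n (\<lambda>g. \<sigma> g * E * (\<rho> g)\<^sup>T)" for E
  have S: "S E \<in> carrier_mat m n" for E unfolding S_def by simp
  have Sinv: "\<sigma> h * S E * (\<rho> h)\<^sup>T = S E" if h: "h \<in> carrier W" and E: "E \<in> carrier_mat m n" for h E
  proof -
    have c: "\<sigma> g * E * (\<rho> g)\<^sup>T \<in> carrier_mat m n" if "g \<in> carrier W" for g
      using \<sigma>(1)[OF that] \<rho>T[OF that] E by (auto intro!: mult_carrier_mat)
    have "\<sigma> h * S E = msum m n (\<lambda>g. \<sigma> h * (\<sigma> g * E * (\<rho> g)\<^sup>T))"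
      unfolding S_def using \<sigma>(1)[OF h] c by (intro mult_msum)
    also have "\<dots> * (\<rho> h)\<^sup>T = msum m n (\<lambda>g. \<sigma> h * (\<sigma> g * E * (\<rho> g)\<^sup>T) * (\<rho> h)\<^sup>T)"
      using mult_carrier_mat[OF \<sigma>(1)[OF h] c] \<rho>T[OF h] by (intro msum_mult)
    also have "\<dots> = msum m n (\<lambda>g. \<sigma> (h \<otimes> g) * E * (\<rho> (h \<otimes> g))\<^sup>T)"
    proof (rule msum_cong)
      fix g assume g: "g \<in> carrier W"
      note cg = \<sigma>(1)[OF g] \<sigma>(1)[OF h] \<rho>T[OF g] \<rho>T[OF h]
      have "\<sigma> h * (\<sigma> g * E * (\<rho> g)\<^sup>T) = \<sigma> h * (\<sigma> g * E) * (\<rho> g)\<^sup>T"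
        using cg E by (intro assoc_mult_mat[symmetric, of _ m m _ n _ n]) auto
      also have "\<sigma> h * (\<sigma> g * E) = \<sigma> h * \<sigma> g * E" using cg E by (intro assoc_mult_mat[symmetric, of _ m m _ m _ n]) auto
      also have "\<sigma> h * \<sigma> g * E * (\<rho> g)\<^sup>T * (\<rho> h)\<^sup>T = \<sigma> h * \<sigma> g * E * ((\<rho> g)\<^sup>T * (\<rho> h)\<^sup>T)"
        using cg E by (intro assoc_mult_mat[of _ m n _ n _ n]) auto
      finally show "\<sigma> h * (\<sigma> g * E * (\<rho> g)\<^sup>T) * (\<rho> h)\<^sup>T = \<sigma> (h \<otimes> g) * E * (\<rho> (h \<otimes> g))\<^sup>T"
        unfolding \<rho>(2)[OF h g] \<sigma>(2)[OF h g] transpose_mult[OF \<rho>(1)[OF h] \<rho>(1)[OF g]] .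
    qed
    also have "\<dots> = S E" unfolding S_def by (rule msum_translate(1)[OF h, of m n "\<lambda>g. \<sigma> g * E * (\<rho> g)\<^sup>T"])
    finally show ?thesis .
  qed
  have SB: "S E * B = 0\<^sub>m m n" if E: "E \<in> carrier_mat m n" for E
  proof -
    have "S E * B * \<rho> h = \<sigma> h * (S E * B)" if h: "h \<in> carrier W" for h
    proof -
      note ch = \<sigma>(1)[OF h] \<rho>(1)[OF h] \<rho>T[OF h]
      have "S E * B * \<rho> h = (\<sigma> h * S E * (\<rho> h)\<^sup>T) * B * \<rho> h" using Sinv[OF h E] by simp
      also have "\<dots> = (\<sigma> h * S E * (\<rho> h)\<^sup>T) * (B * \<rho> h)" using ch S B by (intro assoc_mult_mat[of _ m n _ n _ n]) auto
      also have "\<dots> = \<sigma> h * S E * ((\<rho> h)\<^sup>T * (B * \<rho> h))" using ch S B by (intro assoc_mult_mat[of _ m n _ n _ n]) auto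
      also have "(\<rho> h)\<^sup>T * (B * \<rho> h) = B" using Binv[OF h] ch B by (simp add: assoc_mult_mat[of _ n n _ n _ n])
      also have "\<sigma> h * S E * B = \<sigma> h * (S E * B)" using ch S B by (intro assoc_mult_mat[of _ m m _ n _ n]) auto
      finally show ?thesis .
    qed
    moreover have "S E * B \<in> carrier_mat m n" by (rule mult_carrier_mat[OF S B])
    ultimately show ?thesis using none by blast
  qed
  \<comment> \<open>With \<open>C g = \<rho> g * (S E)\<^sup>T\<close>, the zero matrix
    \<open>S E * B * (S E)\<^sup>T\<close> is the sum of all \<open>(C g)\<^sup>T * C g\<close>,
    whose diagonal entries are sums of squares. Hence every \<open>C g\<close> vanishes, in
    particular \<open>C \<one> = (S E)\<^sup>T\<close>; this stands in for the invertibility of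
    \<open>B\<close>.\<close>
  have S0: "S E $$ (i, k) = 0" if E: "E \<in> carrier_mat m n" and ik: "i < m" "k < n" for E i k
  proof -
    define C where "C g = \<rho> g * (S E)\<^sup>T" for g
    have C: "C g \<in> carrier_mat n m" if "g \<in> carrier W" for g
      unfolding C_def using \<rho>(1)[OF that] S[of E] by auto
    have ST: "(S E)\<^sup>T \<in> carrier_mat n m" using S[of E] by simp
    have "S E * B = msum m n (\<lambda>g. S E * ((\<rho> g)\<^sup>T * \<rho> g))"
      unfolding B_def by (rule mult_msum[OF S TT])
    also have "\<dots> * (S E)\<^sup>T = msum m m (\<lambda>g. S E * ((\<rho> g)\<^sup>T * \<rho> g) * (S E)\<^sup>T)"
    proof (rule msum_mult[OF ST])
      show "S E * ((\<rho> g)\<^sup>T * \<rho> g) \<in> carrier_mat m n" if "g \<in> carrier W" for g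
        using mult_carrier_mat[OF S mult_carrier_mat[OF \<rho>T[OF that] \<rho>(1)[OF that]]] .
    qed
    also have "\<dots> = msum m m (\<lambda>g. (C g)\<^sup>T * C g)"
    proof (rule msum_cong)
      fix g assume g: "g \<in> carrier W"
      have t: "(C g)\<^sup>T = S E * (\<rho> g)\<^sup>T" unfolding C_def transpose_mult[OF \<rho>(1)[OF g] ST] by simp
      have "S E * ((\<rho> g)\<^sup>T * \<rho> g) = S E * (\<rho> g)\<^sup>T * \<rho> g"
        by (rule assoc_mult_mat[symmetric, OF S \<rho>T[OF g] \<rho>(1)[OF g]])
      then show "S E * ((\<rho> g)\<^sup>T * \<rho> g) * (S E)\<^sup>T = (C g)\<^sup>T * C g"
        unfolding t unfolding C_def
        using assoc_mult_mat[OF mult_carrier_mat[OF S \<rho>T[OF g]] \<rho>(1)[OF g] ST] by simp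
    qed
    finally have Z: "msum m m (\<lambda>g. (C g)\<^sup>T * C g) = 0\<^sub>m m m" unfolding SB[OF E] using left_mult_zero_mat[OF ST] by simp
    have "(\<Sum>g\<in>carrier W. \<Sum>l<n. (C g $$ (l, i))\<^sup>2) = msum m m (\<lambda>g. (C g)\<^sup>T * C g) $$ (i, i)"
      unfolding index_msum[OF ik(1) ik(1)]
    proof (rule sum.cong[OF refl])
      fix g assume g: "g \<in> carrier W"
      have CT: "(C g)\<^sup>T \<in> carrier_mat m n" using C[OF g] by simp
      have "((C g)\<^sup>T * C g) $$ (i, i) = (\<Sum>l<n. (C g)\<^sup>T $$ (i, l) * C g $$ (l, i))"
        by (rule index_mult_mat_sum[OF CT C[OF g] ik(1) ik(1)])
      also have "\<dots> = (\<Sum>l<n. (C g $$ (l, i))\<^sup>2)" using C[OF g] ik by (intro sum.cong) (auto simp: power2_eq_square)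
      finally show "(\<Sum>l<n. (C g $$ (l, i))\<^sup>2) = ((C g)\<^sup>T * C g) $$ (i, i)" by simp
    qed
    then have "(\<Sum>g\<in>carrier W. \<Sum>l<n. (C g $$ (l, i))\<^sup>2) = 0" unfolding Z using ik by simp
    then have "\<forall>g\<in>carrier W. (\<Sum>l<n. (C g $$ (l, i))\<^sup>2) = 0"
      using fin by (subst (asm) sum_nonneg_eq_0_iff) (auto intro: sum_nonneg)
    then have "(\<Sum>l<n. (C \<one> $$ (l, i))\<^sup>2) = 0" by simp
    then have "\<forall>l\<in>{..<n}. (C \<one> $$ (l, i))\<^sup>2 = 0" by (subst (asm) sum_nonneg_eq_0_iff) auto
    then have "C \<one> $$ (k, i) = 0" using ik by simp
    moreover have "C \<one> = (S E)\<^sup>T" unfolding C_def \<rho>(3) using ST by simp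
    ultimately show ?thesis using S[of E] ik by simp
  qed
  have "(\<Sum>g\<in>carrier W. \<sigma> g $$ (i, i) * \<rho> g $$ (j, j)) = 0" if ij: "i < m" "j < n" for i j
  proof -
    \<comment> \<open>The matrix unit at \<open>(i, j)\<close> makes the \<open>(i, j)\<close> entry
      of \<open>S E\<close> a sum of products of diagonal entries; summed over all \<open>i\<close>
      and \<open>j\<close>, it becomes the sum of the products of the two characters.\<close>
    define E where "E = mat m n (\<lambda>(a, b). if a = i \<and> b = j then 1 else 0 :: rat)"
    have E: "E \<in> carrier_mat m n" unfolding E_def by simp
    have "(\<sigma> g * E * (\<rho> g)\<^sup>T) $$ (i, j) = \<sigma> g $$ (i, i) * \<rho> g $$ (j, j)" if g: "g \<in> carrier W" for g
    proof -
      have \<sigma>E: "(\<sigma> g * E) $$ (i, b) = (if b = j then \<sigma> g $$ (i, i) else 0)" if b: "b < n" for b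
      proof -
        have "(\<sigma> g * E) $$ (i, b) = (\<Sum>a<m. \<sigma> g $$ (i, a) * E $$ (a, b))"
          by (rule index_mult_mat_sum[OF \<sigma>(1)[OF g] E ij(1) b])
        also have "\<dots> = (\<Sum>a<m. if a = i then (if b = j then \<sigma> g $$ (i, i) else 0) else 0)"
          using b by (intro sum.cong) (auto simp: E_def)
        finally show ?thesis using ij by simp
      qed
      have "(\<sigma> g * E * (\<rho> g)\<^sup>T) $$ (i, j) = (\<Sum>b<n. (\<sigma> g * E) $$ (i, b) * (\<rho> g)\<^sup>T $$ (b, j))"
        by (rule index_mult_mat_sum[OF mult_carrier_mat[OF \<sigma>(1)[OF g] E] \<rho>T[OF g] ij])
      also have "\<dots> = (\<Sum>b<n. if b = j then \<sigma> g $$ (i, i) * \<rho> g $$ (j, j) else 0)"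
        using \<rho>(1)[OF g] ij \<sigma>E by (intro sum.cong) auto
      finally show ?thesis using ij by simp
    qed
    then have "(\<Sum>g\<in>carrier W. \<sigma> g $$ (i, i) * \<rho> g $$ (j, j)) = S E $$ (i, j)"
      unfolding S_def index_msum[OF ij] by simp
    then show ?thesis using S0[OF E ij] by simp
  qed
  then have "0 = (\<Sum>i<m. \<Sum>j<n. \<Sum>g\<in>carrier W. \<sigma> g $$ (i, i) * \<rho> g $$ (j, j))" by simp
  also have "\<dots> = (\<Sum>g\<in>carrier W. \<Sum>i<m. \<Sum>j<n. \<sigma> g $$ (i, i) * \<rho> g $$ (j, j))"
    by (subst sum.swap[of _ "carrier W"]) (simp add: sum.swap[of _ "carrier W"])
  also have "\<dots> = (\<Sum>g\<in>carrier W. (rchar (n, \<rho>) g)\<^sup>2)"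
  proof (rule sum.cong[OF refl])
    fix g assume g: "g \<in> carrier W"
    have "(\<Sum>i<m. \<Sum>j<n. \<sigma> g $$ (i, i) * \<rho> g $$ (j, j)) = rchar (m, \<sigma>) g * rchar (n, \<rho>) g"
      unfolding rchar_pair mtrace_def using \<rho>(1)[OF g] \<sigma>(1)[OF g] by (simp add: sum_product)
    then show "(\<Sum>i<m. \<Sum>j<n. \<sigma> g $$ (i, i) * \<rho> g $$ (j, j)) = (rchar (n, \<rho>) g)\<^sup>2"
      using eq[OF g] by (simp add: power2_eq_square)
  qed
  finally have "(\<Sum>g\<in>carrier W. (rchar (n, \<rho>) g)\<^sup>2) = 0" by simp
  then have "\<forall>g\<in>carrier W. (rchar (n, \<rho>) g)\<^sup>2 = 0" using fin by (subst (asm) sum_nonneg_eq_0_iff) auto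
  then have "rchar (n, \<rho>) \<one> = 0" by simp
  then show False using rchar_one[OF V] n by simp
qed

lemma four_block_mat_inj:
  assumes "four_block_mat A B C D = four_block_mat A' B' C' D'"
    and "A \<in> carrier_mat r r'" "A' \<in> carrier_mat r r'" "B \<in> carrier_mat r s'" "B' \<in> carrier_mat r s'"
    "C \<in> carrier_mat s r'" "C' \<in> carrier_mat s r'" "D \<in> carrier_mat s s'" "D' \<in> carrier_mat s s'"
  shows "A = A'" "B = B'" "C = C'" "D = D'"
proof -
  have e: "four_block_mat A B C D $$ (i, j) = four_block_mat A' B' C' D' $$ (i, j)" for i j using assms(1) by simp
  show "A = A'"
  proof (rule eq_matI)
    show "A $$ (i, j) = A' $$ (i, j)" if "i < dim_row A'" "j < dim_col A'" for i j
      using e[of i j] that assms(2-9) by simp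
  qed (use assms(2-9) in auto)
  show "B = B'"
  proof (rule eq_matI)
    show "B $$ (i, j) = B' $$ (i, j)" if "i < dim_row B'" "j < dim_col B'" for i j
      using e[of i "r' + j"] that assms(2-9) by simp
  qed (use assms(2-9) in auto)
  show "C = C'"
  proof (rule eq_matI)
    show "C $$ (i, j) = C' $$ (i, j)" if "i < dim_row C'" "j < dim_col C'" for i j
      using e[of "r + i" j] that assms(2-9) by simp
  qed (use assms(2-9) in auto)
  show "D = D'"
  proof (rule eq_matI)
    show "D $$ (i, j) = D' $$ (i, j)" if "i < dim_row D'" "j < dim_col D'" for i j
      using e[of "r + i" "r' + j"] that assms(2-9) by simp
  qed (use assms(2-9) in auto)
qed

text \<open>Maschke's averaging argument. The lower left block satisfies
  \<open>c (g \<otimes> h) = c g * a h + d g * c h\<close>. The average \<open>X\<close> of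
  \<open>c h * a (inv h)\<close> over the group then satisfies
  \<open>X * a g = c g + d g * X\<close>, so the unipotent matrix with block \<open>X\<close>
  intertwines the diagonal and the triangular form.\<close>

lemma triangular_rep_splits:
  assumes V: "is_rep W (r + s, \<lambda>g. four_block_mat (a g) (0\<^sub>m r s) (c g) (d g))"
    and cr: "\<And>g. a g \<in> carrier_mat r r" "\<And>g. c g \<in> carrier_mat s r" "\<And>g. d g \<in> carrier_mat s s"
  shows "is_rep W (r, a)" "is_rep W (s, d)"
    "rep_iso W (rep_sum (r, a) (s, d)) (r + s, \<lambda>g. four_block_mat (a g) (0\<^sub>m r s) (c g) (d g))"
proof -
  note \<rho> = is_repD[OF V]
  have mult: "a (g \<otimes> h) = a g * a h" "c (g \<otimes> h) = c g * a h + d g * c h" "d (g \<otimes> h) = d g * d h"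
    if g: "g \<in> carrier W" and h: "h \<in> carrier W" for g h
  proof -
    have "four_block_mat (a (g \<otimes> h)) (0\<^sub>m r s) (c (g \<otimes> h)) (d (g \<otimes> h)) =
        four_block_mat (a g * a h + 0\<^sub>m r s * c h) (a g * 0\<^sub>m r s + 0\<^sub>m r s * d h) (c g * a h + d g * c h) (c g * 0\<^sub>m r s + d g * d h)"
      unfolding \<rho>(2)[OF g h] using cr by (intro mult_four_block_mat[of _ r r _ s _ s _ _ r _ s]) auto
    note * = four_block_mat_inj[OF this cr(1) add_carrier_mat[OF mult_carrier_mat[OF zero_carrier_mat cr(2)]]
      zero_carrier_mat add_carrier_mat[OF mult_carrier_mat[OF zero_carrier_mat cr(3)]]
      cr(2) add_carrier_mat[OF mult_carrier_mat[OF cr(3,2)]] cr(3) add_carrier_mat[OF mult_carrier_mat[OF cr(3,3)]]]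
    from *(1,3,4) show "a (g \<otimes> h) = a g * a h" "c (g \<otimes> h) = c g * a h + d g * c h" "d (g \<otimes> h) = d g * d h"
      using mult_carrier_mat[OF cr(1) cr(1)] mult_carrier_mat[OF cr(3) cr(3)] left_mult_zero_mat[OF cr(2)]
        right_mult_zero_mat[OF cr(2)] by simp_all
  qed
  have "four_block_mat (a \<one>) (0\<^sub>m r s) (c \<one>) (d \<one>) = four_block_mat (1\<^sub>m r) (0\<^sub>m r s) (0\<^sub>m s r) (1\<^sub>m s)"
    using \<rho>(3) by simp
  from four_block_mat_inj[OF this, of r r s s] have one: "a \<one> = 1\<^sub>m r" "d \<one> = 1\<^sub>m s" using cr by auto
  show a: "is_rep W (r, a)" and d: "is_rep W (s, d)"
    by (rule is_repI; use mult one cr in simp)+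
  define M where "M = msum s r (\<lambda>h. c h * a (inv h))"
  define k where "k = (1 :: rat) / of_nat (card (carrier W))"
  have card: "of_nat (card (carrier W)) \<noteq> (0 :: rat)" using fin by (simp add: card_gt_0_iff) (metis empty_iff one_closed)
  have M: "M \<in> carrier_mat s r" unfolding M_def by simp
  define X where "X = k \<cdot>\<^sub>m M"
  have X: "X \<in> carrier_mat s r" unfolding X_def using M by simp
  define Y where "Y = - X"
  have Y: "Y \<in> carrier_mat s r" "X + Y = 0\<^sub>m s r" unfolding Y_def using X by (auto intro!: eq_matI)
  have ca: "c g * a h \<in> carrier_mat s r" "d g * (c g' * a h) \<in> carrier_mat s r" for g g' h
    using cr mult_carrier_mat[OF cr(3) mult_carrier_mat[OF cr(2) cr(1)]] by (auto intro!: mult_carrier_mat)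
  have key: "X * a g = c g + d g * X" if g: "g \<in> carrier W" for g
  proof -
    have "M * a g = msum s r (\<lambda>h. c h * a (inv h) * a g)"
      unfolding M_def by (rule msum_mult[OF cr(1) ca(1)])
    also have "\<dots> = msum s r (\<lambda>h. c (g \<otimes> h) * a (inv (g \<otimes> h)) * a g)"
      by (rule msum_translate(1)[OF g, symmetric, of s r "\<lambda>h. c h * a (inv h) * a g"])
    also have "\<dots> = msum s r (\<lambda>h. c g + d g * (c h * a (inv h)))"
    proof (rule msum_cong)
      fix h assume h: "h \<in> carrier W"
      have "c (g \<otimes> h) * a (inv (g \<otimes> h)) * a g = c (g \<otimes> h) * (a (inv (g \<otimes> h)) * a g)"
        by (rule assoc_mult_mat[OF cr(2,1,1)])
      also have "a (inv (g \<otimes> h)) * a g = a (inv h)"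
        using mult(1)[of "inv (g \<otimes> h)" g] g h by (simp add: inv_mult_group m_assoc)
      also have "c (g \<otimes> h) * a (inv h) = c g * a h * a (inv h) + d g * c h * a (inv h)"
        unfolding mult(2)[OF g h] by (rule add_mult_distrib_mat[OF ca(1) mult_carrier_mat[OF cr(3,2)] cr(1)])
      also have "c g * a h * a (inv h) = c g * (a h * a (inv h))" by (rule assoc_mult_mat[OF cr(2,1,1)])
      also have "a h * a (inv h) = 1\<^sub>m r" using mult(1)[of h "inv h"] h one by simp
      also have "c g * 1\<^sub>m r = c g" using cr(2) by (rule right_mult_one_mat)
      also have "d g * c h * a (inv h) = d g * (c h * a (inv h))" by (rule assoc_mult_mat[OF cr(3,2,1)])
      finally show "c (g \<otimes> h) * a (inv (g \<otimes> h)) * a g = c g + d g * (c h * a (inv h))" .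
    qed
    also have "\<dots> = of_nat (card (carrier W)) \<cdot>\<^sub>m c g + msum s r (\<lambda>h. d g * (c h * a (inv h)))"
    proof (rule eq_matI)
      fix i j assume "i < dim_row (of_nat (card (carrier W)) \<cdot>\<^sub>m c g + msum s r (\<lambda>h. d g * (c h * a (inv h))))"
        "j < dim_col (of_nat (card (carrier W)) \<cdot>\<^sub>m c g + msum s r (\<lambda>h. d g * (c h * a (inv h))))"
      then have ij: "i < s" "j < r" by (auto simp: msum_def)
      have "(c g + d g * (c h * a (inv h))) $$ (i, j) = c g $$ (i, j) + (d g * (c h * a (inv h))) $$ (i, j)" for h
        using ij cr(2)[of g] ca(2)[of g h "inv h"] by (metis carrier_matD index_add_mat(1))
      then have "msum s r (\<lambda>h. c g + d g * (c h * a (inv h))) $$ (i, j) =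
          of_nat (card (carrier W)) * c g $$ (i, j) + (\<Sum>h\<in>carrier W. (d g * (c h * a (inv h))) $$ (i, j))"
        using ij by (simp add: index_msum sum.distrib)
      then show "msum s r (\<lambda>h. c g + d g * (c h * a (inv h))) $$ (i, j) =
          (of_nat (card (carrier W)) \<cdot>\<^sub>m c g + msum s r (\<lambda>h. d g * (c h * a (inv h)))) $$ (i, j)"
        using ij cr(2)[of g] by (simp add: index_msum[OF ij] msum_def)
    qed (use cr in \<open>auto simp: msum_def\<close>)
    also have "msum s r (\<lambda>h. d g * (c h * a (inv h))) = d g * M"
      unfolding M_def by (rule mult_msum[OF cr(3) ca(1), symmetric])
    finally have "M * a g = of_nat (card (carrier W)) \<cdot>\<^sub>m c g + d g * M" .
    then have "k \<cdot>\<^sub>m (M * a g) = k \<cdot>\<^sub>m (of_nat (card (carrier W)) \<cdot>\<^sub>m c g) + k \<cdot>\<^sub>m (d g * M)"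
      by (simp add: add_smult_distrib_left_mat[OF smult_carrier_mat[OF cr(2)] mult_carrier_mat[OF cr(3) M]])
    also have "k \<cdot>\<^sub>m (of_nat (card (carrier W)) \<cdot>\<^sub>m c g) = c g"
      using card unfolding k_def by (intro eq_matI) auto
    finally show ?thesis unfolding X_def
      using mult_smult_assoc_mat[OF M cr(1), of k g] mult_smult_distrib[OF cr(3) M, of g k] by simp
  qed
  show "rep_iso W (rep_sum (r, a) (s, d)) (r + s, \<lambda>g. four_block_mat (a g) (0\<^sub>m r s) (c g) (d g))"
    unfolding rep_sum_pair
  proof (rule rep_isoI[of "four_block_mat (1\<^sub>m r) (0\<^sub>m r s) X (1\<^sub>m s)" _ "four_block_mat (1\<^sub>m r) (0\<^sub>m r s) Y (1\<^sub>m s)"])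
    show "four_block_mat (1\<^sub>m r) (0\<^sub>m r s) X (1\<^sub>m s) * four_block_mat (1\<^sub>m r) (0\<^sub>m r s) Y (1\<^sub>m s) = 1\<^sub>m (r + s)"
      using X Y by (subst mult_four_block_mat[of _ r r _ s _ s _ _ r _ s]) auto
    fix g assume g: "g \<in> carrier W"
    have "four_block_mat (1\<^sub>m r) (0\<^sub>m r s) X (1\<^sub>m s) * bdiag r s (a g) (d g) = four_block_mat (a g) (0\<^sub>m r s) (X * a g) (d g)"
      using X cr mult_carrier_mat[OF X cr(1), of g] right_mult_zero_mat[OF X, of s] left_mult_one_mat[OF cr(1), of g]
        left_mult_one_mat[OF cr(3), of g] left_mult_zero_mat[OF cr(3), of r g]
      by (subst mult_four_block_mat[of _ r r _ s _ s _ _ r _ s]) auto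
    also have "\<dots> = four_block_mat (a g) (0\<^sub>m r s) (c g) (d g) * four_block_mat (1\<^sub>m r) (0\<^sub>m r s) X (1\<^sub>m s)"
      unfolding key[OF g]
      using X cr mult_carrier_mat[OF cr(3) X, of g] right_mult_one_mat[OF cr(1), of g] right_mult_one_mat[OF cr(2), of g]
        right_mult_one_mat[OF cr(3), of g] right_mult_zero_mat[OF cr(1), of g s] right_mult_zero_mat[OF cr(2), of g s] left_mult_zero_mat[OF X, of r]
      by (subst mult_four_block_mat[of _ r r _ s _ s _ _ r _ s]) auto
    finally show "four_block_mat (1\<^sub>m r) (0\<^sub>m r s) X (1\<^sub>m s) * bdiag r s (a g) (d g) =
        four_block_mat (a g) (0\<^sub>m r s) (c g) (d g) * four_block_mat (1\<^sub>m r) (0\<^sub>m r s) X (1\<^sub>m s)" .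
  qed (use X Y in auto)
qed

lemma is_rep_iso:
  assumes "is_rep W (n, \<rho>)" "rep_iso W (n, \<rho>) (n, \<sigma>)" and c: "\<And>g. g \<in> carrier W \<Longrightarrow> \<sigma> g \<in> carrier_mat n n"
  shows "is_rep W (n, \<sigma>)"
proof -
  note \<rho> = is_repD[OF assms(1)]
  obtain T S where TS: "n = n" "T \<in> carrier_mat n n" "S \<in> carrier_mat n n" "T * S = 1\<^sub>m n" "S * T = 1\<^sub>m n"
    "\<forall>g\<in>carrier W. T * \<rho> g = \<sigma> g * T"
    by (rule rep_isoE[OF assms(2)])
  have eq: "\<sigma> g = T * (\<rho> g * S)" if g: "g \<in> carrier W" for g
  proof -
    have "T * (\<rho> g * S) = T * \<rho> g * S" by (rule assoc_mult_mat[symmetric, OF TS(2) \<rho>(1)[OF g] TS(3)])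
    also have "\<dots> = \<sigma> g * (T * S)" unfolding TS(6)[rule_format, OF g] by (rule assoc_mult_mat[OF c[OF g] TS(2,3)])
    finally show ?thesis using TS(4) c[OF g] by simp
  qed
  show ?thesis
  proof (rule is_repI[OF c])
    fix g h assume g: "g \<in> carrier W" and h: "h \<in> carrier W"
    note cc = TS(2,3) \<rho>(1)[OF g] \<rho>(1)[OF h]
    have "\<sigma> g * \<sigma> h = T * (\<rho> g * ((S * T) * (\<rho> h * S)))"
      unfolding eq[OF g] eq[OF h] using cc by (simp add: assoc_mult_mat[of _ n n _ n _ n] del: TS(5))
    also have "\<dots> = \<sigma> (g \<otimes> h)"
      unfolding TS(5) eq[OF m_closed[OF g h]] \<rho>(2)[OF g h] using cc by (simp add: assoc_mult_mat[of _ n n _ n _ n])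
    finally show "\<sigma> (g \<otimes> h) = \<sigma> g * \<sigma> h" by simp
  next
    show "\<sigma> \<one> = 1\<^sub>m n" unfolding eq[OF one_closed] \<rho>(3) using TS by simp
  qed
qed

lemma rep_iso_conj:
  assumes V: "is_rep W (n, \<rho>)" and P: "P \<in> carrier_mat n n" "P' \<in> carrier_mat n n" "P * P' = 1\<^sub>m n"
  shows "is_rep W (n, \<lambda>g. P * \<rho> g * P')" "rep_iso W (n, \<rho>) (n, \<lambda>g. P * \<rho> g * P')"
proof -
  have P': "P' * P = 1\<^sub>m n" by (rule mat_mult_left_right_inverse[OF P])
  show iso: "rep_iso W (n, \<rho>) (n, \<lambda>g. P * \<rho> g * P')"
  proof (rule rep_isoI[OF P])
    fix g assume g: "g \<in> carrier W"
    have P\<rho>: "P * \<rho> g \<in> carrier_mat n n" using P is_repD(1)[OF V g] by simp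
    show "P * \<rho> g = P * \<rho> g * P' * P"
      unfolding assoc_mult_mat[OF P\<rho> P(2,1)] P' by (rule right_mult_one_mat[OF P\<rho>, symmetric])
  qed
  show "is_rep W (n, \<lambda>g. P * \<rho> g * P')"
    using P is_repD(1)[OF V] by (intro is_rep_iso[OF V iso]) (auto intro!: mult_carrier_mat[of _ n n])
qed

text \<open>Induction on the dimension, without decomposing into irreducibles. A non-zero
  intertwiner of rank \<open>r\<close> becomes \<open>rank_mat n n r\<close> in suitable bases,
  which forces both representations to be block triangular with a common block \<open>a\<close> of
  size \<open>r\<close>. Both split by averaging, and the complements have equal characters and
  smaller dimension.\<close>

theorem rep_iso_if_rchar_eq:
  assumes "is_rep W V" "is_rep W U" "\<And>g. g \<in> carrier W \<Longrightarrow> rchar V g = rchar U g"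
  shows "rep_iso W V U"
proof -
  have "rep_iso W (n, \<rho>) (n, \<sigma>)" if "is_rep W (n, \<rho>)" "is_rep W (n, \<sigma>)"
    "\<And>g. g \<in> carrier W \<Longrightarrow> rchar (n, \<rho>) g = rchar (n, \<sigma>) g" for n \<rho> \<sigma>
    using that
  proof (induction n arbitrary: \<rho> \<sigma> rule: less_induct)
    case (less n)
    note V = less.prems(1) and U = less.prems(2) and eq = less.prems(3)
    show ?case
    proof (cases "n = 0")
      case True
      show ?thesis unfolding True
      proof (rule rep_isoI[of "1\<^sub>m 0" _ "1\<^sub>m 0"])
        fix g assume g: "g \<in> carrier W"
        note c = carrier_matD[OF is_repD(1)[OF V g]] carrier_matD[OF is_repD(1)[OF U g]]
        show "1\<^sub>m 0 * \<rho> g = \<sigma> g * 1\<^sub>m 0" by (rule eq_matI) (simp_all add: c True)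
      qed auto
    next
      case False
      obtain T where T: "T \<in> carrier_mat n n" "T \<noteq> 0\<^sub>m n n" "\<And>g. g \<in> carrier W \<Longrightarrow> T * \<rho> g = \<sigma> g * T"
        using exists_intertwiner[OF V U eq] False by auto
      obtain r where r: "r \<le> n" "mat_eqv n n T (rank_mat n n r)" using rank_normal_form[OF T(1)] by auto
      let ?J = "rank_mat n n r"
      obtain P P' Q Q' where P: "P \<in> carrier_mat n n" "P' \<in> carrier_mat n n" "P * P' = 1\<^sub>m n"
        and Q: "Q \<in> carrier_mat n n" "Q' \<in> carrier_mat n n" "Q * Q' = 1\<^sub>m n" and J: "P * T * Q = ?J"
        using r(2) unfolding mat_eqv_def by blast
      have P': "P' * P = 1\<^sub>m n" and Q': "Q' * Q = 1\<^sub>m n"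
        using mat_mult_left_right_inverse P Q by auto
      have JQ: "?J * Q' = P * T"
      proof -
        have "?J * Q' = P * T * (Q * Q')" unfolding J[symmetric] using P Q T(1) by (intro assoc_mult_mat[of _ n n _ n _ n]) auto
        then show ?thesis using P T(1) Q(3) by simp
      qed
      have Jc: "?J \<in> carrier_mat n n" by (simp add: rank_mat_def)
      have "r \<noteq> 0"
      proof
        assume "r = 0"
        then have "?J = 0\<^sub>m n n" by (intro eq_matI) (auto simp: rank_mat_def)
        then have "P * T = 0\<^sub>m n n" using JQ left_mult_zero_mat[OF Q(2)] by simp
        then have "P' * (P * T) = 0\<^sub>m n n" using right_mult_zero_mat[OF P(2)] by simp
        moreover have "P' * (P * T) = T" unfolding assoc_mult_mat[symmetric, OF P(2,1) T(1)] P' using T(1) by simp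
        ultimately show False using T(2) by simp
      qed
      define s where "s = n - r"
      have n: "n = r + s" "s < n" using r(1) \<open>r \<noteq> 0\<close> unfolding s_def by auto
      define \<rho>' where "\<rho>' g = Q' * \<rho> g * Q" for g
      define \<sigma>' where "\<sigma>' g = P * \<sigma> g * P'" for g
      have \<rho>': "is_rep W (n, \<rho>')" "rep_iso W (n, \<rho>) (n, \<rho>')"
        using rep_iso_conj[OF V Q(2,1) Q'] unfolding \<rho>'_def[abs_def] .
      have \<sigma>': "is_rep W (n, \<sigma>')" "rep_iso W (n, \<sigma>) (n, \<sigma>')"
        using rep_iso_conj[OF U P] unfolding \<sigma>'_def[abs_def] .
      have inter: "?J * \<rho>' g = \<sigma>' g * ?J" if g: "g \<in> carrier W" for g
      proof -
        note c = is_repD(1)[OF V g] is_repD(1)[OF U g] P(1,2) Q(1,2) T(1) Jc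
        have "?J * \<rho>' g = (?J * Q') * (\<rho> g * Q)"
          unfolding \<rho>'_def using c by (simp add: assoc_mult_mat[of _ n n _ n _ n])
        also have "\<dots> = P * ((T * \<rho> g) * Q)" unfolding JQ using c by (simp add: assoc_mult_mat[of _ n n _ n _ n])
        also have "\<dots> = P * (\<sigma> g * ((P' * P) * (T * Q)))"
          unfolding T(3)[OF g] P' using c by (simp add: assoc_mult_mat[of _ n n _ n _ n])
        also have "\<dots> = \<sigma>' g * (P * T * Q)" unfolding \<sigma>'_def using c by (simp add: assoc_mult_mat[of _ n n _ n _ n])
        finally show ?thesis unfolding J .
      qed
      \<comment> \<open>Entrywise form of the intertwining relation: it gives a zero upper right
        block of \<open>\<rho>'\<close>, a zero lower left block of \<open>\<sigma>'\<close> and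
        equal upper left blocks.\<close>
      have entries: "(if i < r then \<rho>' g $$ (i, j) else 0) = (if j < r then \<sigma>' g $$ (i, j) else 0)"
        if g: "g \<in> carrier W" and ij: "i < n" "j < n" for g i j
      proof -
        note c = is_repD(1)[OF \<rho>'(1) g] is_repD(1)[OF \<sigma>'(1) g]
        have "(?J * \<rho>' g) $$ (i, j) = (\<Sum>l<n. ?J $$ (i, l) * \<rho>' g $$ (l, j))"
          by (rule index_mult_mat_sum[OF Jc c(1) ij])
        also have "\<dots> = (\<Sum>l<n. if l = i then (if i < r then \<rho>' g $$ (i, j) else 0) else 0)"
          using ij by (intro sum.cong) (auto simp: rank_mat_def)
        finally have 1: "(?J * \<rho>' g) $$ (i, j) = (if i < r then \<rho>' g $$ (i, j) else 0)" using ij by simp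
        have "(\<sigma>' g * ?J) $$ (i, j) = (\<Sum>l<n. \<sigma>' g $$ (i, l) * ?J $$ (l, j))"
          by (rule index_mult_mat_sum[OF c(2) Jc ij])
        also have "\<dots> = (\<Sum>l<n. if l = j then (if j < r then \<sigma>' g $$ (i, j) else 0) else 0)"
          using ij by (intro sum.cong) (auto simp: rank_mat_def)
        finally have "(\<sigma>' g * ?J) $$ (i, j) = (if j < r then \<sigma>' g $$ (i, j) else 0)" using ij by simp
        then show ?thesis using 1 inter[OF g] by simp
      qed
      define a where "a g = mat r r (\<lambda>(i, j). \<rho>' g $$ (i, j))" for g
      define c where "c g = mat s r (\<lambda>(i, j). \<rho>' g $$ (i + r, j))" for g
      define d where "d g = mat s s (\<lambda>(i, j). \<rho>' g $$ (i + r, j + r))" for g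
      define b where "b g = mat r s (\<lambda>(i, j). \<sigma>' g $$ (i, j + r))" for g
      define d' where "d' g = mat s s (\<lambda>(i, j). \<sigma>' g $$ (i + r, j + r))" for g
      have cr: "\<And>g. a g \<in> carrier_mat r r" "\<And>g. c g \<in> carrier_mat s r" "\<And>g. d g \<in> carrier_mat s s"
        "\<And>g. b g \<in> carrier_mat r s" "\<And>g. d' g \<in> carrier_mat s s"
        by (auto simp: a_def c_def d_def b_def d'_def)
      let ?L = "\<lambda>g. four_block_mat (a g) (0\<^sub>m r s) (c g) (d g)"
      let ?R = "\<lambda>g. four_block_mat (d' g) (0\<^sub>m s r) (b g) (a g)"
      have L: "?L g = \<rho>' g" if g: "g \<in> carrier W" for g
      proof (rule eq_matI)
        note cg = is_repD(1)[OF \<rho>'(1) g]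
        fix i j assume "i < dim_row (\<rho>' g)" "j < dim_col (\<rho>' g)"
        then have ij: "i < r + s" "j < r + s" using cg n by auto
        have "\<rho>' g $$ (i, j) = 0" if "i < r" "\<not> j < r" using entries[OF g, of i j] that ij n by simp
        then show "?L g $$ (i, j) = \<rho>' g $$ (i, j)" using ij cr[of g]
          by (cases "i < r"; cases "j < r") (auto simp: a_def c_def d_def)
      qed (use is_repD(1)[OF \<rho>'(1) g] carrier_matD[OF cr(1)[of g]] carrier_matD[OF cr(3)[of g]] n in auto)
      \<comment> \<open>\<open>\<sigma>'\<close> is upper triangular; listing the last
        \<open>s\<close> coordinates first makes it lower triangular, so that the same splitting
        applies.\<close>
      define f where "f i = (if i < r then s + i else i - r)" for i
      have f: "bij_betw f {..<n} {..<n}" unfolding n(1)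
        by (rule bij_betw_byWitness[of _ "\<lambda>i. if i < s then r + i else i - s"]) (auto simp: f_def)
      have Rc: "?R g \<in> carrier_mat n n" for g
        using four_block_carrier_mat[OF cr(5)[of g] cr(1)[of g]] n by (simp add: add.commute)
      have isoR: "rep_iso W (n, \<sigma>') (n, ?R)"
      proof (rule rep_iso_reindex[OF f])
        fix g i j assume g: "g \<in> carrier W" and ij: "i < n" "j < n"
        have 0: "\<sigma>' g $$ (i, j) = 0" if "\<not> i < r" "j < r" using entries[OF g ij] that by simp
        have 1: "\<sigma>' g $$ (i, j) = \<rho>' g $$ (i, j)" if "i < r" "j < r" using entries[OF g ij] that by simp
        show "?R g $$ (f i, f j) = \<sigma>' g $$ (i, j)" using ij 0 1 cr[of g] n(1)
          by (cases "i < r"; cases "j < r") (auto simp: f_def a_def b_def d'_def)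
      qed (use is_repD(1)[OF \<sigma>'(1)] Rc in auto)
      have repL: "is_rep W (r + s, ?L)"
        using is_rep_iso[OF \<rho>'(1) rep_iso_eq[OF \<rho>'(1) L]] L is_repD(1)[OF \<rho>'(1)] unfolding n(1) by simp
      have repR: "is_rep W (s + r, ?R)"
        using is_rep_iso[OF \<sigma>'(1) isoR Rc] unfolding n(1) by (simp add: add.commute)
      note splitL = triangular_rep_splits[OF repL cr(1-3)]
      note splitR = triangular_rep_splits[OF repR cr(5,4,1)]
      have reps: "is_rep W (rep_sum (r, a) (s, d))" "is_rep W (rep_sum (s, d) (r, a))" "is_rep W (rep_sum (s, d') (r, a))"
        using is_rep_sum splitL(1,2) splitR(1) by auto
      have "rchar (s, d) g = rchar (s, d') g" if g: "g \<in> carrier W" for g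
      proof -
        have "rchar (r, a) g + rchar (s, d) g = rchar (n, \<rho>) g"
          using rchar_sum[OF splitL(1,2) g] rchar_iso[OF reps(1) repL splitL(3) g] L[OF g]
            rchar_iso[OF V \<rho>'(1) \<rho>'(2) g] by (simp add: rchar_pair)
        moreover have "rchar (s, d') g + rchar (r, a) g = rchar (n, \<sigma>) g"
          using rchar_sum[OF splitR(1,2) g] rchar_iso[OF reps(3) repR splitR(3) g]
            rchar_iso[OF \<sigma>'(1) is_rep_iso[OF \<sigma>'(1) isoR Rc] isoR g] rchar_iso[OF U \<sigma>'(1) \<sigma>'(2) g] by (simp add: rchar_pair)
        ultimately show ?thesis using eq[OF g] by simp
      qed
      then have IH: "rep_iso W (s, d) (s, d')" using less.IH[OF n(2) splitL(2) splitR(1)] by blast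
      have LL: "rep_iso W (n, \<rho>') (rep_sum (r, a) (s, d))"
        using rep_iso_trans[OF \<rho>'(1) repL[folded n(1)] reps(1) rep_iso_eq[OF \<rho>'(1) L]]
          rep_iso_sym[OF reps(1) repL splitL(3)] unfolding n(1) by simp
      have RR: "rep_iso W (rep_sum (s, d') (r, a)) (n, \<sigma>')"
        using rep_iso_trans[OF reps(3) repR \<sigma>'(1) splitR(3)]
          rep_iso_sym[OF \<sigma>'(1) is_rep_iso[OF \<sigma>'(1) isoR Rc] isoR] unfolding n(1) by (simp add: add.commute)
      have "rep_iso W (rep_sum (r, a) (s, d)) (rep_sum (s, d') (r, a))"
        using rep_iso_trans[OF reps(1,2,3) rep_sum_commute[OF splitL(1,2)]
          rep_sum_cong[OF splitL(2) splitR(1) splitL(1) splitL(1) IH rep_iso_refl[OF splitL(1)]]] .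
      then have "rep_iso W (n, \<rho>') (n, \<sigma>')"
        using rep_iso_trans[OF \<rho>'(1) reps(1) \<sigma>'(1) LL] rep_iso_trans[OF reps(1,3) \<sigma>'(1) _ RR] by blast
      then show ?thesis
        using rep_iso_trans[OF V \<rho>'(1) U \<rho>'(2)] rep_iso_trans[OF \<rho>'(1) \<sigma>'(1) U _ rep_iso_sym[OF U \<sigma>'(1,2)]] by blast
    qed
  qed
  moreover obtain n \<rho> m \<sigma> where V: "V = (n, \<rho>)" and U: "U = (m, \<sigma>)" by (cases V; cases U)
  moreover have "(of_nat n :: rat) = of_nat m"
    using rchar_one[OF assms(1)[unfolded V]] rchar_one[OF assms(2)[unfolded U]] assms(3)[OF one_closed] V U by simp
  ultimately show ?thesis using assms by simp
qed

end


section \<open>Virtual representations\<close>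

definition isocl :: "'g monoid \<Rightarrow> 'g rep \<Rightarrow> 'g rep set" where
  "isocl W V = {U. is_rep W U \<and> rep_iso W V U}"

lemma isocl_eq_iff:
  assumes "is_rep W V" "is_rep W U"
  shows "isocl W V = isocl W U \<longleftrightarrow> rep_iso W V U"
proof
  assume "isocl W V = isocl W U"
  then show "rep_iso W V U" using assms rep_iso_refl[OF assms(2)] by (auto simp: isocl_def)
next
  assume i: "rep_iso W V U"
  show "isocl W V = isocl W U" unfolding isocl_def
    using rep_iso_trans[OF assms _ i] rep_iso_trans[OF assms(2,1) _ rep_iso_sym[OF assms i]] by blast
qed

text \<open>Isomorphism classes form a commutative monoid under direct sum. Identities between
  formal differences then become computations in this monoid, with associativity and commutativity
  in place of explicit isomorphisms.\<close>

definition rep_monoid :: "'g monoid \<Rightarrow> 'g rep set monoid" where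
  "rep_monoid W = \<lparr>carrier = isocl W ` {V. is_rep W V},
     monoid.mult = (\<lambda>X Y. isocl W (rep_sum (SOME V. V \<in> X) (SOME U. U \<in> Y))), one = isocl W rep_zero\<rparr>"

lemma isocl_closed [simp]: "is_rep W V \<Longrightarrow> isocl W V \<in> carrier (rep_monoid W)"
  by (simp add: rep_monoid_def)

lemma isocl_sum:
  assumes "is_rep W V" "is_rep W U"
  shows "isocl W (rep_sum V U) = isocl W V \<otimes>\<^bsub>rep_monoid W\<^esub> isocl W U"
proof -
  have "V \<in> isocl W V" "U \<in> isocl W U" using assms rep_iso_refl[OF assms(1)] rep_iso_refl[OF assms(2)] by (simp_all add: isocl_def)
  then have "(SOME x. x \<in> isocl W V) \<in> isocl W V" "(SOME x. x \<in> isocl W U) \<in> isocl W U" by (metis someI)+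
  then have *: "is_rep W (SOME x. x \<in> isocl W V)" "rep_iso W V (SOME x. x \<in> isocl W V)"
    "is_rep W (SOME x. x \<in> isocl W U)" "rep_iso W U (SOME x. x \<in> isocl W U)" by (auto simp: isocl_def)
  have "rep_iso W (rep_sum V U) (rep_sum (SOME x. x \<in> isocl W V) (SOME x. x \<in> isocl W U))"
    using rep_sum_cong[OF assms(1) *(1) assms(2) *(3) *(2,4)] .
  then show ?thesis using isocl_eq_iff[OF is_rep_sum[OF assms] is_rep_sum[OF *(1,3)]] by (simp add: rep_monoid_def)
qed

lemma rep_monoid_cases:
  assumes "X \<in> carrier (rep_monoid W)"
  obtains V where "is_rep W V" "X = isocl W V"
  using assms by (auto simp: rep_monoid_def)

lemma comm_monoid_rep_monoid: "comm_monoid (rep_monoid W)"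
proof (rule comm_monoidI)
  show "\<one>\<^bsub>rep_monoid W\<^esub> \<in> carrier (rep_monoid W)" using isocl_closed[OF is_rep_zero[of W]] by (simp add: rep_monoid_def)
next
  fix X Y assume "X \<in> carrier (rep_monoid W)" "Y \<in> carrier (rep_monoid W)"
  then obtain V U where V: "is_rep W V" "X = isocl W V" and U: "is_rep W U" "Y = isocl W U"
    by (metis rep_monoid_cases)
  show "X \<otimes>\<^bsub>rep_monoid W\<^esub> Y \<in> carrier (rep_monoid W)"
    unfolding V(2) U(2) isocl_sum[OF V(1) U(1), symmetric] using is_rep_sum[OF V(1) U(1)] by simp
  show "X \<otimes>\<^bsub>rep_monoid W\<^esub> Y = Y \<otimes>\<^bsub>rep_monoid W\<^esub> X"
    unfolding V(2) U(2) isocl_sum[OF V(1) U(1), symmetric] isocl_sum[OF U(1) V(1), symmetric]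
    using isocl_eq_iff[OF is_rep_sum[OF V(1) U(1)] is_rep_sum[OF U(1) V(1)]] rep_sum_commute[OF V(1) U(1)] by simp
next
  fix X Y Z assume "X \<in> carrier (rep_monoid W)" "Y \<in> carrier (rep_monoid W)" "Z \<in> carrier (rep_monoid W)"
  then obtain V U T where V: "is_rep W V" "X = isocl W V" and U: "is_rep W U" "Y = isocl W U"
    and T: "is_rep W T" "Z = isocl W T" by (metis rep_monoid_cases)
  note s = is_rep_sum[OF V(1) U(1)] is_rep_sum[OF U(1) T(1)]
  show "X \<otimes>\<^bsub>rep_monoid W\<^esub> Y \<otimes>\<^bsub>rep_monoid W\<^esub> Z = X \<otimes>\<^bsub>rep_monoid W\<^esub> (Y \<otimes>\<^bsub>rep_monoid W\<^esub> Z)"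
    unfolding V(2) U(2) T(2) isocl_sum[OF V(1) U(1), symmetric] isocl_sum[OF U(1) T(1), symmetric]
      isocl_sum[OF s(1) T(1), symmetric] isocl_sum[OF V(1) s(2), symmetric]
    using isocl_eq_iff[OF is_rep_sum[OF s(1) T(1)] is_rep_sum[OF V(1) s(2)]] rep_sum_assoc[OF V(1) U(1) T(1)] by simp
next
  fix X assume "X \<in> carrier (rep_monoid W)"
  then obtain V where V: "is_rep W V" "X = isocl W V" by (metis rep_monoid_cases)
  have "rep_iso W V (rep_sum V rep_zero)"
    using rep_sum_dim0[OF V(1), of "\<lambda>_. 1\<^sub>m 0"] is_rep_zero[of W] unfolding rep_zero_def by blast
  moreover have "rep_iso W (rep_sum V rep_zero) (rep_sum rep_zero V)" by (rule rep_sum_commute[OF V(1) is_rep_zero])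
  ultimately have "rep_iso W V (rep_sum rep_zero V)"
    using rep_iso_trans[OF V(1) is_rep_sum[OF V(1) is_rep_zero] is_rep_sum[OF is_rep_zero V(1)]] by blast
  then have "isocl W (rep_sum rep_zero V) = isocl W V"
    using isocl_eq_iff[OF V(1) is_rep_sum[OF is_rep_zero V(1)]] by simp
  then show "\<one>\<^bsub>rep_monoid W\<^esub> \<otimes>\<^bsub>rep_monoid W\<^esub> X = X"
    using isocl_sum[OF is_rep_zero V(1)] V(2) by (simp add: rep_monoid_def)
qed

lemma isocl_zero: "isocl W rep_zero = \<one>\<^bsub>rep_monoid W\<^esub>"
  by (simp add: rep_monoid_def)

lemma rep_iso_dim0:
  assumes "is_rep W (0, \<rho>)" "is_rep W (0, \<sigma>)"
  shows "rep_iso W (0, \<rho>) (0, \<sigma>)"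
proof (rule rep_isoI[of "1\<^sub>m 0" _ "1\<^sub>m 0"])
  fix g assume g: "g \<in> carrier W"
  note c = carrier_matD[OF is_repD(1)[OF assms(1) g]] carrier_matD[OF is_repD(1)[OF assms(2) g]]
  show "1\<^sub>m 0 * \<rho> g = \<sigma> g * 1\<^sub>m 0" by (rule eq_matI) (simp_all add: c)
qed auto

lemma isocl_dim0:
  assumes "is_rep W (0, \<rho>)"
  shows "isocl W (0, \<rho>) = \<one>\<^bsub>rep_monoid W\<^esub>"
proof -
  have "is_rep W (0, \<lambda>_. 1\<^sub>m 0)" using is_rep_zero unfolding rep_zero_def .
  then show ?thesis unfolding isocl_zero[symmetric] rep_zero_def
    using isocl_eq_iff[OF assms] rep_iso_dim0[OF assms] by blast
qed

lemma vrep_rel_iff: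
  "((V, V'), (U, U')) \<in> vrep_rel W \<longleftrightarrow> is_rep W V \<and> is_rep W V' \<and> is_rep W U \<and> is_rep W U' \<and>
    (\<exists>x\<in>carrier (rep_monoid W). isocl W V \<otimes>\<^bsub>rep_monoid W\<^esub> isocl W U' \<otimes>\<^bsub>rep_monoid W\<^esub> x =
      isocl W U \<otimes>\<^bsub>rep_monoid W\<^esub> isocl W V' \<otimes>\<^bsub>rep_monoid W\<^esub> x)"
proof (cases "is_rep W V \<and> is_rep W V' \<and> is_rep W U \<and> is_rep W U'")
  case True
  have "rep_iso W (rep_sum (rep_sum V U') X) (rep_sum (rep_sum U V') X) \<longleftrightarrow>
      isocl W V \<otimes>\<^bsub>rep_monoid W\<^esub> isocl W U' \<otimes>\<^bsub>rep_monoid W\<^esub> isocl W X =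
      isocl W U \<otimes>\<^bsub>rep_monoid W\<^esub> isocl W V' \<otimes>\<^bsub>rep_monoid W\<^esub> isocl W X" if "is_rep W X" for X
    using True that by (simp add: isocl_eq_iff[symmetric] is_rep_sum isocl_sum)
  note iff = this
  have "(\<exists>X. is_rep W X \<and> rep_iso W (rep_sum (rep_sum V U') X) (rep_sum (rep_sum U V') X)) \<longleftrightarrow>
     (\<exists>x\<in>carrier (rep_monoid W). isocl W V \<otimes>\<^bsub>rep_monoid W\<^esub> isocl W U' \<otimes>\<^bsub>rep_monoid W\<^esub> x =
      isocl W U \<otimes>\<^bsub>rep_monoid W\<^esub> isocl W V' \<otimes>\<^bsub>rep_monoid W\<^esub> x)" (is "?A \<longleftrightarrow> ?B")
  proof
    assume ?A
    then obtain X where X: "is_rep W X" "rep_iso W (rep_sum (rep_sum V U') X) (rep_sum (rep_sum U V') X)" by blast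
    show ?B by (rule bexI[of _ "isocl W X"], rule iffD1[OF iff[OF X(1)] X(2)], rule isocl_closed[OF X(1)])
  next
    assume ?B
    then obtain x where x: "x \<in> carrier (rep_monoid W)" "isocl W V \<otimes>\<^bsub>rep_monoid W\<^esub> isocl W U' \<otimes>\<^bsub>rep_monoid W\<^esub> x =
      isocl W U \<otimes>\<^bsub>rep_monoid W\<^esub> isocl W V' \<otimes>\<^bsub>rep_monoid W\<^esub> x" by blast
    obtain X where X: "is_rep W X" "x = isocl W X" using rep_monoid_cases[OF x(1)] .
    show ?A by (rule exI[of _ X], rule conjI[OF X(1) iffD2[OF iff[OF X(1)] x(2)[unfolded X(2)]]])
  qed
  then show ?thesis using True by (auto simp: vrep_rel_def)
qed (auto simp: vrep_rel_def)

text \<open>Multiplying the two given equations leaves \<open>u\<close> and \<open>u'\<close> on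
  both sides; as nothing can be cancelled in a monoid, they are absorbed into the auxiliary element
  together with \<open>x\<close> and \<open>y\<close>.\<close>

lemma (in comm_monoid) difference_trans:
  assumes c: "v \<in> carrier G" "v' \<in> carrier G" "u \<in> carrier G" "u' \<in> carrier G" "t \<in> carrier G" "t' \<in> carrier G"
    "x \<in> carrier G" "y \<in> carrier G"
    and 1: "v \<otimes> u' \<otimes> x = u \<otimes> v' \<otimes> x" and 2: "u \<otimes> t' \<otimes> y = t \<otimes> u' \<otimes> y"
  shows "v \<otimes> t' \<otimes> (u' \<otimes> u \<otimes> x \<otimes> y) = t \<otimes> v' \<otimes> (u' \<otimes> u \<otimes> x \<otimes> y)"
proof -
  have "v \<otimes> t' \<otimes> (u' \<otimes> u \<otimes> x \<otimes> y) = (v \<otimes> u' \<otimes> x) \<otimes> (u \<otimes> t' \<otimes> y)" using c by (simp add: m_ac)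
  also have "\<dots> = (u \<otimes> v' \<otimes> x) \<otimes> (t \<otimes> u' \<otimes> y)" unfolding 1 2 ..
  also have "\<dots> = t \<otimes> v' \<otimes> (u' \<otimes> u \<otimes> x \<otimes> y)" using c by (simp add: m_ac)
  finally show ?thesis .
qed

lemma (in comm_monoid) difference_add:
  assumes c: "v \<in> carrier G" "v' \<in> carrier G" "u \<in> carrier G" "u' \<in> carrier G"
    "a \<in> carrier G" "a' \<in> carrier G" "b \<in> carrier G" "b' \<in> carrier G" "x \<in> carrier G" "y \<in> carrier G"
    and 1: "v \<otimes> u' \<otimes> x = u \<otimes> v' \<otimes> x" and 2: "a \<otimes> b' \<otimes> y = b \<otimes> a' \<otimes> y"
  shows "(v \<otimes> a) \<otimes> (u' \<otimes> b') \<otimes> (x \<otimes> y) = (u \<otimes> b) \<otimes> (v' \<otimes> a') \<otimes> (x \<otimes> y)"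
proof -
  have "(v \<otimes> a) \<otimes> (u' \<otimes> b') \<otimes> (x \<otimes> y) = (v \<otimes> u' \<otimes> x) \<otimes> (a \<otimes> b' \<otimes> y)" using c by (simp add: m_ac)
  also have "\<dots> = (u \<otimes> v' \<otimes> x) \<otimes> (b \<otimes> a' \<otimes> y)" unfolding 1 2 ..
  also have "\<dots> = (u \<otimes> b) \<otimes> (v' \<otimes> a') \<otimes> (x \<otimes> y)" using c by (simp add: m_ac)
  finally show ?thesis .
qed

lemma equiv_vrep_rel: "equiv ({V. is_rep W V} \<times> {V. is_rep W V}) (vrep_rel W)"
proof -
  interpret comm_monoid "rep_monoid W" by (rule comm_monoid_rep_monoid)
  show ?thesis
  proof (rule equivI)
    show "vrep_rel W \<subseteq> ({V. is_rep W V} \<times> {V. is_rep W V}) \<times> ({V. is_rep W V} \<times> {V. is_rep W V})"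
      by (auto simp: vrep_rel_def)
    show "refl_on ({V. is_rep W V} \<times> {V. is_rep W V}) (vrep_rel W)"
    proof (rule refl_onI)
      fix p assume "p \<in> {V. is_rep W V} \<times> {V. is_rep W V}"
      then obtain V V' where p: "p = (V, V')" "is_rep W V" "is_rep W V'" by blast
      show "(p, p) \<in> vrep_rel W" unfolding p(1) vrep_rel_iff by (intro conjI p(2,3) bexI[OF refl one_closed])
    qed
    show "sym (vrep_rel W)"
    proof (rule symI)
      fix p q assume "(p, q) \<in> vrep_rel W"
      then show "(q, p) \<in> vrep_rel W" by (cases p; cases q) (auto simp: vrep_rel_iff intro: sym)
    qed
    show "trans (vrep_rel W)"
    proof (rule transI)
      fix p q z assume pq: "(p, q) \<in> vrep_rel W" and qz: "(q, z) \<in> vrep_rel W"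
      obtain V V' U U' T T' where e: "p = (V, V')" "q = (U, U')" "z = (T, T')" by (cases p; cases q; cases z)
      from pq obtain x where x: "is_rep W V" "is_rep W V'" "is_rep W U" "is_rep W U'" "x \<in> carrier (rep_monoid W)"
        "isocl W V \<otimes>\<^bsub>rep_monoid W\<^esub> isocl W U' \<otimes>\<^bsub>rep_monoid W\<^esub> x = isocl W U \<otimes>\<^bsub>rep_monoid W\<^esub> isocl W V' \<otimes>\<^bsub>rep_monoid W\<^esub> x"
        unfolding e vrep_rel_iff by blast
      from qz obtain y where y: "is_rep W T" "is_rep W T'" "y \<in> carrier (rep_monoid W)"
        "isocl W U \<otimes>\<^bsub>rep_monoid W\<^esub> isocl W T' \<otimes>\<^bsub>rep_monoid W\<^esub> y = isocl W T \<otimes>\<^bsub>rep_monoid W\<^esub> isocl W U' \<otimes>\<^bsub>rep_monoid W\<^esub> y"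
        unfolding e vrep_rel_iff by blast
      note d = difference_trans[OF isocl_closed[OF x(1)] isocl_closed[OF x(2)] isocl_closed[OF x(3)] isocl_closed[OF x(4)]
        isocl_closed[OF y(1)] isocl_closed[OF y(2)] x(5) y(3) x(6) y(4)]
      show "(p, z) \<in> vrep_rel W" unfolding e vrep_rel_iff
        by (intro conjI bexI[of _ "isocl W U' \<otimes>\<^bsub>rep_monoid W\<^esub> isocl W U \<otimes>\<^bsub>rep_monoid W\<^esub> x \<otimes>\<^bsub>rep_monoid W\<^esub> y"]
            d x(1,2,5) y(1-3) m_closed isocl_closed x(3,4))
    qed
  qed
qed

lemma vclass_eq_iff:
  assumes "is_rep W V" "is_rep W V'" "is_rep W U" "is_rep W U'"
  shows "vclass W V V' = vclass W U U' \<longleftrightarrow> ((V, V'), (U, U')) \<in> vrep_rel W"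
  unfolding vclass_def by (rule eq_equiv_class_iff[OF equiv_vrep_rel]) (use assms in simp_all)

lemma mem_vclass_iff:
  assumes "is_rep W V" "is_rep W V'"
  shows "(U, U') \<in> vclass W V V' \<longleftrightarrow> is_rep W U \<and> is_rep W U' \<and> vclass W U U' = vclass W V V'"
proof
  assume "(U, U') \<in> vclass W V V'"
  then have r: "((V, V'), (U, U')) \<in> vrep_rel W" unfolding vclass_def by simp
  then have "is_rep W U" "is_rep W U'" unfolding vrep_rel_iff by blast+
  then show "is_rep W U \<and> is_rep W U' \<and> vclass W U U' = vclass W V V'"
    using vclass_eq_iff[OF assms, of U U'] r by simp
next
  assume U: "is_rep W U \<and> is_rep W U' \<and> vclass W U U' = vclass W V V'"
  then have "((V, V'), (U, U')) \<in> vrep_rel W" using vclass_eq_iff[OF assms, of U U'] by simp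
  then show "(U, U') \<in> vclass W V V'" unfolding vclass_def by simp
qed

lemma vclass_self: "is_rep W V \<Longrightarrow> is_rep W V' \<Longrightarrow> (V, V') \<in> vclass W V V'"
  by (simp add: mem_vclass_iff)

lemma vclass_closed: "is_rep W V \<Longrightarrow> is_rep W V' \<Longrightarrow> vclass W V V' \<in> carrier (VRep W)"
  unfolding VRep_def vclass_def by (auto intro: quotientI)

lemma VRep_cases:
  assumes "X \<in> carrier (VRep W)"
  obtains V V' where "is_rep W V" "is_rep W V'" "X = vclass W V V'"
  using assms unfolding VRep_def by (auto elim!: quotientE simp: vclass_def)

text \<open>Operations on virtual representations are defined as unions over representatives. Once
  the value is the same for all representatives, the union over the non-empty class is that
  value.\<close>

lemma UN_vclass:
  assumes "is_rep W V" "is_rep W V'"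
    and "\<And>U U'. is_rep W U \<Longrightarrow> is_rep W U' \<Longrightarrow> vclass W U U' = vclass W V V' \<Longrightarrow> f U U' = C"
  shows "(\<Union>(U, U')\<in>vclass W V V'. f U U') = C"
proof -
  have C: "f U U' = C" if "(U, U') \<in> vclass W V V'" for U U'
  proof -
    from that have "is_rep W U \<and> is_rep W U' \<and> vclass W U U' = vclass W V V'"
      by (simp only: mem_vclass_iff[OF assms(1,2)])
    then show ?thesis by (intro assms(3)) blast+
  qed
  show ?thesis
  proof (intro equalityI subsetI)
    fix x assume "x \<in> (\<Union>(U, U')\<in>vclass W V V'. f U U')"
    then obtain U U' where "(U, U') \<in> vclass W V V'" "x \<in> f U U'" by blast
    then show "x \<in> C" by (simp only: C)
  next
    fix x assume "x \<in> C"
    then have "x \<in> f V V'" by (simp only: C[OF vclass_self[OF assms(1,2)]])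
    then show "x \<in> (\<Union>(U, U')\<in>vclass W V V'. f U U')" using vclass_self[OF assms(1,2)] by blast
  qed
qed

lemma vclass_sum_cong:
  assumes r: "is_rep W V" "is_rep W V'" "is_rep W U" "is_rep W U'" "is_rep W A" "is_rep W A'" "is_rep W B" "is_rep W B'"
    and "vclass W V V' = vclass W U U'" "vclass W A A' = vclass W B B'"
  shows "vclass W (rep_sum V A) (rep_sum V' A') = vclass W (rep_sum U B) (rep_sum U' B')"
proof -
  interpret comm_monoid "rep_monoid W" by (rule comm_monoid_rep_monoid)
  from assms(9) obtain x where x: "x \<in> carrier (rep_monoid W)"
    "isocl W V \<otimes>\<^bsub>rep_monoid W\<^esub> isocl W U' \<otimes>\<^bsub>rep_monoid W\<^esub> x = isocl W U \<otimes>\<^bsub>rep_monoid W\<^esub> isocl W V' \<otimes>\<^bsub>rep_monoid W\<^esub> x"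
    unfolding vclass_eq_iff[OF r(1-4)] vrep_rel_iff by blast
  from assms(10) obtain y where y: "y \<in> carrier (rep_monoid W)"
    "isocl W A \<otimes>\<^bsub>rep_monoid W\<^esub> isocl W B' \<otimes>\<^bsub>rep_monoid W\<^esub> y = isocl W B \<otimes>\<^bsub>rep_monoid W\<^esub> isocl W A' \<otimes>\<^bsub>rep_monoid W\<^esub> y"
    unfolding vclass_eq_iff[OF r(5-8)] vrep_rel_iff by blast
  note c = isocl_closed[OF r(1)] isocl_closed[OF r(2)] isocl_closed[OF r(3)] isocl_closed[OF r(4)]
    isocl_closed[OF r(5)] isocl_closed[OF r(6)] isocl_closed[OF r(7)] isocl_closed[OF r(8)]
  note s = is_rep_sum[OF r(1,5)] is_rep_sum[OF r(2,6)] is_rep_sum[OF r(3,7)] is_rep_sum[OF r(4,8)]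
  show ?thesis unfolding vclass_eq_iff[OF s] vrep_rel_iff
    isocl_sum[OF r(1,5)] isocl_sum[OF r(2,6)] isocl_sum[OF r(3,7)] isocl_sum[OF r(4,8)]
    by (intro conjI s bexI[of _ "x \<otimes>\<^bsub>rep_monoid W\<^esub> y"] difference_add[OF c(1-4) c(5-8) x(1) y(1) x(2) y(2)]
        m_closed x(1) y(1))
qed

lemma vclass_swap:
  assumes r: "is_rep W V" "is_rep W V'" "is_rep W U" "is_rep W U'" and eq: "vclass W V V' = vclass W U U'"
  shows "vclass W V' V = vclass W U' U"
proof -
  interpret comm_monoid "rep_monoid W" by (rule comm_monoid_rep_monoid)
  from eq obtain x where x: "x \<in> carrier (rep_monoid W)"
    "isocl W V \<otimes>\<^bsub>rep_monoid W\<^esub> isocl W U' \<otimes>\<^bsub>rep_monoid W\<^esub> x = isocl W U \<otimes>\<^bsub>rep_monoid W\<^esub> isocl W V' \<otimes>\<^bsub>rep_monoid W\<^esub> x"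
    unfolding vclass_eq_iff[OF r] vrep_rel_iff by blast
  have "isocl W V' \<otimes>\<^bsub>rep_monoid W\<^esub> isocl W U \<otimes>\<^bsub>rep_monoid W\<^esub> x = isocl W U' \<otimes>\<^bsub>rep_monoid W\<^esub> isocl W V \<otimes>\<^bsub>rep_monoid W\<^esub> x"
    using x r by (simp add: m_ac)
  then show ?thesis unfolding vclass_eq_iff[OF r(2,1,4,3)] vrep_rel_iff using x(1) r by blast
qed

lemma vclass_eqI:
  assumes r: "is_rep W V" "is_rep W V'" "is_rep W U" "is_rep W U'"
    and eq: "isocl W V \<otimes>\<^bsub>rep_monoid W\<^esub> isocl W U' = isocl W U \<otimes>\<^bsub>rep_monoid W\<^esub> isocl W V'"
  shows "vclass W V V' = vclass W U U'"
proof -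
  interpret comm_monoid "rep_monoid W" by (rule comm_monoid_rep_monoid)
  show ?thesis unfolding vclass_eq_iff[OF r] vrep_rel_iff
    using r eq by (intro conjI bexI[of _ "\<one>\<^bsub>rep_monoid W\<^esub>"]) simp_all
qed

section \<open>The additive group of virtual representations\<close>

lemma VRep_add:
  assumes r: "is_rep W V" "is_rep W V'" "is_rep W U" "is_rep W U'"
  shows "vclass W V V' \<oplus>\<^bsub>VRep W\<^esub> vclass W U U' = vclass W (rep_sum V U) (rep_sum V' U')"
proof -
  have "vclass W V V' \<oplus>\<^bsub>VRep W\<^esub> vclass W U U' = (\<Union>(A, A')\<in>vclass W V V'. \<Union>(B, B')\<in>vclass W U U'.
      vclass W (rep_sum A B) (rep_sum A' B'))" by (simp add: VRep_def)
  also have "\<dots> = vclass W (rep_sum V U) (rep_sum V' U')"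
  proof (rule UN_vclass[OF r(1,2)])
    fix A A' assume A: "is_rep W A" "is_rep W A'" "vclass W A A' = vclass W V V'"
    show "(\<Union>(B, B')\<in>vclass W U U'. vclass W (rep_sum A B) (rep_sum A' B')) = vclass W (rep_sum V U) (rep_sum V' U')"
    proof (rule UN_vclass[OF r(3,4)])
      fix B B' assume B: "is_rep W B" "is_rep W B'" "vclass W B B' = vclass W U U'"
      show "vclass W (rep_sum A B) (rep_sum A' B') = vclass W (rep_sum V U) (rep_sum V' U')"
        by (rule vclass_sum_cong[OF A(1,2) r(1,2) B(1,2) r(3,4) A(3) B(3)])
    qed
  qed
  finally show ?thesis .
qed

lemma VRep_zero: "\<zero>\<^bsub>VRep W\<^esub> = vclass W rep_zero rep_zero"
  and VRep_one: "\<one>\<^bsub>VRep W\<^esub> = vclass W rep_triv rep_zero"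
  by (simp_all add: VRep_def)

lemma vclass_same:
  assumes "is_rep W V"
  shows "vclass W V V = \<zero>\<^bsub>VRep W\<^esub>"
proof -
  interpret comm_monoid "rep_monoid W" by (rule comm_monoid_rep_monoid)
  show ?thesis unfolding VRep_zero
    using assms by (intro vclass_eqI is_rep_zero) (simp_all add: isocl_zero)
qed

lemma abelian_group_VRep: "abelian_group (VRep W)"
proof -
  interpret comm_monoid "rep_monoid W" by (rule comm_monoid_rep_monoid)
  show ?thesis
  proof (rule abelian_groupI)
    show "\<zero>\<^bsub>VRep W\<^esub> \<in> carrier (VRep W)" unfolding VRep_zero by (intro vclass_closed is_rep_zero)
  next
    fix X Y assume "X \<in> carrier (VRep W)" "Y \<in> carrier (VRep W)"
    then obtain V V' U U' where r: "is_rep W V" "is_rep W V'" "is_rep W U" "is_rep W U'"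
      and X: "X = vclass W V V'" "Y = vclass W U U'" by (metis VRep_cases)
    show "X \<oplus>\<^bsub>VRep W\<^esub> Y \<in> carrier (VRep W)" unfolding X VRep_add[OF r] by (intro vclass_closed is_rep_sum r)
    show "X \<oplus>\<^bsub>VRep W\<^esub> Y = Y \<oplus>\<^bsub>VRep W\<^esub> X" unfolding X VRep_add[OF r] VRep_add[OF r(3,4,1,2)]
      by (intro vclass_eqI is_rep_sum r) (simp add: isocl_sum r m_ac)
  next
    fix X Y Z assume "X \<in> carrier (VRep W)" "Y \<in> carrier (VRep W)" "Z \<in> carrier (VRep W)"
    then obtain V V' U U' T T' where r: "is_rep W V" "is_rep W V'" "is_rep W U" "is_rep W U'" "is_rep W T" "is_rep W T'"
      and X: "X = vclass W V V'" "Y = vclass W U U'" "Z = vclass W T T'" by (metis VRep_cases)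
    show "X \<oplus>\<^bsub>VRep W\<^esub> Y \<oplus>\<^bsub>VRep W\<^esub> Z = X \<oplus>\<^bsub>VRep W\<^esub> (Y \<oplus>\<^bsub>VRep W\<^esub> Z)"
      unfolding X VRep_add[OF r(1-4)] VRep_add[OF r(3-6)]
        VRep_add[OF is_rep_sum[OF r(1,3)] is_rep_sum[OF r(2,4)] r(5,6)]
        VRep_add[OF r(1,2) is_rep_sum[OF r(3,5)] is_rep_sum[OF r(4,6)]]
      by (intro vclass_eqI is_rep_sum r) (simp add: isocl_sum r is_rep_sum m_ac)
  next
    fix X assume "X \<in> carrier (VRep W)"
    then obtain V V' where r: "is_rep W V" "is_rep W V'" and X: "X = vclass W V V'" by (metis VRep_cases)
    show "\<zero>\<^bsub>VRep W\<^esub> \<oplus>\<^bsub>VRep W\<^esub> X = X" unfolding X VRep_zero VRep_add[OF is_rep_zero is_rep_zero r]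
      by (intro vclass_eqI is_rep_sum is_rep_zero r) (simp add: isocl_sum isocl_zero is_rep_zero r)
    have "vclass W V' V \<oplus>\<^bsub>VRep W\<^esub> X = \<zero>\<^bsub>VRep W\<^esub>"
      unfolding X VRep_zero VRep_add[OF r(2,1) r]
      by (intro vclass_eqI is_rep_sum is_rep_zero r) (simp add: isocl_sum isocl_zero r m_ac)
    then show "\<exists>Y\<in>carrier (VRep W). Y \<oplus>\<^bsub>VRep W\<^esub> X = \<zero>\<^bsub>VRep W\<^esub>" using vclass_closed[OF r(2,1)] by blast
  qed
qed

lemma VRep_minus:
  assumes r: "is_rep W V" "is_rep W V'"
  shows "\<ominus>\<^bsub>VRep W\<^esub> vclass W V V' = vclass W V' V"
proof -
  interpret R: abelian_group "VRep W" by (rule abelian_group_VRep)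
  have "vclass W V' V \<oplus>\<^bsub>VRep W\<^esub> vclass W V V' = vclass W (rep_sum V' V) (rep_sum V V')" by (rule VRep_add[OF r(2,1) r])
  also have "\<dots> = \<zero>\<^bsub>VRep W\<^esub>"
  proof -
    interpret comm_monoid "rep_monoid W" by (rule comm_monoid_rep_monoid)
    show ?thesis unfolding VRep_zero
      by (intro vclass_eqI is_rep_sum is_rep_zero r) (simp add: isocl_sum isocl_zero r m_ac)
  qed
  finally show ?thesis using R.minus_equality[OF _ vclass_closed[OF r] vclass_closed[OF r(2,1)]] by simp
qed

text \<open>The conditions under which a construction on representations descends to formal
  differences; the instances are tensoring with a fixed representation and induction.\<close>

definition additive_functor :: "'g monoid \<Rightarrow> 'h monoid \<Rightarrow> ('g rep \<Rightarrow> 'h rep) \<Rightarrow> bool" where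
  "additive_functor W W' \<Phi> \<longleftrightarrow> (\<forall>V. is_rep W V \<longrightarrow> is_rep W' (\<Phi> V)) \<and>
    (\<forall>V U. is_rep W V \<and> is_rep W U \<and> rep_iso W V U \<longrightarrow> rep_iso W' (\<Phi> V) (\<Phi> U)) \<and>
    (\<forall>V U. is_rep W V \<and> is_rep W U \<longrightarrow> rep_iso W' (\<Phi> (rep_sum V U)) (rep_sum (\<Phi> V) (\<Phi> U)))"

lemma additive_functor_vclass:
  assumes \<Phi>: "additive_functor W W' \<Phi>" and r: "is_rep W V" "is_rep W V'" "is_rep W U" "is_rep W U'"
    and eq: "vclass W V V' = vclass W U U'"
  shows "vclass W' (\<Phi> V) (\<Phi> V') = vclass W' (\<Phi> U) (\<Phi> U')"
proof -
  have rep: "is_rep W' (\<Phi> V)" if "is_rep W V" for V using \<Phi> that unfolding additive_functor_def by blast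
  have cong: "isocl W' (\<Phi> V) = isocl W' (\<Phi> U)" if "is_rep W V" "is_rep W U" "isocl W V = isocl W U" for V U
    using \<Phi> that isocl_eq_iff[OF that(1,2)] isocl_eq_iff[OF rep[OF that(1)] rep[OF that(2)]] unfolding additive_functor_def by blast
  have sum: "isocl W' (\<Phi> (rep_sum V U)) = isocl W' (\<Phi> V) \<otimes>\<^bsub>rep_monoid W'\<^esub> isocl W' (\<Phi> U)"
    if "is_rep W V" "is_rep W U" for V U
    unfolding isocl_sum[OF rep[OF that(1)] rep[OF that(2)], symmetric]
    using \<Phi> that isocl_eq_iff[OF rep[OF is_rep_sum[OF that]] is_rep_sum[OF rep[OF that(1)] rep[OF that(2)]]]
    unfolding additive_functor_def by blast
  from eq have "((V, V'), (U, U')) \<in> vrep_rel W" using vclass_eq_iff[OF r] by simp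
  then obtain X where X: "is_rep W X" "rep_iso W (rep_sum (rep_sum V U') X) (rep_sum (rep_sum U V') X)"
    unfolding vrep_rel_def by blast
  note s = is_rep_sum[OF r(1,4)] is_rep_sum[OF r(3,2)]
  have "isocl W (rep_sum (rep_sum V U') X) = isocl W (rep_sum (rep_sum U V') X)"
    using isocl_eq_iff[OF is_rep_sum[OF s(1) X(1)] is_rep_sum[OF s(2) X(1)]] X(2) by simp
  from cong[OF is_rep_sum[OF s(1) X(1)] is_rep_sum[OF s(2) X(1)] this]
  have "isocl W' (\<Phi> V) \<otimes>\<^bsub>rep_monoid W'\<^esub> isocl W' (\<Phi> U') \<otimes>\<^bsub>rep_monoid W'\<^esub> isocl W' (\<Phi> X) =
      isocl W' (\<Phi> U) \<otimes>\<^bsub>rep_monoid W'\<^esub> isocl W' (\<Phi> V') \<otimes>\<^bsub>rep_monoid W'\<^esub> isocl W' (\<Phi> X)"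
    unfolding sum[OF s(1) X(1)] sum[OF s(2) X(1)] sum[OF r(1,4)] sum[OF r(3,2)] .
  then show ?thesis unfolding vclass_eq_iff[OF rep[OF r(1)] rep[OF r(2)] rep[OF r(3)] rep[OF r(4)]] vrep_rel_iff
    using rep r isocl_closed[OF rep[OF X(1)]] by blast
qed

lemma additive_functor_tensor:
  assumes "is_rep W A"
  shows "additive_functor W W (\<lambda>V. rep_tensor V A)"
  unfolding additive_functor_def
  using is_rep_tensor[OF _ assms] rep_tensor_cong_left[OF _ _ assms] rep_tensor_sum_left[OF _ _ assms] by blast

text \<open>With the summands of the negative part in the other order, the product is the sum of the
  image of \<open>V - V'\<close> under tensoring with \<open>A\<close> and the image of
  \<open>V' - V\<close> under tensoring with \<open>A'\<close>; both are well defined by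
  additivity.\<close>

lemma vclass_tensor_left:
  assumes r: "is_rep W V" "is_rep W V'" "is_rep W T" "is_rep W T'" and A: "is_rep W A" "is_rep W A'"
    and eq: "vclass W V V' = vclass W T T'"
  shows "vclass W (rep_sum (rep_tensor V A) (rep_tensor V' A')) (rep_sum (rep_tensor V A') (rep_tensor V' A)) =
    vclass W (rep_sum (rep_tensor T A) (rep_tensor T' A')) (rep_sum (rep_tensor T A') (rep_tensor T' A))"
proof -
  interpret comm_monoid "rep_monoid W" by (rule comm_monoid_rep_monoid)
  have split: "vclass W (rep_sum (rep_tensor V A) (rep_tensor V' A')) (rep_sum (rep_tensor V A') (rep_tensor V' A)) =
    vclass W (rep_sum (rep_tensor V A) (rep_tensor V' A')) (rep_sum (rep_tensor V' A) (rep_tensor V A'))"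
    if "is_rep W V" "is_rep W V'" for V V'
    using that A by (intro vclass_eqI is_rep_sum is_rep_tensor) (simp_all add: isocl_sum is_rep_tensor m_ac)
  note t = is_rep_tensor[OF r(1) A(1)] is_rep_tensor[OF r(2) A(1)] is_rep_tensor[OF r(3) A(1)] is_rep_tensor[OF r(4) A(1)]
    is_rep_tensor[OF r(1) A(2)] is_rep_tensor[OF r(2) A(2)] is_rep_tensor[OF r(3) A(2)] is_rep_tensor[OF r(4) A(2)]
  show ?thesis unfolding split[OF r(1,2)] split[OF r(3,4)]
  proof (rule vclass_sum_cong[OF t(1-4) t(6,5) t(8,7)])
    show "vclass W (rep_tensor V A) (rep_tensor V' A) = vclass W (rep_tensor T A) (rep_tensor T' A)"
      by (rule additive_functor_vclass[OF additive_functor_tensor[OF A(1)] r eq])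
    show "vclass W (rep_tensor V' A') (rep_tensor V A') = vclass W (rep_tensor T' A') (rep_tensor T A')"
      by (rule vclass_swap[OF t(5-8) additive_functor_vclass[OF additive_functor_tensor[OF A(2)] r eq]])
  qed
qed

lemma isocl_zero_tensor:
  assumes "is_rep W A"
  shows "isocl W (rep_tensor rep_zero A) = \<one>\<^bsub>rep_monoid W\<^esub>"
proof -
  obtain n \<rho> where A: "A = (n, \<rho>)" by (cases A)
  have "is_rep W (rep_tensor rep_zero A)" using is_rep_tensor[OF is_rep_zero assms] .
  then show ?thesis unfolding A rep_zero_def rep_tensor_pair by (simp add: isocl_dim0)
qed

lemma isocl_triv_tensor:
  assumes "is_rep W A"
  shows "isocl W (rep_tensor rep_triv A) = isocl W A"
  using isocl_eq_iff[OF assms is_rep_tensor[OF is_rep_triv assms]] rep_tensor_triv[OF assms] by simp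

text \<open>The representatives of the left factor may be fixed in advance, so a product with one or
  zero reduces to a computation valid for every representative of \<open>X\<close>.\<close>

lemma VRep_mult_left:
  assumes T: "is_rep W T" "is_rep W T'" and X: "X = vclass W A A'" "is_rep W A" "is_rep W A'"
    and eq: "\<And>B B'. is_rep W B \<Longrightarrow> is_rep W B' \<Longrightarrow> vclass W B B' = vclass W A A' \<Longrightarrow>
      vclass W (rep_sum (rep_tensor T B) (rep_tensor T' B')) (rep_sum (rep_tensor T B') (rep_tensor T' B)) = Y"
  shows "vclass W T T' \<otimes>\<^bsub>VRep W\<^esub> X = Y"
proof -
  have "vclass W T T' \<otimes>\<^bsub>VRep W\<^esub> X = (\<Union>(V, V')\<in>vclass W T T'. \<Union>(B, B')\<in>vclass W A A'.
     vclass W (rep_sum (rep_tensor V B) (rep_tensor V' B')) (rep_sum (rep_tensor V B') (rep_tensor V' B)))"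
    unfolding X(1) by (simp add: VRep_def)
  also have "\<dots> = Y"
  proof (rule UN_vclass[OF T])
    fix V V' assume V: "is_rep W V" "is_rep W V'" "vclass W V V' = vclass W T T'"
    show "(\<Union>(B, B')\<in>vclass W A A'.
      vclass W (rep_sum (rep_tensor V B) (rep_tensor V' B')) (rep_sum (rep_tensor V B') (rep_tensor V' B))) = Y"
    proof (rule UN_vclass[OF X(2,3)])
      fix B B' assume B: "is_rep W B" "is_rep W B'" "vclass W B B' = vclass W A A'"
      show "vclass W (rep_sum (rep_tensor V B) (rep_tensor V' B')) (rep_sum (rep_tensor V B') (rep_tensor V' B)) = Y"
        unfolding vclass_tensor_left[OF V(1,2) T B(1,2) V(3)] by (rule eq[OF B])
    qed
  qed
  finally show ?thesis .
qed

lemma VRep_one_mult: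
  assumes "X \<in> carrier (VRep W)"
  shows "\<one>\<^bsub>VRep W\<^esub> \<otimes>\<^bsub>VRep W\<^esub> X = X"
proof -
  interpret comm_monoid "rep_monoid W" by (rule comm_monoid_rep_monoid)
  obtain A A' where X: "is_rep W A" "is_rep W A'" "X = vclass W A A'" using VRep_cases[OF assms] .
  show ?thesis unfolding VRep_one
  proof (rule VRep_mult_left[OF is_rep_triv is_rep_zero X(3,1,2)])
    fix B B' assume B: "is_rep W B" "is_rep W B'" "vclass W B B' = vclass W A A'"
    show "vclass W (rep_sum (rep_tensor rep_triv B) (rep_tensor rep_zero B')) (rep_sum (rep_tensor rep_triv B') (rep_tensor rep_zero B)) = X"
      unfolding X(3) B(3)[symmetric]
      by (intro vclass_eqI is_rep_sum is_rep_tensor is_rep_triv is_rep_zero B(1,2))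
        (simp add: isocl_sum is_rep_tensor is_rep_triv is_rep_zero B(1,2) isocl_zero_tensor isocl_triv_tensor)
  qed
qed

lemma VRep_zero_mult:
  assumes "X \<in> carrier (VRep W)"
  shows "\<zero>\<^bsub>VRep W\<^esub> \<otimes>\<^bsub>VRep W\<^esub> X = \<zero>\<^bsub>VRep W\<^esub>"
proof -
  interpret comm_monoid "rep_monoid W" by (rule comm_monoid_rep_monoid)
  obtain A A' where X: "is_rep W A" "is_rep W A'" "X = vclass W A A'" using VRep_cases[OF assms] .
  show ?thesis unfolding VRep_zero
  proof (rule VRep_mult_left[OF is_rep_zero is_rep_zero X(3,1,2)])
    fix B B' assume B: "is_rep W B" "is_rep W B'" "vclass W B B' = vclass W A A'"
    show "vclass W (rep_sum (rep_tensor rep_zero B) (rep_tensor rep_zero B')) (rep_sum (rep_tensor rep_zero B') (rep_tensor rep_zero B)) =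
      vclass W rep_zero rep_zero"
      by (intro vclass_eqI is_rep_sum is_rep_tensor is_rep_zero B(1,2))
        (simp add: isocl_sum is_rep_tensor is_rep_zero B(1,2) isocl_zero_tensor isocl_zero)
  qed
qed

lemma VRep_one_closed: "\<one>\<^bsub>VRep W\<^esub> \<in> carrier (VRep W)"
  unfolding VRep_one by (intro vclass_closed is_rep_triv is_rep_zero)

context induction_setup
begin

lemma vind_vclass:
  assumes r: "is_rep WH V" "is_rep WH V'"
  shows "vind W H (vclass WH V V') = vclass W (rep_ind W H V) (rep_ind W H V')"
  unfolding vind_def
proof (rule UN_vclass[OF r])
  fix U U' assume U: "is_rep WH U" "is_rep WH U'" "vclass WH U U' = vclass WH V V'"
  have "additive_functor WH W (rep_ind W H)"
    unfolding additive_functor_def using is_rep_ind rep_ind_cong rep_ind_sum by blast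
  then show "vclass W (rep_ind W H U) (rep_ind W H U') = vclass W (rep_ind W H V) (rep_ind W H V')"
    using additive_functor_vclass U r by blast
qed

lemma vind_closed: "X \<in> carrier (VRep WH) \<Longrightarrow> vind W H X \<in> carrier (VRep W)"
  by (elim VRep_cases) (simp add: vind_vclass vclass_closed is_rep_ind)

lemma vind_zero: "vind W H \<zero>\<^bsub>VRep WH\<^esub> = \<zero>\<^bsub>VRep W\<^esub>"
  unfolding VRep_zero[of WH] vind_vclass[OF is_rep_zero is_rep_zero] by (rule vclass_same[OF is_rep_ind[OF is_rep_zero]])

end

lemma induction_setup_self:
  assumes "group W"
  shows "induction_setup W (carrier W)"
proof -
  interpret group W by fact
  have "g <#\<^bsub>W\<^esub> carrier W = carrier W" if "g \<in> carrier W" for g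
    using that coset_join3[OF that subgroup_self] by simp
  then have "(\<lambda>g. g <#\<^bsub>W\<^esub> carrier W) ` carrier W \<subseteq> {carrier W}" by blast
  then have "finite ((\<lambda>g. g <#\<^bsub>W\<^esub> carrier W) ` carrier W)" using finite_subset by blast
  then show ?thesis by (intro induction_setup.intro induction_setup_axioms.intro is_group subgroup_self)
qed

text \<open>Serves the term of the empty flat in the Z-polynomial, whose stabilizer is the whole
  group.\<close>

lemma vind_self:
  assumes "group W" "X \<in> carrier (VRep W)"
  shows "vind W (carrier W) X = X"
proof -
  interpret induction_setup W "carrier W" by (rule induction_setup_self[OF assms(1)])
  obtain V V' where X: "is_rep W V" "is_rep W V'" "X = vclass W V V'" using VRep_cases[OF assms(2)] .
  have "isocl W (rep_ind W (carrier W) V) = isocl W V" if "is_rep W V" for V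
  proof -
    have "is_rep W (rep_ind W (carrier W) V)" using is_rep_ind[of V] that by simp
    then show ?thesis using isocl_eq_iff[OF that] rep_ind_self[OF assms(1) that] by blast
  qed
  then have "vclass W (rep_ind W (carrier W) V) (rep_ind W (carrier W) V') = vclass W V V'"
    using X is_rep_ind by (intro vclass_eqI) simp_all
  then show ?thesis using X vind_vclass by simp
qed


subsection \<open>Characters of virtual representations\<close>

definition vch :: "'g vrep \<Rightarrow> 'g \<Rightarrow> rat" where
  "vch X g = (case SOME p. p \<in> X of (V, V') \<Rightarrow> rchar V g - rchar V' g)"

lemma rchar_diff_cong:
  assumes r: "is_rep W V" "is_rep W V'" "is_rep W U" "is_rep W U'" and eq: "vclass W V V' = vclass W U U'"
    and g: "g \<in> carrier W"
  shows "rchar V g - rchar V' g = rchar U g - rchar U' g"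
proof -
  from eq have "((V, V'), (U, U')) \<in> vrep_rel W" using vclass_eq_iff[OF r] by simp
  then obtain X where X: "is_rep W X" "rep_iso W (rep_sum (rep_sum V U') X) (rep_sum (rep_sum U V') X)"
    unfolding vrep_rel_def by blast
  note s = is_rep_sum[OF r(1,4)] is_rep_sum[OF r(3,2)]
  from rchar_iso[OF is_rep_sum[OF s(1) X(1)] is_rep_sum[OF s(2) X(1)] X(2) g] show ?thesis
    unfolding rchar_sum[OF s(1) X(1) g] rchar_sum[OF s(2) X(1) g] rchar_sum[OF r(1,4) g] rchar_sum[OF r(3,2) g]
    by simp
qed

lemma vch_vclass:
  assumes r: "is_rep W V" "is_rep W V'" and g: "g \<in> carrier W"
  shows "vch (vclass W V V') g = rchar V g - rchar V' g"
proof -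
  obtain U U' where U: "(SOME p. p \<in> vclass W V V') = (U, U')" by (cases "SOME p. p \<in> vclass W V V'")
  have "\<exists>p. p \<in> vclass W V V'" using vclass_self[OF r] by blast
  then have "(U, U') \<in> vclass W V V'" unfolding U[symmetric] by (rule someI_ex)
  then have "is_rep W U" "is_rep W U'" "vclass W U U' = vclass W V V'" using mem_vclass_iff[OF r] by auto
  then show ?thesis unfolding vch_def U using rchar_diff_cong[OF _ _ r _ g] by simp
qed

lemma vch_add:
  assumes "X \<in> carrier (VRep W)" "Y \<in> carrier (VRep W)" "g \<in> carrier W"
  shows "vch (X \<oplus>\<^bsub>VRep W\<^esub> Y) g = vch X g + vch Y g"
proof -
  obtain V V' where r: "is_rep W V" "is_rep W V'" and X: "X = vclass W V V'" using VRep_cases[OF assms(1)] .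
  obtain U U' where r': "is_rep W U" "is_rep W U'" and Y: "Y = vclass W U U'" using VRep_cases[OF assms(2)] .
  show ?thesis unfolding X Y VRep_add[OF r r']
    using assms(3) r r' by (simp add: vch_vclass is_rep_sum rchar_sum)
qed

lemma vch_zero: "g \<in> carrier W \<Longrightarrow> vch \<zero>\<^bsub>VRep W\<^esub> g = 0"
  unfolding VRep_zero by (simp add: vch_vclass is_rep_zero)

lemma vch_one: "g \<in> carrier W \<Longrightarrow> vch \<one>\<^bsub>VRep W\<^esub> g = 1"
  unfolding VRep_one vch_vclass[OF is_rep_triv is_rep_zero]
  by (simp add: vch_vclass[OF is_rep_triv is_rep_zero] rep_triv_def[THEN arg_cong[of _ _ rchar]]
      rep_zero_def[THEN arg_cong[of _ _ rchar]] rchar_pair mtrace_def)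

lemma vch_minus:
  assumes "X \<in> carrier (VRep W)" "Y \<in> carrier (VRep W)" "g \<in> carrier W"
  shows "vch (X \<ominus>\<^bsub>VRep W\<^esub> Y) g = vch X g - vch Y g"
proof -
  interpret R: abelian_group "VRep W" by (rule abelian_group_VRep)
  obtain U U' where r': "is_rep W U" "is_rep W U'" and Y: "Y = vclass W U U'" using VRep_cases[OF assms(2)] .
  have "vch (\<ominus>\<^bsub>VRep W\<^esub> Y) g = - vch Y g" unfolding Y VRep_minus[OF r'] using assms(3) r' by (simp add: vch_vclass)
  then show ?thesis unfolding a_minus_def using assms by (simp add: vch_add)
qed

lemma vch_finsum:
  assumes "finite A" "f \<in> A \<rightarrow> carrier (VRep W)" "g \<in> carrier W"
  shows "vch (finsum (VRep W) f A) g = (\<Sum>a\<in>A. vch (f a) g)"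
proof -
  interpret R: abelian_group "VRep W" by (rule abelian_group_VRep)
  show ?thesis using assms(1,2)
  proof (induction A rule: finite_induct)
    case empty
    then show ?case using vch_zero[OF assms(3)] by simp
  next
    case (insert a A)
    then have "f \<in> A \<rightarrow> carrier (VRep W)" "f a \<in> carrier (VRep W)" by auto
    then show ?case using insert assms(3) by (simp add: R.finsum_insert vch_add)
  qed
qed

text \<open>Moving the negative parts across turns equal differences of characters into equal
  characters of the representations \<open>rep_sum V U'\<close> and \<open>rep_sum U V'\<close>,
  which are then isomorphic.\<close>

lemma (in finite_group) vch_inject:
  assumes "X \<in> carrier (VRep W)" "Y \<in> carrier (VRep W)" "\<And>g. g \<in> carrier W \<Longrightarrow> vch X g = vch Y g"
  shows "X = Y"
proof -
  obtain V V' where r: "is_rep W V" "is_rep W V'" and X: "X = vclass W V V'" using VRep_cases[OF assms(1)] .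
  obtain U U' where r': "is_rep W U" "is_rep W U'" and Y: "Y = vclass W U U'" using VRep_cases[OF assms(2)] .
  have "rep_iso W (rep_sum V U') (rep_sum U V')"
  proof (rule rep_iso_if_rchar_eq)
    fix g assume g: "g \<in> carrier W"
    show "rchar (rep_sum V U') g = rchar (rep_sum U V') g"
      unfolding rchar_sum[OF r(1) r'(2) g] rchar_sum[OF r'(1) r(2) g]
      using assms(3)[OF g] unfolding X Y vch_vclass[OF r g] vch_vclass[OF r' g] by simp
  qed (intro is_rep_sum r r')+
  then show ?thesis unfolding X Y
    using r r' isocl_eq_iff[OF is_rep_sum[OF r(1) r'(2)] is_rep_sum[OF r'(1) r(2)]]
    by (intro vclass_eqI) (simp_all add: isocl_sum)
qed

lemma (in induction_setup) vch_vind: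
  assumes "X \<in> carrier (VRep WH)" "g \<in> carrier W"
  shows "vch (vind W H X) g = (\<Sum>a<length ts. if conj a g a \<in> H then vch X (conj a g a) else 0)"
proof -
  obtain V V' where r: "is_rep WH V" "is_rep WH V'" and X: "X = vclass WH V V'" using VRep_cases[OF assms(1)] .
  have "vch (vind W H X) g = rchar (rep_ind W H V) g - rchar (rep_ind W H V') g"
    unfolding X vind_vclass[OF r] by (rule vch_vclass[OF is_rep_ind[OF r(1)] is_rep_ind[OF r(2)] assms(2)])
  also have "\<dots> = (\<Sum>a<length ts. if conj a g a \<in> H then vch X (conj a g a) else 0)"
    unfolding rchar_ind[OF r(1)] rchar_ind[OF r(2)] sum_subtractf[symmetric]
  proof (rule sum.cong[OF refl])
    fix a
    show "(if conj a g a \<in> H then rchar V (conj a g a) else 0) - (if conj a g a \<in> H then rchar V' (conj a g a) else 0) =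
      (if conj a g a \<in> H then vch X (conj a g a) else 0)"
      unfolding X using vch_vclass[OF r, of "conj a g a"] by simp
  qed
  finally show ?thesis .
qed

lemma finite_group_DirProd:
  assumes "finite_group G" "finite_group H"
  shows "finite_group (G \<times>\<times> H)"
proof -
  interpret G: finite_group G by fact
  interpret H: finite_group H by fact
  show ?thesis using DirProd_group[OF G.is_group H.is_group] G.fin H.fin
    by (intro finite_group.intro finite_group_axioms.intro) (auto simp: DirProd_def)
qed

text \<open>Independence of the representatives is obtained from the characters: over a finite group
  a class is determined by its character, here a product of values that depend on \<open>X\<close>
  and \<open>Y\<close> alone.\<close>

lemma vext_tensor_char:
  assumes fin: "finite_group G" "finite_group H" and X: "X \<in> carrier (VRep G)" and Y: "Y \<in> carrier (VRep H)"
  shows "vext_tensor G H X Y \<in> carrier (VRep (G \<times>\<times> H))"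
    "g \<in> carrier G \<Longrightarrow> h \<in> carrier H \<Longrightarrow> vch (vext_tensor G H X Y) (g, h) = vch X g * vch Y h"
proof -
  let ?W = "G \<times>\<times> H"
  interpret W: finite_group ?W by (rule finite_group_DirProd[OF fin])
  obtain V V' where r: "is_rep G V" "is_rep G V'" and XV: "X = vclass G V V'" using VRep_cases[OF X] .
  obtain U U' where r': "is_rep H U" "is_rep H U'" and YU: "Y = vclass H U U'" using VRep_cases[OF Y] .
  define C where "C V V' U U' = vclass ?W (rep_sum (rep_ext_tensor V U) (rep_ext_tensor V' U'))
    (rep_sum (rep_ext_tensor V U') (rep_ext_tensor V' U))" for V V' U U'
  have rep: "is_rep ?W (rep_sum (rep_ext_tensor V U) (rep_ext_tensor V' U'))"
      "is_rep ?W (rep_sum (rep_ext_tensor V U') (rep_ext_tensor V' U))"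
    if "is_rep G V" "is_rep G V'" "is_rep H U" "is_rep H U'" for V V' U U'
    using that by (auto intro: is_rep_sum is_rep_ext_tensor)
  have closed: "C V V' U U' \<in> carrier (VRep ?W)" if "is_rep G V" "is_rep G V'" "is_rep H U" "is_rep H U'" for V V' U U'
    unfolding C_def using rep[OF that] by (rule vclass_closed)
  have char: "vch (C V V' U U') (g, h) = vch (vclass G V V') g * vch (vclass H U U') h"
    if "is_rep G V" "is_rep G V'" "is_rep H U" "is_rep H U'" and g: "g \<in> carrier G" and h: "h \<in> carrier H" for V V' U U' g h
  proof -
    have gh: "(g, h) \<in> carrier ?W" using g h by (simp add: DirProd_def)
    show ?thesis unfolding C_def vch_vclass[OF rep[OF that(1-4)] gh] vch_vclass[OF that(1,2) g] vch_vclass[OF that(3,4) h]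
      unfolding rchar_sum[OF is_rep_ext_tensor[OF that(1,3)] is_rep_ext_tensor[OF that(2,4)] gh]
        rchar_sum[OF is_rep_ext_tensor[OF that(1,4)] is_rep_ext_tensor[OF that(2,3)] gh]
        rchar_ext_tensor[OF that(1,3) g h] rchar_ext_tensor[OF that(2,4) g h]
        rchar_ext_tensor[OF that(1,4) g h] rchar_ext_tensor[OF that(2,3) g h]
      by (simp add: algebra_simps)
  qed
  have "vext_tensor G H X Y = C V V' U U'"
    unfolding vext_tensor_def XV YU C_def[symmetric]
  proof (rule UN_vclass[OF r])
    fix A A' assume A: "is_rep G A" "is_rep G A'" "vclass G A A' = vclass G V V'"
    show "(\<Union>(B, B')\<in>vclass H U U'. C A A' B B') = C V V' U U'"
    proof (rule UN_vclass[OF r'])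
      fix B B' assume B: "is_rep H B" "is_rep H B'" "vclass H B B' = vclass H U U'"
      show "C A A' B B' = C V V' U U'"
      proof (rule W.vch_inject[OF closed[OF A(1,2) B(1,2)] closed[OF r r']])
        fix w assume "w \<in> carrier ?W"
        then obtain g h where w: "w = (g, h)" and gh: "g \<in> carrier G" "h \<in> carrier H" by (auto simp: DirProd_def)
        show "vch (C A A' B B') w = vch (C V V' U U') w"
          unfolding w char[OF A(1,2) B(1,2) gh] char[OF r r' gh] A(3) B(3) ..
      qed
    qed
  qed
  then show "vext_tensor G H X Y \<in> carrier (VRep ?W)"
    "g \<in> carrier G \<Longrightarrow> h \<in> carrier H \<Longrightarrow> vch (vext_tensor G H X Y) (g, h) = vch X g * vch Y h"
    using closed[OF r r'] char[OF r r'] XV YU by auto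
qed


subsection \<open>Graded virtual representations\<close>

context
  fixes R :: "('a, 'b) ring_scheme" (structure)
  assumes R: "abelian_group R"
begin

interpretation R: abelian_group R by (rule R)

lemma up_memI: "(\<And>i. p i \<in> carrier R) \<Longrightarrow> (\<And>i. i > n \<Longrightarrow> p i = \<zero>) \<Longrightarrow> p \<in> carrier (UP R)"
  by (auto simp: UP_def up_def bound_def)

lemma up_memD:
  assumes "p \<in> carrier (UP R)"
  shows "p i \<in> carrier R" "\<exists>n. \<forall>i>n. p i = \<zero>"
  using assms by (auto simp: UP_def up_def bound_def)

lemma up_coeff: "p \<in> carrier (UP R) \<Longrightarrow> up_ring.coeff (UP R) p k = p k"
  by (simp add: UP_def)

lemma up_add: "p \<in> carrier (UP R) \<Longrightarrow> q \<in> carrier (UP R) \<Longrightarrow> p \<oplus>\<^bsub>UP R\<^esub> q = (\<lambda>i. p i \<oplus> q i)"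
  by (simp add: UP_def)

lemma up_zero: "\<zero>\<^bsub>UP R\<^esub> = (\<lambda>i. \<zero>)"
  by (simp add: UP_def)

lemma up_one: "\<one>\<^bsub>UP R\<^esub> = (\<lambda>i. if i = 0 then \<one> else \<zero>)"
  by (simp add: UP_def)

lemma abelian_group_UP: "abelian_group (UP R)"
proof (rule abelian_groupI)
  fix p q assume p: "p \<in> carrier (UP R)" and q: "q \<in> carrier (UP R)"
  obtain n m where nm: "\<forall>i>n. p i = \<zero>" "\<forall>i>m. q i = \<zero>" using up_memD(2)[OF p] up_memD(2)[OF q] by blast
  show "p \<oplus>\<^bsub>UP R\<^esub> q \<in> carrier (UP R)" unfolding up_add[OF p q]
    by (rule up_memI[of _ "max n m"]) (use nm up_memD(1)[OF p] up_memD(1)[OF q] in auto)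
  show "p \<oplus>\<^bsub>UP R\<^esub> q = q \<oplus>\<^bsub>UP R\<^esub> p" unfolding up_add[OF p q] up_add[OF q p]
    using up_memD(1)[OF p] up_memD(1)[OF q] by (simp add: R.a_comm)
  fix s assume s: "s \<in> carrier (UP R)"
  have closed: "(\<lambda>i. p i \<oplus> q i) \<in> carrier (UP R)" if p: "p \<in> carrier (UP R)" and q: "q \<in> carrier (UP R)" for p q
  proof -
    obtain n m where nm: "\<forall>i>n. p i = \<zero>" "\<forall>i>m. q i = \<zero>" using up_memD(2)[OF p] up_memD(2)[OF q] by blast
    show ?thesis
      by (rule up_memI[of _ "max n m"]) (use nm up_memD(1)[OF p] up_memD(1)[OF q] in auto)
  qed
  show "p \<oplus>\<^bsub>UP R\<^esub> q \<oplus>\<^bsub>UP R\<^esub> s = p \<oplus>\<^bsub>UP R\<^esub> (q \<oplus>\<^bsub>UP R\<^esub> s)"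
    unfolding up_add[OF p q] up_add[OF q s] up_add[OF closed[OF p q] s] up_add[OF p closed[OF q s]]
    using up_memD(1)[OF p] up_memD(1)[OF q] up_memD(1)[OF s] by (simp add: R.a_assoc)
next
  show 0: "\<zero>\<^bsub>UP R\<^esub> \<in> carrier (UP R)" unfolding up_zero by (rule up_memI[of _ 0]) auto
  fix p assume p: "p \<in> carrier (UP R)"
  show "\<zero>\<^bsub>UP R\<^esub> \<oplus>\<^bsub>UP R\<^esub> p = p" using up_add[OF 0 p] up_memD(1)[OF p] by (simp add: up_zero)
  obtain n where n: "\<forall>i>n. p i = \<zero>" using up_memD(2)[OF p] by blast
  have q: "(\<lambda>i. \<ominus> p i) \<in> carrier (UP R)" by (rule up_memI[of _ n]) (use n up_memD(1)[OF p] in auto)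
  have "(\<lambda>i. \<ominus> p i) \<oplus>\<^bsub>UP R\<^esub> p = \<zero>\<^bsub>UP R\<^esub>"
    unfolding up_add[OF q p] up_zero using up_memD(1)[OF p] by (simp add: R.l_neg)
  then show "\<exists>q\<in>carrier (UP R). q \<oplus>\<^bsub>UP R\<^esub> p = \<zero>\<^bsub>UP R\<^esub>" using q by blast
qed

interpretation U: abelian_group "UP R" by (rule abelian_group_UP)

lemma up_minus:
  assumes p: "p \<in> carrier (UP R)" and q: "q \<in> carrier (UP R)"
  shows "(p \<ominus>\<^bsub>UP R\<^esub> q) i = p i \<ominus> q i"
proof -
  have "\<ominus>\<^bsub>UP R\<^esub> q \<oplus>\<^bsub>UP R\<^esub> q = \<zero>\<^bsub>UP R\<^esub>" using q by (rule U.l_neg)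
  then have "(\<ominus>\<^bsub>UP R\<^esub> q) i \<oplus> q i = \<zero>" unfolding up_add[OF U.a_inv_closed[OF q] q] up_zero by (rule fun_cong)
  then have "(\<ominus>\<^bsub>UP R\<^esub> q) i = \<ominus> q i"
    using R.minus_equality[OF _ up_memD(1)[OF q] up_memD(1)[OF U.a_inv_closed[OF q]]] by simp
  then show ?thesis unfolding a_minus_def up_add[OF p U.a_inv_closed[OF q]] by simp
qed

lemma up_finsum:
  assumes "finite A" "f \<in> A \<rightarrow> carrier (UP R)"
  shows "finsum (UP R) f A k = (\<Oplus>a\<in>A. f a k)"
  using assms
proof (induction A rule: finite_induct)
  case empty
  then show ?case by (simp add: up_zero)
next
  case (insert a A)
  then have f: "f \<in> A \<rightarrow> carrier (UP R)" "f a \<in> carrier (UP R)" by auto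
  have fk: "(\<lambda>a. f a k) \<in> A \<rightarrow> carrier R" "f a k \<in> carrier R" using up_memD(1) f by auto
  show ?case using insert f fk by (simp add: U.finsum_insert R.finsum_insert up_add[OF f(2) U.finsum_closed[OF f(1)]])
qed

text \<open>In the convolution with a power of x every left factor is one or zero, so the two
  multiplication rules assumed here evaluate it, although \<open>R\<close> is known only to be an
  additive group.\<close>

lemma up_monom_mult:
  assumes one: "\<one> \<in> carrier R" and mult: "\<And>x. x \<in> carrier R \<Longrightarrow> \<one> \<otimes> x = x" "\<And>x. x \<in> carrier R \<Longrightarrow> \<zero> \<otimes> x = \<zero>"
    and p: "p \<in> carrier (UP R)"
  shows "up_ring.monom (UP R) \<one> j \<otimes>\<^bsub>UP R\<^esub> p = (\<lambda>k. if j \<le> k then p (k - j) else \<zero>)"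
    and "up_ring.monom (UP R) \<one> j \<otimes>\<^bsub>UP R\<^esub> p \<in> carrier (UP R)"
proof -
  let ?m = "\<lambda>i. if i = j then \<one> else \<zero>"
  have m: "up_ring.monom (UP R) \<one> j = ?m" using one by (simp add: UP_def)
  have mc: "?m \<in> carrier (UP R)" by (rule up_memI[of _ j]) (use one in auto)
  note pc = up_memD(1)[OF p]
  have "(up_ring.monom (UP R) \<one> j \<otimes>\<^bsub>UP R\<^esub> p) k = (if j \<le> k then p (k - j) else \<zero>)" for k
  proof -
    have "(up_ring.monom (UP R) \<one> j \<otimes>\<^bsub>UP R\<^esub> p) k = (\<Oplus>i\<in>{..k}. ?m i \<otimes> p (k - i))"
      unfolding m using mc p by (simp add: UP_def)
    also have "\<dots> = (\<Oplus>i\<in>{..k}. if j = i then p (k - i) else \<zero>)"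
      using pc by (intro R.finsum_cong') (auto simp: mult)
    also have "\<dots> = (if j \<le> k then p (k - j) else \<zero>)"
    proof (cases "j \<le> k")
      case True
      then show ?thesis using R.finsum_singleton[of j "{..k}" "\<lambda>i. p (k - i)"] pc by simp
    next
      case False
      have "(\<Oplus>i\<in>{..k}. if j = i then p (k - i) else \<zero>) = (\<Oplus>i\<in>{..k}. \<zero>)"
        using False by (intro R.finsum_cong') auto
      then show ?thesis using False by simp
    qed
    finally show ?thesis .
  qed
  then show eq: "up_ring.monom (UP R) \<one> j \<otimes>\<^bsub>UP R\<^esub> p = (\<lambda>k. if j \<le> k then p (k - j) else \<zero>)" by blast
  obtain n where n: "\<forall>i>n. p i = \<zero>" using up_memD(2)[OF p] by blast
  show "up_ring.monom (UP R) \<one> j \<otimes>\<^bsub>UP R\<^esub> p \<in> carrier (UP R)" unfolding eq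
    by (rule up_memI[of _ "n + j"]) (use n pc in auto)
qed

lemma up_deg_less:
  assumes "p \<in> carrier (UP R)" "2 * deg R p < r" "r \<le> 2 * j"
  shows "p j = \<zero>"
proof -
  obtain n where "\<forall>i>n. p i = \<zero>" using up_memD(2)[OF assms(1)] by blast
  then have "bound \<zero> n (up_ring.coeff (UP R) p)" by (auto simp: bound_def up_coeff[OF assms(1)])
  then have "bound \<zero> (deg R p) (up_ring.coeff (UP R) p)" unfolding deg_def by (rule LeastI)
  moreover have "deg R p < j" using assms(2,3) by linarith
  ultimately show ?thesis by (auto simp: bound_def up_coeff[OF assms(1)])
qed

lemma up_deg_lessI:
  assumes "p \<in> carrier (UP R)" "\<And>j. r \<le> 2 * j \<Longrightarrow> p j = \<zero>" "r > 0"
  shows "2 * deg R p < r"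
proof -
  \<comment> \<open>\<open>(r - 1) div 2\<close> is the largest index \<open>j\<close> with
    \<open>2 * j < r\<close>.\<close>
  have "bound \<zero> ((r - 1) div 2) (up_ring.coeff (UP R) p)"
    using assms(2) by (auto simp: bound_def up_coeff[OF assms(1)])
  then have "deg R p \<le> (r - 1) div 2" unfolding deg_def by (rule Least_le)
  then show ?thesis using assms(3) by linarith
qed

end


section \<open>Existence of equivariant Kazhdan--Lusztig polynomials\<close>

locale matroid_action = group W for W :: "'g monoid" (structure) +
  fixes \<phi> :: "'g \<Rightarrow> 'a \<Rightarrow> 'a" and M :: "'a matroid"
  assumes M: "is_matroid M" and loopless: "loopless M" and act: "acts_on_matroid W \<phi> M"

lemma gr_x_pow_mult:
  assumes "p \<in> carrier (grVRep W)"
  shows "gr_x_pow W j \<otimes>\<^bsub>grVRep W\<^esub> p = (\<lambda>k. if j \<le> k then p (k - j) else \<zero>\<^bsub>VRep W\<^esub>)"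
    "gr_x_pow W j \<otimes>\<^bsub>grVRep W\<^esub> p \<in> carrier (grVRep W)"
  using up_monom_mult[OF abelian_group_VRep VRep_one_closed _ _ assms] VRep_one_mult VRep_zero_mult by blast+

lemma grVRep_one_closed: "\<one>\<^bsub>grVRep W\<^esub> \<in> carrier (grVRep W)"
proof -
  interpret R: abelian_group "VRep W" by (rule abelian_group_VRep)
  show ?thesis unfolding up_one[OF abelian_group_VRep]
    by (rule up_memI[OF abelian_group_VRep, of _ _ 0]) (auto simp: VRep_one_closed)
qed

lemma matroid_actionI:
  assumes "group W" "is_matroid M" "loopless M"
    and bij: "\<And>g. g \<in> carrier W \<Longrightarrow> bij_betw (\<phi> g) (ground M) (ground M)"
    and mult: "\<And>g h x. g \<in> carrier W \<Longrightarrow> h \<in> carrier W \<Longrightarrow> x \<in> ground M \<Longrightarrow> \<phi> (g \<otimes>\<^bsub>W\<^esub> h) x = \<phi> g (\<phi> h x)"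
    and bases: "\<And>g Y. g \<in> carrier W \<Longrightarrow> Y \<in> bases M \<Longrightarrow> \<phi> g ` Y \<in> bases M"
  shows "matroid_action W \<phi> M"
proof -
  interpret group W by fact
  let ?E = "ground M"
  have mem: "restrict (\<phi> g) ?E \<in> Bij ?E" if "g \<in> carrier W" for g
    using bij[OF that] bij_betw_cong[of ?E "restrict (\<phi> g) ?E" "\<phi> g" ?E] by (simp add: Bij_def)
  have "group_hom W (BijGroup ?E) (\<lambda>g. restrict (\<phi> g) ?E)"
  proof (intro group_hom.intro group_hom_axioms.intro is_group group_BijGroup homI)
    show "restrict (\<phi> g) ?E \<in> carrier (BijGroup ?E)" if "g \<in> carrier W" for g
      using mem[OF that] by (simp add: BijGroup_def)
    fix g h assume g: "g \<in> carrier W" and h: "h \<in> carrier W"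
    have "restrict (\<phi> (g \<otimes>\<^bsub>W\<^esub> h)) ?E = compose ?E (restrict (\<phi> g) ?E) (restrict (\<phi> h) ?E)"
    proof
      fix x
      show "restrict (\<phi> (g \<otimes>\<^bsub>W\<^esub> h)) ?E x = compose ?E (restrict (\<phi> g) ?E) (restrict (\<phi> h) ?E) x"
        using mult[OF g h, of x] bij_betwE[OF bij[OF h]] by (cases "x \<in> ?E") (auto simp: compose_def)
    qed
    then show "restrict (\<phi> (g \<otimes>\<^bsub>W\<^esub> h)) ?E = restrict (\<phi> g) ?E \<otimes>\<^bsub>BijGroup ?E\<^esub> restrict (\<phi> h) ?E"
      using mem[OF g] mem[OF h] by (simp add: BijGroup_def)
  qed
  then have "acts_on_matroid W \<phi> M" unfolding acts_on_matroid_def group_action_def using bases by blast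
  then show ?thesis by (intro matroid_action.intro matroid_action_axioms.intro is_group assms(2,3))
qed

context matroid_action
begin

lemma bij:
  assumes "g \<in> carrier W"
  shows "bij_betw (\<phi> g) (ground M) (ground M)"
proof -
  interpret a: group_action W "ground M" "\<lambda>g. restrict (\<phi> g) (ground M)" using act by (simp add: acts_on_matroid_def)
  have "bij_betw (restrict (\<phi> g) (ground M)) (ground M) (ground M)" using a.bij_prop0[OF assms] by (simp add: Bij_def)
  then show ?thesis using bij_betw_cong[of "ground M" "restrict (\<phi> g) (ground M)" "\<phi> g" "ground M"] by simp
qed

lemma closed: "g \<in> carrier W \<Longrightarrow> x \<in> ground M \<Longrightarrow> \<phi> g x \<in> ground M"
  using bij_betwE[OF bij] by blast

lemma action_mult:
  assumes "g \<in> carrier W" "h \<in> carrier W" "x \<in> ground M"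
  shows "\<phi> (g \<otimes> h) x = \<phi> g (\<phi> h x)"
proof -
  interpret a: group_action W "ground M" "\<lambda>g. restrict (\<phi> g) (ground M)" using act by (simp add: acts_on_matroid_def)
  show ?thesis using a.composition_rule[OF assms(3,1,2)] closed[OF assms(2,3)] assms by simp
qed

lemma action_one: "x \<in> ground M \<Longrightarrow> \<phi> \<one> x = x"
proof -
  interpret a: group_action W "ground M" "\<lambda>g. restrict (\<phi> g) (ground M)" using act by (simp add: acts_on_matroid_def)
  show "x \<in> ground M \<Longrightarrow> \<phi> \<one> x = x" using fun_cong[OF a.id_eq_one, of x] by simp
qed

lemma image_mult: "g \<in> carrier W \<Longrightarrow> h \<in> carrier W \<Longrightarrow> F \<subseteq> ground M \<Longrightarrow> \<phi> (g \<otimes> h) ` F = \<phi> g ` (\<phi> h ` F)"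
  unfolding image_image by (intro image_cong refl) (auto simp: action_mult)

lemma image_one: "F \<subseteq> ground M \<Longrightarrow> \<phi> \<one> ` F = F"
  by (rule trans[OF image_cong[of F F "\<phi> \<one>" "\<lambda>x. x"] image_ident]) (auto simp: action_one)

lemma image_inv: "g \<in> carrier W \<Longrightarrow> F \<subseteq> ground M \<Longrightarrow> \<phi> (inv g) ` (\<phi> g ` F) = F"
  using image_mult[of "inv g" g F] image_one by simp

lemma image_subset: "g \<in> carrier W \<Longrightarrow> F \<subseteq> ground M \<Longrightarrow> \<phi> g ` F \<subseteq> ground M"
  using closed by blast

lemma bases_image:
  assumes "g \<in> carrier W"
  shows "bases M = (`) (\<phi> g) ` bases M"
proof -
  have sub: "(`) (\<phi> g) ` bases M \<subseteq> bases M" if "g \<in> carrier W" for g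
    using act that by (auto simp: acts_on_matroid_def)
  have "bases M \<subseteq> (`) (\<phi> g) ` bases M"
  proof
    fix Y assume Y: "Y \<in> bases M"
    have "\<phi> (inv g) ` Y \<in> bases M" using sub[of "inv g"] assms Y by auto
    moreover have "\<phi> g ` (\<phi> (inv g) ` Y) = Y"
      using image_inv[of "inv g" Y] basis_subset[OF M Y] assms by simp
    ultimately show "Y \<in> (`) (\<phi> g) ` bases M" by (metis imageI)
  qed
  then show ?thesis using sub[OF assms] by (rule subset_antisym)
qed

lemma mrank_translate: "g \<in> carrier W \<Longrightarrow> F \<subseteq> ground M \<Longrightarrow> mrank M (\<phi> g ` F) = mrank M F"
  using mrank_image[OF M _ bases_image] bij_betw_imp_inj_on[OF bij] by blast

lemma flat_translate: "g \<in> carrier W \<Longrightarrow> F \<in> flats M \<Longrightarrow> \<phi> g ` F \<in> flats M"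
  using flats_image[OF M bij bases_image flat_subset] by simp

abbreviation stab :: "'a set \<Rightarrow> 'g set" where
  "stab F \<equiv> set_stabilizer W \<phi> F"

lemma stab_iff: "g \<in> stab F \<longleftrightarrow> g \<in> carrier W \<and> \<phi> g ` F = F"
  by (simp add: set_stabilizer_def stabilizer_def)

lemma subgroup_stab:
  assumes F: "F \<subseteq> ground M"
  shows "subgroup (stab F) W"
proof (rule subgroupI)
  show "stab F \<noteq> {}" using image_one[OF F] stab_iff[of \<one> F] by auto
  fix g assume g: "g \<in> stab F"
  then have gc: "g \<in> carrier W" "\<phi> g ` F = F" by (simp_all add: stab_iff)
  have "\<phi> (inv g) ` F = F" using image_inv[OF gc(1) F] unfolding gc(2) .
  then show "inv g \<in> stab F" using gc(1) by (simp add: stab_iff)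
  fix h assume h: "h \<in> stab F"
  show "g \<otimes> h \<in> stab F" using g h image_mult[of g h F] F by (simp add: stab_iff)
qed (auto simp: stab_iff)

lemma image_eq_iff:
  assumes g: "g \<in> carrier W" and h: "h \<in> carrier W" and F: "F \<subseteq> ground M"
  shows "\<phi> g ` F = \<phi> h ` F \<longleftrightarrow> inv h \<otimes> g \<in> stab F"
proof
  assume "\<phi> g ` F = \<phi> h ` F"
  then show "inv h \<otimes> g \<in> stab F" using image_mult[of "inv h" g F] image_inv[of h F] g h F by (simp add: stab_iff)
next
  assume "inv h \<otimes> g \<in> stab F"
  then have "\<phi> h ` (\<phi> (inv h \<otimes> g) ` F) = \<phi> h ` F" by (simp add: stab_iff)
  moreover have "\<phi> h ` (\<phi> (inv h \<otimes> g) ` F) = \<phi> (h \<otimes> (inv h \<otimes> g)) ` F" using image_mult[of h "inv h \<otimes> g" F] g h F by simp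
  moreover have "h \<otimes> (inv h \<otimes> g) = g" using g h by (simp add: m_assoc[symmetric])
  ultimately show "\<phi> g ` F = \<phi> h ` F" by simp
qed

lemma finite_ground: "finite (ground M)"
  using M by (simp add: is_matroid_def)

text \<open>Cosets of the stabilizer correspond to the images of \<open>F\<close>, which are subsets
  of the finite ground set; so the index is finite even if \<open>W\<close> is infinite.\<close>

lemma induction_setup_stab:
  assumes F: "F \<subseteq> ground M"
  shows "induction_setup W (stab F)"
proof (intro induction_setup.intro induction_setup_axioms.intro is_group subgroup_stab[OF F])
  let ?u = "\<lambda>g. \<phi> g ` F" and ?v = "\<lambda>g. g <# stab F"
  have eq: "?v g = ?v h" if "g \<in> carrier W" "h \<in> carrier W" "?u g = ?u h" for g h
  proof -
    have "g \<in> h <# stab F"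
      using mem_l_coset_iff[OF subgroup_stab[OF F] that(2,1)] image_eq_iff[OF that(1,2) F] that(3) by simp
    then show ?thesis using l_repr_independence[OF _ that(2) subgroup_stab[OF F]] by simp
  qed
  have "?v ` carrier W \<subseteq> (\<lambda>y. ?v (SOME g. g \<in> carrier W \<and> ?u g = y)) ` (?u ` carrier W)"
  proof
    fix C assume "C \<in> ?v ` carrier W"
    then obtain g where g: "g \<in> carrier W" "C = ?v g" by blast
    define h where "h = (SOME h. h \<in> carrier W \<and> ?u h = ?u g)"
    have "h \<in> carrier W \<and> ?u h = ?u g" unfolding h_def by (rule someI[of _ g]) (use g in simp)
    then have "C = ?v h" using eq[of h g] g by simp
    then show "C \<in> (\<lambda>y. ?v (SOME g. g \<in> carrier W \<and> ?u g = y)) ` (?u ` carrier W)" using g(1) unfolding h_def by blast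
  qed
  moreover have "?u ` carrier W \<subseteq> Pow (ground M)" using image_subset F by blast
  then have "finite (?u ` carrier W)" using finite_ground finite_subset by blast
  ultimately show "finite (?v ` carrier W)" by (meson finite_imageI finite_subset)
qed

lemma contract_action:
  assumes F: "F \<in> flats M"
  shows "matroid_action (W\<lparr>carrier := stab F\<rparr>) \<phi> (contract M F)"
proof (rule matroid_actionI)
  have FM: "F \<subseteq> ground M" using flat_subset[OF F] .
  show "group (W\<lparr>carrier := stab F\<rparr>)" using subgroup_imp_group[OF subgroup_stab[OF FM]] .
  show "is_matroid (contract M F)" using is_matroid_contract[OF M] .
  show "loopless (contract M F)" using loopless_contract[OF M F] .
  fix g assume "g \<in> carrier (W\<lparr>carrier := stab F\<rparr>)"
  then have g: "g \<in> carrier W" "\<phi> g ` F = F" by (auto simp: stab_iff)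
  show "bij_betw (\<phi> g) (ground (contract M F)) (ground (contract M F))"
    using image_contract_eq[OF bij[OF g(1)] FM g(2)] by simp
  show "\<phi> g ` Y \<in> bases (contract M F)" if "Y \<in> bases (contract M F)" for Y
    using contract_image(1)[OF M bij[OF g(1)] bases_image[OF g(1)] FM] that unfolding g(2) by blast
  fix h x assume "h \<in> carrier (W\<lparr>carrier := stab F\<rparr>)" "x \<in> ground (contract M F)"
  then show "\<phi> (g \<otimes>\<^bsub>W\<lparr>carrier := stab F\<rparr>\<^esub> h) x = \<phi> g (\<phi> h x)" using g by (simp add: stab_iff action_mult)
qed

section \<open>Orbits of flats and their contributions to the Z-polynomial\<close>

definition orb :: "'a set \<Rightarrow> 'a set set" where
  "orb F = (\<lambda>g. \<phi> g ` F) ` carrier W"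

lemma flat_orbits_eq: "flat_orbits W \<phi> M = orb ` flats M"
  unfolding flat_orbits_def orbits_def orbit_def orb_def by auto

lemma orb_self: "F \<subseteq> ground M \<Longrightarrow> F \<in> orb F"
  unfolding orb_def using image_one[of F] by (metis imageI one_closed)

lemma orb_eq:
  assumes F: "F \<subseteq> ground M" and F': "F' \<in> orb F"
  shows "orb F' = orb F"
proof -
  obtain g where g: "g \<in> carrier W" "F' = \<phi> g ` F" using F' unfolding orb_def by blast
  have 1: "\<phi> h ` F' = \<phi> (h \<otimes> g) ` F" if "h \<in> carrier W" for h using image_mult[OF that g(1) F] g(2) by simp
  have 2: "\<phi> h ` F = \<phi> (h \<otimes> inv g) ` F'" if h: "h \<in> carrier W" for h
    using image_mult[of h "inv g" F'] image_inv[OF g(1) F] image_subset[OF g(1) F] h g by simp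
  show ?thesis
  proof (intro equalityI subsetI)
    fix Y assume "Y \<in> orb F'"
    then obtain h where h: "h \<in> carrier W" "Y = \<phi> h ` F'" unfolding orb_def by blast
    show "Y \<in> orb F" unfolding h(2) 1[OF h(1)] orb_def by (rule imageI[OF m_closed[OF h(1) g(1)]])
  next
    fix Y assume "Y \<in> orb F"
    then obtain h where h: "h \<in> carrier W" "Y = \<phi> h ` F" unfolding orb_def by blast
    show "Y \<in> orb F'" unfolding h(2) 2[OF h(1)] orb_def by (rule imageI[OF m_closed[OF h(1) inv_closed[OF g(1)]]])
  qed
qed

lemma flat_orbitsD:
  assumes \<Omega>: "\<Omega> \<in> flat_orbits W \<phi> M"
  shows "(SOME F. F \<in> \<Omega>) \<in> \<Omega>" "\<Omega> \<subseteq> flats M" "\<And>F. F \<in> \<Omega> \<Longrightarrow> orb F = \<Omega>"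
proof -
  obtain F where F: "F \<in> flats M" "\<Omega> = orb F" using \<Omega> unfolding flat_orbits_eq by blast
  have "F \<in> \<Omega>" unfolding F(2) by (rule orb_self[OF flat_subset[OF F(1)]])
  then show "(SOME F. F \<in> \<Omega>) \<in> \<Omega>" by (rule someI)
  show "\<Omega> \<subseteq> flats M" unfolding F(2) orb_def using flat_translate F(1) by blast
  show "orb F' = \<Omega>" if "F' \<in> \<Omega>" for F' using orb_eq[OF flat_subset[OF F(1)]] that unfolding F(2) by blast
qed

lemma finite_flat_orbits: "finite (flat_orbits W \<phi> M)"
  unfolding flat_orbits_eq using finite_flats[OF M] by simp

lemma orb_empty: "orb {} = {{}}"
  unfolding orb_def using one_closed by auto

lemma empty_orbit: "{{}} \<in> flat_orbits W \<phi> M"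
  unfolding flat_orbits_eq using imageI[OF empty_flat[OF M loopless], of orb] by (simp only: orb_empty)

lemma nonempty_orbit:
  assumes "\<Omega> \<in> flat_orbits W \<phi> M - {{{}}}" "F \<in> \<Omega>"
  shows "F \<in> flats M" "F \<noteq> {}"
  using assms flat_orbitsD(2,3)[of \<Omega>] orb_empty by auto

definition rep_flat :: "'a set set \<Rightarrow> 'a set" where
  "rep_flat \<Omega> = (SOME F. F \<in> \<Omega>)"

lemma rep_flat:
  assumes "\<Omega> \<in> flat_orbits W \<phi> M"
  shows "rep_flat \<Omega> \<in> \<Omega>" "rep_flat \<Omega> \<in> flats M" "orb (rep_flat \<Omega>) = \<Omega>"
  using flat_orbitsD[OF assms] unfolding rep_flat_def by auto

lemma sum_flat_orbits:
  fixes f :: "'a set \<Rightarrow> rat"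
  shows "(\<Sum>\<Omega>\<in>flat_orbits W \<phi> M. \<Sum>F\<in>{F \<in> \<Omega>. R F}. f F) = (\<Sum>F\<in>{F \<in> flats M. R F}. f F)"
proof -
  have fin: "finite \<Omega>" if "\<Omega> \<in> flat_orbits W \<phi> M" for \<Omega>
    using finite_subset[OF flat_orbitsD(2)[OF that] finite_flats[OF M]] .
  have "\<Union>(flat_orbits W \<phi> M) = flats M"
  proof (intro equalityI subsetI)
    fix F assume "F \<in> \<Union>(flat_orbits W \<phi> M)"
    then obtain \<Omega> where "\<Omega> \<in> flat_orbits W \<phi> M" "F \<in> \<Omega>" by (rule UnionE)
    then show "F \<in> flats M" by (rule subsetD[OF flat_orbitsD(2)])
  next
    fix F assume F: "F \<in> flats M"
    show "F \<in> \<Union>(flat_orbits W \<phi> M)" unfolding flat_orbits_eq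
      by (rule UnionI[of "orb F"], rule imageI[OF F], rule orb_self[OF flat_subset[OF F]])
  qed
  then have "{F \<in> flats M. R F} = (\<Union>\<Omega>\<in>flat_orbits W \<phi> M. {F \<in> \<Omega>. R F})" by blast
  moreover have "(\<Sum>F\<in>(\<Union>\<Omega>\<in>flat_orbits W \<phi> M. {F \<in> \<Omega>. R F}). f F) = (\<Sum>\<Omega>\<in>flat_orbits W \<phi> M. \<Sum>F\<in>{F \<in> \<Omega>. R F}. f F)"
  proof (rule sum.UNION_disjoint[OF finite_flat_orbits])
    show "\<forall>\<Omega>\<in>flat_orbits W \<phi> M. finite {F \<in> \<Omega>. R F}" using fin by simp
    show "\<forall>\<Omega>\<in>flat_orbits W \<phi> M. \<forall>\<Omega>'\<in>flat_orbits W \<phi> M. \<Omega> \<noteq> \<Omega>' \<longrightarrow> {F \<in> \<Omega>. R F} \<inter> {F \<in> \<Omega>'. R F} = {}"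
    proof (intro ballI impI)
      fix \<Omega> \<Omega>' assume \<Omega>: "\<Omega> \<in> flat_orbits W \<phi> M" "\<Omega>' \<in> flat_orbits W \<phi> M" "\<Omega> \<noteq> \<Omega>'"
      have False if "F \<in> \<Omega>" "F \<in> \<Omega>'" for F
        using flat_orbitsD(3)[OF \<Omega>(1) that(1)] flat_orbitsD(3)[OF \<Omega>(2) that(2)] \<Omega>(3) by simp
      then show "{F \<in> \<Omega>. R F} \<inter> {F \<in> \<Omega>'. R F} = {}" by blast
    qed
  qed
  ultimately show ?thesis by simp
qed

definition flat_term where
  "flat_term P F = gr_x_pow W (mrank M F) \<otimes>\<^bsub>grVRep W\<^esub> gr_ind W (stab F) (P (W\<lparr>carrier := stab F\<rparr>) \<phi> (contract M F))"

definition rest where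
  "rest P = (\<Oplus>\<^bsub>grVRep W\<^esub>\<Omega>\<in>flat_orbits W \<phi> M - {{{}}}. flat_term P (rep_flat \<Omega>))"

lemma Z_sum_eq: "Z_sum P W \<phi> M = (\<Oplus>\<^bsub>grVRep W\<^esub>\<Omega>\<in>flat_orbits W \<phi> M. flat_term P (rep_flat \<Omega>))"
  unfolding Z_sum_def flat_term_def rep_flat_def Let_def ..

lemma flat_term:
  assumes F: "F \<in> flats M" and p: "P (W\<lparr>carrier := stab F\<rparr>) \<phi> (contract M F) \<in> carrier (grVRep (W\<lparr>carrier := stab F\<rparr>))"
  shows "flat_term P F \<in> carrier (grVRep W)"
    "flat_term P F k = (if mrank M F \<le> k
      then vind W (stab F) (P (W\<lparr>carrier := stab F\<rparr>) \<phi> (contract M F) (k - mrank M F)) else \<zero>\<^bsub>VRep W\<^esub>)"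
proof -
  let ?p = "P (W\<lparr>carrier := stab F\<rparr>) \<phi> (contract M F)"
  interpret i: induction_setup W "stab F" by (rule induction_setup_stab[OF flat_subset[OF F]])
  have ind: "gr_ind W (stab F) ?p = (\<lambda>k. vind W (stab F) (?p k))"
    unfolding gr_ind_def up_coeff[OF abelian_group_VRep p] ..
  obtain n where n: "\<forall>i>n. ?p i = \<zero>\<^bsub>VRep (W\<lparr>carrier := stab F\<rparr>)\<^esub>" using up_memD(2)[OF abelian_group_VRep p] by blast
  have ic: "(\<lambda>k. vind W (stab F) (?p k)) \<in> carrier (grVRep W)"
  proof (rule up_memI[OF abelian_group_VRep, of _ _ n])
    show "vind W (stab F) (?p i) \<in> carrier (VRep W)" for i
      by (rule i.vind_closed[OF up_memD(1)[OF abelian_group_VRep p]])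
    show "vind W (stab F) (?p i) = \<zero>\<^bsub>VRep W\<^esub>" if "i > n" for i
      using n that i.vind_zero by simp
  qed
  note m = gr_x_pow_mult[OF ic]
  show "flat_term P F \<in> carrier (grVRep W)" unfolding flat_term_def ind by (rule m(2))
  show "flat_term P F k = (if mrank M F \<le> k then vind W (stab F) (?p (k - mrank M F)) else \<zero>\<^bsub>VRep W\<^esub>)"
    unfolding flat_term_def ind m(1) ..
qed

lemma flat_term_empty:
  assumes p: "P W \<phi> M \<in> carrier (grVRep W)"
  shows "flat_term P {} = P W \<phi> M"
proof
  fix k
  have s: "stab {} = carrier W" by (auto simp: stab_iff)
  have "P (W\<lparr>carrier := stab {}\<rparr>) \<phi> (contract M {}) \<in> carrier (grVRep (W\<lparr>carrier := stab {}\<rparr>))"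
    using p M by (simp add: s)
  from flat_term(2)[of "{}" P, OF empty_flat[OF M loopless] this, of k]
  show "flat_term P {} k = P W \<phi> M k"
    using M vind_self[OF is_group up_memD(1)[OF abelian_group_VRep p, of k]] by (simp add: s)
qed

text \<open>Normalisation and degree bound in terms of coefficients, the form in which indices can
  be reflected. A loopless matroid has positive rank as soon as its ground set is non-empty, so the
  two cases are those of rank zero and positive rank.\<close>

definition kl_bounded where
  "kl_bounded p \<longleftrightarrow> p \<in> carrier (grVRep W) \<and> (ground M = {} \<longrightarrow> p = \<one>\<^bsub>grVRep W\<^esub>) \<and>
    (ground M \<noteq> {} \<longrightarrow> (\<forall>j. rk M \<le> 2 * j \<longrightarrow> p j = \<zero>\<^bsub>VRep W\<^esub>))"

lemma kl_bounded_coeff_0: "kl_bounded p \<Longrightarrow> rk M < j \<Longrightarrow> p j = \<zero>\<^bsub>VRep W\<^esub>"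
  unfolding kl_bounded_def by (cases "ground M = {}") (auto simp: up_one[OF abelian_group_VRep])

end

definition bounded_on_contractions where
  "bounded_on_contractions P W \<phi> M \<longleftrightarrow> (\<forall>F\<in>flats M. F \<noteq> {} \<longrightarrow>
    matroid_action.kl_bounded (W\<lparr>carrier := set_stabilizer W \<phi> F\<rparr>) (contract M F)
      (P (W\<lparr>carrier := set_stabilizer W \<phi> F\<rparr>) \<phi> (contract M F)))"

context matroid_action
begin

lemma contraction_closed:
  assumes "bounded_on_contractions P W \<phi> M" "F \<in> flats M" "F \<noteq> {}"
  shows "P (W\<lparr>carrier := stab F\<rparr>) \<phi> (contract M F) \<in> carrier (grVRep (W\<lparr>carrier := stab F\<rparr>))"
  using assms matroid_action.kl_bounded_def[OF contract_action[OF assms(2)]] unfolding bounded_on_contractions_def by blast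

lemma rest:
  assumes B: "bounded_on_contractions P W \<phi> M"
  shows "(\<lambda>\<Omega>. flat_term P (rep_flat \<Omega>)) \<in> flat_orbits W \<phi> M - {{{}}} \<rightarrow> carrier (grVRep W)"
    "rest P \<in> carrier (grVRep W)" "j > rk M \<Longrightarrow> rest P j = \<zero>\<^bsub>VRep W\<^esub>"
proof -
  interpret R: abelian_group "VRep W" by (rule abelian_group_VRep)
  interpret U: abelian_group "grVRep W" by (rule abelian_group_UP[OF abelian_group_VRep])
  let ?S = "flat_orbits W \<phi> M - {{{}}}"
  have F: "rep_flat \<Omega> \<in> flats M" "rep_flat \<Omega> \<noteq> {}" if "\<Omega> \<in> ?S" for \<Omega>
    using nonempty_orbit[OF that rep_flat(1)] that by auto
  have ft: "flat_term P (rep_flat \<Omega>) \<in> carrier (grVRep W)"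
    "flat_term P (rep_flat \<Omega>) k = (if mrank M (rep_flat \<Omega>) \<le> k then vind W (stab (rep_flat \<Omega>))
       (P (W\<lparr>carrier := stab (rep_flat \<Omega>)\<rparr>) \<phi> (contract M (rep_flat \<Omega>)) (k - mrank M (rep_flat \<Omega>))) else \<zero>\<^bsub>VRep W\<^esub>)"
    if "\<Omega> \<in> ?S" for \<Omega> k
    by (rule flat_term[where P = P and F = "rep_flat \<Omega>", OF F(1)[OF that] contraction_closed[OF B F[OF that]]])+
  show f: "(\<lambda>\<Omega>. flat_term P (rep_flat \<Omega>)) \<in> ?S \<rightarrow> carrier (grVRep W)" using ft(1) by blast
  show "rest P \<in> carrier (grVRep W)" unfolding rest_def by (rule U.finsum_closed[OF f])
  assume j: "j > rk M"
  have "flat_term P (rep_flat \<Omega>) j = \<zero>\<^bsub>VRep W\<^esub>" if \<Omega>: "\<Omega> \<in> ?S" for \<Omega>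
  proof -
    let ?F = "rep_flat \<Omega>"
    interpret c: matroid_action "W\<lparr>carrier := stab ?F\<rparr>" \<phi> "contract M ?F" by (rule contract_action[OF F(1)[OF \<Omega>]])
    interpret i: induction_setup W "stab ?F" by (rule induction_setup_stab[OF flat_subset[OF F(1)[OF \<Omega>]]])
    have b: "c.kl_bounded (P (W\<lparr>carrier := stab ?F\<rparr>) \<phi> (contract M ?F))"
      using B F[OF \<Omega>] unfolding bounded_on_contractions_def by blast
    have "rk (contract M ?F) + mrank M ?F = rk M" by (rule rk_contract[OF M])
    then have "rk (contract M ?F) < j - mrank M ?F" using j by linarith
    then show ?thesis unfolding ft(2)[OF \<Omega>] using c.kl_bounded_coeff_0[OF b] i.vind_zero by simp
  qed
  then have "rest P j = (\<Oplus>\<^bsub>VRep W\<^esub>\<Omega>\<in>?S. \<zero>\<^bsub>VRep W\<^esub>)"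
    unfolding rest_def up_finsum[OF abelian_group_VRep finite_Diff[OF finite_flat_orbits] f]
    by (intro R.finsum_cong') auto
  then show "rest P j = \<zero>\<^bsub>VRep W\<^esub>" by simp
qed

lemma Z_sum_split:
  assumes B: "bounded_on_contractions P W \<phi> M" and p: "P W \<phi> M \<in> carrier (grVRep W)"
  shows "Z_sum P W \<phi> M = P W \<phi> M \<oplus>\<^bsub>grVRep W\<^esub> rest P"
proof -
  interpret U: abelian_group "grVRep W" by (rule abelian_group_UP[OF abelian_group_VRep])
  let ?S = "flat_orbits W \<phi> M - {{{}}}"
  have S: "flat_orbits W \<phi> M = insert {{}} ?S" using empty_orbit by blast
  have e: "flat_term P (rep_flat {{}}) = P W \<phi> M" using flat_term_empty[of P] p by (simp add: rep_flat_def)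
  have "Z_sum P W \<phi> M = (\<Oplus>\<^bsub>grVRep W\<^esub>\<Omega>\<in>insert {{}} ?S. flat_term P (rep_flat \<Omega>))"
    unfolding Z_sum_eq using S by simp
  also have "\<dots> = flat_term P (rep_flat {{}}) \<oplus>\<^bsub>grVRep W\<^esub> rest P"
    unfolding rest_def using rest(1)[OF B] e p finite_flat_orbits by (intro U.finsum_insert) auto
  finally show ?thesis unfolding e .
qed

text \<open>The terms of non-empty flats see \<open>P\<close> only on contractions, which have
  smaller ground sets; the recursion rests on this.\<close>

lemma rest_cong:
  assumes B: "bounded_on_contractions P W \<phi> M"
    and eq: "\<And>F. F \<in> flats M \<Longrightarrow> F \<noteq> {} \<Longrightarrow> P' (W\<lparr>carrier := stab F\<rparr>) \<phi> (contract M F) = P (W\<lparr>carrier := stab F\<rparr>) \<phi> (contract M F)"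
  shows "rest P' = rest P"
proof -
  interpret U: abelian_group "grVRep W" by (rule abelian_group_UP[OF abelian_group_VRep])
  show ?thesis unfolding rest_def
  proof (rule U.finsum_cong'[OF refl rest(1)[OF B]])
    fix \<Omega> assume \<Omega>: "\<Omega> \<in> flat_orbits W \<phi> M - {{{}}}"
    then have "rep_flat \<Omega> \<in> flats M" "rep_flat \<Omega> \<noteq> {}" using nonempty_orbit[OF \<Omega> rep_flat(1)] by auto
    then show "flat_term P' (rep_flat \<Omega>) = flat_term P (rep_flat \<Omega>)" unfolding flat_term_def using eq by simp
  qed
qed

text \<open>For a given sum \<open>Q\<close> of the terms of positive rank, the polynomial \<open>p\<close> with
  \<open>p\<^sub>j = Q\<^sub>r\<^sub>-\<^sub>j - Q\<^sub>j\<close> for \<open>2 j < r\<close> is the only one of degree less than \<open>r/2\<close> that makes \<open>p + Q\<close>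
  palindromic.\<close>

definition complete where
  "complete P = (if ground M = {} then \<one>\<^bsub>grVRep W\<^esub>
    else (\<lambda>j. if 2 * j < rk M then rest P (rk M - j) \<ominus>\<^bsub>VRep W\<^esub> rest P j else \<zero>\<^bsub>VRep W\<^esub>))"

lemma complete_bounded:
  assumes B: "bounded_on_contractions P W \<phi> M"
  shows "kl_bounded (complete P)"
proof -
  interpret R: abelian_group "VRep W" by (rule abelian_group_VRep)
  note rc = up_memD(1)[OF abelian_group_VRep rest(2)[OF B]]
  have one: "\<one>\<^bsub>grVRep W\<^esub> \<in> carrier (grVRep W)" by (rule grVRep_one_closed)
  have "(\<lambda>j. if 2 * j < rk M then rest P (rk M - j) \<ominus>\<^bsub>VRep W\<^esub> rest P j else \<zero>\<^bsub>VRep W\<^esub>) \<in> carrier (grVRep W)"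
    by (rule up_memI[OF abelian_group_VRep, of _ _ "rk M"]) (auto intro: rc)
  then show ?thesis unfolding kl_bounded_def complete_def using one by simp
qed

lemma complete_palindromic:
  assumes B: "bounded_on_contractions P W \<phi> M" and P: "P W \<phi> M = complete P"
  shows "Z_sum P W \<phi> M \<in> carrier (grVRep W)" "palindromic W (rk M) (Z_sum P W \<phi> M)"
    "ground M = {} \<Longrightarrow> Z_sum P W \<phi> M = \<one>\<^bsub>grVRep W\<^esub>"
proof -
  interpret R: abelian_group "VRep W" by (rule abelian_group_VRep)
  interpret U: abelian_group "grVRep W" by (rule abelian_group_UP[OF abelian_group_VRep])
  have p: "P W \<phi> M \<in> carrier (grVRep W)" using complete_bounded[OF B] P by (simp add: kl_bounded_def)
  note Z = Z_sum_split[OF B p]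
  have rc: "rest P j \<in> carrier (VRep W)" for j using up_memD(1)[OF abelian_group_VRep rest(2)[OF B]] .
  have pc: "P W \<phi> M j \<in> carrier (VRep W)" for j using up_memD(1)[OF abelian_group_VRep p] .
  show ZC: "Z_sum P W \<phi> M \<in> carrier (grVRep W)" unfolding Z using p rest(2)[OF B] by simp
  have Zj: "Z_sum P W \<phi> M j = P W \<phi> M j \<oplus>\<^bsub>VRep W\<^esub> rest P j" for j
    unfolding Z up_add[OF abelian_group_VRep p rest(2)[OF B]] ..
  show one: "Z_sum P W \<phi> M = \<one>\<^bsub>grVRep W\<^esub>" if g: "ground M = {}"
  proof -
    have "flats M \<subseteq> {{}}" using flat_subset g by blast
    then have e: "flat_orbits W \<phi> M - {{{}}} = {}" unfolding flat_orbits_eq using orb_empty by blast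
    have "rest P = \<zero>\<^bsub>grVRep W\<^esub>" unfolding rest_def e by simp
    moreover have "P W \<phi> M = \<one>\<^bsub>grVRep W\<^esub>" using P g by (simp add: complete_def)
    ultimately show ?thesis unfolding Z using p by simp
  qed
  show "palindromic W (rk M) (Z_sum P W \<phi> M)"
  proof (cases "ground M = {}")
    case True
    have "rk M = 0" using rk_eq_0_iff[OF M loopless] True by simp
    then show ?thesis unfolding palindromic_def up_coeff[OF abelian_group_VRep ZC]
      unfolding one[OF True] up_one[OF abelian_group_VRep] by simp
  next
    case False
    have Pj: "P W \<phi> M j = (if 2 * j < rk M then rest P (rk M - j) \<ominus>\<^bsub>VRep W\<^esub> rest P j else \<zero>\<^bsub>VRep W\<^esub>)" for j
      unfolding P complete_def using False by simp
    have "(x \<ominus>\<^bsub>VRep W\<^esub> y) \<oplus>\<^bsub>VRep W\<^esub> y = x" if "x \<in> carrier (VRep W)" "y \<in> carrier (VRep W)" for x y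
      using that by (simp add: a_minus_def R.a_assoc R.l_neg)
    \<comment> \<open>Below the middle the sum takes the mirrored value of \<open>rest\<close>, and
      from the middle on it is \<open>rest\<close> itself; reflection exchanges the two halves and
      fixes the middle index, if there is one.\<close>
    then have Z1: "Z_sum P W \<phi> M j = (if 2 * j < rk M then rest P (rk M - j) else rest P j)" for j
      unfolding Zj Pj using rc by simp
    show ?thesis unfolding palindromic_def up_coeff[OF abelian_group_VRep ZC]
    proof (intro conjI allI impI)
      fix j assume j: "j \<le> rk M"
      consider "2 * j < rk M" "\<not> 2 * (rk M - j) < rk M" | "2 * (rk M - j) < rk M" "\<not> 2 * j < rk M" | "rk M - j = j"
        using j by linarith
      then show "Z_sum P W \<phi> M j = Z_sum P W \<phi> M (rk M - j)" unfolding Z1 by cases (use j in simp_all)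
    next
      fix j assume j: "rk M < j"
      then show "Z_sum P W \<phi> M j = \<zero>\<^bsub>VRep W\<^esub>" unfolding Z1 using rest(3)[OF B j] by simp
    qed
  qed
qed

end

text \<open>The recursion changes group and matroid together, so it is organised as an iteration:
  the n-th approximation is final on ground sets with at most n elements. The start value 1 is right
  for the empty ground set.\<close>

primrec kl_approx :: "nat \<Rightarrow> 'g monoid \<Rightarrow> ('g \<Rightarrow> 'a \<Rightarrow> 'a) \<Rightarrow> 'a matroid \<Rightarrow> (nat \<Rightarrow> 'g vrep)" where
  "kl_approx 0 = (\<lambda>W \<phi> M. \<one>\<^bsub>grVRep W\<^esub>)"
| "kl_approx (Suc n) = (\<lambda>W \<phi> M. matroid_action.complete W \<phi> M (kl_approx n))"

text \<open>Boundedness and stability are proved together, because passing from one approximation to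
  the next by \<open>rest_cong\<close> requires bounded values on the contractions.\<close>

lemma kl_approx_stable:
  assumes "matroid_action W \<phi> M" "card (ground M) \<le> n"
  shows "matroid_action.kl_bounded W M (kl_approx n W \<phi> M) \<and> kl_approx (Suc n) W \<phi> M = kl_approx n W \<phi> M"
  using assms
proof (induction n arbitrary: W \<phi> M)
  case 0
  interpret matroid_action W \<phi> M by (rule 0)
  have g: "ground M = {}" using 0 finite_ground by simp
  have one: "\<one>\<^bsub>grVRep W\<^esub> \<in> carrier (grVRep W)" by (rule grVRep_one_closed)
  show ?case using g one by (simp add: kl_bounded_def complete_def)
next
  case (Suc n)
  interpret matroid_action W \<phi> M by (rule Suc)
  have IH: "matroid_action.kl_bounded (W\<lparr>carrier := stab F\<rparr>) (contract M F) (kl_approx n (W\<lparr>carrier := stab F\<rparr>) \<phi> (contract M F)) \<and>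
      kl_approx (Suc n) (W\<lparr>carrier := stab F\<rparr>) \<phi> (contract M F) = kl_approx n (W\<lparr>carrier := stab F\<rparr>) \<phi> (contract M F)"
    if F: "F \<in> flats M" "F \<noteq> {}" for F
  proof (rule Suc.IH[OF contract_action[OF F(1)]])
    show "card (ground (contract M F)) \<le> n" using card_contract_less[OF M F] Suc.prems(2) by linarith
  qed
  then have B: "bounded_on_contractions (kl_approx n) W \<phi> M" unfolding bounded_on_contractions_def by blast
  have e: "rest (kl_approx (Suc n)) = rest (kl_approx n)" using IH by (intro rest_cong[OF B]) blast
  have "complete (kl_approx (Suc n)) = complete (kl_approx n)" unfolding complete_def e ..
  then have "kl_approx (Suc (Suc n)) W \<phi> M = kl_approx (Suc n) W \<phi> M" by (simp only: kl_approx.simps)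
  then show ?case using complete_bounded[OF B] by simp
qed

definition kl_family :: "'g monoid \<Rightarrow> ('g \<Rightarrow> 'a \<Rightarrow> 'a) \<Rightarrow> 'a matroid \<Rightarrow> (nat \<Rightarrow> 'g vrep)" where
  "kl_family W \<phi> M = kl_approx (card (ground M)) W \<phi> M"

lemma kl_approx_eq:
  assumes "matroid_action W \<phi> M" "card (ground M) \<le> n"
  shows "kl_approx n W \<phi> M = kl_family W \<phi> M"
  using assms(2)
proof (induction n rule: dec_induct)
  case base
  then show ?case by (simp add: kl_family_def)
next
  case (step n)
  then show ?case using kl_approx_stable[OF assms(1), of n] by simp
qed

lemma kl_family_properties:
  assumes "matroid_action W \<phi> M"
  shows "bounded_on_contractions kl_family W \<phi> M" "kl_family W \<phi> M = matroid_action.complete W \<phi> M kl_family"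
proof -
  interpret matroid_action W \<phi> M by (rule assms)
  show B: "bounded_on_contractions kl_family W \<phi> M"
    unfolding bounded_on_contractions_def
  proof (intro ballI impI)
    fix F assume F: "F \<in> flats M" "F \<noteq> {}"
    show "matroid_action.kl_bounded (W\<lparr>carrier := stab F\<rparr>) (contract M F) (kl_family (W\<lparr>carrier := stab F\<rparr>) \<phi> (contract M F))"
      unfolding kl_family_def using kl_approx_stable[OF contract_action[OF F(1)] le_refl] by blast
  qed
  show "kl_family W \<phi> M = complete kl_family"
  proof (cases "card (ground M)")
    case 0
    then have "ground M = {}" using finite_ground by simp
    then show ?thesis by (simp add: kl_family_def complete_def)
  next
    case (Suc n)
    have "rest (kl_approx n) = rest kl_family"
    proof (rule rest_cong[OF B])
      fix F assume F: "F \<in> flats M" "F \<noteq> {}"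
      have "card (ground (contract M F)) \<le> n" using card_contract_less[OF M F] Suc by linarith
      then show "kl_approx n (W\<lparr>carrier := stab F\<rparr>) \<phi> (contract M F) = kl_family (W\<lparr>carrier := stab F\<rparr>) \<phi> (contract M F)"
        by (rule kl_approx_eq[OF contract_action[OF F(1)]])
    qed
    then have "complete (kl_approx n) = complete kl_family" by (simp only: complete_def)
    then show ?thesis by (simp only: kl_family_def[of W \<phi> M] Suc kl_approx.simps)
  qed
qed

theorem is_KLZ_family_kl_family:
  "is_KLZ_family (kl_family :: 'g monoid \<Rightarrow> ('g \<Rightarrow> 'a \<Rightarrow> 'a) \<Rightarrow> 'a matroid \<Rightarrow> _) (Z_sum kl_family)"
  unfolding is_KLZ_family_def
proof (intro allI impI)
  fix W :: "'g monoid" and \<phi> :: "'g \<Rightarrow> 'a \<Rightarrow> 'a" and M :: "'a matroid"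
  assume "group W \<and> is_matroid M \<and> loopless M \<and> acts_on_matroid W \<phi> M"
  then have A: "matroid_action W \<phi> M" by (intro matroid_action.intro matroid_action_axioms.intro) auto
  interpret matroid_action W \<phi> M by (rule A)
  note B = kl_family_properties[OF A]
  note Z = complete_palindromic[OF B]
  have b: "kl_bounded (kl_family W \<phi> M)" using complete_bounded[OF B(1)] unfolding B(2)[symmetric] .
  then have p: "kl_family W \<phi> M \<in> carrier (grVRep W)" by (simp add: kl_bounded_def)
  have "rk M = 0 \<longrightarrow> kl_family W \<phi> M = \<one>\<^bsub>grVRep W\<^esub> \<and> Z_sum kl_family W \<phi> M = \<one>\<^bsub>grVRep W\<^esub>"
    using b Z(3) rk_eq_0_iff[OF M loopless] unfolding kl_bounded_def by blast
  moreover have "0 < rk M \<longrightarrow> 2 * deg (VRep W) (kl_family W \<phi> M) < rk M"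
  proof
    assume r: "0 < rk M"
    then have "ground M \<noteq> {}" using rk_eq_0_iff[OF M loopless] by auto
    then show "2 * deg (VRep W) (kl_family W \<phi> M) < rk M"
      using b r unfolding kl_bounded_def by (intro up_deg_lessI[OF abelian_group_VRep p]) auto
  qed
  ultimately show "kl_family W \<phi> M \<in> carrier (grVRep W) \<and> Z_sum kl_family W \<phi> M \<in> carrier (grVRep W) \<and>
    (rk M = 0 \<longrightarrow> kl_family W \<phi> M = \<one>\<^bsub>grVRep W\<^esub> \<and> Z_sum kl_family W \<phi> M = \<one>\<^bsub>grVRep W\<^esub>) \<and>
    (0 < rk M \<longrightarrow> 2 * deg (VRep W) (kl_family W \<phi> M) < rk M) \<and>
    Z_sum kl_family W \<phi> M = Z_sum kl_family W \<phi> M \<and> palindromic W (rk M) (Z_sum kl_family W \<phi> M)"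
    using p Z(1,2) by blast
qed


section \<open>The character of the Kazhdan--Lusztig polynomial\<close>

context matroid_action
begin

text \<open>The induced character at \<open>w\<close> evaluates conjugates
  \<open>inv t \<otimes> w \<otimes> t\<close> on the contraction by \<open>F\<close>. Translation
  by \<open>t\<close> turns this into \<open>w\<close> acting on the contraction by the translated
  flat, which is what the sum over an orbit requires.\<close>

lemma kl_translate:
  assumes t: "t \<in> carrier W" and w: "w \<in> carrier W" and F: "F \<in> flats M" and fixed: "\<phi> (inv t \<otimes> w \<otimes> t) ` F = F"
  shows "kl (contract M (\<phi> t ` F)) (\<phi> w) = kl (contract M F) (\<phi> (inv t \<otimes> w \<otimes> t))"
proof (rule kl_iso[OF is_matroid_contract[OF M]])
  note c = contract_image[OF M bij[OF t] bases_image[OF t] flat_subset[OF F]]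
  show "bij_betw (\<phi> t) (ground (contract M F)) (ground (contract M (\<phi> t ` F)))" by (rule c(2))
  show "bases (contract M (\<phi> t ` F)) = (`) (\<phi> t) ` bases (contract M F)" by (rule c(1))
  have wt: "inv t \<otimes> w \<otimes> t \<in> carrier W" using t w by simp
  show "bij_betw (\<phi> (inv t \<otimes> w \<otimes> t)) (ground (contract M F)) (ground (contract M F))"
    using image_contract_eq[OF bij[OF wt] flat_subset[OF F] fixed] by simp
  fix x assume "x \<in> ground (contract M F)"
  then have x: "x \<in> ground M" by simp
  have "\<phi> t (\<phi> (inv t \<otimes> w \<otimes> t) x) = \<phi> (t \<otimes> (inv t \<otimes> w \<otimes> t)) x" using action_mult[OF t wt x] by simp
  also have "t \<otimes> (inv t \<otimes> w \<otimes> t) = w \<otimes> t" using t w by (simp add: m_assoc[symmetric])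
  finally show "\<phi> t (\<phi> (inv t \<otimes> w \<otimes> t) x) = \<phi> w (\<phi> t x)" using action_mult[OF w t x] by simp
qed

text \<open>The cosets of the stabilizer of \<open>F\<close> correspond to the flats in its orbit, and the cosets fixed
  by \<open>w\<close> to the flats fixed by \<open>w\<close>.\<close>

lemma sum_fixed_cosets:
  fixes f :: "'a set \<Rightarrow> rat"
  assumes F: "F \<in> flats M" and w: "w \<in> carrier W"
    and f: "\<And>t. t \<in> carrier W \<Longrightarrow> inv t \<otimes> w \<otimes> t \<in> stab F \<Longrightarrow> f (\<phi> t ` F) = h (inv t \<otimes> w \<otimes> t)"
  shows "(\<Sum>a<length (induction_setup.ts W (stab F)). if induction_setup.conj W (stab F) a w a \<in> stab F
      then h (induction_setup.conj W (stab F) a w a) else 0) = (\<Sum>F'\<in>{F' \<in> orb F. \<phi> w ` F' = F'}. f F')"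
proof -
  have FM: "F \<subseteq> ground M" using flat_subset[OF F] .
  interpret i: induction_setup W "stab F" by (rule induction_setup_stab[OF FM])
  let ?A = "{a. a < length i.ts \<and> i.conj a w a \<in> stab F}"
  have fixed: "i.conj a w a \<in> stab F \<longleftrightarrow> \<phi> w ` (\<phi> (i.ts ! a) ` F) = \<phi> (i.ts ! a) ` F" if a: "a < length i.ts" for a
    using image_eq_iff[of "w \<otimes> i.ts ! a" "i.ts ! a" F] image_mult[OF w i.ts_carrier[OF a] FM] i.ts_carrier[OF a] w FM
    by (simp add: i.conj_def m_assoc)
  have "(\<Sum>a<length i.ts. if i.conj a w a \<in> stab F then h (i.conj a w a) else 0) = (\<Sum>a\<in>?A. h (i.conj a w a))"
    by (rule sum.mono_neutral_cong_right) auto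
  also have "\<dots> = (\<Sum>F'\<in>{F' \<in> orb F. \<phi> w ` F' = F'}. f F')"
  \<comment> \<open>The reindexing sends a flat of the orbit to the position of the only listed
    representative that moves \<open>F\<close> to it.\<close>
  proof (rule sum.reindex_cong[of "\<lambda>F'. THE a. a < length i.ts \<and> \<phi> (i.ts ! a) ` F = F'"])
    have the: "(THE b. b < length i.ts \<and> \<phi> (i.ts ! b) ` F = \<phi> (i.ts ! a) ` F) = a" if a: "a < length i.ts" for a
    proof (rule the_equality)
      fix b assume b: "b < length i.ts \<and> \<phi> (i.ts ! b) ` F = \<phi> (i.ts ! a) ` F"
      have ca: "i.ts ! a \<in> carrier W" "i.ts ! b \<in> carrier W" using i.ts_carrier a b by auto
      have "inv (i.ts ! b) \<otimes> i.ts ! a \<in> stab F" using image_eq_iff[OF ca FM] b by simp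
      moreover have "inv (i.ts ! a) \<otimes> i.ts ! a \<in> stab F" using ca subgroup.one_closed[OF subgroup_stab[OF FM]] by simp
      moreover have "\<exists>!c. c < length i.ts \<and> inv (i.ts ! c) \<otimes> i.ts ! a \<in> stab F"
        using i.ts ca(1) unfolding transversal_def by blast
      ultimately show "b = a" using a b by blast
    qed (use a in simp)
    have ex: "\<exists>a<length i.ts. F' = \<phi> (i.ts ! a) ` F" if F': "F' \<in> orb F" for F'
    proof -
      obtain g where g: "g \<in> carrier W" "F' = \<phi> g ` F" using F' unfolding orb_def by blast
      obtain a where a: "a < length i.ts" "inv (i.ts ! a) \<otimes> g \<in> stab F"
        using i.ts g(1) unfolding transversal_def by blast
      then show ?thesis using image_eq_iff[OF g(1) i.ts_carrier[OF a(1)] FM] g(2) by auto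
    qed
    show "inj_on (\<lambda>F'. THE a. a < length i.ts \<and> \<phi> (i.ts ! a) ` F = F') {F' \<in> orb F. \<phi> w ` F' = F'}"
    proof (rule inj_onI)
      fix F1 F2 assume 1: "F1 \<in> {F' \<in> orb F. \<phi> w ` F' = F'}" "F2 \<in> {F' \<in> orb F. \<phi> w ` F' = F'}"
        and eq: "(THE a. a < length i.ts \<and> \<phi> (i.ts ! a) ` F = F1) = (THE a. a < length i.ts \<and> \<phi> (i.ts ! a) ` F = F2)"
      have "F1 \<in> orb F" "F2 \<in> orb F" using 1 by simp_all
      from ex[OF this(1)] ex[OF this(2)] obtain a b where a: "a < length i.ts" "F1 = \<phi> (i.ts ! a) ` F"
        and b: "b < length i.ts" "F2 = \<phi> (i.ts ! b) ` F" by (elim exE conjE)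
      show "F1 = F2" using eq unfolding a(2) b(2) the[OF a(1)] the[OF b(1)] by simp
    qed
    show "?A = (\<lambda>F'. THE a. a < length i.ts \<and> \<phi> (i.ts ! a) ` F = F') ` {F' \<in> orb F. \<phi> w ` F' = F'}"
    proof (intro equalityI subsetI)
      fix a assume a: "a \<in> ?A"
      then have ac: "a < length i.ts" "i.conj a w a \<in> stab F" by simp_all
      have "\<phi> w ` (\<phi> (i.ts ! a) ` F) = \<phi> (i.ts ! a) ` F" by (rule iffD1[OF fixed[OF ac(1)] ac(2)])
      moreover have "\<phi> (i.ts ! a) ` F \<in> orb F" unfolding orb_def using a by (intro imageI i.ts_carrier) simp
      ultimately have "\<phi> (i.ts ! a) ` F \<in> {F' \<in> orb F. \<phi> w ` F' = F'}" by (intro CollectI conjI)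
      then show "a \<in> (\<lambda>F'. THE a. a < length i.ts \<and> \<phi> (i.ts ! a) ` F = F') ` {F' \<in> orb F. \<phi> w ` F' = F'}"
        using the[of a] a by (intro image_eqI[of _ _ "\<phi> (i.ts ! a) ` F"]) auto
    next
      fix a assume "a \<in> (\<lambda>F'. THE a. a < length i.ts \<and> \<phi> (i.ts ! a) ` F = F') ` {F' \<in> orb F. \<phi> w ` F' = F'}"
      then obtain F' where F': "F' \<in> orb F" "\<phi> w ` F' = F'" "a = (THE a. a < length i.ts \<and> \<phi> (i.ts ! a) ` F = F')" by blast
      from ex[OF F'(1)] obtain b where b: "b < length i.ts" "F' = \<phi> (i.ts ! b) ` F" by (elim exE conjE)
      have "a = b" unfolding F'(3) b(2) by (rule the[OF b(1)])
      then show "a \<in> ?A" using b F'(2) fixed by simp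
    qed
    fix F' assume F': "F' \<in> {F' \<in> orb F. \<phi> w ` F' = F'}"
    then have "F' \<in> orb F" by simp
    from ex[OF this] obtain b where b: "b < length i.ts" "F' = \<phi> (i.ts ! b) ` F" by (elim exE conjE)
    have st: "i.conj b w b \<in> stab F" using F' b fixed by simp
    show "h (i.conj (THE a. a < length i.ts \<and> \<phi> (i.ts ! a) ` F = F') w (THE a. a < length i.ts \<and> \<phi> (i.ts ! a) ` F = F')) = f F'"
      unfolding b(2) the[OF b(1)] using f[OF i.ts_carrier[OF b(1)]] st by (simp add: i.conj_def)
  qed
  finally show ?thesis .
qed

end

text \<open>Valid for every admissible family \<open>P\<close>. Characters turn each induced term
  into a sum over the fixed flats of one orbit, so the Z-polynomial has character
  \<open>p + kl_rest M (\<phi> w)\<close>, where \<open>p\<close> is the character of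
  \<open>P W \<phi> M\<close>; the degree bound and palindromicity then leave only
  \<open>kl\<close>.\<close>

theorem kl_character:
  fixes W :: "'g monoid" and \<phi> :: "'g \<Rightarrow> 'a \<Rightarrow> 'a"
  assumes fam: "is_KLZ_family P Z" and "matroid_action W \<phi> M" "finite_group W" "w \<in> carrier W"
  shows "vch (P W \<phi> M j) w = poly.coeff (kl M (\<phi> w)) j"
  using assms(2-)
proof (induction "card (ground M)" arbitrary: W \<phi> M w j rule: less_induct)
  case less
  interpret matroid_action W \<phi> M by (rule less.prems(1))
  interpret fg: finite_group W by (rule less.prems(2))
  note w = less.prems(3)
  have props: "P W \<phi> M \<in> carrier (grVRep W)" "Z W \<phi> M \<in> carrier (grVRep W)" "rk M = 0 \<Longrightarrow> P W \<phi> M = \<one>\<^bsub>grVRep W\<^esub>"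
    "rk M > 0 \<Longrightarrow> 2 * deg (VRep W) (P W \<phi> M) < rk M" "Z W \<phi> M = Z_sum P W \<phi> M" "palindromic W (rk M) (Z W \<phi> M)"
    if "matroid_action W \<phi> M" for W :: "'g monoid" and \<phi> :: "'g \<Rightarrow> 'a \<Rightarrow> 'a" and M
  proof -
    interpret m: matroid_action W \<phi> M by (rule that)
    show "P W \<phi> M \<in> carrier (grVRep W)" "Z W \<phi> M \<in> carrier (grVRep W)" "rk M = 0 \<Longrightarrow> P W \<phi> M = \<one>\<^bsub>grVRep W\<^esub>"
    "rk M > 0 \<Longrightarrow> 2 * deg (VRep W) (P W \<phi> M) < rk M" "Z W \<phi> M = Z_sum P W \<phi> M" "palindromic W (rk M) (Z W \<phi> M)"
      using fam m.is_group m.M m.loopless m.act unfolding is_KLZ_family_def by blast+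
  qed
  note pr = props[OF less.prems(1)]
  have pc: "P W \<phi> M i \<in> carrier (VRep W)" for i by (rule up_memD(1)[OF abelian_group_VRep pr(1)])
  show ?case
  proof (cases "ground M = {}")
    case True
    then have "P W \<phi> M = \<one>\<^bsub>grVRep W\<^esub>" using pr(3) rk_eq_0_iff[OF M loopless] by simp
    then show ?thesis using True vch_one[OF w] vch_zero[OF w]
      by (simp add: up_one[OF abelian_group_VRep] kl_empty_ground)
  next
    case False
    have rk: "rk M > 0" using False rk_eq_0_iff[OF M loopless] by auto
    have Pz: "P W \<phi> M i = \<zero>\<^bsub>VRep W\<^esub>" if "rk M \<le> 2 * i" for i
      by (rule up_deg_less[OF abelian_group_VRep pr(1) pr(4)[OF rk] that])
    define p where "p = Abs_poly (\<lambda>i. vch (P W \<phi> M i) w)"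
    have p: "poly.coeff p i = vch (P W \<phi> M i) w" for i
      unfolding p_def by (subst coeff_Abs_poly[of "rk M"]) (auto simp: Pz vch_zero[OF w])
    \<comment> \<open>The degree \<open>k\<close> part of the contribution of one flat; at the empty
      flat it uses \<open>p\<close>, which is not yet known to be \<open>kl\<close>.\<close>
    define f where "f k F = poly.coeff (Polynomial.monom 1 (mrank M F) * (if F = {} then p else kl (contract M F) (\<phi> w))) k" for k F
    have cl: "P (W\<lparr>carrier := stab F\<rparr>) \<phi> (contract M F) \<in> carrier (grVRep (W\<lparr>carrier := stab F\<rparr>))" if "F \<in> flats M" for F
      by (rule props(1)[OF contract_action[OF that]])
    have ft: "vch (flat_term P F k) w = (\<Sum>F'\<in>{F' \<in> orb F. \<phi> w ` F' = F'}. f k F')" if F: "F \<in> flats M" for F k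
    proof (cases "F = {}")
      case True
      have "{F' \<in> orb F. \<phi> w ` F' = F'} = {{}}" unfolding True orb_empty by auto
      then show ?thesis unfolding True flat_term_empty[where P = P, OF pr(1)] using M by (simp add: f_def p)
    next
      case nF: False
      have FM: "F \<subseteq> ground M" using flat_subset[OF F] .
      interpret i: induction_setup W "stab F" by (rule induction_setup_stab[OF FM])
      show ?thesis
      proof (cases "mrank M F \<le> k")
        case False
        have "f k F' = 0" if "F' \<in> orb F" for F'
        proof -
          have "mrank M F' = mrank M F" using that mrank_translate[OF _ FM] unfolding orb_def by auto
          then show ?thesis using False by (simp add: f_def coeff_monom_mult)
        qed
        then show ?thesis unfolding flat_term(2)[where P = P, OF F cl[OF F]] using False vch_zero[OF w] by simp
      next
        case True
        let ?p = "P (W\<lparr>carrier := stab F\<rparr>) \<phi> (contract M F)"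
        have pFc: "?p (k - mrank M F) \<in> carrier (VRep (W\<lparr>carrier := stab F\<rparr>))"
          by (rule up_memD(1)[OF abelian_group_VRep cl[OF F]])
        have fgF: "finite_group (W\<lparr>carrier := stab F\<rparr>)"
        proof (intro finite_group.intro finite_group_axioms.intro)
          show "group (W\<lparr>carrier := stab F\<rparr>)" using subgroup_imp_group[OF subgroup_stab[OF FM]] .
          have "stab F \<subseteq> carrier W" by (auto simp: stab_iff)
          then show "finite (carrier (W\<lparr>carrier := stab F\<rparr>))" using fg.fin finite_subset by auto
        qed
        have "vch (flat_term P F k) w = vch (vind W (stab F) (?p (k - mrank M F))) w"
          unfolding flat_term(2)[where P = P, OF F cl[OF F]] using True by simp
        also have "\<dots> = (\<Sum>a<length i.ts. if i.conj a w a \<in> stab F then vch (?p (k - mrank M F)) (i.conj a w a) else 0)"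
          by (rule i.vch_vind[OF pFc w])
        also have "\<dots> = (\<Sum>F'\<in>{F' \<in> orb F. \<phi> w ` F' = F'}. f k F')"
        proof (rule sum_fixed_cosets[OF F w])
          fix t assume t: "t \<in> carrier W" and st: "inv\<^bsub>W\<^esub> t \<otimes>\<^bsub>W\<^esub> w \<otimes>\<^bsub>W\<^esub> t \<in> stab F"
          have "vch (?p (k - mrank M F)) (inv\<^bsub>W\<^esub> t \<otimes>\<^bsub>W\<^esub> w \<otimes>\<^bsub>W\<^esub> t) = poly.coeff (kl (contract M F) (\<phi> (inv\<^bsub>W\<^esub> t \<otimes>\<^bsub>W\<^esub> w \<otimes>\<^bsub>W\<^esub> t))) (k - mrank M F)"
            by (rule less.hyps[OF card_contract_less[OF M F nF] contract_action[OF F] fgF]) (use st in simp)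
          also have "kl (contract M F) (\<phi> (inv\<^bsub>W\<^esub> t \<otimes>\<^bsub>W\<^esub> w \<otimes>\<^bsub>W\<^esub> t)) = kl (contract M (\<phi> t ` F)) (\<phi> w)"
            using kl_translate[OF t w F] st by (simp add: stab_iff)
          finally show "f k (\<phi> t ` F) = vch (?p (k - mrank M F)) (inv\<^bsub>W\<^esub> t \<otimes>\<^bsub>W\<^esub> w \<otimes>\<^bsub>W\<^esub> t)"
            using True nF by (simp add: f_def coeff_monom_mult mrank_translate[OF t FM])
        qed
        finally show ?thesis .
      qed
    qed
    have fc: "(\<lambda>\<Omega>. flat_term P (rep_flat \<Omega>)) \<in> flat_orbits W \<phi> M \<rightarrow> carrier (grVRep W)"
      using flat_term(1)[where P = P, OF rep_flat(2) cl[OF rep_flat(2)]] by blast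
    have Zk: "vch (Z W \<phi> M k) w = poly.coeff (p + kl_rest M (\<phi> w)) k" for k
    proof -
      have c: "(\<lambda>\<Omega>. flat_term P (rep_flat \<Omega>) k) \<in> flat_orbits W \<phi> M \<rightarrow> carrier (VRep W)"
        using up_memD(1)[OF abelian_group_VRep] fc by blast
      have "vch (Z W \<phi> M k) w = (\<Sum>\<Omega>\<in>flat_orbits W \<phi> M. vch (flat_term P (rep_flat \<Omega>) k) w)"
        unfolding pr(5) Z_sum_eq up_finsum[OF abelian_group_VRep finite_flat_orbits fc]
        by (rule vch_finsum[OF finite_flat_orbits c w])
      also have "\<dots> = (\<Sum>\<Omega>\<in>flat_orbits W \<phi> M. \<Sum>F\<in>{F \<in> \<Omega>. \<phi> w ` F = F}. f k F)"
      proof (rule sum.cong[OF refl])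
        fix \<Omega> assume \<Omega>: "\<Omega> \<in> flat_orbits W \<phi> M"
        show "vch (flat_term P (rep_flat \<Omega>) k) w = (\<Sum>F\<in>{F \<in> \<Omega>. \<phi> w ` F = F}. f k F)"
          unfolding ft[OF rep_flat(2)[OF \<Omega>]] rep_flat(3)[OF \<Omega>] ..
      qed
      also have "\<dots> = (\<Sum>F\<in>{F \<in> flats M. \<phi> w ` F = F}. f k F)" by (rule sum_flat_orbits)
      also have "{F \<in> flats M. \<phi> w ` F = F} = insert {} {F \<in> flats M. F \<noteq> {} \<and> \<phi> w ` F = F}"
        using empty_flat[OF M loopless] by auto
      also have "(\<Sum>F\<in>insert {} {F \<in> flats M. F \<noteq> {} \<and> \<phi> w ` F = F}. f k F) =
          f k {} + (\<Sum>F\<in>{F \<in> flats M. F \<noteq> {} \<and> \<phi> w ` F = F}. f k F)"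
        using finite_flats[OF M] by (intro sum.insert) auto
      also have "f k {} = poly.coeff p k" using M by (simp add: f_def)
      also have "(\<Sum>F\<in>{F \<in> flats M. F \<noteq> {} \<and> \<phi> w ` F = F}. f k F) = poly.coeff (kl_rest M (\<phi> w)) k"
        unfolding kl_rest_def coeff_sum by (intro sum.cong) (auto simp: f_def)
      finally show ?thesis by simp
    qed
    have "kl M (\<phi> w) = p"
    proof (rule kl_unique[OF M False])
      show "poly.coeff p i = 0" if "rk M \<le> 2 * i" for i using Pz[OF that] vch_zero[OF w] by (simp add: p)
      show "pal (rk M) (p + kl_rest M (\<phi> w))"
        unfolding pal_def Zk[symmetric] using pr(6) vch_zero[OF w]
        unfolding palindromic_def up_coeff[OF abelian_group_VRep pr(2)] by metis
    qed
    then show ?thesis using p by simp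
  qed
qed


text \<open>The family constructed above guarantees that the choice in \<open>KL_poly\<close> is one
  of an admissible family, and for finite groups all of these have the same character.\<close>

lemma KL_poly_character:
  fixes W :: "'g monoid" and \<phi> :: "'g \<Rightarrow> 'a \<Rightarrow> 'a"
  assumes A: "matroid_action W \<phi> M" and "finite_group W"
  shows "KL_poly W \<phi> M \<in> carrier (grVRep W)"
    "w \<in> carrier W \<Longrightarrow> vch (KL_poly W \<phi> M j) w = poly.coeff (kl M (\<phi> w)) j"
proof -
  interpret matroid_action W \<phi> M by (rule A)
  define P where "P = (SOME P :: 'g monoid \<Rightarrow> ('g \<Rightarrow> 'a \<Rightarrow> 'a) \<Rightarrow> 'a matroid \<Rightarrow> (nat \<Rightarrow> 'g vrep). \<exists>Z. is_KLZ_family P Z)"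
  have "\<exists>P :: 'g monoid \<Rightarrow> ('g \<Rightarrow> 'a \<Rightarrow> 'a) \<Rightarrow> 'a matroid \<Rightarrow> (nat \<Rightarrow> 'g vrep). \<exists>Z. is_KLZ_family P Z"
    using is_KLZ_family_kl_family by blast
  from someI_ex[OF this] have "\<exists>Z. is_KLZ_family P Z" unfolding P_def .
  then obtain Z where fam: "is_KLZ_family P Z" by blast
  have KL: "KL_poly W \<phi> M = P W \<phi> M" using loopless by (simp add: KL_poly_def P_def)
  show "KL_poly W \<phi> M \<in> carrier (grVRep W)"
    using fam is_group M loopless act unfolding KL is_KLZ_family_def by blast
  show "vch (KL_poly W \<phi> M j) w = poly.coeff (kl M (\<phi> w)) j" if "w \<in> carrier W"
    unfolding KL by (rule kl_character[OF fam A assms(2) that])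
qed

section \<open>The actions of the theorem and their characters\<close>

lemma finite_group_BijGroup:
  assumes "finite S"
  shows "finite_group (BijGroup S)"
proof (intro finite_group.intro finite_group_axioms.intro group_BijGroup)
  have "Bij S \<subseteq> S \<rightarrow>\<^sub>E S" by (auto simp: Bij_def PiE_def extensional_def bij_betw_def)
  then show "finite (carrier (BijGroup S))"
    using finite_PiE[OF assms, of "\<lambda>_. S"] assms finite_subset by (auto simp: BijGroup_def)
qed

lemma BijGroup_mult_apply:
  "\<sigma> \<in> carrier (BijGroup S) \<Longrightarrow> \<sigma>' \<in> carrier (BijGroup S) \<Longrightarrow> x \<in> S \<Longrightarrow> (\<sigma> \<otimes>\<^bsub>BijGroup S\<^esub> \<sigma>') x = \<sigma> (\<sigma>' x)"
  by (simp add: BijGroup_def compose_eq)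

lemma BijGroup_bij: "\<sigma> \<in> carrier (BijGroup S) \<Longrightarrow> bij_betw \<sigma> S S"
  by (simp add: BijGroup_def Bij_def)

lemma cycle_bases_image:
  assumes "bij_betw \<pi> S S" "Y \<in> bases (cycle_matroid S)"
  shows "\<pi> ` Y \<in> bases (cycle_matroid S)"
proof -
  have Y: "Y \<subseteq> S" "card Y = card S - 1" using assms(2) by (auto simp: cycle_matroid_def uniform_matroid_def)
  have "inj_on \<pi> Y" using assms(1) Y(1) by (auto simp: bij_betw_def intro: inj_on_subset)
  then have "card (\<pi> ` Y) = card Y" by (rule card_image)
  moreover have "\<pi> ` Y \<subseteq> S" using assms(1) Y(1) by (auto simp: bij_betw_def)
  ultimately show ?thesis using Y(2) by (simp add: cycle_matroid_def uniform_matroid_def)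
qed

lemma kl_cong:
  assumes "is_matroid M" "bij_betw \<pi> (ground M) (ground M)" "\<And>x. x \<in> ground M \<Longrightarrow> \<pi> x = \<pi>' x"
  shows "kl M \<pi>' = kl M \<pi>"
  by (rule kl_iso[OF assms(1), of "\<lambda>x. x"]) (use assms in \<open>auto simp: bij_betw_def\<close>)

lemma klc_cong:
  assumes "finite S" "bij_betw \<pi> S S" "\<And>x. x \<in> S \<Longrightarrow> \<pi> x = \<pi>' x"
  shows "klc S \<pi>' = klc S \<pi>"
  unfolding klc_def using kl_cong[OF is_matroid_cycle[OF assms(1)], of \<pi> \<pi>'] assms(2,3) by simp

text \<open>When \<open>S\<close> has one element the matroid is a loop, and both sides vanish by
  convention; this is the reason for \<open>klc\<close> in place of \<open>kl\<close>.\<close>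

lemma KL_poly_cycle:
  assumes "finite S"
  defines "G \<equiv> BijGroup S"
  shows "KL_poly G (\<lambda>\<sigma>. \<sigma>) (cycle_matroid S) \<in> carrier (grVRep G)"
    "\<sigma> \<in> carrier G \<Longrightarrow> vch (KL_poly G (\<lambda>\<sigma>. \<sigma>) (cycle_matroid S) j) \<sigma> = poly.coeff (klc S \<sigma>) j"
proof -
  interpret G: finite_group G unfolding G_def by (rule finite_group_BijGroup[OF assms(1)])
  interpret U: abelian_group "grVRep G" by (rule abelian_group_UP[OF abelian_group_VRep])
  have "KL_poly G (\<lambda>\<sigma>. \<sigma>) (cycle_matroid S) \<in> carrier (grVRep G) \<and>
    (\<forall>\<sigma>\<in>carrier G. \<forall>j. vch (KL_poly G (\<lambda>\<sigma>. \<sigma>) (cycle_matroid S) j) \<sigma> = poly.coeff (klc S \<sigma>) j)"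
  proof (cases "card S = 1")
    case True
    then have "\<not> loopless (cycle_matroid S)" using loopless_cycle[OF assms(1)] by simp
    then have "KL_poly G (\<lambda>\<sigma>. \<sigma>) (cycle_matroid S) = \<zero>\<^bsub>grVRep G\<^esub>" by (simp add: KL_poly_def)
    then show ?thesis using True vch_zero[of _ G] U.zero_closed by (simp add: up_zero[OF abelian_group_VRep] klc_def)
  next
    case False
    have A: "matroid_action G (\<lambda>\<sigma>. \<sigma>) (cycle_matroid S)"
    proof (rule matroid_actionI[OF G.is_group is_matroid_cycle[OF assms(1)]])
      show "loopless (cycle_matroid S)" using loopless_cycle[OF assms(1)] False by simp
      show "bij_betw \<sigma> (ground (cycle_matroid S)) (ground (cycle_matroid S))" if "\<sigma> \<in> carrier G" for \<sigma>
        using BijGroup_bij that unfolding G_def by simp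
      show "(\<sigma> \<otimes>\<^bsub>G\<^esub> \<sigma>') x = \<sigma> (\<sigma>' x)" if "\<sigma> \<in> carrier G" "\<sigma>' \<in> carrier G" "x \<in> ground (cycle_matroid S)" for \<sigma> \<sigma>' x
        using BijGroup_mult_apply that unfolding G_def by simp
      show "\<sigma> ` Y \<in> bases (cycle_matroid S)" if "\<sigma> \<in> carrier G" "Y \<in> bases (cycle_matroid S)" for \<sigma> Y
        using cycle_bases_image[OF BijGroup_bij] that unfolding G_def by blast
    qed
    show ?thesis using KL_poly_character[OF A G.finite_group_axioms] False by (simp add: klc_def)
  qed
  then show "KL_poly G (\<lambda>\<sigma>. \<sigma>) (cycle_matroid S) \<in> carrier (grVRep G)"
    "\<sigma> \<in> carrier G \<Longrightarrow> vch (KL_poly G (\<lambda>\<sigma>. \<sigma>) (cycle_matroid S) j) \<sigma> = poly.coeff (klc S \<sigma>) j"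
    by blast+
qed

lemma gr_ext_tensor_character:
  assumes fin: "finite_group G" "finite_group H" and p: "p \<in> carrier (grVRep G)" and q: "q \<in> carrier (grVRep H)"
  shows "gr_ext_tensor G H p q \<in> carrier (grVRep (G \<times>\<times> H))"
    "g \<in> carrier G \<Longrightarrow> h \<in> carrier H \<Longrightarrow> vch (gr_ext_tensor G H p q k) (g, h) = (\<Sum>i\<le>k. vch (p i) g * vch (q (k - i)) h)"
proof -
  let ?W = "G \<times>\<times> H"
  interpret W: finite_group ?W by (rule finite_group_DirProd[OF fin])
  interpret R: abelian_group "VRep ?W" by (rule abelian_group_VRep)
  note pc = up_memD(1)[OF abelian_group_VRep p] and qc = up_memD(1)[OF abelian_group_VRep q]
  note v = vext_tensor_char[OF fin pc qc]
  have f: "(\<lambda>i. vext_tensor G H (p i) (q (k - i))) \<in> {..k} \<rightarrow> carrier (VRep ?W)" for k using v(1) by blast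
  have eq: "gr_ext_tensor G H p q k = (\<Oplus>\<^bsub>VRep ?W\<^esub>i\<in>{..k}. vext_tensor G H (p i) (q (k - i)))" for k
    unfolding gr_ext_tensor_def up_coeff[OF abelian_group_VRep p] up_coeff[OF abelian_group_VRep q] ..
  have closed: "gr_ext_tensor G H p q k \<in> carrier (VRep ?W)" for k unfolding eq by (rule R.finsum_closed[OF f])
  have char: "vch (gr_ext_tensor G H p q k) (g, h) = (\<Sum>i\<le>k. vch (p i) g * vch (q (k - i)) h)"
    if g: "g \<in> carrier G" and h: "h \<in> carrier H" for k g h
  proof -
    have "(g, h) \<in> carrier ?W" using g h by (simp add: DirProd_def)
    then show ?thesis unfolding eq vch_finsum[OF finite_atMost f] using v(2)[OF g h] vch_finsum[OF finite_atMost f] by simp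
  qed
  obtain n where n: "\<forall>i>n. p i = \<zero>\<^bsub>VRep G\<^esub>" using up_memD(2)[OF abelian_group_VRep p] by blast
  obtain m where m: "\<forall>i>m. q i = \<zero>\<^bsub>VRep H\<^esub>" using up_memD(2)[OF abelian_group_VRep q] by blast
  show "gr_ext_tensor G H p q \<in> carrier (grVRep ?W)"
  \<comment> \<open>In degrees above \<open>n + m\<close> every product has a factor beyond the
    support of \<open>p\<close> or of \<open>q\<close>; the coefficient is zero because its
    character is.\<close>
  proof (rule up_memI[OF abelian_group_VRep closed, of "n + m"])
    fix k assume k: "n + m < k"
    show "gr_ext_tensor G H p q k = \<zero>\<^bsub>VRep ?W\<^esub>"
    proof (rule W.vch_inject[OF closed R.zero_closed])
      fix w assume w: "w \<in> carrier ?W"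
      then obtain g h where gh: "w = (g, h)" "g \<in> carrier G" "h \<in> carrier H" by (auto simp: DirProd_def)
      have "vch (p i) g * vch (q (k - i)) h = 0" if "i \<in> {..k}" for i
      proof (cases "i > n")
        case True
        then show ?thesis using n vch_zero[OF gh(2)] by simp
      next
        case False
        then have "k - i > m" using k by simp
        then show ?thesis using m vch_zero[OF gh(3)] by simp
      qed
      then show "vch (gr_ext_tensor G H p q k) w = vch \<zero>\<^bsub>VRep ?W\<^esub> w"
        unfolding vch_zero[OF w] unfolding gh(1) char[OF gh(2,3)] by (rule sum.neutral[OF ballI])
    qed
  qed
  show "g \<in> carrier G \<Longrightarrow> h \<in> carrier H \<Longrightarrow> vch (gr_ext_tensor G H p q k) (g, h) = (\<Sum>i\<le>k. vch (p i) g * vch (q (k - i)) h)"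
    by (rule char)
qed

text \<open>The permutation preserves each of the three paths, hence maps pairs on different paths
  to such pairs.\<close>

lemma (in theta) bases_M_image:
  assumes \<pi>: "bij_betw \<pi> P P" "bij_betw \<pi> Q Q" "\<pi> e = e" and Y: "Y \<in> bases M"
  shows "bij_betw \<pi> E E" "\<pi> ` Y \<in> bases M"
proof -
  have "bij_betw \<pi> ({e} \<union> (P \<union> Q)) ({e} \<union> (P \<union> Q))"
    using \<pi> e_notin disj by (intro bij_betw_combine) (auto simp: bij_betw_def)
  then show b: "bij_betw \<pi> E E" by simp
  obtain u v where uv: "u \<in> E" "v \<in> E" "path u \<noteq> path v" "Y = E - {u, v}" using basis_pairE[OF Y] .
  have P: "\<pi> x \<in> P" if "x \<in> P" for x using \<pi>(1) that bij_betwE by metis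
  have Q: "\<pi> x \<in> Q" if "x \<in> Q" for x using \<pi>(2) that bij_betwE by metis
  have path: "path (\<pi> x) = path x" if "x \<in> E" for x
    using that P[of x] Q[of x] \<pi>(3) e_notin disj by (auto simp: path_def)
  have "\<pi> ` Y = \<pi> ` E - \<pi> ` {u, v}" unfolding uv(4)
    using uv(1,2) b by (intro inj_on_image_set_diff[of \<pi> E]) (auto simp: bij_betw_def)
  also have "\<dots> = E - {\<pi> u, \<pi> v}" using b by (simp add: bij_betw_def)
  finally have Y': "\<pi> ` Y = E - {\<pi> u, \<pi> v}" .
  show "\<pi> ` Y \<in> bases M" unfolding Y'
    using bij_betwE[OF b] uv path[OF uv(1)] path[OF uv(2)] by (intro basis_pairI) auto
qed

theorem mainTheorem2:
  fixes A B :: "'a set" and e :: 'a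
  assumes "finite A" and "finite B" and "card A \<ge> 2" and "card B \<ge> 2" and "A \<inter> B = {e}"
  defines "G \<equiv> BijGroup (A - {e})" and "H \<equiv> BijGroup (B - {e})"
  shows "KL_poly (G \<times>\<times> H) (glued_action A B e) (glued_cycles_matroid A B e) =
    KL_poly (G \<times>\<times> H) (glued_action A B e) (cycle_matroid ((A \<union> B) - {e}))
    \<ominus>\<^bsub>grVRep (G \<times>\<times> H)\<^esub>
    gr_x_pow (G \<times>\<times> H) 1 \<otimes>\<^bsub>grVRep (G \<times>\<times> H)\<^esub>
      gr_ext_tensor G H
        (KL_poly G (\<lambda>\<sigma>. \<sigma>) (cycle_matroid (A - {e})))
        (KL_poly H (\<lambda>\<tau>. \<tau>) (cycle_matroid (B - {e})))"
proof -
  let ?W = "G \<times>\<times> H" and ?\<phi> = "glued_action A B e"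
  define P where "P = A - {e}"
  define Q where "Q = B - {e}"
  have e: "e \<in> A" "e \<in> B" using assms(5) by auto
  have AP: "insert e P = A" and BQ: "insert e Q = B" unfolding P_def Q_def using e by auto
  have PQ: "(A \<union> B) - {e} = P \<union> Q" unfolding P_def Q_def by auto
  have "card P = card A - 1" "card Q = card B - 1" unfolding P_def Q_def using e assms(1,2) by auto
  then have cards: "card P > 0" "card Q > 0" using assms(3,4) by auto
  have th: "theta P Q e"
  proof
    show "P \<noteq> {}" "Q \<noteq> {}" using cards by auto
    show "P \<inter> Q = {}" using assms(5) unfolding P_def Q_def by blast
  qed (use assms(1,2) in \<open>auto simp: P_def Q_def\<close>)
  interpret theta P Q e by (rule th)
  have finG: "finite_group G" and finH: "finite_group H"
    unfolding G_def H_def using assms(1,2) by (auto intro!: finite_group_BijGroup)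
  interpret W: finite_group ?W by (rule finite_group_DirProd[OF finG finH])
  have G: "G = BijGroup P" and H: "H = BijGroup Q" by (simp_all add: G_def H_def P_def Q_def)
  have onP: "?\<phi> (\<sigma>, \<tau>) x = \<sigma> x" if "x \<in> P" for \<sigma> \<tau> x
    using that by (simp add: glued_action_def P_def)
  have onQ: "?\<phi> (\<sigma>, \<tau>) x = \<tau> x" if "x \<in> Q" for \<sigma> \<tau> x
    using that disj unfolding P_def[symmetric] glued_action_def by (auto simp: P_def[symmetric] Q_def[symmetric])
  have one: "?\<phi> w e = e" for w by (cases w) (simp add: glued_action_def)
  have bijP: "bij_betw (?\<phi> w) P P" and bijQ: "bij_betw (?\<phi> w) Q Q" if w: "w \<in> carrier ?W" for w
  proof -
    obtain \<sigma> \<tau> where st: "w = (\<sigma>, \<tau>)" "\<sigma> \<in> carrier G" "\<tau> \<in> carrier H" using w by (auto simp: DirProd_def)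
    show "bij_betw (?\<phi> w) P P"
      using BijGroup_bij[of \<sigma> P] st(2) bij_betw_cong[of P "?\<phi> w" \<sigma> P] onP unfolding st(1) G by simp
    show "bij_betw (?\<phi> w) Q Q"
      using BijGroup_bij[of \<tau> Q] st(3) bij_betw_cong[of Q "?\<phi> w" \<tau> Q] onQ unfolding st(1) H by simp
  qed
  have mult: "?\<phi> (v \<otimes>\<^bsub>?W\<^esub> w) x = ?\<phi> v (?\<phi> w x)"
    if v: "v \<in> carrier ?W" and w: "w \<in> carrier ?W" and x: "x \<in> E" for v w x
  proof -
    obtain \<sigma> \<tau> where st: "v = (\<sigma>, \<tau>)" "\<sigma> \<in> carrier G" "\<tau> \<in> carrier H" using v by (auto simp: DirProd_def)
    obtain \<sigma>' \<tau>' where st': "w = (\<sigma>', \<tau>')" "\<sigma>' \<in> carrier G" "\<tau>' \<in> carrier H" using w by (auto simp: DirProd_def)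
    have vw: "v \<otimes>\<^bsub>?W\<^esub> w = (\<sigma> \<otimes>\<^bsub>G\<^esub> \<sigma>', \<tau> \<otimes>\<^bsub>H\<^esub> \<tau>')" unfolding st st' by (simp add: DirProd_def)
    consider "x = e" | "x \<in> P" | "x \<in> Q" using x by blast
    then show ?thesis
    proof cases
      case 1
      then show ?thesis by (simp add: one)
    next
      case 2
      then have "\<sigma>' x \<in> P" using BijGroup_bij[of \<sigma>' P] st'(2) bij_betwE unfolding G by blast
      then show ?thesis using 2 BijGroup_mult_apply[of \<sigma> P \<sigma>' x] st(2) st'(2) unfolding vw unfolding st(1) st'(1) G by (simp add: onP)
    next
      case 3
      then have "\<tau>' x \<in> Q" using BijGroup_bij[of \<tau>' Q] st'(3) bij_betwE unfolding H by blast
      then show ?thesis using 3 BijGroup_mult_apply[of \<tau> Q \<tau>' x] st(3) st'(3) unfolding vw unfolding st(1) st'(1) H by (simp add: onQ)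
    qed
  qed
  obtain Y0 where Y0: "Y0 \<in> bases M" using is_matroid_M by (auto simp: is_matroid_def)
  have actM: "matroid_action ?W ?\<phi> M"
  proof (rule matroid_actionI[OF W.is_group is_matroid_M loopless_M])
    show "bij_betw (?\<phi> w) (ground M) (ground M)" if "w \<in> carrier ?W" for w
      unfolding ground_M by (rule bases_M_image(1)[OF bijP[OF that] bijQ[OF that] one Y0])
    show "?\<phi> (v \<otimes>\<^bsub>?W\<^esub> w) x = ?\<phi> v (?\<phi> w x)" if "v \<in> carrier ?W" "w \<in> carrier ?W" "x \<in> ground M" for v w x
      using mult that unfolding ground_M by blast
    show "?\<phi> w ` Y \<in> bases M" if "w \<in> carrier ?W" "Y \<in> bases M" for w Y
      by (rule bases_M_image(2)[OF bijP[OF that(1)] bijQ[OF that(1)] one that(2)])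
  qed
  have finPQ: "finite (P \<union> Q)" and card2: "card (P \<union> Q) \<noteq> 1" using fin cards card_Un_disjoint[OF fin disj] by auto
  have actC: "matroid_action ?W ?\<phi> (cycle_matroid (P \<union> Q))"
  proof (rule matroid_actionI[OF W.is_group is_matroid_cycle[OF finPQ]])
    show "loopless (cycle_matroid (P \<union> Q))" using loopless_cycle[OF finPQ] card2 by simp
    have b: "bij_betw (?\<phi> w) (P \<union> Q) (P \<union> Q)" if "w \<in> carrier ?W" for w
      by (rule bij_betw_combine[OF bijP[OF that] bijQ[OF that] disj])
    show "bij_betw (?\<phi> w) (ground (cycle_matroid (P \<union> Q))) (ground (cycle_matroid (P \<union> Q)))" if "w \<in> carrier ?W" for w
      using b[OF that] by simp
    show "?\<phi> (v \<otimes>\<^bsub>?W\<^esub> w) x = ?\<phi> v (?\<phi> w x)"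
      if "v \<in> carrier ?W" "w \<in> carrier ?W" "x \<in> ground (cycle_matroid (P \<union> Q))" for v w x
      using mult[OF that(1,2)] that(3) by simp
    show "?\<phi> w ` Y \<in> bases (cycle_matroid (P \<union> Q))" if "w \<in> carrier ?W" "Y \<in> bases (cycle_matroid (P \<union> Q))" for w Y
      by (rule cycle_bases_image[OF b[OF that(1)] that(2)])
  qed
  define p where "p = KL_poly ?W ?\<phi> M"
  define q where "q = KL_poly ?W ?\<phi> (cycle_matroid (P \<union> Q))"
  define a where "a = KL_poly G (\<lambda>\<sigma>. \<sigma>) (cycle_matroid P)"
  define b where "b = KL_poly H (\<lambda>\<tau>. \<tau>) (cycle_matroid Q)"
  note p = KL_poly_character[OF actM W.finite_group_axioms, folded p_def]
  note q = KL_poly_character[OF actC W.finite_group_axioms, folded q_def]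
  note a = KL_poly_cycle[OF fin(1), folded G, folded a_def]
  note b = KL_poly_cycle[OF fin(2), folded H, folded b_def]
  note t = gr_ext_tensor_character[OF finG finH a(1) b(1)]
  let ?t = "gr_ext_tensor G H a b"
  note x = gr_x_pow_mult[OF t(1), of 1]
  interpret R: abelian_group "VRep ?W" by (rule abelian_group_VRep)
  interpret U: abelian_group "grVRep ?W" by (rule abelian_group_UP[OF abelian_group_VRep])
  have r: "q \<ominus>\<^bsub>grVRep ?W\<^esub> gr_x_pow ?W 1 \<otimes>\<^bsub>grVRep ?W\<^esub> ?t \<in> carrier (grVRep ?W)"
    by (rule U.minus_closed[OF q(1) x(2)])
  have "p = q \<ominus>\<^bsub>grVRep ?W\<^esub> gr_x_pow ?W 1 \<otimes>\<^bsub>grVRep ?W\<^esub> ?t"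
  proof
    fix j
    show "p j = (q \<ominus>\<^bsub>grVRep ?W\<^esub> gr_x_pow ?W 1 \<otimes>\<^bsub>grVRep ?W\<^esub> ?t) j"
    proof (rule W.vch_inject[OF up_memD(1)[OF abelian_group_VRep p(1)] up_memD(1)[OF abelian_group_VRep r]])
      fix w assume w: "w \<in> carrier ?W"
      then obtain \<sigma> \<tau> where st: "w = (\<sigma>, \<tau>)" "\<sigma> \<in> carrier G" "\<tau> \<in> carrier H" by (auto simp: DirProd_def)
      let ?\<pi> = "?\<phi> w"
      \<comment> \<open>On \<open>P\<close> the glued action is \<open>\<sigma>\<close> and on
        \<open>Q\<close> it is \<open>\<tau>\<close>, so the two factors of the correction term
        become the characters of the tensor factors.\<close>
      have k: "klc P ?\<pi> = klc P \<sigma>" "klc Q ?\<pi> = klc Q \<tau>"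
        using klc_cong[OF fin(1) BijGroup_bij[OF st(2)[unfolded G]], of ?\<pi>]
          klc_cong[OF fin(2) BijGroup_bij[OF st(3)[unfolded H]], of ?\<pi>] onP onQ
        unfolding st(1) by simp_all
      have tk: "vch (?t i) w = poly.coeff (klc P ?\<pi> * klc Q ?\<pi>) i" for i
        unfolding k coeff_mult unfolding st(1) t(2)[OF st(2,3)] a(2)[OF st(2)] b(2)[OF st(3)] ..
      have xk: "vch ((gr_x_pow ?W 1 \<otimes>\<^bsub>grVRep ?W\<^esub> ?t) j) w = poly.coeff ([:0, 1:] * (klc P ?\<pi> * klc Q ?\<pi>)) j"
        unfolding x(1) using tk vch_zero[OF w] by (cases j) (simp_all add: coeff_pCons)
      have "vch (p j) w = poly.coeff (kl (cycle_matroid (P \<union> Q)) ?\<pi>) j - poly.coeff ([:0, 1:] * (klc P ?\<pi> * klc Q ?\<pi>)) j"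
        unfolding p(2)[OF w] kl_glued_cycles[OF th bijP[OF w] bijQ[OF w] one] by (rule coeff_diff)
      also have "\<dots> = vch (q j) w - vch ((gr_x_pow ?W 1 \<otimes>\<^bsub>grVRep ?W\<^esub> ?t) j) w" unfolding q(2)[OF w] xk ..
      also have "\<dots> = vch ((q \<ominus>\<^bsub>grVRep ?W\<^esub> gr_x_pow ?W 1 \<otimes>\<^bsub>grVRep ?W\<^esub> ?t) j) w"
        unfolding up_minus[OF abelian_group_VRep q(1) x(2)]
        by (rule vch_minus[symmetric, OF up_memD(1)[OF abelian_group_VRep q(1)] up_memD(1)[OF abelian_group_VRep x(2)] w])
      finally show "vch (p j) w = vch ((q \<ominus>\<^bsub>grVRep ?W\<^esub> gr_x_pow ?W 1 \<otimes>\<^bsub>grVRep ?W\<^esub> ?t) j) w" .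
    qed
  qed
  then show ?thesis unfolding p_def q_def a_def b_def AP BQ PQ P_def[symmetric] Q_def[symmetric] .
qed

end
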